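(* Let $\mathcal{A}$ be a unital complex algebra, $\psi:\mathcal{A}\to\mathbb{C}$ a unital linear functional, $D\psi:\mathcal{A}\to\mathbb{C}$ a tracial linear functional with $D\psi(1_{\mathcal{A}})=0$, with free cumulants $\kappa^\psi$ and cyclic free cumulants $D\kappa^\psi$. Let $\{a_1,\ldots,a_n\}$ be cyclically free from $\{b_1,\ldots,b_n\}$ with respect to $(\psi,D\psi)$. Then $$D\kappa^\psi_n(a_1b_1,\ldots,a_nb_n)=\sum_{\pi\in NC^{(B)}(n)}[\kappa^\psi,D\kappa^\psi]^{(B)}_\pi(a_1,\ldots,a_n)\;[\kappa^\psi,D\kappa^\psi]^{(B)}_{Kr(\pi)}(b_1,\ldots,b_n).$$
   Context: Two sets are cyclically free with respect to $(\psi,\omega)$ ($\omega$ tracial) if the unital algebras $\mathcal{A}_1,\mathcal{A}_2$ they generate are: $\mathcal{A}_1,\mathcal{A}_2$ are free with respect to $\psi$ and $\omega(c_1\cdots c_m)=0$ for all $m\ge2$ and $c_k\in\mathcal{A}_{j_k}$ with $\psi(c_k)=0$ for all $k$, $j_k\ne j_{k+1}$ for $1\le k\le m-1$, and $j_m\ne j_1$. Free cumulants $\kappa^\psi_n$: $\psi(a_1\cdots a_n)=\sum_{\pi\in NC(n)}\prod_{V\in\pi}\kappa^\psi_{|V|}(a_V)$, with $NC(n)$ the non-crossing partitions of $\{1,\ldots,n\}$ and $a_V$ listing $(a_v)_{v\in V}$ in increasing order. Cyclic free cumulants $D\kappa^\psi_n$ (they are cyclically invariant), recursively: $D\psi(a_1\cdots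 a_n)=\sum_{\pi\in NC(n)}\sum_{V\in\pi}D\kappa^\psi_{|V|}(a_V)\prod_{W\in\pi,W\neq V}\kappa^\psi_{|W|}(a_{(W,\prec_V)})$. Here and below, for $O\subset\{1,\ldots,n\}$, arrange $1,\ldots,n$ clockwise on a circle; a block $W$ disjoint from and not crossing $O$ lies in one arc between two cyclically consecutive elements of $O$ (the whole circle minus $O$ if $|O|=1$), and $a_{(W,\prec_O)}$ lists $(a_w)_{w\in W}$ in the order met when traversing this arc clockwise. Type B partitions: $NC^{(B)}(n)$ is the set of partitions of $\{1,\ldots,n,-1,\ldots,-n\}$ that are non-crossing for the circular order $1,\ldots,n,-1,\ldots,-n$ and invariant under $x\mapsto-x$. A zero block is a block $Z=-Z$ (at most one exists). $NCZ(n)$, resp. $NCZ'(n)$, is the set of $\pi\in NC^{(B)}(n)$ with, resp. without, a zero block. $\mathrm{Abs}(\pi)\in NC(n)$ is the image of $\pi$ under absolute value. The Kreweras complement $Kr(\pi)\in NC^{(B)}(n)$ is the largest partition of the barred set $\{\overline{\pm1},\ldots,\overline{\pm n}\}$ (identified with $\{\pm1,\ldots,\pm n\}$) such that $\pi\cup Kr(\pi)$ is non-crossing for the circular order $1,\overline1,\ldots,n,\overline n,-1,\overline{-1},\ldots,-n,\overline{-n}$; $\pi\in NCZ'(n)$ iff $Kr(\pi)\in NCZ(n)$. For $\pi\in NCZ(n)$ let $O\in\mathrm{Abs}(\pi)$ be the image of its zero block and set $[f,g]^{(B)}_\pi(a_1,\ldots,a_n)=g_{|O|}(a_O)\prod_{V\in\mathrm{Abs}(\pi),V\ne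 O}f_{|V|}(a_{(V,\prec_O)})$. For $\pi\in NCZ'(n)$ let $R\subset\{\overline1,\ldots,\overline n\}$ be the absolute value of the zero block of $Kr(\pi)$ (a block of the Kreweras complement of $\mathrm{Abs}(\pi)$) and set $[f,g]^{(B)}_\pi(a_1,\ldots,a_n)=\prod_{V\in\mathrm{Abs}(\pi)}f_{|V|}(a_{(V,\prec_R)})$, where, on the circle $1,\overline1,\ldots,n,\overline n$ (clockwise), $V$ lies in one arc between two cyclically consecutive elements of $R$ and is listed in the order met when traversing this arc clockwise. *)

theory Defs
  imports Complex_Main "HOL-Library.Disjoint_Sets"
begin

section \<open>Unital complex algebras and cyclic freeness\<close>

text \<open>
  HOL has no type class of complex algebras: an algebra is a unital ring together with a
  compatible complex scalar multiplication.  The class \<^class>\<open>ring_1\<close> asks for \<open>0 \<noteq> 1\<close>, which is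
  no restriction in the presence of a linear functional with value \<open>1\<close> at \<open>1\<close>.
\<close>

locale unital_complex_algebra = vector_space scale
  for scale :: "complex \<Rightarrow> 'a::ring_1 \<Rightarrow> 'a" +
  assumes scale_mult_left: "scale c x * y = scale c (x * y)"
    and scale_mult_right: "x * scale c y = scale c (x * y)"

definition tracial :: "('a::ring_1 \<Rightarrow> complex) \<Rightarrow> bool" where
  "tracial \<omega> \<longleftrightarrow> (\<forall>x y. \<omega> (x * y) = \<omega> (y * x))"

inductive_set generated_algebra :: "(complex \<Rightarrow> 'a::ring_1 \<Rightarrow> 'a) \<Rightarrow> 'a set \<Rightarrow> 'a set"
  for scale :: "complex \<Rightarrow> 'a::ring_1 \<Rightarrow> 'a" and S :: "'a set" where
  generator: "x \<in> S \<Longrightarrow> x \<in> generated_algebra scale S"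
| one: "1 \<in> generated_algebra scale S"
| add: "x \<in> generated_algebra scale S \<Longrightarrow> y \<in> generated_algebra scale S
    \<Longrightarrow> x + y \<in> generated_algebra scale S"
| mult: "x \<in> generated_algebra scale S \<Longrightarrow> y \<in> generated_algebra scale S
    \<Longrightarrow> x * y \<in> generated_algebra scale S"
| scale: "x \<in> generated_algebra scale S \<Longrightarrow> scale c x \<in> generated_algebra scale S"

text \<open>\<open>c 1, \<dots>, c m\<close> are centred, \<open>c k\<close> lies in the algebra with index \<open>j k\<close>, and neighbouring
  indices differ.\<close>

definition alternating_centred ::
    "('a::ring_1 \<Rightarrow> complex) \<Rightarrow> (nat \<Rightarrow> 'a set) \<Rightarrow> nat \<Rightarrow> (nat \<Rightarrow> nat) \<Rightarrow> (nat \<Rightarrow> 'a) \<Rightarrow> bool" where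
  "alternating_centred \<psi> A m j c \<longleftrightarrow>
     (\<forall>k\<in>{1..m}. j k \<in> {1, 2} \<and> c k \<in> A (j k) \<and> \<psi> (c k) = 0) \<and>
     (\<forall>k\<in>{1..<m}. j k \<noteq> j (k + 1))"

definition free_algebras :: "('a::ring_1 \<Rightarrow> complex) \<Rightarrow> (nat \<Rightarrow> 'a set) \<Rightarrow> bool" where
  "free_algebras \<psi> A \<longleftrightarrow>
     (\<forall>m j c. m \<ge> 1 \<longrightarrow> alternating_centred \<psi> A m j c \<longrightarrow> \<psi> (prod_list (map c [1..<Suc m])) = 0)"

definition cyclically_free_algebras ::
    "('a::ring_1 \<Rightarrow> complex) \<Rightarrow> ('a \<Rightarrow> complex) \<Rightarrow> (nat \<Rightarrow> 'a set) \<Rightarrow> bool" where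
  "cyclically_free_algebras \<psi> \<omega> A \<longleftrightarrow>
     free_algebras \<psi> A \<and>
     (\<forall>m j c. m \<ge> 2 \<longrightarrow> alternating_centred \<psi> A m j c \<longrightarrow> j m \<noteq> j 1 \<longrightarrow>
        \<omega> (prod_list (map c [1..<Suc m])) = 0)"

definition cyclically_free ::
    "(complex \<Rightarrow> 'a::ring_1 \<Rightarrow> 'a) \<Rightarrow> ('a \<Rightarrow> complex) \<Rightarrow> ('a \<Rightarrow> complex) \<Rightarrow> 'a set \<Rightarrow> 'a set \<Rightarrow> bool" where
  "cyclically_free scale \<psi> \<omega> S T \<longleftrightarrow>
     cyclically_free_algebras \<psi> \<omega>
       (\<lambda>i. if i = 1 then generated_algebra scale S else generated_algebra scale T)"


section \<open>Partitions of a circle\<close>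

text \<open>
  A circle is a list of distinct points, given in clockwise order.  Which point the list
  starts with does not matter for being non-crossing.
\<close>

definition noncrossing :: "'p list \<Rightarrow> 'p set set \<Rightarrow> bool" where
  "noncrossing cs \<pi> \<longleftrightarrow>
     \<not> (\<exists>V\<in>\<pi>. \<exists>W\<in>\<pi>. V \<noteq> W \<and>
        (\<exists>h i j k. h < i \<and> i < j \<and> j < k \<and> k < length cs \<and>
           cs ! h \<in> V \<and> cs ! i \<in> W \<and> cs ! j \<in> V \<and> cs ! k \<in> W))"

definition NC_on :: "'p list \<Rightarrow> 'p set set set" where
  "NC_on cs = {\<pi>. partition_on (set cs) \<pi> \<and> noncrossing cs \<pi>}"

definition circle :: "nat \<Rightarrow> nat list" where
  "circle n = [1..<Suc n]"

abbreviation NC :: "nat \<Rightarrow> nat set set set" where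
  "NC n \<equiv> NC_on (circle n)"

text \<open>\<open>arc cs Q u\<close> lists the points met when going clockwise from \<open>u\<close> until the next element of
  \<open>Q\<close>, which is \<open>u\<close> itself if \<open>Q = {u}\<close>.\<close>

definition arc :: "'p list \<Rightarrow> 'p set \<Rightarrow> 'p \<Rightarrow> 'p list" where
  "arc cs Q u = takeWhile (\<lambda>x. x \<notin> Q) (tl (dropWhile (\<lambda>x. x \<noteq> u) cs @ takeWhile (\<lambda>x. x \<noteq> u) cs))"

text \<open>The listing \<open>(W, \<prec>\<^sub>Q)\<close> of \<open>W\<close> along the arc between consecutive elements of \<open>Q\<close> in which
  it lies; this arc is unique for nonempty \<open>W\<close>.\<close>

definition arc_listing :: "'p list \<Rightarrow> 'p set \<Rightarrow> 'p set \<Rightarrow> 'p list" where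
  "arc_listing cs Q W =
     filter (\<lambda>x. x \<in> W) (arc cs Q (THE u. u \<in> Q \<and> W \<subseteq> set (arc cs Q u)))"


section \<open>Free cumulants and cyclic free cumulants\<close>

text \<open>
  A sequence of multilinear functionals is one function on lists, whose restriction to lists of
  length \<open>n\<close> is the \<open>n\<close>-th functional.  Entries of a list are numbered from \<open>1\<close>.
\<close>

definition entry :: "'a list \<Rightarrow> nat \<Rightarrow> 'a" where
  "entry as i = as ! (i - 1)"

lemma set_circle [simp]: "set (circle n) = {1..n}"
  by (auto simp: circle_def)

lemma finite_NC_on: "finite (NC_on cs)"
  by (rule finite_subset[OF _ finitely_many_partition_on[of "set cs"]]) (auto simp: NC_on_def)

lemma NC_block_subset: "\<pi> \<in> NC n \<Longrightarrow> V \<in> \<pi> \<Longrightarrow> V \<subseteq> {1..n}"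
  by (auto simp: NC_on_def partition_on_def)

lemma NC_block_card_less:
  assumes "\<pi> \<in> NC n" "\<pi> \<noteq> {{1..n}}" "V \<in> \<pi>"
  shows "card V < n"
proof -
  have sub: "V \<subseteq> {1..n}" using NC_block_subset assms by blast
  have p: "partition_on {1..n} \<pi>"
    using assms(1) by (simp add: NC_on_def)
  have "V \<noteq> {1..n}"
  proof
    assume V: "V = {1..n}"
    have "W = V" if "W \<in> \<pi>" for W
    proof (rule ccontr)
      assume "W \<noteq> V"
      then have "W \<inter> V = {}"
        using p that assms(3) by (auto simp: partition_on_def disjoint_def)
      moreover have "W \<subseteq> V" "W \<noteq> {}"
        using p that V by (auto simp: partition_on_def)
      ultimately show False by blast
    qed
    with assms(2,3) V show False by blast
  qed
  with sub have "V \<subset> {1..n}" by blast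
  then have "card V < card {1..n}" by (intro psubset_card_mono) auto
  then show ?thesis by simp
qed

lemma full_in_NC: "n \<ge> 1 \<Longrightarrow> {{1..n}} \<in> NC n"
  by (simp add: NC_on_def noncrossing_def partition_on_def)

text \<open>The defining formulas, solved for the cumulant of the full block; see \<open>moment_cumulant\<close> and
  \<open>cyclic_moment_cumulant\<close> below.\<close>

function free_cumulant :: "('a::ring_1 \<Rightarrow> complex) \<Rightarrow> 'a list \<Rightarrow> complex" where
  "free_cumulant \<psi> as = \<psi> (prod_list as) -
     (\<Sum>\<pi>\<in>NC (length as) - {{{1..length as}}}.
        \<Prod>V\<in>\<pi>. free_cumulant \<psi> (map (entry as) (sorted_list_of_set V)))"
  by pat_completeness auto
termination
proof (relation "measure (\<lambda>(\<psi>, as). length as)", goal_cases)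
  case (2 \<psi> as \<pi> V)
  then show ?case using NC_block_card_less[of \<pi> "length as" V] by simp
qed simp

declare free_cumulant.simps [simp del]

function cyclic_free_cumulant ::
    "('a::ring_1 \<Rightarrow> complex) \<Rightarrow> ('a \<Rightarrow> complex) \<Rightarrow> 'a list \<Rightarrow> complex" where
  "cyclic_free_cumulant \<psi> D\<psi> as = D\<psi> (prod_list as) -
     (\<Sum>\<pi>\<in>NC (length as) - {{{1..length as}}}.
        \<Sum>V\<in>\<pi>. cyclic_free_cumulant \<psi> D\<psi> (map (entry as) (sorted_list_of_set V)) *
          (\<Prod>W\<in>\<pi> - {V}.
             free_cumulant \<psi> (map (entry as) (arc_listing (circle (length as)) V W))))"
  by pat_completeness auto
termination
proof (relation "measure (\<lambda>(\<psi>, D\<psi>, as). length as)", goal_cases)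
  case (2 \<psi> D\<psi> as \<pi> V)
  then show ?case using NC_block_card_less[of \<pi> "length as" V] by simp
qed simp

declare cyclic_free_cumulant.simps [simp del]

lemma entry_full: "map (entry as) (sorted_list_of_set {1..length as}) = as"
proof -
  have "sorted_list_of_set {1..length as} = [1..<Suc (length as)]"
    unfolding atLeastLessThanSuc_atLeastAtMost[symmetric] by (rule sorted_list_of_set_range)
  moreover have "map (entry as) [1..<Suc (length as)] = as"
  proof (rule nth_equalityI)
    show "map (entry as) [1..<Suc (length as)] ! i = as ! i"
      if "i < length (map (entry as) [1..<Suc (length as)])" for i
      using that by (simp add: entry_def del: upt_Suc)
  qed (simp del: upt_Suc)
  ultimately show ?thesis by (simp only:)
qed

lemma sum_NC_full:
  assumes "as \<noteq> []"
  shows "(\<Sum>\<pi>\<in>NC (length as). h \<pi>) =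
    h {{1..length as}} + (\<Sum>\<pi>\<in>NC (length as) - {{{1..length as}}}. h \<pi> :: complex)"
proof (rule sum.remove[OF finite_NC_on])
  show "{{1..length as}} \<in> NC (length as)"
    using assms by (intro full_in_NC) (simp add: Suc_leI)
qed

lemma moment_cumulant:
  assumes "as \<noteq> []"
  shows "\<psi> (prod_list as) =
    (\<Sum>\<pi>\<in>NC (length as). \<Prod>V\<in>\<pi>. free_cumulant \<psi> (map (entry as) (sorted_list_of_set V)))"
proof -
  have single: "(\<Prod>V\<in>{X}. h V) = h X" for h :: "nat set \<Rightarrow> complex" and X
    by simp
  show ?thesis
    unfolding sum_NC_full[OF assms] single entry_full
    by (subst free_cumulant.simps) (rule diff_add_cancel[symmetric])
qed

lemma cyclic_moment_cumulant:
  assumes "as \<noteq> []"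
  shows "D\<psi> (prod_list as) =
    (\<Sum>\<pi>\<in>NC (length as). \<Sum>V\<in>\<pi>.
       cyclic_free_cumulant \<psi> D\<psi> (map (entry as) (sorted_list_of_set V)) *
       (\<Prod>W\<in>\<pi> - {V}. free_cumulant \<psi> (map (entry as) (arc_listing (circle (length as)) V W))))"
proof -
  have single: "(\<Sum>V\<in>{X}. h V * (\<Prod>W\<in>{X} - {V}. g V W)) = h X"
    for h :: "nat set \<Rightarrow> complex" and g X
    by simp
  show ?thesis
    unfolding sum_NC_full[OF assms] single entry_full
    by (subst cyclic_free_cumulant.simps) (rule diff_add_cancel[symmetric])
qed


section \<open>Non-crossing partitions of type B\<close>

definition circleB :: "nat \<Rightarrow> int list" where
  "circleB n = map int (circle n) @ map (\<lambda>i. - int i) (circle n)"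

definition NCB :: "nat \<Rightarrow> int set set set" where
  "NCB n = {\<pi> \<in> NC_on (circleB n). \<forall>V\<in>\<pi>. uminus ` V \<in> \<pi>}"

definition is_zero_block :: "int set set \<Rightarrow> int set \<Rightarrow> bool" where
  "is_zero_block \<pi> Z \<longleftrightarrow> Z \<in> \<pi> \<and> uminus ` Z = Z"

definition zero_block :: "int set set \<Rightarrow> int set" where
  "zero_block \<pi> = (THE Z. is_zero_block \<pi> Z)"

definition NCZ :: "nat \<Rightarrow> int set set set" where
  "NCZ n = {\<pi> \<in> NCB n. \<exists>Z. is_zero_block \<pi> Z}"

definition abs_block :: "int set \<Rightarrow> nat set" where
  "abs_block V = (\<lambda>x. nat \<bar>x\<bar>) ` V"

definition Abs_part :: "int set set \<Rightarrow> nat set set" where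
  "Abs_part \<pi> = abs_block ` \<pi>"

datatype 'i point = Plain (idx: 'i) | Bar (idx: 'i)

definition barred_circle :: "'i list \<Rightarrow> 'i point list" where
  "barred_circle cs = concat (map (\<lambda>i. [Plain i, Bar i]) cs)"

text \<open>The partitions admitted in the definition of the Kreweras complement are arbitrary partitions
  of the barred set, here with the bars removed; the largest one is automatically of type B.\<close>

definition Kreweras_admissible :: "nat \<Rightarrow> int set set \<Rightarrow> int set set \<Rightarrow> bool" where
  "Kreweras_admissible n \<pi> \<sigma> \<longleftrightarrow>
     partition_on (set (circleB n)) \<sigma> \<and>
     noncrossing (barred_circle (circleB n)) ((`) Plain ` \<pi> \<union> (`) Bar ` \<sigma>)"

definition Kr :: "nat \<Rightarrow> int set set \<Rightarrow> int set set" where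
  "Kr n \<pi> = (THE \<sigma>. Kreweras_admissible n \<pi> \<sigma> \<and>
     (\<forall>\<tau>. Kreweras_admissible n \<pi> \<tau> \<longrightarrow> refines (set (circleB n)) \<tau> \<sigma>))"

text \<open>The second case concerns the partitions of type B without a zero block, for which
  \<open>Kr n \<pi>\<close> has one.\<close>

definition bracketB ::
    "nat \<Rightarrow> ('a list \<Rightarrow> complex) \<Rightarrow> ('a list \<Rightarrow> complex) \<Rightarrow> int set set \<Rightarrow> (nat \<Rightarrow> 'a) \<Rightarrow> complex" where
  "bracketB n f g \<pi> a =
     (if \<pi> \<in> NCZ n then
        (let Q = abs_block (zero_block \<pi>)
         in g (map a (sorted_list_of_set Q)) *
            (\<Prod>V\<in>Abs_part \<pi> - {Q}. f (map a (arc_listing (circle n) Q V))))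
      else
        (let R = abs_block (zero_block (Kr n \<pi>))
         in \<Prod>V\<in>Abs_part \<pi>.
              f (map a (map idx (arc_listing (barred_circle (circle n)) (Bar ` R) (Plain ` V))))))"

end

theory Submission
  imports Defs
begin

text \<open>
  Write \<open>x (Plain i) = a i\<close> and \<open>x (Bar i) = b i\<close> on the barred circle.  Mixed free and cyclic free
  cumulants vanish: merging two neighbours of one colour does not change the formula for the cumulant
  anchored at a point of the other colour, and alternating words vanish by cyclic freeness after
  centring.  Call a non-crossing partition complete if the two ends of every arc of a block lie in
  one block; the monochrome complete partitions of the barred circle are the \<open>\<pi> \<union> Kr \<pi>\<close>.  The cyclic
  moments of the products \<open>a i * b i\<close> and the sums over monochrome complete structures satisfy the
  same cyclic moment-cumulant recursion, so the cyclic cumulant of the products is the sum over a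
  block \<open>V\<close>, weighted by its cyclic cumulant, and over a complete partition of each arc of \<open>V\<close>.
  In type B, \<open>\<pi> \<union> Kr \<pi>\<close> has exactly one zero block, and folding the circle by the absolute value
  turns it into \<open>V\<close> and each pair of opposite arcs into one arc of \<open>V\<close>.
\<close>

text \<open>Two obstacles shape the proof. \<open>\<psi>\<close> is not tracial in general, so a
  free cumulant depends on where its listing starts. An arc is therefore a list that begins just
  behind a point of the block: this is the order demanded by the cyclic moment-cumulant formula, and
  the cyclic sum over all partitions with a marked block factors over the arcs of that block. The
  Kreweras complement is defined by maximality, a global property that does not restrict to arcs.
  Completeness is a condition on single arcs, is inherited by the arcs of a block, and still
  determines the complement. The common recursion comes from counting pairs
  \<open>V \<subseteq> X\<close> in two ways. \<open>V\<close> is the monochrome block of a moment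
  expansion; expanding the moments of its arcs produces a set \<open>X\<close> of positions that
  consists of whole pairs, apart from an unpaired end of a word. For fixed \<open>X\<close>, the sum
  over \<open>V\<close> rebuilds the complete structures on \<open>X\<close>, and what is left are
  moments in the gaps of \<open>X\<close>.\<close>

definition cyc :: "'p list \<Rightarrow> 'p list \<Rightarrow> bool" where
  "cyc xs ys \<longleftrightarrow> (\<exists>p s. xs = p @ s \<and> ys = s @ p)"

lemma cyc_append: "cyc (p @ s) (s @ p)"
  by (auto simp: cyc_def)

lemma cyc_refl: "cyc xs xs"
  using cyc_append[of "[]" xs] by simp

lemma cyc_sym: "cyc xs ys \<Longrightarrow> cyc ys xs"
  by (auto simp: cyc_def)

text \<open>Two splittings of a list do not compose directly, whereas powers of
  \<open>rotate\<close> do; this gives transitivity.\<close>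

lemma cyc_rotate_iff: "cyc xs ys \<longleftrightarrow> (\<exists>n. ys = rotate n xs)"
proof
  assume "cyc xs ys"
  then obtain p s where "xs = p @ s" "ys = s @ p" by (auto simp: cyc_def)
  then have "ys = rotate (length p) xs" by (simp add: rotate_append)
  then show "\<exists>n. ys = rotate n xs" by blast
next
  assume "\<exists>n. ys = rotate n xs"
  then obtain n where n: "ys = rotate n xs" by blast
  let ?m = "n mod length xs"
  have "ys = drop ?m xs @ take ?m xs"
    unfolding n by (rule rotate_drop_take)
  then show "cyc xs ys"
    using cyc_append[of "take ?m xs" "drop ?m xs"] by (simp only: append_take_drop_id)
qed

lemma cyc_trans: "cyc xs ys \<Longrightarrow> cyc ys zs \<Longrightarrow> cyc xs zs"
  unfolding cyc_rotate_iff by (metis rotate_rotate)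

lemma cyc_set: "cyc xs ys \<Longrightarrow> set ys = set xs"
  by (auto simp: cyc_def)

lemma cyc_length: "cyc xs ys \<Longrightarrow> length ys = length xs"
  by (auto simp: cyc_def)

lemma cyc_distinct: "cyc xs ys \<Longrightarrow> distinct ys \<longleftrightarrow> distinct xs"
  by (auto simp: cyc_def)

lemma cyc_map: "cyc xs ys \<Longrightarrow> cyc (map f xs) (map f ys)"
  unfolding cyc_def by (metis map_append)

lemma cyc_filter: "cyc xs ys \<Longrightarrow> cyc (filter P xs) (filter P ys)"
  unfolding cyc_def by (metis filter_append)

lemma cyc_to_head:
  assumes "u \<in> set xs"
  obtains ys where "cyc xs (u # ys)"
proof -
  obtain p s where "xs = p @ u # s" using split_list[OF assms] by blast
  then have "cyc xs (u # (s @ p))" using cyc_append[of p "u # s"] by simp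
  with that show thesis by blast
qed

text \<open>Since the entries are distinct, the head fixes the cut. Explicit readings of a circle
  from a known point can thus be compared, which is how most arcs below are computed.\<close>

lemma cyc_distinct_unique_head:
  assumes "distinct xs" "cyc xs (u # ys)" "cyc xs (u # zs)"
  shows "ys = zs"
proof -
  have "cyc (u # ys) (u # zs)" using assms cyc_sym cyc_trans by blast
  then obtain p s where ps: "u # ys = p @ s" "u # zs = s @ p" by (auto simp: cyc_def)
  have "distinct (u # ys)" using assms cyc_distinct by blast
  with ps show ?thesis by (cases p; cases s) auto
qed

section \<open>Arcs\<close>

lemma arc_cyc:
  assumes "distinct xs" "cyc xs (u # ys)"
  shows "arc xs Q u = takeWhile (\<lambda>x. x \<notin> Q) ys"
proof -
  have "u \<in> set xs" using cyc_set[OF assms(2)] by auto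
  then obtain p s where xs: "xs = p @ u # s" using split_list by metis
  have "cyc xs (u # (s @ p))" using cyc_append[of p "u # s"] xs by simp
  then have ys: "ys = s @ p" using cyc_distinct_unique_head[OF assms] by metis
  have "u \<notin> set p" using assms(1) xs by auto
  then have "dropWhile (\<lambda>x. x \<noteq> u) xs = u # s" "takeWhile (\<lambda>x. x \<noteq> u) xs = p"
    unfolding xs by (subst dropWhile_append2 takeWhile_append2; auto)+
  then show ?thesis by (simp add: arc_def ys)
qed

lemma arc_cyc_eq:
  assumes "distinct xs" "cyc xs zs" "u \<in> set xs"
  shows "arc zs Q u = arc xs Q u"
proof -
  obtain ys where "cyc xs (u # ys)" using cyc_to_head[OF assms(3)] .
  moreover have "cyc zs (u # ys)" using calculation assms cyc_sym cyc_trans by blast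
  moreover have "distinct zs" using assms cyc_distinct by blast
  ultimately show ?thesis using arc_cyc assms(1) by metis
qed

text \<open>The normal form of a circle seen from a point of \<open>V\<close>: the point, its arc,
  and a rest that is empty or begins in \<open>V\<close>. Nearly every argument about arcs starts
  from it.\<close>

lemma arcE:
  assumes "distinct cs" "v \<in> V" "v \<in> set cs"
  obtains z where "cyc cs (v # arc cs V v @ z)" "z = [] \<or> hd z \<in> V"
    "distinct (v # arc cs V v @ z)" "set (arc cs V v) \<inter> V = {}"
    "set cs = insert v (set (arc cs V v) \<union> set z)"
proof -
  obtain ys where ys: "cyc cs (v # ys)" using cyc_to_head[OF assms(3)] .
  define z where "z = dropWhile (\<lambda>x. x \<notin> V) ys"
  have a: "arc cs V v = takeWhile (\<lambda>x. x \<notin> V) ys" using arc_cyc[OF assms(1) ys] .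
  have e: "v # arc cs V v @ z = v # ys" by (simp add: a z_def)
  have 1: "cyc cs (v # arc cs V v @ z)" using ys e by simp
  have 2: "z = [] \<or> hd z \<in> V" unfolding z_def using hd_dropWhile[of "\<lambda>x. x \<notin> V" ys] by auto
  have 3: "distinct (v # arc cs V v @ z)" using 1 assms(1) cyc_distinct by blast
  have 4: "set (arc cs V v) \<inter> V = {}" unfolding a by (auto dest: set_takeWhileD)
  have 5: "set cs = insert v (set (arc cs V v) \<union> set z)" using cyc_set[OF 1] by auto
  show thesis using that 1 2 3 4 5 by blast
qed

lemma arc_eqI:
  assumes "distinct cs" "cyc cs (v # g @ z)" "set g \<inter> V = {}" "z = [] \<or> hd z \<in> V"
  shows "arc cs V v = g"
proof -
  have "takeWhile (\<lambda>x. x \<notin> V) (g @ z) = g @ takeWhile (\<lambda>x. x \<notin> V) z"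
    by (rule takeWhile_append2) (use assms(3) in blast)
  also have "takeWhile (\<lambda>x. x \<notin> V) z = []" using assms(4) by (cases z) auto
  finally show ?thesis using arc_cyc[OF assms(1,2)] by simp
qed

lemma arc_subset:
  assumes "distinct cs" "v \<in> V" "v \<in> set cs"
  shows "set (arc cs V v) \<subseteq> set cs - V"
  by (rule arcE[OF assms]) auto

lemma distinct_arc:
  assumes "distinct cs" "v \<in> V" "v \<in> set cs"
  shows "distinct (arc cs V v)"
  by (rule arcE[OF assms]) auto

lemma length_arc:
  assumes "distinct cs" "v \<in> V" "v \<in> set cs"
  shows "length (arc cs V v) < length cs"
proof -
  obtain z where "cyc cs (v # arc cs V v @ z)" using arcE[OF assms] by blast
  then have "length (v # arc cs V v @ z) = length cs" by (rule cyc_length)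
  then show ?thesis by simp
qed

text \<open>Read the circle from \<open>p\<close> and take the last point of \<open>V\<close>:
  nothing of \<open>V\<close> follows it before the reading returns to \<open>p\<close>.\<close>

lemma arc_cover:
  assumes "distinct cs" "V \<subseteq> set cs" "V \<noteq> {}" "p \<in> set cs" "p \<notin> V"
  shows "\<exists>v\<in>V. p \<in> set (arc cs V v)"
proof -
  obtain xs where xs: "cyc cs (p # xs)" using cyc_to_head[OF assms(4)] .
  have s: "set cs = insert p (set xs)" using cyc_set[OF xs] by auto
  have "\<exists>v\<in>set xs. v \<in> V" using s assms by auto
  then obtain b v c where xs2: "xs = b @ v # c" "v \<in> V" "\<forall>y\<in>set c. y \<notin> V"
    using split_list_last_prop[of xs "\<lambda>v. v \<in> V"] by metis
  have "cyc (p # xs) (v # (c @ p # b))"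
    using cyc_append[of "p # b" "v # c"] xs2 by simp
  then have c: "cyc cs (v # (c @ p # b))" using xs cyc_trans by blast
  have "arc cs V v = takeWhile (\<lambda>x. x \<notin> V) (c @ p # b)" using arc_cyc[OF assms(1) c] .
  also have "\<dots> = c @ takeWhile (\<lambda>x. x \<notin> V) (p # b)" using xs2 by (intro takeWhile_append2) auto
  finally have "p \<in> set (arc cs V v)" using assms(5) by simp
  with xs2 show ?thesis by blast
qed

text \<open>Read from \<open>v\<close>, everything in the arc of \<open>w\<close> comes behind
  \<open>w\<close>: the walk from \<open>w\<close> stops at \<open>v\<close> at the latest, before
  it can reach the arc of \<open>v\<close>.\<close>

lemma arc_disjoint:
  assumes "distinct cs" "V \<subseteq> set cs" "v \<in> V" "w \<in> V" "v \<noteq> w"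
  shows "set (arc cs V v) \<inter> set (arc cs V w) = {}"
proof -
  obtain z where z: "cyc cs (v # arc cs V v @ z)" "z = [] \<or> hd z \<in> V"
    "distinct (v # arc cs V v @ z)" "set (arc cs V v) \<inter> V = {}"
    "set cs = insert v (set (arc cs V v) \<union> set z)"
    by (rule arcE[OF assms(1,3)]) (use assms in blast)
  have "w \<in> set z" using z assms by auto
  then obtain b c where bc: "z = b @ w # c" using split_list by metis
  have "cyc (v # arc cs V v @ z) (w # (c @ v # arc cs V v @ b))"
    using cyc_append[of "v # arc cs V v @ b" "w # c"] bc by simp
  then have "cyc cs (w # (c @ v # arc cs V v @ b))" using z cyc_trans by blast
  then have "arc cs V w = takeWhile (\<lambda>x. x \<notin> V) (c @ v # arc cs V v @ b)"
    using arc_cyc assms by metis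
  also have "set \<dots> \<subseteq> set c"
  proof (cases "\<exists>x\<in>set c. x \<in> V")
    case True
    then have "takeWhile (\<lambda>x. x \<notin> V) (c @ v # arc cs V v @ b) = takeWhile (\<lambda>x. x \<notin> V) c"
      using takeWhile_append1[of _ c "\<lambda>x. x \<notin> V"] by auto
    then show ?thesis using set_takeWhileD by (metis subsetI)
  next
    case False
    then have "takeWhile (\<lambda>x. x \<notin> V) (c @ v # arc cs V v @ b) = c"
      using assms by (subst takeWhile_append2) auto
    then show ?thesis by simp
  qed
  finally show ?thesis using z(3) bc by auto
qed

lemma arc_unique:
  assumes "distinct cs" "V \<subseteq> set cs" "v \<in> V" "w \<in> V" "p \<in> set (arc cs V v)" "p \<in> set (arc cs V w)"
  shows "v = w"
  using arc_disjoint[OF assms(1-4)] assms(5,6) by blast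

lemma takeWhile_filter_mem:
  assumes "\<And>x. x \<in> Q \<Longrightarrow> P x"
  shows "takeWhile (\<lambda>x. x \<notin> Q) (filter P xs) = filter P (takeWhile (\<lambda>x. x \<notin> Q) xs)"
proof (induction xs)
  case (Cons a xs)
  then show ?case using assms[of a] by (cases "a \<in> Q"; cases "P a") simp_all
qed simp

lemma arc_filter:
  assumes "distinct cs" "\<And>x. x \<in> Q \<Longrightarrow> P x" "u \<in> Q" "u \<in> set cs"
  shows "arc (filter P cs) Q u = filter P (arc cs Q u)"
proof -
  obtain ys where ys: "cyc cs (u # ys)" using cyc_to_head[OF assms(4)] .
  have "cyc (filter P cs) (u # filter P ys)" using cyc_filter[OF ys, of P] assms by simp
  then have "arc (filter P cs) Q u = takeWhile (\<lambda>x. x \<notin> Q) (filter P ys)"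
    by (rule arc_cyc[rotated]) (use assms in simp)
  then show ?thesis using takeWhile_filter_mem[of Q P] arc_cyc[OF assms(1) ys] assms(2) by metis
qed

lemma arc_map:
  assumes "distinct cs" "inj_on f (set cs)" "Q \<subseteq> set cs" "u \<in> set cs"
  shows "arc (map f cs) (f ` Q) (f u) = map f (arc cs Q u)"
proof -
  obtain ys where ys: "cyc cs (u # ys)" using cyc_to_head[OF assms(4)] .
  have s: "set cs = insert u (set ys)" using cyc_set[OF ys] by auto
  have "cyc (map f cs) (f u # map f ys)" using cyc_map[OF ys, of f] by simp
  then have "arc (map f cs) (f ` Q) (f u) = takeWhile (\<lambda>x. x \<notin> f ` Q) (map f ys)"
    by (rule arc_cyc[rotated]) (use assms in \<open>simp add: distinct_map\<close>)
  also have "\<dots> = map f (takeWhile (\<lambda>x. f x \<notin> f ` Q) ys)" by (simp add: takeWhile_map comp_def)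
  also have "takeWhile (\<lambda>x. f x \<notin> f ` Q) ys = takeWhile (\<lambda>x. x \<notin> Q) ys"
  proof (intro takeWhile_cong refl)
    fix x assume "x \<in> set ys"
    then have "x \<in> set cs" using s by simp
    then have "f x \<in> f ` Q \<longleftrightarrow> x \<in> Q" using inj_on_image_mem_iff[OF assms(2) _ assms(3)] by metis
    then show "(f x \<notin> f ` Q) = (x \<notin> Q)" by simp
  qed
  finally show ?thesis using arc_cyc[OF assms(1) ys] by simp
qed

text \<open>Refining \<open>V\<close> to \<open>X\<close> only cuts the individual arcs of \<open>V\<close>.\<close>

lemma arc_nested:
  assumes "distinct cs" "V \<subseteq> X" "X \<subseteq> set cs" "v \<in> V" "u = v \<or> u \<in> X \<inter> set (arc cs V v)"
  shows "arc cs X u = arc (v # arc cs V v) (insert v (X \<inter> set (arc cs V v))) u"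
proof -
  have v: "v \<in> set cs" using assms by blast
  obtain z where z: "cyc cs (v # arc cs V v @ z)" "z = [] \<or> hd z \<in> V"
    "distinct (v # arc cs V v @ z)" "set (arc cs V v) \<inter> V = {}"
    "set cs = insert v (set (arc cs V v) \<union> set z)"
    by (rule arcE[OF assms(1,4) v])
  define a where "a = arc cs V v"
  define U where "U = insert v (X \<inter> set a)"
  have u: "u \<in> set (v # a)" using assms(5) a_def by auto
  then obtain p s where ps: "v # a = p @ u # s" using split_list by metis
  have d: "distinct (v # a)" using z(3) by (simp add: a_def)
  have "cyc (v # a @ z) (u # (s @ z @ p))"
    using cyc_append[of p "u # s @ z"] ps by (metis append.assoc append_Cons)
  then have "cyc cs (u # (s @ z @ p))" using z(1) a_def cyc_trans by blast
  then have 1: "arc cs X u = takeWhile (\<lambda>x. x \<notin> X) (s @ z @ p)" using arc_cyc assms(1) by metis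
  have "cyc (v # a) (u # (s @ p))" using cyc_append[of p "u # s"] ps by simp
  then have 2: "arc (v # a) U u = takeWhile (\<lambda>x. x \<notin> U) (s @ p)" using arc_cyc d by metis
  have sa: "set s \<subseteq> set a" using ps by (cases p) auto
  have nv: "v \<notin> set s" using sa d by auto
  have s_eq: "x \<in> X \<longleftrightarrow> x \<in> U" if "x \<in> set s" for x using that sa nv by (auto simp: U_def)
  show ?thesis
  proof (cases "\<exists>x\<in>set s. x \<in> X")
    case True
    then obtain x where x: "x \<in> set s" "x \<in> X" by blast
    have "takeWhile (\<lambda>x. x \<notin> X) (s @ z @ p) = takeWhile (\<lambda>x. x \<notin> X) s"
      using x takeWhile_append1[of x s "\<lambda>x. x \<notin> X" "z @ p"] by simp
    moreover have "takeWhile (\<lambda>x. x \<notin> U) (s @ p) = takeWhile (\<lambda>x. x \<notin> U) s"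
      using x s_eq takeWhile_append1[of x s "\<lambda>x. x \<notin> U" p] by simp
    moreover have "takeWhile (\<lambda>x. x \<notin> X) s = takeWhile (\<lambda>x. x \<notin> U) s"
      using s_eq by (intro takeWhile_cong) auto
    ultimately show ?thesis using 1 2 by (simp add: a_def U_def)
  next
    case False
    \<comment> \<open>If \<open>s\<close> contains no point of \<open>X\<close>, both walks leave
      the sector here: the large circle continues with a point of \<open>V\<close>, the small one
      returns to \<open>v\<close>. Both arcs therefore end with \<open>s\<close>.\<close>
    have hp: "p = [] \<or> hd p = v" using ps by (cases p) auto
    have "takeWhile (\<lambda>x. x \<notin> X) (z @ p) = []"
      using z(2) hp assms(2,4) by (cases z; cases p) auto
    then have "takeWhile (\<lambda>x. x \<notin> X) (s @ z @ p) = s"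
      using False by (subst takeWhile_append2) auto
    moreover have "takeWhile (\<lambda>x. x \<notin> U) p = []" using hp by (cases p) (auto simp: U_def)
    then have "takeWhile (\<lambda>x. x \<notin> U) (s @ p) = s"
      using False s_eq by (subst takeWhile_append2) auto
    ultimately show ?thesis using 1 2 by (simp add: a_def U_def)
  qed
qed

lemma sectors_partition:
  assumes "distinct cs" "V \<subseteq> X" "X \<subseteq> set cs" "V \<noteq> {}"
  shows "X = (\<Union>v\<in>V. insert v (X \<inter> set (arc cs V v)))"
proof -
  have "\<exists>v\<in>V. p \<in> set (arc cs V v)" if "p \<in> X" "p \<notin> V" for p
    using arc_cover[OF assms(1) _ assms(4)] assms that by auto
  then show ?thesis using assms(2) by blast
qed

text \<open>Sorts the gaps of the finer set by the arc of \<open>V\<close> that contains them. Each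
  group is a product over the small circle \<open>v # arc cs V v\<close>, so that it can be treated
  without reference to the rest.\<close>

lemma prod_arcs_nested:
  fixes f :: "'p list \<Rightarrow> 'b::comm_monoid_mult"
  assumes "distinct cs" "V \<subseteq> X" "X \<subseteq> set cs" "V \<noteq> {}"
  shows "(\<Prod>u\<in>X. f (arc cs X u)) =
    (\<Prod>v\<in>V. \<Prod>u\<in>insert v (X \<inter> set (arc cs V v)).
       f (arc (v # arc cs V v) (insert v (X \<inter> set (arc cs V v))) u))"
proof -
  have VS: "V \<subseteq> set cs" using assms by blast
  have fin: "finite V" using VS finite_subset by blast
  have dj: "insert v (X \<inter> set (arc cs V v)) \<inter> insert w (X \<inter> set (arc cs V w)) = {}"
    if "v \<in> V" "w \<in> V" "v \<noteq> w" for v w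
  proof -
    have "v \<in> set cs" "w \<in> set cs" using that VS by auto
    then show ?thesis
      using arc_disjoint[OF assms(1) VS that] arc_subset[OF assms(1) that(1)] arc_subset[OF assms(1) that(2)]
        that by auto
  qed
  have "(\<Prod>u\<in>X. f (arc cs X u)) = (\<Prod>u\<in>(\<Union>v\<in>V. insert v (X \<inter> set (arc cs V v))). f (arc cs X u))"
    using sectors_partition[OF assms] by simp
  also have "\<dots> = (\<Prod>v\<in>V. \<Prod>u\<in>insert v (X \<inter> set (arc cs V v)). f (arc cs X u))"
    using fin dj by (intro prod.UNION_disjoint) auto
  also have "\<dots> = (\<Prod>v\<in>V. \<Prod>u\<in>insert v (X \<inter> set (arc cs V v)).
       f (arc (v # arc cs V v) (insert v (X \<inter> set (arc cs V v))) u))"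
    using assms by (intro prod.cong refl arg_cong[of _ _ f] arc_nested) auto
  finally show ?thesis .
qed

text \<open>The complement of an arc is an interval of the circle, hence is met in one go by the
  walk that starts at the last point of \<open>W\<close> in the arc.\<close>

lemma arc_within:
  assumes "distinct cs" "V \<subseteq> set cs" "v \<in> V" "W \<subseteq> set (arc cs V v)" "W \<noteq> {}"
  shows "\<exists>w\<in>W. set cs - set (arc cs V v) \<subseteq> set (arc cs W w)"
proof -
  have v: "v \<in> set cs" using assms by blast
  obtain z where z: "cyc cs (v # arc cs V v @ z)" "z = [] \<or> hd z \<in> V"
    "distinct (v # arc cs V v @ z)" "set (arc cs V v) \<inter> V = {}"
    "set cs = insert v (set (arc cs V v) \<union> set z)"
    by (rule arcE[OF assms(1,3) v])
  have "\<exists>w\<in>set (arc cs V v). w \<in> W" using assms by blast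
  then obtain b w c where bc: "arc cs V v = b @ w # c" "w \<in> W" "\<forall>y\<in>set c. y \<notin> W"
    using split_list_last_prop[of "arc cs V v" "\<lambda>w. w \<in> W"] by metis
  have "cyc (v # arc cs V v @ z) (w # (c @ z @ v # b))"
    using cyc_append[of "v # b" "w # c @ z"] bc by simp
  then have "cyc cs (w # (c @ z @ v # b))" using z cyc_trans by blast
  then have "arc cs W w = takeWhile (\<lambda>x. x \<notin> W) (c @ z @ v # b)" using arc_cyc assms(1) by metis
  moreover have "W \<inter> set z = {}" "v \<notin> W" using assms(4) z(3) by auto
  ultimately have "arc cs W w = c @ z @ v # takeWhile (\<lambda>x. x \<notin> W) b"
    using bc by (subst (asm) takeWhile_append2, blast, subst (asm) takeWhile_append2) auto
  then have "set cs - set (arc cs V v) \<subseteq> set (arc cs W w)" using z(5) by auto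
  then show ?thesis using bc by blast
qed

lemma arc_adjacent_next:
  assumes "distinct cs" "v \<in> V" "V \<subseteq> set cs" "cyc cs (p # q # r)" "p \<in> set (arc cs V v)"
  shows "q \<in> V \<or> q \<in> set (arc cs V v)"
proof -
  have v: "v \<in> set cs" using assms by blast
  obtain z where z: "cyc cs (v # arc cs V v @ z)" "z = [] \<or> hd z \<in> V"
    "distinct (v # arc cs V v @ z)" "set (arc cs V v) \<inter> V = {}"
    "set cs = insert v (set (arc cs V v) \<union> set z)"
    by (rule arcE[OF assms(1,2) v])
  obtain b c where bc: "arc cs V v = b @ p # c" using assms(5) split_list by metis
  have "cyc (v # arc cs V v @ z) (p # (c @ z @ v # b))"
    using cyc_append[of "v # b" "p # c @ z"] bc by simp
  then have "cyc cs (p # (c @ z @ v # b))" using z cyc_trans by blast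
  then have "q # r = c @ z @ v # b" using cyc_distinct_unique_head[OF assms(1,4)] by metis
  then show ?thesis using z(2) bc assms(2) by (cases c; cases z) auto
qed

text \<open>Reduced to the forward statement: otherwise \<open>p\<close> lies in the arc of another
  point of \<open>V\<close>, and stepping on to \<open>q\<close> cannot enter the arc of
  \<open>v\<close>.\<close>

lemma arc_adjacent_prev:
  assumes "distinct cs" "v \<in> V" "V \<subseteq> set cs" "cyc cs (p # q # r)" "q \<in> set (arc cs V v)"
  shows "p \<in> V \<or> p \<in> set (arc cs V v)"
proof (rule ccontr)
  assume n: "\<not> ?thesis"
  have p: "p \<in> set cs" using cyc_set[OF assms(4)] by auto
  obtain w where w: "w \<in> V" "p \<in> set (arc cs V w)"
    using arc_cover[OF assms(1,3) _ p] n assms(2) by auto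
  have "q \<in> V \<or> q \<in> set (arc cs V w)" using arc_adjacent_next[OF assms(1) w(1) assms(3,4) w(2)] .
  moreover have "q \<notin> V" using arc_subset[OF assms(1,2)] assms by blast
  ultimately have "w = v" using arc_unique[OF assms(1,3) w(1) assms(2)] assms(5) by blast
  then show False using w n by blast
qed

section \<open>Non-crossing partitions and the arcs of a block\<close>

text \<open>Symmetric in the two sets on purpose: rotating the list turns the pattern V W V W into W
  V W V, so only the symmetric form is preserved for a fixed pair.\<close>

definition crosses :: "'p list \<Rightarrow> 'p set \<Rightarrow> 'p set \<Rightarrow> bool" where
  "crosses cs V W \<longleftrightarrow> (\<exists>h i j k. h < i \<and> i < j \<and> j < k \<and> k < length cs \<and>
     (cs ! h \<in> V \<and> cs ! i \<in> W \<and> cs ! j \<in> V \<and> cs ! k \<in> W \<or>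
      cs ! h \<in> W \<and> cs ! i \<in> V \<and> cs ! j \<in> W \<and> cs ! k \<in> V))"

lemma noncrossing_iff_crosses:
  "noncrossing cs \<pi> \<longleftrightarrow> (\<forall>V\<in>\<pi>. \<forall>W\<in>\<pi>. V \<noteq> W \<longrightarrow> \<not> crosses cs V W)"
proof -
  define alternates where "alternates V W \<longleftrightarrow> (\<exists>h i j k. h < i \<and> i < j \<and> j < k \<and> k < length cs \<and>
     cs ! h \<in> V \<and> cs ! i \<in> W \<and> cs ! j \<in> V \<and> cs ! k \<in> W)" for V W
  have 1: "crosses cs V W \<longleftrightarrow> alternates V W \<or> alternates W V" for V W
    unfolding crosses_def alternates_def conj_disj_distribL ex_disj_distrib ..
  have 2: "noncrossing cs \<pi> \<longleftrightarrow> \<not> (\<exists>V\<in>\<pi>. \<exists>W\<in>\<pi>. V \<noteq> W \<and> alternates V W)"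
    unfolding noncrossing_def alternates_def ..
  show ?thesis unfolding 1 2 by blast
qed

lemma crosses_rotate1:
  assumes "crosses (x # xs) V W"
  shows "crosses (xs @ [x]) V W"
proof -
  let ?l = "xs @ [x]"
  obtain h i j k where b: "h < i" "i < j" "j < k" "k < length (x # xs)" and
    m: "(x # xs) ! h \<in> V \<and> (x # xs) ! i \<in> W \<and> (x # xs) ! j \<in> V \<and> (x # xs) ! k \<in> W \<or>
        (x # xs) ! h \<in> W \<and> (x # xs) ! i \<in> V \<and> (x # xs) ! j \<in> W \<and> (x # xs) ! k \<in> V"
    using assms unfolding crosses_def by blast
  have shift: "?l ! (p - 1) = (x # xs) ! p" if "0 < p" "p < length (x # xs)" for p
    using that by (cases p) (auto simp: nth_append)
  show ?thesis
  proof (cases h)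
    case 0
    \<comment> \<open>The first of the four positions moves to the end, and the pattern is read with
      the two sets exchanged.\<close>
    have "(x # xs) ! h = ?l ! length xs" using 0 by simp
    moreover have "?l ! (i - 1) = (x # xs) ! i" "?l ! (j - 1) = (x # xs) ! j" "?l ! (k - 1) = (x # xs) ! k"
      using shift b by auto
    moreover have "i - 1 < j - 1" "j - 1 < k - 1" "k - 1 < length xs" "length xs < length ?l" using b by auto
    ultimately show ?thesis using m unfolding crosses_def by metis
  next
    case (Suc h')
    moreover have "?l ! (h - 1) = (x # xs) ! h" using b Suc by (intro shift) auto
    moreover have "?l ! (i - 1) = (x # xs) ! i" using b Suc by (intro shift) auto
    moreover have "?l ! (j - 1) = (x # xs) ! j" using b Suc by (intro shift) auto
    moreover have "?l ! (k - 1) = (x # xs) ! k" using b Suc by (intro shift) auto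
    moreover have "h - 1 < i - 1" "i - 1 < j - 1" "j - 1 < k - 1" "k - 1 < length ?l" using b Suc by auto
    ultimately show ?thesis using m unfolding crosses_def by metis
  qed
qed

lemma crosses_cyc:
  assumes "cyc xs ys" "crosses xs V W"
  shows "crosses ys V W"
proof -
  have "crosses (rotate n xs) V W" for n
  proof (induction n)
    case (Suc n)
    then show ?case using crosses_rotate1 by (cases "rotate n xs") auto
  qed (simp add: assms)
  then show ?thesis using assms(1) cyc_rotate_iff by metis
qed

text \<open>Translates quadruples of positions into arcs. From here on non-crossing means that one
  block lies in a single arc of the other.\<close>

lemma not_crosses_iff_arc:
  assumes "distinct cs" "V \<subseteq> set cs" "W \<subseteq> set cs" "V \<inter> W = {}" "V \<noteq> {}" "W \<noteq> {}"
  shows "\<not> crosses cs V W \<longleftrightarrow> (\<exists>v\<in>V. W \<subseteq> set (arc cs V v))"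
proof
  assume n: "\<not> crosses cs V W"
  obtain w where w: "w \<in> W" using assms by blast
  then obtain v where v: "v \<in> V" "w \<in> set (arc cs V v)"
    using arc_cover[OF assms(1,2,5), of w] assms(3,4) by auto
  have vc: "v \<in> set cs" using v assms by blast
  obtain z where z: "cyc cs (v # arc cs V v @ z)" "z = [] \<or> hd z \<in> V"
    "distinct (v # arc cs V v @ z)" "set (arc cs V v) \<inter> V = {}"
    "set cs = insert v (set (arc cs V v) \<union> set z)"
    by (rule arcE[OF assms(1) v(1) vc])
  define a where "a = arc cs V v"
  have "u \<in> set a" if u: "u \<in> W" for u
  proof (rule ccontr)
    assume "u \<notin> set a"
    then have uz: "u \<in> set z" using z(5) u assms v a_def by auto
    obtain i where i: "i < length a" "a ! i = w" using v a_def by (metis in_set_conv_nth)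
    obtain k where k: "k < length z" "z ! k = u" using uz by (metis in_set_conv_nth)
    \<comment> \<open>The rest \<open>z\<close> starts in \<open>V\<close>, so \<open>v\<close>,
      \<open>w\<close>, \<open>z ! 0\<close>, \<open>u\<close> alternate between the two
      sets.\<close>
    have "z ! 0 \<in> V" using z(2) uz by (cases z) auto
    then have "k \<noteq> 0" using k u assms(4) by (metis disjoint_iff)
    let ?l = "v # a @ z"
    have "?l ! 0 = v" "?l ! (Suc i) = w" "?l ! (Suc (length a)) = z ! 0" "?l ! (Suc (length a + k)) = u"
      using i k by (auto simp: nth_append)
    moreover have "0 < Suc i" "Suc i < Suc (length a)" "Suc (length a) < Suc (length a + k)"
      "Suc (length a + k) < length ?l" using i k \<open>k \<noteq> 0\<close> by auto
    ultimately have "crosses ?l V W" using v w u \<open>z ! 0 \<in> V\<close> unfolding crosses_def by metis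
    then have "crosses cs V W" using crosses_cyc z(1) cyc_sym a_def by metis
    with n show False by blast
  qed
  then show "\<exists>v\<in>V. W \<subseteq> set (arc cs V v)" using v a_def by blast
next
  assume "\<exists>v\<in>V. W \<subseteq> set (arc cs V v)"
  then obtain v where v: "v \<in> V" "W \<subseteq> set (arc cs V v)" by blast
  have vc: "v \<in> set cs" using v assms by blast
  obtain z where z: "cyc cs (v # arc cs V v @ z)" "z = [] \<or> hd z \<in> V"
    "distinct (v # arc cs V v @ z)" "set (arc cs V v) \<inter> V = {}"
    "set cs = insert v (set (arc cs V v) \<union> set z)"
    by (rule arcE[OF assms(1) v(1) vc])
  define a where "a = arc cs V v"
  let ?l = "v # a @ z"
  \<comment> \<open>In this reading \<open>W\<close> occupies positions in the interval from
    \<open>1\<close> to \<open>length a\<close> and \<open>V\<close> only positions outside it; four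
    alternating positions would contradict this.\<close>
  have pos: "?l ! p \<in> set a \<longleftrightarrow> 0 < p \<and> p \<le> length a" if p: "p < length ?l" for p
  proof
    assume "?l ! p \<in> set a"
    then obtain i where i: "i < length a" "a ! i = ?l ! p" by (metis in_set_conv_nth)
    then have "?l ! (Suc i) = ?l ! p" by (simp add: nth_append)
    moreover have "distinct ?l" "Suc i < length ?l" using z(3) i a_def by auto
    ultimately have "Suc i = p" using p nth_eq_iff_index_eq by blast
    then show "0 < p \<and> p \<le> length a" using i by auto
  next
    assume "0 < p \<and> p \<le> length a"
    then show "?l ! p \<in> set a" by (cases p) (auto simp: nth_append)
  qed
  have W: "?l ! p \<in> W \<Longrightarrow> 0 < p \<and> p \<le> length a" if "p < length ?l" for p
    using pos[OF that] v a_def by auto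
  have V: "?l ! p \<in> V \<Longrightarrow> \<not> (0 < p \<and> p \<le> length a)" if "p < length ?l" for p
    using pos[OF that] z(4) a_def by auto
  have "\<not> crosses ?l V W"
  proof
    assume "crosses ?l V W"
    then obtain h i j k where b: "h < i" "i < j" "j < k" "k < length ?l" and
      m: "?l ! h \<in> V \<and> ?l ! i \<in> W \<and> ?l ! j \<in> V \<and> ?l ! k \<in> W \<or>
        ?l ! h \<in> W \<and> ?l ! i \<in> V \<and> ?l ! j \<in> W \<and> ?l ! k \<in> V"
      unfolding crosses_def by blast
    have l: "h < length ?l" "i < length ?l" "j < length ?l" using b by linarith+
    from m show False
    proof
      assume "?l ! h \<in> V \<and> ?l ! i \<in> W \<and> ?l ! j \<in> V \<and> ?l ! k \<in> W"
      then have "0 < i" "k \<le> length a" "\<not> (0 < j \<and> j \<le> length a)" using V W l b(4) by blast+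
      then show False using b by linarith
    next
      assume "?l ! h \<in> W \<and> ?l ! i \<in> V \<and> ?l ! j \<in> W \<and> ?l ! k \<in> V"
      then have "0 < h" "j \<le> length a" "\<not> (0 < i \<and> i \<le> length a)" using V W l b(4) by blast+
      then show False using b by linarith
    qed
  qed
  then show "\<not> crosses cs V W" using crosses_cyc z(1) a_def by metis
qed

lemma NC_on_iff:
  assumes "distinct cs"
  shows "\<pi> \<in> NC_on cs \<longleftrightarrow> partition_on (set cs) \<pi> \<and>
    (\<forall>V\<in>\<pi>. \<forall>W\<in>\<pi>. V \<noteq> W \<longrightarrow> (\<exists>v\<in>V. W \<subseteq> set (arc cs V v)))"
proof -
  have "(\<not> crosses cs V W) = (\<exists>v\<in>V. W \<subseteq> set (arc cs V v))"
    if "partition_on (set cs) \<pi>" "V \<in> \<pi>" "W \<in> \<pi>" "V \<noteq> W" for V W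
    using that by (intro not_crosses_iff_arc[OF assms]) (auto simp: partition_on_def disjoint_def)
  then have "(\<forall>V\<in>\<pi>. \<forall>W\<in>\<pi>. V \<noteq> W \<longrightarrow> \<not> crosses cs V W) \<longleftrightarrow>
      (\<forall>V\<in>\<pi>. \<forall>W\<in>\<pi>. V \<noteq> W \<longrightarrow> (\<exists>v\<in>V. W \<subseteq> set (arc cs V v)))"
    if "partition_on (set cs) \<pi>"
    using that by meson
  then show ?thesis unfolding NC_on_def noncrossing_iff_crosses mem_Collect_eq by meson
qed

lemma NC_onD:
  assumes "\<pi> \<in> NC_on cs"
  shows "partition_on (set cs) \<pi>" "V \<in> \<pi> \<Longrightarrow> V \<subseteq> set cs" "V \<in> \<pi> \<Longrightarrow> V \<noteq> {}"
    "V \<in> \<pi> \<Longrightarrow> W \<in> \<pi> \<Longrightarrow> V \<noteq> W \<Longrightarrow> V \<inter> W = {}" "finite \<pi>" "V \<in> \<pi> \<Longrightarrow> finite V"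
    "x \<in> set cs \<Longrightarrow> \<exists>V\<in>\<pi>. x \<in> V"
proof -
  show p: "partition_on (set cs) \<pi>" using assms by (simp add: NC_on_def)
  then show s: "V \<in> \<pi> \<Longrightarrow> V \<subseteq> set cs" "V \<in> \<pi> \<Longrightarrow> V \<noteq> {}"
    "V \<in> \<pi> \<Longrightarrow> W \<in> \<pi> \<Longrightarrow> V \<noteq> W \<Longrightarrow> V \<inter> W = {}"
    "x \<in> set cs \<Longrightarrow> \<exists>V\<in>\<pi>. x \<in> V"
    by (auto simp: partition_on_def disjoint_def)
  show "finite \<pi>" using finite_elements[OF _ p] by simp
  show "V \<in> \<pi> \<Longrightarrow> finite V" using s finite_subset by blast
qed

lemma NC_on_cyc:
  assumes "distinct cs" "cyc cs ds"
  shows "NC_on ds = NC_on cs"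
proof -
  have "\<pi> \<in> NC_on ds \<longleftrightarrow> \<pi> \<in> NC_on cs" for \<pi>
  proof -
    have d: "distinct ds" using assms cyc_distinct by blast
    have s: "set ds = set cs" using assms cyc_set by blast
    have "arc ds V v = arc cs V v" if "v \<in> set cs" for V v using arc_cyc_eq[OF assms that] .
    then have "\<forall>V\<in>\<pi>. \<forall>v\<in>V. arc ds V v = arc cs V v" if "partition_on (set cs) \<pi>"
      using that unfolding partition_on_def by blast
    then show ?thesis unfolding NC_on_iff[OF assms(1)] NC_on_iff[OF d] s by (metis (no_types, lifting))
  qed
  then show ?thesis by blast
qed

lemma crosses_map:
  assumes "inj_on f (set cs)" "V \<subseteq> set cs" "W \<subseteq> set cs"
  shows "crosses (map f cs) (f ` V) (f ` W) \<longleftrightarrow> crosses cs V W"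
proof -
  have "f (cs ! i) \<in> f ` U \<longleftrightarrow> cs ! i \<in> U" if "i < length cs" "U \<subseteq> set cs" for i U
    using inj_on_image_mem_iff[OF assms(1) _ that(2)] that(1) nth_mem by metis
  then have "map f cs ! i \<in> f ` V \<longleftrightarrow> cs ! i \<in> V" "map f cs ! i \<in> f ` W \<longleftrightarrow> cs ! i \<in> W"
    if "i < length cs" for i using that assms by auto
  then show ?thesis unfolding crosses_def by (smt (verit, ccfv_SIG) length_map order.strict_trans)
qed

lemma NC_on_map_mem:
  assumes "distinct cs" "inj_on f (set cs)" "\<pi> \<in> NC_on cs"
  shows "(`) f ` \<pi> \<in> NC_on (map f cs)"
proof -
  have "partition_on (f ` set cs) ((`) f ` \<pi> - {{}})"
    by (rule partition_on_inj_image) (use assms NC_onD in auto)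
  moreover have "{} \<notin> (`) f ` \<pi>" using NC_onD(3)[OF assms(3)] by auto
  ultimately have p: "partition_on (f ` set cs) ((`) f ` \<pi>)" by simp
  have "\<not> crosses (map f cs) (f ` V) (f ` W)" if "V \<in> \<pi>" "W \<in> \<pi>" "f ` V \<noteq> f ` W" for V W
  proof -
    have "\<not> crosses cs V W" using assms(3) that unfolding NC_on_def noncrossing_iff_crosses by blast
    then show ?thesis using crosses_map[OF assms(2)] NC_onD(2)[OF assms(3)] that by metis
  qed
  then have "noncrossing (map f cs) ((`) f ` \<pi>)" unfolding noncrossing_iff_crosses by blast
  with p show ?thesis by (simp add: NC_on_def)
qed

lemma bij_betw_NC_on_map:
  assumes "distinct cs" "inj_on f (set cs)"
  shows "bij_betw ((`) ((`) f)) (NC_on cs) (NC_on (map f cs))"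
proof -
  define g where "g = inv_into (set cs) f"
  have gf: "g (f x) = x" if "x \<in> set cs" for x using that assms by (simp add: g_def)
  have m: "map g (map f cs) = cs" by (simp add: gf map_idI)
  have d: "distinct (map f cs)" using assms by (simp add: distinct_map)
  have i: "inj_on g (set (map f cs))" using gf assms by (auto simp: inj_on_def)
  have gf_id: "(`) g ` ((`) f ` \<pi>) = \<pi>" if "\<pi> \<in> NC_on cs" for \<pi>
  proof -
    have "g ` f ` V = V" if "V \<in> \<pi>" for V
      using NC_onD(2)[OF \<open>\<pi> \<in> NC_on cs\<close> that] gf by (force simp: image_image)
    then show ?thesis by (force simp: image_image)
  qed
  have fg_id: "(`) f ` ((`) g ` \<sigma>) = \<sigma>" if "\<sigma> \<in> NC_on (map f cs)" for \<sigma>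
  proof -
    have "f ` g ` V = V" if "V \<in> \<sigma>" for V
    proof -
      have "V \<subseteq> f ` set cs" using NC_onD(2)[OF \<open>\<sigma> \<in> NC_on (map f cs)\<close> that] by simp
      then have "\<forall>y\<in>V. f (g y) = y" by (auto simp: gf)
      then show ?thesis by (force simp: image_image)
    qed
    then show ?thesis by (force simp: image_image)
  qed
  show ?thesis
  proof (rule bij_betw_byWitness[where f' = "(`) ((`) g)"])
    show "\<forall>\<pi>\<in>NC_on cs. (`) g ` ((`) f ` \<pi>) = \<pi>" using gf_id by blast
    show "\<forall>\<sigma>\<in>NC_on (map f cs). (`) f ` ((`) g ` \<sigma>) = \<sigma>" using fg_id by blast
    show "(`) ((`) f) ` NC_on cs \<subseteq> NC_on (map f cs)" using NC_on_map_mem[OF assms] by blast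
    show "(`) ((`) g) ` NC_on (map f cs) \<subseteq> NC_on cs" using NC_on_map_mem[OF d i] m by auto
  qed
qed

text \<open>An arc may run over the end of the list, so the order of \<open>cs\<close> gives back
  the arc only up to rotation.\<close>

lemma filter_arc:
  assumes "distinct cs" "v \<in> V" "v \<in> set cs"
  shows "cyc (filter (\<lambda>x. x \<in> set (arc cs V v)) cs) (arc cs V v)"
proof -
  obtain z where z: "cyc cs (v # arc cs V v @ z)" "distinct (v # arc cs V v @ z)"
    by (rule arcE[OF assms])
  have "filter (\<lambda>x. x \<in> set (arc cs V v)) (arc cs V v) = arc cs V v" by (simp add: filter_id_conv)
  moreover have "filter (\<lambda>x. x \<in> set (arc cs V v)) z = []" using z(2) by (auto simp: filter_empty_conv)
  ultimately have "filter (\<lambda>x. x \<in> set (arc cs V v)) (v # arc cs V v @ z) = arc cs V v"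
    using z(2) by simp
  then show ?thesis using cyc_filter[OF z(1), of "\<lambda>x. x \<in> set (arc cs V v)"] by simp
qed

text \<open>Treating an arc as a circle of its own merely deletes the outside from the arcs of sets
  within it. This makes recursion into arcs possible.\<close>

lemma arc_of_arc:
  assumes "distinct cs" "v \<in> V" "v \<in> set cs" "W \<subseteq> set (arc cs V v)" "w \<in> W"
  shows "arc (arc cs V v) W w = filter (\<lambda>x. x \<in> set (arc cs V v)) (arc cs W w)"
proof -
  have w: "w \<in> set cs" using arc_subset[OF assms(1-3)] assms by blast
  have "arc (arc cs V v) W w = arc (filter (\<lambda>x. x \<in> set (arc cs V v)) cs) W w"
    using arc_cyc_eq[OF _ filter_arc[OF assms(1-3)]] assms(1,4,5) w by auto
  also have "\<dots> = filter (\<lambda>x. x \<in> set (arc cs V v)) (arc cs W w)"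
    using assms w by (intro arc_filter) auto
  finally show ?thesis .
qed

definition sector :: "'p list \<Rightarrow> 'p set \<Rightarrow> 'p set set \<Rightarrow> 'p \<Rightarrow> 'p set set" where
  "sector cs V \<pi> v = {W \<in> \<pi>. W \<subseteq> set (arc cs V v)}"

definition glue :: "'p set \<Rightarrow> ('p \<Rightarrow> 'p set set) \<Rightarrow> 'p set set" where
  "glue V \<nu> = insert V (\<Union>v\<in>V. \<nu> v)"

lemma sector_in_NC_on:
  assumes "distinct cs" "\<pi> \<in> NC_on cs" "V \<in> \<pi>" "v \<in> V"
  shows "sector cs V \<pi> v \<in> NC_on (arc cs V v)"
proof -
  let ?a = "arc cs V v"
  have v: "v \<in> set cs" "V \<subseteq> set cs" using NC_onD[OF assms(2)] assms by auto
  have VI: "set ?a \<inter> V = {}" using arc_subset[OF assms(1,4) v(1)] by blast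
  have "p \<in> \<Union> (sector cs V \<pi> v)" if p: "p \<in> set ?a" for p
  proof -
    obtain W where W: "W \<in> \<pi>" "p \<in> W"
      using NC_onD(7)[OF assms(2)] p arc_subset[OF assms(1,4) v(1)] by blast
    have "W \<noteq> V" using p VI W by blast
    then obtain u where u: "u \<in> V" "W \<subseteq> set (arc cs V u)"
      using assms(1-3) W NC_on_iff by metis
    then have "u = v" using arc_unique[OF assms(1) v(2) u(1) assms(4)] p W by blast
    then show ?thesis using u W by (auto simp: sector_def)
  qed
  then have "\<Union> (sector cs V \<pi> v) = set ?a" by (auto simp: sector_def)
  moreover have "disjoint (sector cs V \<pi> v)" "{} \<notin> sector cs V \<pi> v"
    using NC_onD(1)[OF assms(2)] by (auto simp: sector_def partition_on_def disjoint_def)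
  ultimately have p: "partition_on (set ?a) (sector cs V \<pi> v)" by (auto simp: partition_on_def)
  have "\<exists>w\<in>W. W' \<subseteq> set (arc ?a W w)"
    if W: "W \<in> sector cs V \<pi> v" "W' \<in> sector cs V \<pi> v" "W \<noteq> W'" for W W'
  proof -
    have "W \<in> \<pi>" "W' \<in> \<pi>" "W \<subseteq> set ?a" "W' \<subseteq> set ?a" using W by (auto simp: sector_def)
    then obtain w where w: "w \<in> W" "W' \<subseteq> set (arc cs W w)" using assms(1,2) W(3) NC_on_iff by metis
    then have "W' \<subseteq> set (arc ?a W w)"
      using arc_of_arc[OF assms(1,4) v(1) \<open>W \<subseteq> set ?a\<close> w(1)] \<open>W' \<subseteq> set ?a\<close> by auto
    then show ?thesis using w by blast
  qed
  then show ?thesis using p NC_on_iff distinct_arc[OF assms(1,4) v(1)] by blast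
qed

lemma glue_sector:
  assumes "distinct cs" "\<pi> \<in> NC_on cs" "V \<in> \<pi>"
  shows "glue V (sector cs V \<pi>) = \<pi>"
proof -
  have "W \<in> glue V (sector cs V \<pi>)" if W: "W \<in> \<pi>" for W
  proof (cases "W = V")
    case False
    then obtain u where "u \<in> V" "W \<subseteq> set (arc cs V u)"
      using assms W NC_on_iff[OF assms(1), of \<pi>] by blast
    then show ?thesis using W by (auto simp: glue_def sector_def)
  qed (simp add: glue_def)
  then show ?thesis using assms(3) by (auto simp: glue_def sector_def)
qed

text \<open>Only blocks of different sectors need an argument: by \<open>arc_within\<close>, all
  that lies outside the arc of \<open>v\<close> is behind a single point of any block inside that
  arc. Disjointness then follows, because an arc of a block avoids the block.\<close>

lemma glue_in_NC_on:
  assumes "distinct cs" "V \<subseteq> set cs" "V \<noteq> {}" "\<And>v. v \<in> V \<Longrightarrow> \<nu> v \<in> NC_on (arc cs V v)"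
  shows "glue V \<nu> \<in> NC_on cs"
proof -
  have vc: "v \<in> set cs" if "v \<in> V" for v using assms(2) that by blast
  have sub: "W \<subseteq> set (arc cs V v)" "W \<noteq> {}" "W \<inter> V = {}" "W \<subseteq> set cs" if "v \<in> V" "W \<in> \<nu> v" for v W
    using NC_onD(2,3)[OF assms(4)[OF that(1)] that(2)] arc_subset[OF assms(1) that(1) vc[OF that(1)]] by auto
  have cover: "p \<in> \<Union> (glue V \<nu>)" if pc: "p \<in> set cs" for p
  proof (cases "p \<in> V")
    case False
    then obtain v where v: "v \<in> V" "p \<in> set (arc cs V v)"
      using arc_cover[OF assms(1-3) pc False] by blast
    then show ?thesis using NC_onD(7)[OF assms(4)[OF v(1)] v(2)] by (auto simp: glue_def)
  qed (simp add: glue_def)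
  have arcs: "\<exists>x\<in>A. B \<subseteq> set (arc cs A x)" if AB: "A \<in> glue V \<nu>" "B \<in> glue V \<nu>" "A \<noteq> B" for A B
  proof -
    consider (1) "A = V" | (2) v where "v \<in> V" "A \<in> \<nu> v" using AB by (auto simp: glue_def)
    then show ?thesis
    proof cases
      case 1
      then obtain v where "v \<in> V" "B \<in> \<nu> v" using AB by (auto simp: glue_def)
      then show ?thesis using sub 1 by blast
    next
      case 2
      note A = sub[OF 2]
      show ?thesis
      proof (cases "B \<in> \<nu> v")
        case True
        obtain w where w: "w \<in> A" "B \<subseteq> set (arc (arc cs V v) A w)"
          using assms(4)[OF 2(1)] NC_on_iff[OF distinct_arc[OF assms(1) 2(1) vc[OF 2(1)]]] 2 True AB(3) by blast
        then have "B \<subseteq> set (arc cs A w)"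
          using arc_of_arc[OF assms(1) 2(1) vc[OF 2(1)] A(1) w(1)] by auto
        with w show ?thesis by blast
      next
        case False
        obtain w where w: "w \<in> A" "set cs - set (arc cs V v) \<subseteq> set (arc cs A w)"
          using arc_within[OF assms(1,2) 2(1) A(1,2)] by blast
        have "B \<subseteq> set cs - set (arc cs V v)"
        proof (cases "B = V")
          case True
          then show ?thesis using assms(2) arc_subset[OF assms(1) 2(1) vc[OF 2(1)]] by blast
        next
          case False
          then obtain u where u: "u \<in> V" "B \<in> \<nu> u" using AB by (auto simp: glue_def)
          then have "u \<noteq> v" using \<open>B \<notin> \<nu> v\<close> by blast
          then show ?thesis using sub[OF u] arc_disjoint[OF assms(1,2) u(1) 2(1)] by blast
        qed
        with w show ?thesis by blast
      qed
    qed
  qed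
  have "A \<inter> B = {}" if AB: "A \<in> glue V \<nu>" "B \<in> glue V \<nu>" "A \<noteq> B" for A B
  proof -
    obtain x where x: "x \<in> A" "B \<subseteq> set (arc cs A x)" using arcs[OF AB] by blast
    have "A \<subseteq> set cs"
    proof (cases "A = V")
      case False
      then obtain v where "v \<in> V" "A \<in> \<nu> v" using AB(1) unfolding glue_def by blast
      then show ?thesis by (rule sub(4))
    qed (use assms(2) in simp)
    then show ?thesis using arc_subset[OF assms(1) x(1)] x by blast
  qed
  then have "disjoint (glue V \<nu>)" by (auto simp: disjoint_def)
  moreover have "{} \<notin> glue V \<nu>" using assms(3) sub(2) unfolding glue_def by blast
  moreover have "\<Union> (glue V \<nu>) \<subseteq> set cs"
  proof -
    have "W \<subseteq> set cs" if W: "W \<in> glue V \<nu>" for W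
    proof (cases "W = V")
      case False
      then obtain v where "v \<in> V" "W \<in> \<nu> v" using W unfolding glue_def by blast
      then show ?thesis by (rule sub(4))
    qed (use assms(2) in simp)
    then show ?thesis by blast
  qed
  then have "\<Union> (glue V \<nu>) = set cs" using cover by blast
  ultimately show ?thesis using arcs NC_on_iff[OF assms(1)] by (auto simp: partition_on_def)
qed

lemma sector_glue:
  assumes "distinct cs" "V \<subseteq> set cs" "V \<noteq> {}" "\<And>v. v \<in> V \<Longrightarrow> \<nu> v \<in> NC_on (arc cs V v)" "v \<in> V"
  shows "sector cs V (glue V \<nu>) v = \<nu> v"
proof -
  have vc: "v \<in> set cs" if "v \<in> V" for v using assms(2) that by blast
  have sub: "W \<subseteq> set (arc cs V v)" "W \<noteq> {}" if "v \<in> V" "W \<in> \<nu> v" for v W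
    using NC_onD(2,3)[OF assms(4)[OF that(1)] that(2)] by auto
  have "W \<in> \<nu> v" if W: "W \<in> glue V \<nu>" "W \<subseteq> set (arc cs V v)" for W
  proof -
    have "W \<noteq> V" using W assms(3) arc_subset[OF assms(1,5) vc[OF assms(5)]] by blast
    then obtain u where u: "u \<in> V" "W \<in> \<nu> u" using W(1) unfolding glue_def by blast
    obtain p where "p \<in> W" using sub[OF u] by blast
    then have "u = v" using arc_unique[OF assms(1,2) u(1) assms(5)] sub[OF u] W(2) by blast
    with u show ?thesis by simp
  qed
  then show ?thesis using sub(1)[OF assms(5)] assms(5) by (auto simp: sector_def glue_def)
qed

text \<open>A non-crossing partition containing \<open>V\<close> amounts to independent non-crossing
  partitions of the arcs of \<open>V\<close>; cutting and gluing are mutually inverse.\<close>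

lemma bij_betw_sectors:
  assumes "distinct cs" "V \<subseteq> set cs" "V \<noteq> {}"
  shows "bij_betw (\<lambda>\<pi>. restrict (sector cs V \<pi>) V) {\<pi> \<in> NC_on cs. V \<in> \<pi>}
    (PiE V (\<lambda>v. NC_on (arc cs V v)))"
proof (rule bij_betw_byWitness[where f' = "glue V"])
  have g: "glue V (restrict \<nu> V) = glue V \<nu>" for \<nu> by (simp add: glue_def)
  show "\<forall>\<pi>\<in>{\<pi> \<in> NC_on cs. V \<in> \<pi>}. glue V (restrict (sector cs V \<pi>) V) = \<pi>"
    using glue_sector[OF assms(1)] g by auto
  show "\<forall>\<nu>\<in>PiE V (\<lambda>v. NC_on (arc cs V v)). restrict (sector cs V (glue V \<nu>)) V = \<nu>"
  proof
    fix \<nu> assume n: "\<nu> \<in> PiE V (\<lambda>v. NC_on (arc cs V v))"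
    show "restrict (sector cs V (glue V \<nu>)) V = \<nu>"
    proof (rule PiE_ext[of _ V "\<lambda>v. NC_on (arc cs V v)", OF _ n])
      show "restrict (sector cs V (glue V \<nu>)) V x = \<nu> x" if "x \<in> V" for x
        using sector_glue[OF assms _ that] n that by auto
      then show "restrict (sector cs V (glue V \<nu>)) V \<in> PiE V (\<lambda>v. NC_on (arc cs V v))"
        using n by auto
    qed
  qed
  show "(\<lambda>\<pi>. restrict (sector cs V \<pi>) V) ` {\<pi> \<in> NC_on cs. V \<in> \<pi>} \<subseteq> PiE V (\<lambda>v. NC_on (arc cs V v))"
    using sector_in_NC_on[OF assms(1)] by auto
  show "glue V ` PiE V (\<lambda>v. NC_on (arc cs V v)) \<subseteq> {\<pi> \<in> NC_on cs. V \<in> \<pi>}"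
    using glue_in_NC_on[OF assms] by (auto simp: glue_def)
qed

text \<open>The factorisation behind all recursions: weights that are products over sectors sum to a
  product of sums over arcs.\<close>

lemma sum_NC_on_block:
  fixes H :: "'p \<Rightarrow> 'p set set \<Rightarrow> 'b::comm_semiring_1"
  assumes "distinct cs" "V \<subseteq> set cs" "V \<noteq> {}"
  shows "(\<Sum>\<pi> | \<pi> \<in> NC_on cs \<and> V \<in> \<pi>. \<Prod>v\<in>V. H v (sector cs V \<pi> v)) =
    (\<Prod>v\<in>V. \<Sum>\<nu>\<in>NC_on (arc cs V v). H v \<nu>)"
proof -
  have fin: "finite V" using assms finite_subset by blast
  have "(\<Prod>v\<in>V. \<Sum>\<nu>\<in>NC_on (arc cs V v). H v \<nu>) =
      (\<Sum>\<nu>\<in>PiE V (\<lambda>v. NC_on (arc cs V v)). \<Prod>v\<in>V. H v (\<nu> v))"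
    using fin by (intro prod_sum_PiE) (auto simp: finite_NC_on)
  also have "\<dots> = (\<Sum>\<pi> | \<pi> \<in> NC_on cs \<and> V \<in> \<pi>. \<Prod>v\<in>V. H v (restrict (sector cs V \<pi>) V v))"
    using sum.reindex_bij_betw[OF bij_betw_sectors[OF assms], of "\<lambda>\<nu>. \<Prod>v\<in>V. H v (\<nu> v)"] by simp
  finally show ?thesis by simp
qed

lemma prod_NC_on_block:
  fixes h :: "'p set \<Rightarrow> 'b::comm_monoid_mult"
  assumes "distinct cs" "\<pi> \<in> NC_on cs" "V \<in> \<pi>"
  shows "(\<Prod>W\<in>\<pi> - {V}. h W) = (\<Prod>v\<in>V. \<Prod>W\<in>sector cs V \<pi> v. h W)"
proof -
  have V: "V \<subseteq> set cs" "V \<noteq> {}" "finite V" using NC_onD[OF assms(2)] assms(3) by auto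
  have vc: "v \<in> set cs" if "v \<in> V" for v using V that by blast
  have fin: "finite (sector cs V \<pi> v)" for v using NC_onD(5)[OF assms(2)] by (simp add: sector_def)
  have "V \<notin> sector cs V \<pi> v" if "v \<in> V" for v
    using arc_subset[OF assms(1) that vc[OF that]] that by (auto simp: sector_def)
  then have "V \<notin> (\<Union>v\<in>V. sector cs V \<pi> v)" by blast
  then have eq: "\<pi> - {V} = (\<Union>v\<in>V. sector cs V \<pi> v)"
    using glue_sector[OF assms] unfolding glue_def by blast
  have dj: "sector cs V \<pi> v \<inter> sector cs V \<pi> w = {}" if "v \<in> V" "w \<in> V" "v \<noteq> w" for v w
  proof -
    have "W = {}" if "W \<subseteq> set (arc cs V v)" "W \<subseteq> set (arc cs V w)" for W
      using arc_disjoint[OF assms(1) V(1) \<open>v \<in> V\<close> \<open>w \<in> V\<close> \<open>v \<noteq> w\<close>] that by blast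
    then show ?thesis using NC_onD(3)[OF assms(2)] by (auto simp: sector_def)
  qed
  show ?thesis unfolding eq using V(3) fin dj by (intro prod.UNION_disjoint) auto
qed

text \<open>A nonempty \<open>W\<close> meets at most one arc entirely, which resolves the
  description operator in \<open>arc_listing\<close>.\<close>

lemma arc_listing_eq:
  assumes "distinct cs" "V \<subseteq> set cs" "v \<in> V" "W \<subseteq> set (arc cs V v)" "W \<noteq> {}"
  shows "arc_listing cs V W = filter (\<lambda>x. x \<in> W) (arc cs V v)"
proof -
  have "(THE u. u \<in> V \<and> W \<subseteq> set (arc cs V u)) = v"
  proof (rule the_equality)
    show "v \<in> V \<and> W \<subseteq> set (arc cs V v)" using assms by blast
    show "u = v" if "u \<in> V \<and> W \<subseteq> set (arc cs V u)" for u
      using arc_unique[OF assms(1,2) _ assms(3), of u] assms(4,5) that by blast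
  qed
  then show ?thesis by (simp add: arc_listing_def)
qed

section \<open>Moments and cumulants of labelled lists\<close>

abbreviation listing :: "'p list \<Rightarrow> 'p set \<Rightarrow> 'p list" where
  "listing cs V \<equiv> filter (\<lambda>p. p \<in> V) cs"

text \<open>Entries are addressed through labels: the circle stays a list of distinct points even if
  several labels carry the same algebra element, and one entry can be changed by updating
  \<open>x\<close>.\<close>

definition moment :: "('a::ring_1 \<Rightarrow> complex) \<Rightarrow> ('p \<Rightarrow> 'a) \<Rightarrow> 'p list \<Rightarrow> complex" where
  "moment \<phi> x cs = \<phi> (prod_list (map x cs))"

definition kap :: "('a::ring_1 \<Rightarrow> complex) \<Rightarrow> ('p \<Rightarrow> 'a) \<Rightarrow> 'p list \<Rightarrow> complex" where
  "kap \<psi> x cs = free_cumulant \<psi> (map x cs)"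

definition dkap :: "('a::ring_1 \<Rightarrow> complex) \<Rightarrow> ('a \<Rightarrow> complex) \<Rightarrow> ('p \<Rightarrow> 'a) \<Rightarrow> 'p list \<Rightarrow> complex" where
  "dkap \<psi> D x cs = cyclic_free_cumulant \<psi> D (map x cs)"

lemma listing_listing: "W \<subseteq> V \<Longrightarrow> listing (listing cs V) W = listing cs W"
  by (simp add: filter_filter) (metis subsetD)

lemma listing_full: "set cs \<subseteq> V \<Longrightarrow> listing cs V = cs"
  by (simp add: subset_eq)

lemma listing_map:
  assumes "inj_on f (set cs)" "V \<subseteq> set cs"
  shows "listing (map f cs) (f ` V) = map f (listing cs V)"
proof -
  have "f c \<in> f ` V \<longleftrightarrow> c \<in> V" if "c \<in> set cs" for c
    using inj_on_image_mem_iff[OF assms(1) that assms(2)] .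
  then show ?thesis by (simp add: filter_map comp_def cong: filter_cong)
qed

lemma length_listing:
  assumes "distinct cs"
  shows "length (listing cs V) = card (V \<inter> set cs)"
proof -
  have "length (listing cs V) = card (set (listing cs V))"
    using assms distinct_card distinct_filter by metis
  also have "set (listing cs V) = V \<inter> set cs" by auto
  finally show ?thesis .
qed

lemma length_listing_less:
  assumes "distinct cs" "V \<subset> set cs"
  shows "length (listing cs V) < length cs"
  using length_listing[OF assms(1), of V] assms psubset_card_mono[OF _ assms(2)] distinct_card[OF assms(1)]
  by (simp add: Int_absorb2 psubset_imp_subset)

lemma arc_listing_map:
  assumes "distinct cs" "inj_on f (set cs)" "V \<subseteq> set cs" "v \<in> V" "W \<subseteq> set (arc cs V v)" "W \<noteq> {}"
  shows "arc_listing (map f cs) (f ` V) (f ` W) = map f (arc_listing cs V W)"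
proof -
  have v: "v \<in> set cs" using assms by blast
  have sub: "set (arc cs V v) \<subseteq> set cs" using arc_subset[OF assms(1,4) v] by blast
  have a: "arc (map f cs) (f ` V) (f v) = map f (arc cs V v)" using arc_map[OF assms(1-3) v] .
  have "arc_listing (map f cs) (f ` V) (f ` W) = listing (map f (arc cs V v)) (f ` W)"
    unfolding a[symmetric]
    by (rule arc_listing_eq) (use assms a in \<open>auto simp: distinct_map\<close>)
  also have "\<dots> = map f (listing (arc cs V v) W)"
    by (rule listing_map[OF inj_on_subset[OF assms(2) sub] assms(5)])
  finally show ?thesis using arc_listing_eq[OF assms(1,3-6)] by simp
qed

lemma listing_circle: "V \<subseteq> {1..n} \<Longrightarrow> sorted_list_of_set V = listing (circle n) V"
proof -
  assume V: "V \<subseteq> {1..n}"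
  have "set (listing (circle n) V) = V" using V by auto
  moreover have "sorted (listing (circle n) V)" "distinct (listing (circle n) V)"
    by (auto simp: circle_def intro: sorted_wrt_filter simp del: upt_Suc)
  ultimately show ?thesis by (metis sorted_list_of_set.idem_if_sorted_distinct)
qed

lemma distinct_circle [simp]: "distinct (circle n)"
  by (simp add: circle_def del: upt_Suc)

lemma circle_nth_map:
  assumes "distinct xs"
  defines "f \<equiv> \<lambda>i. xs ! (i - 1)"
  shows "map f (circle (length xs)) = xs" "inj_on f {1..length xs}"
proof -
  show "map f (circle (length xs)) = xs"
    unfolding circle_def f_def by (rule nth_equalityI) (auto simp del: upt_Suc)
  show "inj_on f {1..length xs}"
  proof (rule inj_onI)
    fix i j assume ij: "i \<in> {1..length xs}" "j \<in> {1..length xs}" "f i = f j"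
    then have "i - 1 = j - 1"
      using nth_eq_iff_index_eq[OF assms(1), of "i - 1" "j - 1"] by (auto simp: f_def)
    then show "i = j" using ij by auto
  qed
qed

text \<open>Carries the defining formulas, stated for the points \<open>1\<close> to
  \<open>n\<close>, over to an arbitrary list of distinct labels.\<close>

lemma circle_relabel:
  assumes "distinct xs"
  shows "\<exists>f. map f (circle (length xs)) = xs \<and> inj_on f {1..length xs} \<and>
    (\<forall>i\<in>{1..length xs}. f i = xs ! (i - 1)) \<and>
    (\<forall>h :: _ \<Rightarrow> complex. (\<Sum>\<pi>\<in>NC (length xs). h ((`) f ` \<pi>)) = (\<Sum>\<nu>\<in>NC_on xs. h \<nu>))"
proof -
  define f where "f = (\<lambda>i. xs ! (i - 1))"
  have 1: "map f (circle (length xs)) = xs" "inj_on f {1..length xs}"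
    using circle_nth_map[OF assms] unfolding f_def by blast+
  have "bij_betw ((`) ((`) f)) (NC (length xs)) (NC_on (map f (circle (length xs))))"
    using 1(2) by (intro bij_betw_NC_on_map) auto
  then have "(\<Sum>\<pi>\<in>NC (length xs). h ((`) f ` \<pi>)) = (\<Sum>\<nu>\<in>NC_on xs. h \<nu>)" for h :: "_ \<Rightarrow> complex"
    unfolding 1(1) by (rule sum.reindex_bij_betw)
  with 1 show ?thesis unfolding f_def by blast
qed

lemma NC_on_arc:
  assumes "distinct cs" "\<pi> \<in> NC_on cs" "V \<in> \<pi>" "W \<in> \<pi>" "V \<noteq> W"
  obtains v where "v \<in> V" "W \<subseteq> set (arc cs V v)"
  using assms NC_on_iff[OF assms(1), of \<pi>] by blast

lemma NC_on_Nil: "NC_on [] = {{}}"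
  by (auto simp: NC_on_def partition_on_empty noncrossing_def)

lemma moment_NC_on:
  assumes "distinct xs" "\<psi> 1 = 1"
  shows "moment \<psi> x xs = (\<Sum>\<nu>\<in>NC_on xs. \<Prod>W\<in>\<nu>. kap \<psi> x (listing xs W))"
proof (cases "xs = []")
  case True
  \<comment> \<open>For the empty list the only partition is empty, with weight \<open>1\<close>,
    and this is \<open>\<psi> 1\<close>.\<close>
  then show ?thesis by (simp add: NC_on_Nil moment_def assms)
next
  case False
  let ?n = "length xs"
  obtain f where f': "map f (circle ?n) = xs \<and> inj_on f {1..?n} \<and> (\<forall>i\<in>{1..?n}. f i = xs ! (i - 1)) \<and>
    (\<forall>h :: _ \<Rightarrow> complex. (\<Sum>\<pi>\<in>NC ?n. h ((`) f ` \<pi>)) = (\<Sum>\<nu>\<in>NC_on xs. h \<nu>))"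
    using circle_relabel[OF assms(1)] ..
  have f: "map f (circle ?n) = xs" "inj_on f {1..?n}" "\<And>i. i \<in> {1..?n} \<Longrightarrow> f i = xs ! (i - 1)"
    and f_sum: "\<And>h :: _ \<Rightarrow> complex. (\<Sum>\<pi>\<in>NC ?n. h ((`) f ` \<pi>)) = (\<Sum>\<nu>\<in>NC_on xs. h \<nu>)"
    using f' by blast+
  have block: "free_cumulant \<psi> (map (entry (map x xs)) (sorted_list_of_set V)) = kap \<psi> x (listing xs (f ` V))"
    if "V \<subseteq> {1..?n}" for V
  proof -
    have "map (entry (map x xs)) (sorted_list_of_set V) = map (x \<circ> f) (listing (circle ?n) V)"
      unfolding listing_circle[OF that] using f(3) that by (intro map_cong) (auto simp: entry_def)
    also have "\<dots> = map x (listing (map f (circle ?n)) (f ` V))"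
      using listing_map[of f "circle ?n" V] f(2) that by simp
    finally show ?thesis by (simp add: kap_def f(1))
  qed
  have "moment \<psi> x xs = (\<Sum>\<pi>\<in>NC ?n. \<Prod>V\<in>\<pi>. free_cumulant \<psi> (map (entry (map x xs)) (sorted_list_of_set V)))"
    using moment_cumulant[of "map x xs" \<psi>] False by (simp add: moment_def)
  also have "\<dots> = (\<Sum>\<pi>\<in>NC ?n. \<Prod>W\<in>(`) f ` \<pi>. kap \<psi> x (listing xs W))"
  proof (rule sum.cong[OF refl])
    fix \<pi> assume p: "\<pi> \<in> NC ?n"
    have "inj_on ((`) f) \<pi>"
    proof (rule inj_on_subset)
      show "inj_on ((`) f) (Pow {1..?n})" by (rule inj_on_image_Pow[OF f(2)])
      show "\<pi> \<subseteq> Pow {1..?n}" using NC_block_subset[OF p] by blast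
    qed
    then show "(\<Prod>V\<in>\<pi>. free_cumulant \<psi> (map (entry (map x xs)) (sorted_list_of_set V))) =
      (\<Prod>W\<in>(`) f ` \<pi>. kap \<psi> x (listing xs W))"
      using block NC_block_subset[OF p] by (simp add: prod.reindex cong: prod.cong)
  qed
  also have "\<dots> = (\<Sum>\<nu>\<in>NC_on xs. \<Prod>W\<in>\<nu>. kap \<psi> x (listing xs W))"
    by (rule f_sum)
  finally show ?thesis .
qed

lemma cyclic_moment_NC_on:
  assumes "distinct xs" "xs \<noteq> []"
  shows "moment D x xs = (\<Sum>\<pi>\<in>NC_on xs. \<Sum>V\<in>\<pi>. dkap \<psi> D x (listing xs V) *
    (\<Prod>W\<in>\<pi> - {V}. kap \<psi> x (arc_listing xs V W)))"
proof -
  let ?n = "length xs" and ?e = "entry (map x xs)"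
  obtain f where f': "map f (circle ?n) = xs \<and> inj_on f {1..?n} \<and> (\<forall>i\<in>{1..?n}. f i = xs ! (i - 1)) \<and>
    (\<forall>h :: _ \<Rightarrow> complex. (\<Sum>\<pi>\<in>NC ?n. h ((`) f ` \<pi>)) = (\<Sum>\<nu>\<in>NC_on xs. h \<nu>))"
    using circle_relabel[OF assms(1)] ..
  have f: "map f (circle ?n) = xs" "inj_on f {1..?n}" "\<And>i. i \<in> {1..?n} \<Longrightarrow> f i = xs ! (i - 1)"
    and f_sum: "\<And>h :: _ \<Rightarrow> complex. (\<Sum>\<pi>\<in>NC ?n. h ((`) f ` \<pi>)) = (\<Sum>\<nu>\<in>NC_on xs. h \<nu>)"
    using f' by blast+
  have "?e i = x (f i)" if "i \<in> {1..?n}" for i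
    using that f(3)[OF that] nth_map[of "i - 1" xs x] by (auto simp: entry_def simp del: nth_map)
  then have ent: "map ?e l = map x (map f l)" if "set l \<subseteq> {1..?n}" for l
    unfolding map_map using that by (intro map_cong) auto
  have V: "map ?e (sorted_list_of_set V) = map x (listing xs (f ` V))" if "V \<subseteq> {1..?n}" for V
    using ent[of "listing (circle ?n) V"] listing_map[of f "circle ?n" V] f that
    unfolding listing_circle[OF that] by (auto simp del: map_map)
  have "moment D x xs = (\<Sum>\<pi>\<in>NC ?n. \<Sum>V\<in>\<pi>. cyclic_free_cumulant \<psi> D (map ?e (sorted_list_of_set V)) *
       (\<Prod>W\<in>\<pi> - {V}. free_cumulant \<psi> (map ?e (arc_listing (circle ?n) V W))))"
    using cyclic_moment_cumulant[of "map x xs" D \<psi>] assms(2) by (simp add: moment_def)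
  also have "\<dots> = (\<Sum>\<pi>\<in>NC ?n. \<Sum>V\<in>(`) f ` \<pi>. dkap \<psi> D x (listing xs V) *
    (\<Prod>W\<in>(`) f ` \<pi> - {V}. kap \<psi> x (arc_listing xs V W)))"
  proof (rule sum.cong[OF refl])
    fix \<pi> assume p: "\<pi> \<in> NC ?n"
    have s: "\<pi> \<subseteq> Pow {1..?n}" using NC_block_subset[OF p] by blast
    have inj: "inj_on ((`) f) \<pi>"
      by (rule inj_on_subset[OF inj_on_image_Pow[OF f(2)] s])
    have W: "map ?e (arc_listing (circle ?n) V W) = map x (arc_listing xs (f ` V) (f ` W))"
      if VW: "V \<in> \<pi>" "W \<in> \<pi> - {V}" for V W
    proof -
      obtain v where v: "v \<in> V" "W \<subseteq> set (arc (circle ?n) V v)"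
        using NC_on_arc[OF distinct_circle p VW(1), of W] VW(2) by blast
      have sub: "V \<subseteq> {1..?n}" "W \<noteq> {}" using NC_onD[OF p] VW by auto
      have vc: "v \<in> set (circle ?n)" using v sub by auto
      have "arc_listing (map f (circle ?n)) (f ` V) (f ` W) = map f (arc_listing (circle ?n) V W)"
        using f(2) sub v by (intro arc_listing_map) auto
      moreover have "set (arc_listing (circle ?n) V W) \<subseteq> {1..?n}"
        using arc_listing_eq[of "circle ?n" V v W] sub v arc_subset[OF distinct_circle v(1) vc] by auto
      ultimately show ?thesis using ent f(1) by metis
    qed
    have "(\<Prod>W\<in>\<pi> - {V}. free_cumulant \<psi> (map ?e (arc_listing (circle ?n) V W))) =
      (\<Prod>W\<in>(`) f ` \<pi> - {f ` V}. kap \<psi> x (arc_listing xs (f ` V) W))" if "V \<in> \<pi>" for V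
    proof -
      have "(`) f ` \<pi> - {f ` V} = (`) f ` (\<pi> - {V})"
        using inj_on_image_set_diff[OF inj, of \<pi> "{V}"] that by auto
      moreover have "inj_on ((`) f) (\<pi> - {V})" using inj inj_on_subset by blast
      moreover have "(\<Prod>W\<in>\<pi> - {V}. free_cumulant \<psi> (map ?e (arc_listing (circle ?n) V W))) =
          (\<Prod>W\<in>\<pi> - {V}. kap \<psi> x (arc_listing xs (f ` V) (f ` W)))"
        using W[OF that] unfolding kap_def by (intro prod.cong refl) (simp only:)
      ultimately show ?thesis by (simp add: prod.reindex)
    qed
    then show "(\<Sum>V\<in>\<pi>. cyclic_free_cumulant \<psi> D (map ?e (sorted_list_of_set V)) *
       (\<Prod>W\<in>\<pi> - {V}. free_cumulant \<psi> (map ?e (arc_listing (circle ?n) V W)))) =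
      (\<Sum>V\<in>(`) f ` \<pi>. dkap \<psi> D x (listing xs V) *
    (\<Prod>W\<in>(`) f ` \<pi> - {V}. kap \<psi> x (arc_listing xs V W)))"
      using V s inj by (subst sum.reindex) (auto simp: dkap_def intro!: sum.cong)
  qed
  also have "\<dots> = (\<Sum>\<pi>\<in>NC_on xs. \<Sum>V\<in>\<pi>. dkap \<psi> D x (listing xs V) *
    (\<Prod>W\<in>\<pi> - {V}. kap \<psi> x (arc_listing xs V W)))"
    by (rule f_sum)
  finally show ?thesis .
qed

section \<open>Recursions by one block and its arcs\<close>

lemma sum_NC_on_by_block:
  fixes F :: "'p set set \<Rightarrow> complex"
  assumes "i \<in> set cs"
  shows "(\<Sum>\<pi>\<in>NC_on cs. F \<pi>) = (\<Sum>V | i \<in> V \<and> V \<subseteq> set cs. \<Sum>\<pi> | \<pi> \<in> NC_on cs \<and> V \<in> \<pi>. F \<pi>)"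
proof -
  have "NC_on cs = (\<Union>V\<in>{V. i \<in> V \<and> V \<subseteq> set cs}. {\<pi>. \<pi> \<in> NC_on cs \<and> V \<in> \<pi>})"
  proof -
    have "\<exists>V. i \<in> V \<and> V \<subseteq> set cs \<and> V \<in> \<pi>" if "\<pi> \<in> NC_on cs" for \<pi>
      using NC_onD(7)[OF that assms] NC_onD(2)[OF that] by blast
    then show ?thesis by blast
  qed
  moreover have "finite {V. i \<in> V \<and> V \<subseteq> set cs}" by (rule finite_subset[of _ "Pow (set cs)"]) auto
  moreover have "finite {\<pi>. \<pi> \<in> NC_on cs \<and> V \<in> \<pi>}" for V
    by (rule finite_subset[OF _ finite_NC_on]) auto
  moreover have "{\<pi>. \<pi> \<in> NC_on cs \<and> V \<in> \<pi>} \<inter> {\<pi>. \<pi> \<in> NC_on cs \<and> W \<in> \<pi>} = {}"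
    if "i \<in> V" "i \<in> W" "V \<noteq> W" for V W
  proof -
    have False if "\<pi> \<in> NC_on cs" "V \<in> \<pi>" "W \<in> \<pi>" for \<pi>
      using NC_onD(4)[OF that \<open>V \<noteq> W\<close>] \<open>i \<in> V\<close> \<open>i \<in> W\<close> by blast
    then show ?thesis by blast
  qed
  ultimately show ?thesis by (subst (1) \<open>NC_on cs = _\<close>, subst sum.UNION_disjoint) auto
qed

text \<open>The cyclic formula already sums over a marked block, so exchanging the two sums sorts
  its terms without choosing a point \<open>i\<close>.\<close>

lemma sum_NC_on_blocks:
  fixes F :: "'p set set \<Rightarrow> 'p set \<Rightarrow> complex"
  shows "(\<Sum>\<pi>\<in>NC_on cs. \<Sum>V\<in>\<pi>. F \<pi> V) =
    (\<Sum>V | V \<noteq> {} \<and> V \<subseteq> set cs. \<Sum>\<pi> | \<pi> \<in> NC_on cs \<and> V \<in> \<pi>. F \<pi> V)"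
proof -
  have fin: "finite {V. V \<noteq> {} \<and> V \<subseteq> set cs}" by (rule finite_subset[of _ "Pow (set cs)"]) auto
  have "(\<Sum>\<pi>\<in>NC_on cs. \<Sum>V\<in>\<pi>. F \<pi> V) =
    (\<Sum>\<pi>\<in>NC_on cs. \<Sum>V | V \<in> {V. V \<noteq> {} \<and> V \<subseteq> set cs} \<and> V \<in> \<pi>. F \<pi> V)"
  proof (intro sum.cong refl)
    show "\<pi> = {V. V \<in> {V. V \<noteq> {} \<and> V \<subseteq> set cs} \<and> V \<in> \<pi>}" if "\<pi> \<in> NC_on cs" for \<pi>
      using NC_onD(2,3)[OF that] by blast
  qed
  also have "\<dots> = (\<Sum>V | V \<noteq> {} \<and> V \<subseteq> set cs. \<Sum>\<pi> | \<pi> \<in> NC_on cs \<and> V \<in> \<pi>. F \<pi> V)"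
    by (rule sum.swap_restrict[OF finite_NC_on fin])
  finally show ?thesis .
qed

text \<open>Every partition is counted once, by its block through \<open>i\<close>. Free cumulants
  are listed in the linear order of \<open>cs\<close>; hence the moment of an arc is taken of
  \<open>listing cs (set (arc cs V v))\<close>, which differs from the arc when the latter runs over
  the end of the list.\<close>

lemma moment_anchored:
  assumes "distinct cs" "\<psi> 1 = 1" "i \<in> set cs"
  shows "moment \<psi> x cs = (\<Sum>V | i \<in> V \<and> V \<subseteq> set cs. kap \<psi> x (listing cs V) *
    (\<Prod>v\<in>V. moment \<psi> x (listing cs (set (arc cs V v)))))"
proof -
  let ?k = "\<lambda>W. kap \<psi> x (listing cs W)"
  have "(\<Sum>\<pi> | \<pi> \<in> NC_on cs \<and> V \<in> \<pi>. \<Prod>W\<in>\<pi>. ?k W) =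
      ?k V * (\<Prod>v\<in>V. moment \<psi> x (listing cs (set (arc cs V v))))"
    if V: "i \<in> V" "V \<subseteq> set cs" for V
  proof -
    have "(\<Prod>W\<in>\<pi>. ?k W) = ?k V * (\<Prod>v\<in>V. \<Prod>W\<in>sector cs V \<pi> v. ?k W)"
      if "\<pi> \<in> NC_on cs" "V \<in> \<pi>" for \<pi>
      unfolding prod_NC_on_block[OF assms(1) that, symmetric]
      by (rule prod.remove[OF NC_onD(5)[OF that(1)] that(2)])
    then have "(\<Sum>\<pi> | \<pi> \<in> NC_on cs \<and> V \<in> \<pi>. \<Prod>W\<in>\<pi>. ?k W) =
        ?k V * (\<Sum>\<pi> | \<pi> \<in> NC_on cs \<and> V \<in> \<pi>. \<Prod>v\<in>V. \<Prod>W\<in>sector cs V \<pi> v. ?k W)"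
      by (simp add: sum_distrib_left)
    also have "\<dots> = ?k V * (\<Prod>v\<in>V. \<Sum>\<nu>\<in>NC_on (arc cs V v). \<Prod>W\<in>\<nu>. ?k W)"
      using V by (subst sum_NC_on_block[OF assms(1)]) auto
    also have "(\<Prod>v\<in>V. \<Sum>\<nu>\<in>NC_on (arc cs V v). \<Prod>W\<in>\<nu>. ?k W) =
        (\<Prod>v\<in>V. moment \<psi> x (listing cs (set (arc cs V v))))"
    proof (rule prod.cong[OF refl])
      fix v assume v: "v \<in> V"
      let ?l = "listing cs (set (arc cs V v))"
      have vc: "v \<in> set cs" using v V by blast
      have c: "cyc ?l (arc cs V v)" by (rule filter_arc[OF assms(1) v vc])
      have "(\<Sum>\<nu>\<in>NC_on (arc cs V v). \<Prod>W\<in>\<nu>. ?k W) = (\<Sum>\<nu>\<in>NC_on ?l. \<Prod>W\<in>\<nu>. ?k W)"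
        using NC_on_cyc[OF _ c] assms(1) by simp
      also have "\<dots> = (\<Sum>\<nu>\<in>NC_on ?l. \<Prod>W\<in>\<nu>. kap \<psi> x (listing ?l W))"
      proof (intro sum.cong prod.cong refl)
        fix \<nu> W assume "\<nu> \<in> NC_on ?l" "W \<in> \<nu>"
        then have "W \<subseteq> set (arc cs V v)" using NC_onD(2) by fastforce
        then show "?k W = kap \<psi> x (listing ?l W)" by (simp only: listing_listing)
      qed
      also have "\<dots> = moment \<psi> x ?l" using assms by (simp add: moment_NC_on)
      finally show "(\<Sum>\<nu>\<in>NC_on (arc cs V v). \<Prod>W\<in>\<nu>. ?k W) = moment \<psi> x ?l" .
    qed
    finally show ?thesis .
  qed
  then show ?thesis
    unfolding moment_NC_on[of cs \<psi>, OF assms(1,2)] sum_NC_on_by_block[OF assms(3)] by (intro sum.cong) auto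
qed

text \<open>In contrast to the linear formula, blocks are listed here along the arcs of
  \<open>V\<close>, so the moments of the arcs themselves appear.\<close>

lemma sum_cyclic_block:
  assumes "distinct cs" "\<psi> 1 = 1" and V: "V \<noteq> {}" "V \<subseteq> set cs"
  shows "(\<Sum>\<pi> | \<pi> \<in> NC_on cs \<and> V \<in> \<pi>. dkap \<psi> D x (listing cs V) * (\<Prod>W\<in>\<pi> - {V}. kap \<psi> x (arc_listing cs V W))) =
      dkap \<psi> D x (listing cs V) * (\<Prod>v\<in>V. moment \<psi> x (arc cs V v))"
proof -
    have "(\<Prod>W\<in>\<pi> - {V}. kap \<psi> x (arc_listing cs V W)) =
        (\<Prod>v\<in>V. \<Prod>W\<in>sector cs V \<pi> v. kap \<psi> x (listing (arc cs V v) W))"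
      if p: "\<pi> \<in> NC_on cs" "V \<in> \<pi>" for \<pi>
      unfolding prod_NC_on_block[OF assms(1) p]
    proof (intro prod.cong refl)
      fix v W assume "v \<in> V" "W \<in> sector cs V \<pi> v"
      then show "kap \<psi> x (arc_listing cs V W) = kap \<psi> x (listing (arc cs V v) W)"
        using arc_listing_eq[OF assms(1) V(2)] NC_onD(3)[OF p(1)] by (auto simp: sector_def)
    qed
    then have "(\<Sum>\<pi> | \<pi> \<in> NC_on cs \<and> V \<in> \<pi>. dkap \<psi> D x (listing cs V) * (\<Prod>W\<in>\<pi> - {V}. kap \<psi> x (arc_listing cs V W))) =
      dkap \<psi> D x (listing cs V) *
      (\<Sum>\<pi> | \<pi> \<in> NC_on cs \<and> V \<in> \<pi>. \<Prod>v\<in>V. \<Prod>W\<in>sector cs V \<pi> v. kap \<psi> x (listing (arc cs V v) W))"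
      by (simp add: sum_distrib_left)
    also have "(\<Sum>\<pi> | \<pi> \<in> NC_on cs \<and> V \<in> \<pi>. \<Prod>v\<in>V. \<Prod>W\<in>sector cs V \<pi> v. kap \<psi> x (listing (arc cs V v) W)) =
      (\<Prod>v\<in>V. \<Sum>\<nu>\<in>NC_on (arc cs V v). \<Prod>W\<in>\<nu>. kap \<psi> x (listing (arc cs V v) W))"
      by (rule sum_NC_on_block[OF assms(1) V(2,1)])
    also have "\<dots> = (\<Prod>v\<in>V. moment \<psi> x (arc cs V v))"
      using moment_NC_on[of _ \<psi>, OF distinct_arc[OF assms(1)] assms(2)] V by (intro prod.cong) auto
    finally show ?thesis .
qed

lemma cyclic_moment_blocks:
  assumes "distinct cs" "\<psi> 1 = 1" "cs \<noteq> []"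
  shows "moment D x cs = (\<Sum>V | V \<noteq> {} \<and> V \<subseteq> set cs. dkap \<psi> D x (listing cs V) *
    (\<Prod>v\<in>V. moment \<psi> x (arc cs V v)))"
  unfolding cyclic_moment_NC_on[OF assms(1,3), of D x \<psi>] sum_NC_on_blocks
  using sum_cyclic_block[of cs \<psi>, OF assms(1,2)] by (intro sum.cong) auto

lemma arc_full:
  assumes "distinct cs" "v \<in> set cs"
  shows "arc cs (set cs) v = []"
  using arc_subset[OF assms(1) assms(2) assms(2)] by auto

text \<open>The recursion solved for the full block, all of whose arcs are empty and contribute
  \<open>\<psi> 1 = 1\<close>. Inductions on the length rest on this form.\<close>

lemma kap_anchored:
  assumes "distinct cs" "\<psi> 1 = 1" "i \<in> set cs"
  shows "kap \<psi> x cs = moment \<psi> x cs - (\<Sum>V | i \<in> V \<and> V \<subset> set cs. kap \<psi> x (listing cs V) *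
    (\<Prod>v\<in>V. moment \<psi> x (listing cs (set (arc cs V v)))))"
proof -
  have "{V. i \<in> V \<and> V \<subseteq> set cs} = insert (set cs) {V. i \<in> V \<and> V \<subset> set cs}" using assms by blast
  moreover have "finite {V. i \<in> V \<and> V \<subset> set cs}" by (rule finite_subset[of _ "Pow (set cs)"]) auto
  ultimately have "moment \<psi> x cs = kap \<psi> x (listing cs (set cs)) *
      (\<Prod>v\<in>set cs. moment \<psi> x (listing cs (set (arc cs (set cs) v)))) +
    (\<Sum>V | i \<in> V \<and> V \<subset> set cs. kap \<psi> x (listing cs V) *
    (\<Prod>v\<in>V. moment \<psi> x (listing cs (set (arc cs V v)))))"
    using moment_anchored[of cs \<psi>, OF assms] by simp
  moreover have "(\<Prod>v\<in>set cs. moment \<psi> x (listing cs (set (arc cs (set cs) v)))) = 1"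
    using assms arc_full[OF assms(1)] by (simp add: moment_def)
  ultimately show ?thesis by (simp add: listing_full)
qed

lemma dkap_blocks:
  assumes "distinct cs" "\<psi> 1 = 1" "cs \<noteq> []"
  shows "dkap \<psi> D x cs = moment D x cs - (\<Sum>V | V \<noteq> {} \<and> V \<subset> set cs. dkap \<psi> D x (listing cs V) *
    (\<Prod>v\<in>V. moment \<psi> x (arc cs V v)))"
proof -
  have "{V. V \<noteq> {} \<and> V \<subseteq> set cs} = insert (set cs) {V. V \<noteq> {} \<and> V \<subset> set cs}" using assms by auto
  moreover have "finite {V. V \<noteq> {} \<and> V \<subset> set cs}" by (rule finite_subset[of _ "Pow (set cs)"]) auto
  ultimately have "moment D x cs = dkap \<psi> D x (listing cs (set cs)) *
      (\<Prod>v\<in>set cs. moment \<psi> x (arc cs (set cs) v)) +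
    (\<Sum>V | V \<noteq> {} \<and> V \<subset> set cs. dkap \<psi> D x (listing cs V) *
    (\<Prod>v\<in>V. moment \<psi> x (arc cs V v)))"
    using cyclic_moment_blocks[of cs \<psi>, OF assms] by simp
  moreover have "(\<Prod>v\<in>set cs. moment \<psi> x (arc cs (set cs) v)) = 1"
    using assms arc_full[OF assms(1)] by (simp add: moment_def)
  ultimately show ?thesis by (simp add: listing_full)
qed

section \<open>Listings around an inner block and the anchored cyclic recursion\<close>

lemma cyc_arc_empty: "distinct cs \<Longrightarrow> v \<in> set cs \<Longrightarrow> cyc cs (v # arc cs {} v)"
  by (metis arc_cyc cyc_to_head empty_iff takeWhile_eq_all_conv)

text \<open>The order in which a block inside the arc behind \<open>v\<close> sees \<open>V\<close>:
  clockwise, with \<open>v\<close> as the last point. \<open>arc cs {} v\<close> is the whole circle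
  behind \<open>v\<close>.\<close>

definition listing_from :: "'p list \<Rightarrow> 'p set \<Rightarrow> 'p \<Rightarrow> 'p list" where
  "listing_from cs V v = listing (arc cs {} v) V @ [v]"

text \<open>The walk from \<open>v\<close> cuts the circle only at a point of \<open>V\<close>, so
  the arc of any other point of \<open>V\<close> appears in it uncut.\<close>

lemma listing_arc_empty:
  assumes "distinct cs" "V \<subseteq> set cs" "v \<in> V" "u \<in> V" "u \<noteq> v" "W \<subseteq> set (arc cs V u)"
  shows "listing (arc cs {} v) W = listing (arc cs V u) W"
proof -
  have vu: "v \<in> set cs" "u \<in> set cs" using assms by auto
  define y where "y = arc cs {} v"
  have y: "cyc cs (v # y)" using cyc_arc_empty[OF assms(1) vu(1)] by (simp add: y_def)
  have d: "distinct (v # y)" using cyc_distinct[OF y] assms(1) by simp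
  have "u \<in> set y" using cyc_set[OF y] vu assms by auto
  then obtain b s where bs: "y = b @ u # s" using split_list by metis
  have "cyc (v # y) (u # (s @ v # b))" using cyc_append[of "v # b" "u # s"] bs by simp
  then have "cyc cs (u # (s @ v # b))" using y cyc_trans by blast
  then have "arc cs V u = takeWhile (\<lambda>x. x \<notin> V) (s @ v # b)" using arc_cyc assms(1) by metis
  also have "\<dots> = takeWhile (\<lambda>x. x \<notin> V) s" using assms(3) by (induction s) auto
  finally have a: "arc cs V u = takeWhile (\<lambda>x. x \<notin> V) s" .
  have s: "s = arc cs V u @ dropWhile (\<lambda>x. x \<notin> V) s" unfolding a by simp
  then have "y = b @ u # arc cs V u @ dropWhile (\<lambda>x. x \<notin> V) s" using bs by simp
  moreover from this d assms(6) have "listing b W = []" "u \<notin> W" "listing (dropWhile (\<lambda>x. x \<notin> V) s) W = []"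
    by (auto simp: filter_empty_conv)
  ultimately show ?thesis unfolding y_def[symmetric] by simp
qed

text \<open>Behind the last point \<open>w\<close> of \<open>Q\<close> the walk first leaves the arc
  of \<open>v\<close>, runs through everything outside it and reaches \<open>v\<close> last; this is
  the order of \<open>arc cs {} v @ [v]\<close> on the outside.\<close>

lemma outer_arc_listing:
  assumes "distinct cs" "V \<subseteq> set cs" "v \<in> V" "Q \<subseteq> set (arc cs V v)" "Q \<noteq> {}"
  obtains w where "w \<in> Q" "set cs - set (arc cs V v) \<subseteq> set (arc cs Q w)"
    "\<And>U. U \<subseteq> set cs - set (arc cs V v) \<Longrightarrow> listing (arc cs Q w) U = listing (arc cs {} v @ [v]) U"
proof -
  have v: "v \<in> set cs" using assms by blast
  obtain z where z: "cyc cs (v # arc cs V v @ z)" "z = [] \<or> hd z \<in> V"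
    "distinct (v # arc cs V v @ z)" "set (arc cs V v) \<inter> V = {}"
    "set cs = insert v (set (arc cs V v) \<union> set z)"
    by (rule arcE[OF assms(1,3) v])
  have e: "arc cs {} v = arc cs V v @ z"
    using cyc_distinct_unique_head[OF assms(1) cyc_arc_empty[OF assms(1) v] z(1)] .
  have "\<exists>w\<in>set (arc cs V v). w \<in> Q" using assms by blast
  then obtain b w c where bc: "arc cs V v = b @ w # c" "w \<in> Q" "\<forall>y\<in>set c. y \<notin> Q"
    using split_list_last_prop[of "arc cs V v" "\<lambda>w. w \<in> Q"] by metis
  have "cyc (v # arc cs V v @ z) (w # (c @ z @ v # b))"
    using cyc_append[of "v # b" "w # c @ z"] bc by simp
  then have "cyc cs (w # (c @ z @ v # b))" using z cyc_trans by blast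
  then have "arc cs Q w = takeWhile (\<lambda>x. x \<notin> Q) (c @ z @ v # b)" using arc_cyc assms(1) by metis
  moreover have "Q \<inter> set z = {}" "v \<notin> Q" using assms(4) z(3) by auto
  ultimately have a: "arc cs Q w = c @ z @ v # takeWhile (\<lambda>x. x \<notin> Q) b"
    using bc by (subst (asm) takeWhile_append2, blast, subst (asm) takeWhile_append2) auto
  show thesis
  proof (rule that[OF bc(2)])
    show "set cs - set (arc cs V v) \<subseteq> set (arc cs Q w)" using a z(5) by auto
    fix U assume U: "U \<subseteq> set cs - set (arc cs V v)"
    have nU: "p \<notin> U" if "p \<in> set (arc cs V v)" for p using U that by blast
    have "set (takeWhile (\<lambda>x. x \<notin> Q) b) \<subseteq> set b" by (auto dest: set_takeWhileD)
    then have "set (takeWhile (\<lambda>x. x \<notin> Q) b) \<subseteq> set (arc cs V v)" "set c \<subseteq> set (arc cs V v)"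
      unfolding bc(1) by auto
    then have "listing (takeWhile (\<lambda>x. x \<notin> Q) b) U = []" "listing c U = []" "listing (arc cs V v) U = []"
      unfolding filter_empty_conv using nU by blast+
    then show "listing (arc cs Q w) U = listing (arc cs {} v @ [v]) U" unfolding a e by simp
  qed
qed

text \<open>With \<open>Q\<close> in the arc of \<open>v\<close> as marked block, other blocks occur
  in three positions: \<open>V\<close> itself, treated here, blocks in other arcs of
  \<open>V\<close>, and blocks in the arc of \<open>Q\<close>; the next two lemmas deal with the
  latter two.\<close>

lemma arc_listing_outer_block:
  assumes "distinct cs" "V \<subseteq> set cs" "v \<in> V" "Q \<subseteq> set (arc cs V v)" "Q \<noteq> {}"
  shows "arc_listing cs Q V = listing_from cs V v"
proof -
  obtain w where w: "w \<in> Q" "set cs - set (arc cs V v) \<subseteq> set (arc cs Q w)"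
    "\<And>U. U \<subseteq> set cs - set (arc cs V v) \<Longrightarrow> listing (arc cs Q w) U = listing (arc cs {} v @ [v]) U"
    using outer_arc_listing[OF assms] by blast
  have v: "v \<in> set cs" using assms by blast
  have s: "set (arc cs V v) \<subseteq> set cs - V" by (rule arc_subset[OF assms(1,3) v])
  then have V: "V \<subseteq> set cs - set (arc cs V v)" using assms(2) by blast
  have "arc_listing cs Q V = listing (arc cs Q w) V"
    using w V assms s by (intro arc_listing_eq) auto
  then show ?thesis using w(3)[OF V] assms(3) by (simp add: listing_from_def)
qed

lemma arc_listing_other_sector:
  assumes "distinct cs" "V \<subseteq> set cs" "v \<in> V" "Q \<subseteq> set (arc cs V v)" "Q \<noteq> {}"
    "u \<in> V" "u \<noteq> v" "W \<subseteq> set (arc cs V u)" "W \<noteq> {}"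
  shows "arc_listing cs Q W = listing (arc cs V u) W"
proof -
  obtain w where w: "w \<in> Q" "set cs - set (arc cs V v) \<subseteq> set (arc cs Q w)"
    "\<And>U. U \<subseteq> set cs - set (arc cs V v) \<Longrightarrow> listing (arc cs Q w) U = listing (arc cs {} v @ [v]) U"
    using outer_arc_listing[OF assms(1-5)] by blast
  have vu: "v \<in> set cs" "u \<in> set cs" using assms by auto
  have s: "set (arc cs V v) \<subseteq> set cs - V" "set (arc cs V u) \<subseteq> set cs - V"
    using arc_subset[OF assms(1,3) vu(1)] arc_subset[OF assms(1,6) vu(2)] by auto
  have W: "W \<subseteq> set cs - set (arc cs V v)"
    using assms(8) s arc_disjoint[OF assms(1,2,6,3,7)] by blast
  have "v \<notin> W" using assms(3,8) s by blast
  have "arc_listing cs Q W = listing (arc cs Q w) W"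
    using w W assms s by (intro arc_listing_eq) auto
  also have "\<dots> = listing (arc cs {} v) W" using w(3)[OF W] \<open>v \<notin> W\<close> by simp
  also have "\<dots> = listing (arc cs V u) W" by (rule listing_arc_empty[OF assms(1-3,6-8)])
  finally show ?thesis .
qed

lemma arc_listing_same_sector:
  assumes "distinct cs" "V \<subseteq> set cs" "v \<in> V" "\<nu> \<in> NC_on (arc cs V v)" "Q \<in> \<nu>" "W \<in> \<nu>" "Q \<noteq> W"
  shows "arc_listing cs Q W = arc_listing (arc cs V v) Q W"
proof -
  have v: "v \<in> set cs" using assms by blast
  have d: "distinct (arc cs V v)" by (rule distinct_arc[OF assms(1,3) v])
  have s: "set (arc cs V v) \<subseteq> set cs" using arc_subset[OF assms(1,3) v] by blast
  have QW: "Q \<subseteq> set (arc cs V v)" "W \<subseteq> set (arc cs V v)" "W \<noteq> {}" using NC_onD[OF assms(4)] assms by auto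
  obtain q where q: "q \<in> Q" "W \<subseteq> set (arc (arc cs V v) Q q)"
    by (rule NC_on_arc[OF d assms(4-7)])
  note a = arc_of_arc[OF assms(1,3) v QW(1) q(1)]
  have "arc_listing (arc cs V v) Q W = listing (arc (arc cs V v) Q q) W"
    by (rule arc_listing_eq[OF d QW(1) q QW(3)])
  also have "\<dots> = listing (arc cs Q q) W" unfolding a using listing_listing[OF QW(2)] .
  also have "\<dots> = arc_listing cs Q W"
    using a q QW s assms(1) by (intro arc_listing_eq[symmetric]) auto
  finally show ?thesis ..
qed

text \<open>Arcs do not depend on the starting point of the circle, and shorter cyclic cumulants
  agree by induction. Traciality enters only through the moment of the whole word.\<close>

lemma dkap_cyc:
  assumes "distinct cs" "\<psi> 1 = 1" "tracial D" "cyc cs ds"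
  shows "dkap \<psi> D x ds = dkap \<psi> D x cs"
  using assms(1,4)
proof (induction "length cs" arbitrary: cs ds rule: less_induct)
  case less
  show ?case
  proof (cases "cs = []")
    case True
    then show ?thesis using less.prems(2) cyc_length by force
  next
    case False
    have ds: "distinct ds" "ds \<noteq> []" "set ds = set cs"
      using less.prems False cyc_distinct cyc_set by (blast, metis cyc_length length_0_conv, blast)
    obtain p s where "cs = p @ s" "ds = s @ p" using less.prems(2) by (auto simp: cyc_def)
    then have m: "moment D x ds = moment D x cs"
      using assms(3) by (simp add: moment_def tracial_def)
    have "dkap \<psi> D x (listing ds V) * (\<Prod>v\<in>V. moment \<psi> x (arc ds V v)) =
        dkap \<psi> D x (listing cs V) * (\<Prod>v\<in>V. moment \<psi> x (arc cs V v))"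
      if V: "V \<noteq> {}" "V \<subset> set cs" for V
    proof -
      have "dkap \<psi> D x (listing ds V) = dkap \<psi> D x (listing cs V)"
        using less.prems V by (intro less.hyps length_listing_less cyc_filter) auto
      moreover have "arc ds V v = arc cs V v" if "v \<in> V" for v
        using arc_cyc_eq[OF less.prems] that V by blast
      ultimately show ?thesis by simp
    qed
    then show ?thesis
      unfolding dkap_blocks[of ds \<psi>, OF ds(1) assms(2) ds(2)] dkap_blocks[of cs \<psi>, OF less.prems(1) assms(2) False]
      unfolding m ds(3) by (intro arg_cong2[of _ _ _ _ minus] refl sum.cong) auto
  qed
qed

lemma sector_disjoint:
  assumes "distinct cs" "\<pi> \<in> NC_on cs" "V \<in> \<pi>" "v \<in> V" "w \<in> V" "v \<noteq> w"
  shows "sector cs V \<pi> v \<inter> sector cs V \<pi> w = {}"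
proof -
  have V: "V \<subseteq> set cs" using NC_onD[OF assms(2)] assms(3) by auto
  have "W = {}" if "W \<subseteq> set (arc cs V v)" "W \<subseteq> set (arc cs V w)" for W
    using arc_disjoint[OF assms(1) V assms(4-6)] that by blast
  then show ?thesis using NC_onD(3)[OF assms(2)] by (auto simp: sector_def)
qed

lemma other_blocks_eq_sectors:
  assumes "distinct cs" "\<pi> \<in> NC_on cs" "V \<in> \<pi>"
  shows "\<pi> - {V} = (\<Union>v\<in>V. sector cs V \<pi> v)"
proof -
  have V: "V \<subseteq> set cs" using NC_onD[OF assms(2)] assms(3) by auto
  have "V \<notin> sector cs V \<pi> v" if "v \<in> V" for v
    using arc_subset[OF assms(1) that] that V by (auto simp: sector_def)
  then show ?thesis using glue_sector[OF assms] unfolding glue_def by blast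
qed

text \<open>The block through a fixed point either carries the cyclic cumulant itself, or the block that
  does lies in one of its arcs.\<close>

lemma cyclic_moment_anchored:
  assumes "distinct cs" "\<psi> 1 = 1" "tracial D" "D 1 = 0" "i \<in> set cs"
  shows "moment D x cs = (\<Sum>V | i \<in> V \<and> V \<subseteq> set cs.
    dkap \<psi> D x (listing cs V) * (\<Prod>v\<in>V. moment \<psi> x (arc cs V v)) +
    (\<Sum>v\<in>V. kap \<psi> x (listing_from cs V v) * (moment D x (arc cs V v) * (\<Prod>u\<in>V - {v}. moment \<psi> x (arc cs V u)))))"
proof -
  define T where "T \<pi> Q = dkap \<psi> D x (listing cs Q) * (\<Prod>W\<in>\<pi> - {Q}. kap \<psi> x (arc_listing cs Q W))" for \<pi> Q
  define S where "S a Q \<nu> = dkap \<psi> D x (listing a Q) * (\<Prod>W\<in>\<nu> - {Q}. kap \<psi> x (arc_listing a Q W))" for a Q \<nu>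
  have ne: "cs \<noteq> []" using assms(5) by auto
  \<comment> \<open>For an empty arc the right-hand side has no block to mark and is
    \<open>0\<close>; the left-hand side is \<open>D 1 = 0\<close>.\<close>
  have Dm: "moment D x a = (\<Sum>\<nu>\<in>NC_on a. \<Sum>Q\<in>\<nu>. S a Q \<nu>)" if "distinct a" for a
  proof (cases "a = []")
    case True
    then show ?thesis by (simp add: NC_on_Nil moment_def assms(4))
  next
    case False
    then show ?thesis unfolding S_def by (rule cyclic_moment_NC_on[OF that])
  qed
  have "(\<Sum>\<pi> | \<pi> \<in> NC_on cs \<and> V \<in> \<pi>. \<Sum>Q\<in>\<pi>. T \<pi> Q) =
    dkap \<psi> D x (listing cs V) * (\<Prod>v\<in>V. moment \<psi> x (arc cs V v)) +
    (\<Sum>v\<in>V. kap \<psi> x (listing_from cs V v) * (moment D x (arc cs V v) * (\<Prod>u\<in>V - {v}. moment \<psi> x (arc cs V u))))"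
    if iV: "i \<in> V" and V: "V \<subseteq> set cs" for V
  proof -
    have Vne: "V \<noteq> {}" and Vfin: "finite V" using iV V finite_subset by auto
    have vc: "v \<in> set cs" if "v \<in> V" for v using V that by blast
    \<comment> \<open>The marked block lies in the arc of \<open>v\<close>, which yields a cyclic
      moment; all other arcs yield ordinary moments.\<close>
    define H where "H v u \<nu> = (if u = v then \<Sum>Q\<in>\<nu>. S (arc cs V v) Q \<nu>
      else \<Prod>W\<in>\<nu>. kap \<psi> x (listing (arc cs V u) W))" for v u \<nu>
    have Hsum: "(\<Sum>\<nu>\<in>NC_on (arc cs V u). H v u \<nu>) =
        (if u = v then moment D x (arc cs V v) else moment \<psi> x (arc cs V u))" if "u \<in> V" for u v
    proof (cases "u = v")
      case True
      then show ?thesis using Dm[OF distinct_arc[OF assms(1) that vc[OF that]]] by (simp add: H_def)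
    next
      case False
      then show ?thesis
        using moment_NC_on[of _ \<psi>, OF distinct_arc[OF assms(1) that vc[OF that]] assms(2)] by (simp add: H_def)
    qed
    have TH: "(\<Sum>Q\<in>sector cs V \<pi> v. T \<pi> Q) =
        kap \<psi> x (listing_from cs V v) * (\<Prod>u\<in>V. H v u (sector cs V \<pi> u))"
      if p: "\<pi> \<in> NC_on cs" "V \<in> \<pi>" and v: "v \<in> V" for \<pi> v
    proof -
      note sec = sector_in_NC_on[OF assms(1) p]
      have "T \<pi> Q = kap \<psi> x (listing_from cs V v) * S (arc cs V v) Q (sector cs V \<pi> v) *
          (\<Prod>u\<in>V - {v}. H v u (sector cs V \<pi> u))" if Q: "Q \<in> sector cs V \<pi> v" for Q
      proof -
        have Qs: "Q \<in> \<pi>" "Q \<subseteq> set (arc cs V v)" "Q \<noteq> {}"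
          using Q NC_onD(3)[OF p(1)] by (auto simp: sector_def)
        have QV: "Q \<noteq> V" using Qs arc_subset[OF assms(1) v vc[OF v]] v by blast
        let ?R = "\<Union>u\<in>V - {v}. sector cs V \<pi> u"
        have "\<pi> = insert V (\<Union>u\<in>V. sector cs V \<pi> u)"
          using other_blocks_eq_sectors[OF assms(1) p] p(2) by blast
        also have "(\<Union>u\<in>V. sector cs V \<pi> u) = sector cs V \<pi> v \<union> ?R" using v by blast
        finally have pe: "\<pi> = insert V (sector cs V \<pi> v \<union> ?R)" .
        have dj: "sector cs V \<pi> v \<inter> ?R = {}" using sector_disjoint[OF assms(1) p v] by auto
        have nV: "V \<notin> sector cs V \<pi> v \<union> ?R"
          using other_blocks_eq_sectors[OF assms(1) p] v by blast
        have fin: "finite (sector cs V \<pi> u)" for u using NC_onD(5)[OF p(1)] by (simp add: sector_def)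
        \<comment> \<open>The three groups correspond to the three positions of a block relative to
          \<open>Q\<close>.\<close>
        have "\<pi> - {Q} = insert V ((sector cs V \<pi> v - {Q}) \<union> ?R)"
          by (subst pe) (use QV Q dj in blast)
        then have "(\<Prod>W\<in>\<pi> - {Q}. kap \<psi> x (arc_listing cs Q W)) =
            (\<Prod>W\<in>insert V ((sector cs V \<pi> v - {Q}) \<union> ?R). kap \<psi> x (arc_listing cs Q W))" by simp
        also have "\<dots> = kap \<psi> x (arc_listing cs Q V) *
            (\<Prod>W\<in>(sector cs V \<pi> v - {Q}) \<union> ?R. kap \<psi> x (arc_listing cs Q W))"
          using nV fin Vfin by (intro prod.insert) auto
        also have "(\<Prod>W\<in>(sector cs V \<pi> v - {Q}) \<union> ?R. kap \<psi> x (arc_listing cs Q W)) =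
            (\<Prod>W\<in>sector cs V \<pi> v - {Q}. kap \<psi> x (arc_listing cs Q W)) *
            (\<Prod>W\<in>?R. kap \<psi> x (arc_listing cs Q W))"
          using dj fin Vfin by (intro prod.union_disjoint) auto
        also have "(\<Prod>W\<in>?R. kap \<psi> x (arc_listing cs Q W)) =
            (\<Prod>u\<in>V - {v}. \<Prod>W\<in>sector cs V \<pi> u. kap \<psi> x (arc_listing cs Q W))"
          using fin Vfin sector_disjoint[OF assms(1) p] by (intro prod.UNION_disjoint) auto
        also have "\<dots> = (\<Prod>u\<in>V - {v}. H v u (sector cs V \<pi> u))"
        proof (rule prod.cong[OF refl])
          fix u assume u: "u \<in> V - {v}"
          have "arc_listing cs Q W = listing (arc cs V u) W" if "W \<in> sector cs V \<pi> u" for W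
            using arc_listing_other_sector[OF assms(1) V v Qs(2,3)] u that NC_onD(3)[OF p(1)]
            by (auto simp: sector_def)
          then show "(\<Prod>W\<in>sector cs V \<pi> u. kap \<psi> x (arc_listing cs Q W)) = H v u (sector cs V \<pi> u)"
            using u by (simp add: H_def)
        qed
        also have "(\<Prod>W\<in>sector cs V \<pi> v - {Q}. kap \<psi> x (arc_listing cs Q W)) =
            (\<Prod>W\<in>sector cs V \<pi> v - {Q}. kap \<psi> x (arc_listing (arc cs V v) Q W))"
        proof (intro prod.cong refl)
          show "kap \<psi> x (arc_listing cs Q W) = kap \<psi> x (arc_listing (arc cs V v) Q W)"
            if W: "W \<in> sector cs V \<pi> v - {Q}" for W
          proof -
            have "W \<in> sector cs V \<pi> v" "Q \<noteq> W" using W by blast+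
            then show ?thesis using arc_listing_same_sector[OF assms(1) V v sec[OF v] Q] by simp
          qed
        qed
        also have "arc_listing cs Q V = listing_from cs V v"
          by (rule arc_listing_outer_block[OF assms(1) V v Qs(2,3)])
        finally have "(\<Prod>W\<in>\<pi> - {Q}. kap \<psi> x (arc_listing cs Q W)) = kap \<psi> x (listing_from cs V v) *
          ((\<Prod>W\<in>sector cs V \<pi> v - {Q}. kap \<psi> x (arc_listing (arc cs V v) Q W)) *
            (\<Prod>u\<in>V - {v}. H v u (sector cs V \<pi> u)))" .
        \<comment> \<open>The listing of \<open>Q\<close> in \<open>cs\<close> and the one along the
          arc differ by a rotation, which cyclic cumulants ignore.\<close>
        moreover have "dkap \<psi> D x (listing cs Q) = dkap \<psi> D x (listing (arc cs V v) Q)"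
        proof -
          have "cyc (listing (listing cs (set (arc cs V v))) Q) (listing (arc cs V v) Q)"
            by (rule cyc_filter[OF filter_arc[OF assms(1) v vc[OF v]]])
          then show ?thesis
            using dkap_cyc[of _ \<psi> D] assms(1-3) listing_listing[OF Qs(2)] by (metis distinct_filter)
        qed
        ultimately show ?thesis by (simp add: T_def S_def)
      qed
      then have "(\<Sum>Q\<in>sector cs V \<pi> v. T \<pi> Q) = (\<Sum>Q\<in>sector cs V \<pi> v.
          kap \<psi> x (listing_from cs V v) * S (arc cs V v) Q (sector cs V \<pi> v) *
          (\<Prod>u\<in>V - {v}. H v u (sector cs V \<pi> u)))" by (intro sum.cong) auto
      also have "\<dots> = kap \<psi> x (listing_from cs V v) *
         ((\<Sum>Q\<in>sector cs V \<pi> v. S (arc cs V v) Q (sector cs V \<pi> v)) *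
          (\<Prod>u\<in>V - {v}. H v u (sector cs V \<pi> u)))"
        by (simp only: sum_distrib_left sum_distrib_right mult.assoc)
      also have "(\<Sum>Q\<in>sector cs V \<pi> v. S (arc cs V v) Q (sector cs V \<pi> v)) = H v v (sector cs V \<pi> v)"
        by (simp add: H_def)
      also have "H v v (sector cs V \<pi> v) * (\<Prod>u\<in>V - {v}. H v u (sector cs V \<pi> u)) =
          (\<Prod>u\<in>V. H v u (sector cs V \<pi> u))"
        by (rule prod.remove[OF Vfin v, symmetric])
      finally show ?thesis .
    qed
    have split: "(\<Sum>Q\<in>\<pi>. T \<pi> Q) = T \<pi> V +
        (\<Sum>v\<in>V. kap \<psi> x (listing_from cs V v) * (\<Prod>u\<in>V. H v u (sector cs V \<pi> u)))"
      if p: "\<pi> \<in> NC_on cs" "V \<in> \<pi>" for \<pi>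
    proof -
      have fin: "finite (sector cs V \<pi> u)" for u using NC_onD(5)[OF p(1)] by (simp add: sector_def)
      have "(\<Sum>Q\<in>\<pi>. T \<pi> Q) = T \<pi> V + (\<Sum>Q\<in>\<pi> - {V}. T \<pi> Q)"
        by (rule sum.remove[OF NC_onD(5)[OF p(1)] p(2)])
      also have "(\<Sum>Q\<in>\<pi> - {V}. T \<pi> Q) = (\<Sum>v\<in>V. \<Sum>Q\<in>sector cs V \<pi> v. T \<pi> Q)"
        unfolding other_blocks_eq_sectors[OF assms(1) p]
        using fin Vfin sector_disjoint[OF assms(1) p] by (intro sum.UNION_disjoint) auto
      finally show ?thesis using TH[OF p] by simp
    qed
    have "(\<Sum>\<pi> | \<pi> \<in> NC_on cs \<and> V \<in> \<pi>. \<Sum>Q\<in>\<pi>. T \<pi> Q) = (\<Sum>\<pi> | \<pi> \<in> NC_on cs \<and> V \<in> \<pi>. T \<pi> V) +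
       (\<Sum>\<pi> | \<pi> \<in> NC_on cs \<and> V \<in> \<pi>.
        \<Sum>v\<in>V. kap \<psi> x (listing_from cs V v) * (\<Prod>u\<in>V. H v u (sector cs V \<pi> u)))"
      using split by (simp add: sum.distrib)
    also have "(\<Sum>\<pi> | \<pi> \<in> NC_on cs \<and> V \<in> \<pi>. T \<pi> V) =
        dkap \<psi> D x (listing cs V) * (\<Prod>v\<in>V. moment \<psi> x (arc cs V v))"
      unfolding T_def by (rule sum_cyclic_block[of cs \<psi>, OF assms(1,2) Vne V])
    also have "(\<Sum>\<pi> | \<pi> \<in> NC_on cs \<and> V \<in> \<pi>.
        \<Sum>v\<in>V. kap \<psi> x (listing_from cs V v) * (\<Prod>u\<in>V. H v u (sector cs V \<pi> u))) =
      (\<Sum>v\<in>V. kap \<psi> x (listing_from cs V v) *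
        (\<Sum>\<pi> | \<pi> \<in> NC_on cs \<and> V \<in> \<pi>. \<Prod>u\<in>V. H v u (sector cs V \<pi> u)))"
      unfolding sum_distrib_left by (rule sum.swap)
    also have "\<dots> = (\<Sum>v\<in>V. kap \<psi> x (listing_from cs V v) *
        (\<Prod>u\<in>V. \<Sum>\<nu>\<in>NC_on (arc cs V u). H v u \<nu>))"
      by (simp only: sum_NC_on_block[OF assms(1) V Vne])
    also have "\<dots> = (\<Sum>v\<in>V. kap \<psi> x (listing_from cs V v) *
        (\<Prod>u\<in>V. if u = v then moment D x (arc cs V v) else moment \<psi> x (arc cs V u)))"
      by (intro sum.cong arg_cong2[of _ _ _ _ "(*)"] prod.cong refl Hsum)
    also have "\<dots> = (\<Sum>v\<in>V. kap \<psi> x (listing_from cs V v) *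
        (moment D x (arc cs V v) * (\<Prod>u\<in>V - {v}. moment \<psi> x (arc cs V u))))"
    proof (intro sum.cong refl arg_cong2[of _ _ _ _ "(*)"])
      fix v assume v: "v \<in> V"
      show "(\<Prod>u\<in>V. if u = v then moment D x (arc cs V v) else moment \<psi> x (arc cs V u)) =
          moment D x (arc cs V v) * (\<Prod>u\<in>V - {v}. moment \<psi> x (arc cs V u))"
      proof -
        have "(\<Prod>u\<in>V - {v}. if u = v then moment D x (arc cs V v) else moment \<psi> x (arc cs V u)) =
          (\<Prod>u\<in>V - {v}. moment \<psi> x (arc cs V u))" by (intro prod.cong refl) auto
        then show ?thesis by (subst prod.remove[OF Vfin v]) simp
      qed
    qed
    finally show ?thesis .
  qed
  then show ?thesis
    unfolding cyclic_moment_NC_on[OF assms(1) ne, of D x \<psi>] T_def[symmetric] sum_NC_on_by_block[OF assms(5)]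
    by (intro sum.cong) auto
qed

text \<open>For the full block every arc is empty: the product of moments is \<open>1\<close>, and
  the terms with the marked block inside an arc vanish because of \<open>D 1 = 0\<close>.\<close>

lemma dkap_anchored:
  assumes "distinct cs" "\<psi> 1 = 1" "tracial D" "D 1 = 0" "i \<in> set cs"
  shows "dkap \<psi> D x cs = moment D x cs - (\<Sum>V | i \<in> V \<and> V \<subset> set cs.
    dkap \<psi> D x (listing cs V) * (\<Prod>v\<in>V. moment \<psi> x (arc cs V v)) +
    (\<Sum>v\<in>V. kap \<psi> x (listing_from cs V v) * (moment D x (arc cs V v) * (\<Prod>u\<in>V - {v}. moment \<psi> x (arc cs V u)))))"
proof -
  have e: "{V. i \<in> V \<and> V \<subseteq> set cs} = insert (set cs) {V. i \<in> V \<and> V \<subset> set cs}" using assms by blast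
  have f: "finite {V. i \<in> V \<and> V \<subset> set cs}" by (rule finite_subset[of _ "Pow (set cs)"]) auto
  have n: "set cs \<notin> {V. i \<in> V \<and> V \<subset> set cs}" by blast
  have a: "moment \<phi> x (arc cs (set cs) v) = \<phi> 1" if "v \<in> set cs" for v \<phi>
    using that arc_full[OF assms(1)] by (simp add: moment_def)
  show ?thesis
    unfolding cyclic_moment_anchored[of cs \<psi>, OF assms] e sum.insert[OF f n]
    using a assms(2,4) by (simp add: listing_full cong: sum.cong prod.cong)
qed

text \<open>Two neighbours outside \<open>V\<close> are in the same arc and stay neighbours there,
  so replacing them by their product changes no moment of an arc.\<close>

lemma arc_adjacent_block:
  assumes "distinct cs" "v \<in> V" "V \<subseteq> set cs" "cyc cs (p # q # r)" "p \<notin> V" "q \<notin> V"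
  shows "p \<notin> set (arc cs V v) \<and> q \<notin> set (arc cs V v) \<or> (\<exists>b c. arc cs V v = b @ p # q # c)"
proof (cases "p \<in> set (arc cs V v)")
  case True
  have v: "v \<in> set cs" using assms by blast
  obtain z where z: "cyc cs (v # arc cs V v @ z)" "z = [] \<or> hd z \<in> V"
    by (rule arcE[OF assms(1,2) v])
  obtain b c where bc: "arc cs V v = b @ p # c" using True split_list by metis
  have "cyc (v # arc cs V v @ z) (p # (c @ z @ v # b))"
    using cyc_append[of "v # b" "p # c @ z"] bc by simp
  then have "cyc cs (p # (c @ z @ v # b))" using z cyc_trans by blast
  then have e: "q # r = c @ z @ v # b" using cyc_distinct_unique_head[OF assms(1,4)] by metis
  have "c \<noteq> []"
  proof
    assume "c = []"
    then have "q \<in> V" using e z(2) assms(2) by (cases z) auto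
    with assms(6) show False by blast
  qed
  then obtain c' where "c = q # c'" using e by (cases c) auto
  then show ?thesis using bc by blast
next
  case False
  then have "q \<notin> set (arc cs V v)" using arc_adjacent_prev[OF assms(1-4)] assms(5) by blast
  with False show ?thesis by blast
qed

section \<open>Linearity, units and centring\<close>

context unital_complex_algebra
begin

text \<open>Linearity in one entry, in the form in which a mean is subtracted.\<close>

lemma moment_upd_diff:
  assumes lin: "Vector_Spaces.linear scale (*) \<phi>" and "distinct cs" "i \<in> set cs"
  shows "moment \<phi> (x(i := y - scale c z)) cs = moment \<phi> (x(i := y)) cs - c * moment \<phi> (x(i := z)) cs"
proof -
  interpret l: Vector_Spaces.linear scale "(*)" \<phi> by (rule lin)
  obtain p s where ps: "cs = p @ i # s" using assms(3) split_list by metis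
  have n: "i \<notin> set p" "i \<notin> set s" using assms(2) ps by auto
  define P where "P = prod_list (map x p)"
  define S where "S = prod_list (map x s)"
  have m: "moment \<phi> (x(i := w)) cs = \<phi> (P * w * S)" for w
    using n by (simp add: moment_def ps P_def S_def mult.assoc)
  have "P * (y - scale c z) * S = P * y * S - scale c (P * z * S)"
    by (simp add: algebra_simps scale_mult_left scale_mult_right)
  then show ?thesis unfolding m by (simp add: l.diff l.scale)
qed

end

locale cyclic_probability_space = unital_complex_algebra scale
  for scale :: "complex \<Rightarrow> 'a::ring_1 \<Rightarrow> 'a" +
  fixes \<psi> D :: "'a \<Rightarrow> complex"
  assumes psi_linear: "Vector_Spaces.linear scale (*) \<psi>"
    and psi_one: "\<psi> 1 = 1"
    and D_linear: "Vector_Spaces.linear scale (*) D"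
    and D_tracial: "tracial D"
    and D_one: "D 1 = 0"
begin

lemmas moment_anchored' = moment_anchored[where \<psi> = \<psi>, OF _ psi_one]
  and kap_anchored' = kap_anchored[where \<psi> = \<psi>, OF _ psi_one]
  and cyclic_moment_blocks' = cyclic_moment_blocks[where \<psi> = \<psi>, OF _ psi_one]
  and dkap_blocks' = dkap_blocks[where \<psi> = \<psi>, OF _ psi_one]
  and dkap_anchored' = dkap_anchored[where \<psi> = \<psi> and D = D, OF _ psi_one D_tracial D_one]

lemma moment_upd_other: "i \<notin> set cs \<Longrightarrow> moment \<phi> (x(i := y)) cs = moment \<phi> x cs"
  unfolding moment_def by (metis map_fun_upd)

text \<open>Anchored at the changed entry, no arc contains it; the moments of the arcs are
  constants, and the remaining factors are shorter cumulants containing \<open>i\<close>.\<close>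

lemma kap_upd_diff:
  assumes "distinct cs" "i \<in> set cs"
  shows "kap \<psi> (x(i := y - scale c z)) cs = kap \<psi> (x(i := y)) cs - c * kap \<psi> (x(i := z)) cs"
  using assms
proof (induction "length cs" arbitrary: cs rule: less_induct)
  case less
  define P where "P V = (\<Prod>v\<in>V. moment \<psi> x (listing cs (set (arc cs V v))))" for V
  have P: "(\<Prod>v\<in>V. moment \<psi> (x(i := w)) (listing cs (set (arc cs V v)))) = P V"
    if V: "i \<in> V" "V \<subset> set cs" for V w
  proof -
    have "i \<notin> set (arc cs V v)" if "v \<in> V" for v
      using arc_subset[OF less.prems(1) that] V that by blast
    then show ?thesis unfolding P_def by (intro prod.cong refl moment_upd_other) auto
  qed
  have K: "kap \<psi> (x(i := w)) cs = moment \<psi> (x(i := w)) cs -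
      (\<Sum>V | i \<in> V \<and> V \<subset> set cs. kap \<psi> (x(i := w)) (listing cs V) * P V)" for w
    unfolding kap_anchored'[OF less.prems]
    using P by (intro arg_cong2[of _ _ _ _ minus] sum.cong refl) auto
  have "kap \<psi> (x(i := y - scale c z)) (listing cs V) * P V =
      kap \<psi> (x(i := y)) (listing cs V) * P V - c * (kap \<psi> (x(i := z)) (listing cs V) * P V)"
    if "i \<in> V" "V \<subset> set cs" for V
  proof -
    have "kap \<psi> (x(i := y - scale c z)) (listing cs V) =
        kap \<psi> (x(i := y)) (listing cs V) - c * kap \<psi> (x(i := z)) (listing cs V)"
      using less.hyps[OF length_listing_less[OF less.prems(1) that(2)]] less.prems that by simp
    then show ?thesis by (simp only: left_diff_distrib mult.assoc)
  qed
  then have "(\<Sum>V | i \<in> V \<and> V \<subset> set cs. kap \<psi> (x(i := y - scale c z)) (listing cs V) * P V) =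
      (\<Sum>V | i \<in> V \<and> V \<subset> set cs. kap \<psi> (x(i := y)) (listing cs V) * P V) -
      c * (\<Sum>V | i \<in> V \<and> V \<subset> set cs. kap \<psi> (x(i := z)) (listing cs V) * P V)"
    by (simp add: sum_subtractf sum_distrib_left)
  then show ?case
    unfolding K moment_upd_diff[OF psi_linear less.prems] by (simp add: algebra_simps)
qed

lemma listing_from_facts:
  assumes "distinct cs" "V \<subseteq> set cs" "v \<in> V"
  shows "distinct (listing_from cs V v)" "set (listing_from cs V v) = V"
    "length (listing_from cs V v) = card V"
proof -
  have v: "v \<in> set cs" using assms by blast
  note c = cyc_arc_empty[OF assms(1) v]
  have d: "distinct (v # arc cs {} v)" using c cyc_distinct assms(1) by blast
  have s: "set cs = insert v (set (arc cs {} v))" using cyc_set[OF c] by auto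
  show 1: "distinct (listing_from cs V v)" using d by (simp add: listing_from_def)
  show 2: "set (listing_from cs V v) = V" using s assms by (auto simp: listing_from_def)
  show "length (listing_from cs V v) = card V" using distinct_card[OF 1] 2 by simp
qed

text \<open>Anchoring at the changed entry again freezes all arcs. The factors that vary are shorter
  cyclic cumulants and the free cumulants of \<open>listing_from\<close>, for which linearity is
  known.\<close>

lemma dkap_upd_diff:
  assumes "distinct cs" "i \<in> set cs"
  shows "dkap \<psi> D (x(i := y - scale c z)) cs = dkap \<psi> D (x(i := y)) cs - c * dkap \<psi> D (x(i := z)) cs"
  using assms
proof (induction "length cs" arbitrary: cs rule: less_induct)
  case less
  define P where "P V = (\<Prod>v\<in>V. moment \<psi> x (arc cs V v))" for V
  define Q where "Q V v = moment D x (arc cs V v) * (\<Prod>u\<in>V - {v}. moment \<psi> x (arc cs V u))" for V v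
  define E where "E w V = dkap \<psi> D (x(i := w)) (listing cs V) * P V +
      (\<Sum>v\<in>V. kap \<psi> (x(i := w)) (listing_from cs V v) * Q V v)" for w V
  have K: "dkap \<psi> D (x(i := w)) cs = moment D (x(i := w)) cs - (\<Sum>V | i \<in> V \<and> V \<subset> set cs. E w V)" for w
    unfolding dkap_anchored'[OF less.prems]
  proof (intro arg_cong2[of _ _ _ _ minus] sum.cong refl)
    fix V assume "V \<in> {V. i \<in> V \<and> V \<subset> set cs}"
    then have V: "i \<in> V" "V \<subset> set cs" by auto
    have "i \<notin> set (arc cs V v)" if "v \<in> V" for v
      using arc_subset[OF less.prems(1) that] V that by blast
    then have "moment \<phi> (x(i := w)) (arc cs V v) = moment \<phi> x (arc cs V v)" if "v \<in> V" for v \<phi>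
      using that by (simp add: moment_upd_other)
    then show "dkap \<psi> D (x(i := w)) (listing cs V) * (\<Prod>v\<in>V. moment \<psi> (x(i := w)) (arc cs V v)) +
      (\<Sum>v\<in>V. kap \<psi> (x(i := w)) (listing_from cs V v) *
         (moment D (x(i := w)) (arc cs V v) * (\<Prod>u\<in>V - {v}. moment \<psi> (x(i := w)) (arc cs V u)))) = E w V"
      unfolding E_def P_def Q_def
      by (intro arg_cong2[of _ _ _ _ "(+)"] arg_cong2[of _ _ _ _ "(*)"] sum.cong prod.cong refl) auto
  qed
  have "E (y - scale c z) V = E y V - c * E z V" if V: "i \<in> V" "V \<subset> set cs" for V
  proof -
    have "kap \<psi> (x(i := y - scale c z)) (listing_from cs V v) * Q V v =
        kap \<psi> (x(i := y)) (listing_from cs V v) * Q V v - c * (kap \<psi> (x(i := z)) (listing_from cs V v) * Q V v)"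
      if "v \<in> V" for v
    proof -
      have "distinct (listing_from cs V v)" "i \<in> set (listing_from cs V v)"
        using listing_from_facts[OF less.prems(1) _ that] V by auto
      from kap_upd_diff[OF this] show ?thesis by (simp only: left_diff_distrib mult.assoc)
    qed
    then have e1: "(\<Sum>v\<in>V. kap \<psi> (x(i := y - scale c z)) (listing_from cs V v) * Q V v) =
        (\<Sum>v\<in>V. kap \<psi> (x(i := y)) (listing_from cs V v) * Q V v) -
        c * (\<Sum>v\<in>V. kap \<psi> (x(i := z)) (listing_from cs V v) * Q V v)"
      by (simp add: sum_subtractf sum_distrib_left)
    have e2: "dkap \<psi> D (x(i := y - scale c z)) (listing cs V) =
        dkap \<psi> D (x(i := y)) (listing cs V) - c * dkap \<psi> D (x(i := z)) (listing cs V)"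
      using less.hyps[OF length_listing_less[OF less.prems(1) V(2)]] less.prems V by simp
    show ?thesis unfolding E_def e1 e2 by (simp add: algebra_simps)
  qed
  then have "(\<Sum>V | i \<in> V \<and> V \<subset> set cs. E (y - scale c z) V) =
      (\<Sum>V | i \<in> V \<and> V \<subset> set cs. E y V) - c * (\<Sum>V | i \<in> V \<and> V \<subset> set cs. E z V)"
    by (simp add: sum_subtractf sum_distrib_left)
  then show ?case
    unfolding K moment_upd_diff[OF D_linear less.prems] by (simp add: algebra_simps)
qed

lemma moment_remove_unit:
  assumes "x i = 1"
  shows "moment \<phi> x (filter (\<lambda>p. p \<noteq> i) cs) = moment \<phi> x cs"
proof -
  have "prod_list (map x (filter (\<lambda>p. p \<noteq> i) cs)) = prod_list (map x cs)"
    using assms by (induction cs) auto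
  then show ?thesis by (simp add: moment_def)
qed

lemma listing_without:
  assumes "i \<notin> V"
  shows "listing (filter (\<lambda>p. p \<noteq> i) cs) V = listing cs V"
  using assms by (auto simp: filter_filter intro!: filter_cong)

text \<open>Anchor at another point \<open>j\<close>. Proper blocks through both \<open>i\<close>
  and \<open>j\<close> vanish by induction, and the others form the recursion for the word without
  \<open>i\<close>, whose moment equals that of \<open>cs\<close>. Nothing is left for the full
  block.\<close>

lemma kap_unit:
  assumes "distinct cs" "length cs \<ge> 2" "i \<in> set cs" "x i = 1"
  shows "kap \<psi> x cs = 0"
  using assms(1-3)
proof (induction "length cs" arbitrary: cs rule: less_induct)
  case less
  have "card (set cs) \<ge> 2" using less.prems by (simp add: distinct_card)
  then have "set cs \<noteq> {i}" by auto
  then obtain j where j: "j \<in> set cs" "j \<noteq> i" using less.prems(3) by blast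
  define cs' where "cs' = filter (\<lambda>p. p \<noteq> i) cs"
  have cs': "distinct cs'" "set cs' = set cs - {i}" "j \<in> set cs'" using less.prems j by (auto simp: cs'_def)
  let ?t = "\<lambda>V. kap \<psi> x (listing cs V) * (\<Prod>v\<in>V. moment \<psi> x (listing cs (set (arc cs V v))))"
  have z: "?t V = 0" if V: "j \<in> V" "V \<subset> set cs" "i \<in> V" for V
  proof -
    have fin: "finite V" using V finite_subset by blast
    have "card {i, j} \<le> card V" using V fin by (intro card_mono) auto
    then have "2 \<le> length (listing cs V)"
      using length_listing[OF less.prems(1), of V] V j by (simp add: Int_absorb2 psubset_imp_subset)
    then have "kap \<psi> x (listing cs V) = 0"
      using less.hyps[OF length_listing_less[OF less.prems(1) V(2)]] less.prems V by simp
    then show ?thesis by simp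
  qed
  have "kap \<psi> x cs = moment \<psi> x cs - (\<Sum>V | j \<in> V \<and> V \<subset> set cs. ?t V)"
    by (rule kap_anchored'[OF less.prems(1) j(1)])
  also have "(\<Sum>V | j \<in> V \<and> V \<subset> set cs. ?t V) = (\<Sum>V | j \<in> V \<and> V \<subseteq> set cs'. ?t V)"
  proof (rule sum.mono_neutral_right)
    show "finite {V. j \<in> V \<and> V \<subset> set cs}" by (rule finite_subset[of _ "Pow (set cs)"]) auto
    show "{V. j \<in> V \<and> V \<subseteq> set cs'} \<subseteq> {V. j \<in> V \<and> V \<subset> set cs}" using cs'(2) less.prems(3) by blast
    show "\<forall>V\<in>{V. j \<in> V \<and> V \<subset> set cs} - {V. j \<in> V \<and> V \<subseteq> set cs'}. ?t V = 0"
      using z cs'(2) by blast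
  qed
  also have "\<dots> = (\<Sum>V | j \<in> V \<and> V \<subseteq> set cs'. kap \<psi> x (listing cs' V) *
      (\<Prod>v\<in>V. moment \<psi> x (listing cs' (set (arc cs' V v)))))"
  proof (intro sum.cong refl arg_cong2[of _ _ _ _ "(*)"] prod.cong)
    fix V assume "V \<in> {V. j \<in> V \<and> V \<subseteq> set cs'}"
    then have V: "V \<subseteq> set cs" "i \<notin> V" using cs' by auto
    then show "kap \<psi> x (listing cs V) = kap \<psi> x (listing cs' V)"
      unfolding cs'_def by (simp only: listing_without[OF V(2)])
    fix v assume v: "v \<in> V"
    have "arc cs' V v = filter (\<lambda>p. p \<noteq> i) (arc cs V v)"
      unfolding cs'_def using V v less.prems(1) by (intro arc_filter) auto
    then have "listing cs' (set (arc cs' V v)) = filter (\<lambda>p. p \<noteq> i) (listing cs (set (arc cs V v)))"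
      unfolding cs'_def by (auto simp: filter_filter intro!: filter_cong)
    then show "moment \<psi> x (listing cs (set (arc cs V v))) = moment \<psi> x (listing cs' (set (arc cs' V v)))"
      by (simp only: moment_remove_unit[of x i, OF assms(4)])
  qed
  also have "\<dots> = moment \<psi> x cs'" by (rule moment_anchored'[OF cs'(1) cs'(3), symmetric])
  also have "\<dots> = moment \<psi> x cs" unfolding cs'_def by (rule moment_remove_unit[of x i, OF assms(4)])
  finally show ?case by simp
qed

lemma dkap_single: "dkap \<psi> D x [i] = D (x i)"
proof -
  have e: "{V. V \<noteq> {} \<and> V \<subset> set [i]} = {}" by auto
  show ?thesis using dkap_blocks'[of "[i]" D x] unfolding e by (simp add: moment_def)
qed

text \<open>The argument for \<open>kap_unit\<close> without an anchor. Blocks containing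
  \<open>i\<close> now include the singleton, whose cyclic cumulant is
  \<open>D 1 = 0\<close>.\<close>

lemma dkap_unit:
  assumes "distinct cs" "length cs \<ge> 2" "i \<in> set cs" "x i = 1"
  shows "dkap \<psi> D x cs = 0"
  using assms(1-3)
proof (induction "length cs" arbitrary: cs rule: less_induct)
  case less
  have ne: "cs \<noteq> []" using less.prems by auto
  have "card (set cs) \<ge> 2" using less.prems by (simp add: distinct_card)
  then have "set cs \<noteq> {i}" by auto
  then obtain j where j: "j \<in> set cs" "j \<noteq> i" using less.prems(3) by blast
  define cs' where "cs' = filter (\<lambda>p. p \<noteq> i) cs"
  have cs': "distinct cs'" "set cs' = set cs - {i}" "j \<in> set cs'" using less.prems j by (auto simp: cs'_def)
  have ne': "cs' \<noteq> []" using cs'(3) by (cases cs') auto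
  let ?t = "\<lambda>V. dkap \<psi> D x (listing cs V) * (\<Prod>v\<in>V. moment \<psi> x (arc cs V v))"
  have z: "?t V = 0" if V: "V \<noteq> {}" "V \<subset> set cs" "i \<in> V" for V
  proof -
    have fin: "finite V" using V finite_subset by blast
    have len: "length (listing cs V) = card V"
      using length_listing[OF less.prems(1), of V] V by (simp add: Int_absorb2 psubset_imp_subset)
    have "dkap \<psi> D x (listing cs V) = 0"
    proof (cases "card V \<ge> 2")
      case True
      then show ?thesis
        using less.hyps[OF length_listing_less[OF less.prems(1) V(2)]] less.prems V len by simp
    next
      case False
      moreover have "card V > 0" using fin V by (simp add: card_gt_0_iff)
      ultimately have "length (listing cs V) = 1" using len by simp
      moreover have "i \<in> set (listing cs V)" using V less.prems by simp
      ultimately have "listing cs V = [i]"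
        unfolding length_Suc_conv One_nat_def by fastforce
      then show ?thesis by (simp add: dkap_single assms(4) D_one)
    qed
    then show ?thesis by simp
  qed
  have "dkap \<psi> D x cs = moment D x cs - (\<Sum>V | V \<noteq> {} \<and> V \<subset> set cs. ?t V)"
    by (rule dkap_blocks'[OF less.prems(1) ne])
  also have "(\<Sum>V | V \<noteq> {} \<and> V \<subset> set cs. ?t V) = (\<Sum>V | V \<noteq> {} \<and> V \<subseteq> set cs'. ?t V)"
  proof (rule sum.mono_neutral_right)
    show "finite {V. V \<noteq> {} \<and> V \<subset> set cs}" by (rule finite_subset[of _ "Pow (set cs)"]) auto
    show "{V. V \<noteq> {} \<and> V \<subseteq> set cs'} \<subseteq> {V. V \<noteq> {} \<and> V \<subset> set cs}" using cs'(2) less.prems(3) by blast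
    show "\<forall>V\<in>{V. V \<noteq> {} \<and> V \<subset> set cs} - {V. V \<noteq> {} \<and> V \<subseteq> set cs'}. ?t V = 0"
      using z cs'(2) by blast
  qed
  also have "\<dots> = (\<Sum>V | V \<noteq> {} \<and> V \<subseteq> set cs'. dkap \<psi> D x (listing cs' V) *
      (\<Prod>v\<in>V. moment \<psi> x (arc cs' V v)))"
  proof (intro sum.cong refl arg_cong2[of _ _ _ _ "(*)"] prod.cong)
    fix V assume "V \<in> {V. V \<noteq> {} \<and> V \<subseteq> set cs'}"
    then have V: "V \<subseteq> set cs" "i \<notin> V" using cs' by auto
    then show "dkap \<psi> D x (listing cs V) = dkap \<psi> D x (listing cs' V)"
      unfolding cs'_def by (simp only: listing_without[OF V(2)])
    fix v assume v: "v \<in> V"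
    have "arc cs' V v = filter (\<lambda>p. p \<noteq> i) (arc cs V v)"
      unfolding cs'_def using V v less.prems(1) by (intro arc_filter) auto
    then show "moment \<psi> x (arc cs V v) = moment \<psi> x (arc cs' V v)"
      by (simp only: moment_remove_unit[of x i, OF assms(4)])
  qed
  also have "\<dots> = moment D x cs'" by (rule cyclic_moment_blocks'[OF cs'(1) ne', symmetric])
  also have "\<dots> = moment D x cs" unfolding cs'_def by (rule moment_remove_unit[of x i, OF assms(4)])
  finally show ?case by simp
qed

text \<open>The set \<open>T\<close> of entries already centred permits an induction that centres
  one entry at a time.\<close>

definition centred_on :: "'p set \<Rightarrow> ('p \<Rightarrow> 'a) \<Rightarrow> 'p \<Rightarrow> 'a" where
  "centred_on T x = (\<lambda>p. if p \<in> T then x p - scale (\<psi> (x p)) 1 else x p)"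

lemma centred_on_insert:
  assumes "p \<notin> T"
  shows "centred_on (insert p T) x = (centred_on T x)(p := x p - scale (\<psi> (x p)) 1)"
  using assms by (auto simp: centred_on_def)

text \<open>By linearity each centring subtracts a multiple of a cumulant with an entry
  \<open>1\<close>, which is zero from length \<open>2\<close> on.\<close>

lemma kap_centred_on:
  assumes "distinct cs" "length cs \<ge> 2" "finite T" "T \<subseteq> set cs"
  shows "kap \<psi> (centred_on T x) cs = kap \<psi> x cs"
  using assms(3,4)
proof (induction T rule: finite_induct)
  case (insert p T)
  have p: "p \<in> set cs" using insert.prems by blast
  have "(centred_on T x)(p := x p) = centred_on T x" using insert.hyps by (auto simp: centred_on_def)
  moreover have "kap \<psi> ((centred_on T x)(p := 1)) cs = 0"
    by (rule kap_unit[OF assms(1,2) p]) simp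
  ultimately have "kap \<psi> ((centred_on T x)(p := x p - scale (\<psi> (x p)) 1)) cs = kap \<psi> x cs"
    using insert kap_upd_diff[OF assms(1) p, of "centred_on T x" "x p" "\<psi> (x p)" 1] by simp
  then show ?case unfolding centred_on_insert[OF insert.hyps(2)] .
qed (simp add: centred_on_def)

lemma dkap_centred_on:
  assumes "distinct cs" "length cs \<ge> 2" "finite T" "T \<subseteq> set cs"
  shows "dkap \<psi> D (centred_on T x) cs = dkap \<psi> D x cs"
  using assms(3,4)
proof (induction T rule: finite_induct)
  case (insert p T)
  have p: "p \<in> set cs" using insert.prems by blast
  have "(centred_on T x)(p := x p) = centred_on T x" using insert.hyps by (auto simp: centred_on_def)
  moreover have "dkap \<psi> D ((centred_on T x)(p := 1)) cs = 0"
    by (rule dkap_unit[OF assms(1,2) p]) simp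
  ultimately have "dkap \<psi> D ((centred_on T x)(p := x p - scale (\<psi> (x p)) 1)) cs = dkap \<psi> D x cs"
    using insert dkap_upd_diff[OF assms(1) p, of "centred_on T x" "x p" "\<psi> (x p)" 1] by simp
  then show ?case unfolding centred_on_insert[OF insert.hyps(2)] .
qed (simp add: centred_on_def)

text \<open>The product is stored at \<open>p\<close> and the vacated place \<open>q\<close>
  receives a unit. Circle, labels and arcs thus remain the same while the word is merged.\<close>

lemma moment_merge:
  assumes "cs = b @ p # q # c" "distinct cs" "y = x(p := x p * x q, q := 1)"
  shows "moment \<phi> y cs = moment \<phi> x cs"
proof -
  have "map y b = map x b" "map y c = map x c" "p \<noteq> q" using assms by auto
  then show ?thesis using assms by (simp add: moment_def mult.assoc)
qed

lemma moment_cong: "(\<And>p. p \<in> set cs \<Longrightarrow> x p = y p) \<Longrightarrow> moment \<phi> x cs = moment \<phi> y cs"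
  by (simp add: moment_def cong: map_cong)

lemma kap_cong: "(\<And>p. p \<in> set cs \<Longrightarrow> x p = y p) \<Longrightarrow> kap \<psi> x cs = kap \<psi> y cs"
  by (simp add: kap_def cong: map_cong)

lemma dkap_cong: "(\<And>p. p \<in> set cs \<Longrightarrow> x p = y p) \<Longrightarrow> dkap \<psi> D x cs = dkap \<psi> D y cs"
  by (simp add: dkap_def cong: map_cong)

end

section \<open>Vanishing of mixed cumulants\<close>

locale coloured_algebras = cyclic_probability_space scale \<psi> D
  for scale :: "complex \<Rightarrow> 'a::ring_1 \<Rightarrow> 'a" and \<psi> D :: "'a \<Rightarrow> complex" +
  fixes A :: "nat \<Rightarrow> 'a set"
  assumes A_one: "j \<in> {1, 2} \<Longrightarrow> 1 \<in> A j"
    and A_mult: "j \<in> {1, 2} \<Longrightarrow> x \<in> A j \<Longrightarrow> y \<in> A j \<Longrightarrow> x * y \<in> A j"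
    and A_diff: "j \<in> {1, 2} \<Longrightarrow> x \<in> A j \<Longrightarrow> x - scale c 1 \<in> A j"
    and A_free: "cyclically_free_algebras \<psi> D A"
begin

definition coloured :: "('p \<Rightarrow> nat) \<Rightarrow> ('p \<Rightarrow> 'a) \<Rightarrow> 'p list \<Rightarrow> bool" where
  "coloured col x cs \<longleftrightarrow> (\<forall>p\<in>set cs. col p \<in> {1, 2} \<and> x p \<in> A (col p))"

lemma coloured_subset: "coloured col x cs \<Longrightarrow> set ds \<subseteq> set cs \<Longrightarrow> coloured col x ds"
  by (auto simp: coloured_def)

lemma alternating_word:
  assumes "coloured col x cs" "\<And>p. p \<in> set cs \<Longrightarrow> \<psi> (x p) = 0"
    "successively (\<lambda>p q. col p \<noteq> col q) cs"
  defines "c \<equiv> \<lambda>k. x (cs ! (k - 1))" and "j \<equiv> \<lambda>k. col (cs ! (k - 1))"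
  shows "alternating_centred \<psi> A (length cs) j c" "map c [1..<Suc (length cs)] = map x cs"
proof -
  show "alternating_centred \<psi> A (length cs) j c"
    unfolding alternating_centred_def
  proof (intro conjI ballI)
    fix k assume "k \<in> {1..length cs}"
    then have "cs ! (k - 1) \<in> set cs" by auto
    then show "j k \<in> {1, 2}" "c k \<in> A (j k)" "\<psi> (c k) = 0"
      using assms(1,2) by (auto simp: coloured_def c_def j_def)
  next
    fix k assume "k \<in> {1..<length cs}"
    then show "j k \<noteq> j (k + 1)"
      using successively_nth[OF assms(3), of "k - 1"] by (auto simp: j_def)
  qed
  show "map c [1..<Suc (length cs)] = map x cs"
    by (rule nth_equalityI) (auto simp: c_def simp del: upt_Suc)
qed

lemma moment_alternating:
  assumes "coloured col x cs" "\<And>p. p \<in> set cs \<Longrightarrow> \<psi> (x p) = 0"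
    "successively (\<lambda>p q. col p \<noteq> col q) cs" "cs \<noteq> []"
  shows "moment \<psi> x cs = 0"
proof -
  have "length cs \<ge> 1" using assms(4) by (simp add: Suc_leI)
  then show ?thesis
    using alternating_word[of col x cs, OF assms(1-3)] A_free
    unfolding cyclically_free_algebras_def free_algebras_def moment_def by metis
qed

lemma cyclic_moment_alternating:
  assumes "coloured col x cs" "\<And>p. p \<in> set cs \<Longrightarrow> \<psi> (x p) = 0"
    "successively (\<lambda>p q. col p \<noteq> col q) cs" "length cs \<ge> 2" "col (last cs) \<noteq> col (hd cs)"
  shows "moment D x cs = 0"
proof -
  have "cs ! (length cs - 1) = last cs" "cs ! (1 - 1) = hd cs"
    using assms(4) last_conv_nth[of cs] hd_conv_nth[of cs] by fastforce+
  then have "col (cs ! (length cs - 1)) \<noteq> col (cs ! (1 - 1))" using assms(5) by simp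
  then show ?thesis
    using alternating_word[of col x cs, OF assms(1-3)] A_free assms(4)
    unfolding cyclically_free_algebras_def moment_def by metis
qed

lemma coloured_centred:
  assumes "coloured col x cs"
  shows "coloured col (centred_on T x) cs"
  using assms A_diff by (auto simp: coloured_def centred_on_def)

lemma psi_centred: "p \<in> T \<Longrightarrow> \<psi> (centred_on T x p) = 0"
proof -
  interpret l: Vector_Spaces.linear scale "(*)" \<psi> by (rule psi_linear)
  show "p \<in> T \<Longrightarrow> \<psi> (centred_on T x p) = 0"
    by (simp add: centred_on_def l.diff l.scale psi_one)
qed

lemma coloured_merge:
  assumes "coloured col x cs" "p \<in> set cs" "q \<in> set cs" "col p = col q"
  shows "coloured col (x(p := x p * x q, q := 1)) cs"
proof -
  have "col p \<in> {1, 2}" "x p \<in> A (col p)" "x q \<in> A (col p)" "col q = col p"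
    using assms unfolding coloured_def by metis+
  then have "x p * x q \<in> A (col p)" "1 \<in> A (col q)" using A_mult A_one by auto
  then show ?thesis using assms(1) by (auto simp: coloured_def)
qed

lemma successively_append_left: "successively P (xs @ ys) \<Longrightarrow> successively P xs"
  and successively_append_right: "successively P (xs @ ys) \<Longrightarrow> successively P ys"
  by (auto simp: successively_append_iff)

text \<open>Two neighbouring entries of the same colour are merged into one entry and a unit; this
  changes no moment, and the block through an entry of the other colour does not see the merged
  entries.\<close>

lemma kap_mixed:
  assumes "distinct cs" "coloured col x cs" "a \<in> set cs" "b \<in> set cs" "col a \<noteq> col b"
  shows "kap \<psi> x cs = 0"
  using assms
proof (induction "length cs" arbitrary: cs x a b rule: less_induct)
  case less
  note dist = less.prems(1) and wc = less.prems(2)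
  have len2: "length cs \<ge> 2"
  proof -
    have "card {a, b} \<le> card (set cs)" using less.prems by (intro card_mono) auto
    moreover have "a \<noteq> b" using less.prems(5) by auto
    ultimately show ?thesis using distinct_card[OF dist] by simp
  qed
  have mixed0: "kap \<psi> y (listing cs V) = 0"
    if "V \<subset> set cs" "coloured col y cs" "u \<in> V" "w \<in> V" "col u \<noteq> col w" for y V u w
    using that by (intro less.hyps[OF length_listing_less[OF dist that(1)], of y u w])
      (auto simp: dist coloured_def)
  show ?case
  proof (cases "successively (\<lambda>p q. col p \<noteq> col q) cs")
    case False
    then obtain \<beta> p q \<gamma> where s: "cs = \<beta> @ p # q # \<gamma>" "col p = col q"
    proof -
      have "\<exists>\<beta> p q \<gamma>. cs = \<beta> @ p # q # \<gamma> \<and> col p = col q"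
        using False
      proof (induction cs rule: induct_list012)
        case (3 y z zs)
        show ?case
        proof (cases "col y = col z")
          case True
          then show ?thesis by (metis append_Nil)
        next
          case neq: False
          then obtain \<beta> p q \<gamma> where "z # zs = \<beta> @ p # q # \<gamma>" "col p = col q" using 3 by auto
          then show ?thesis by (metis append_Cons)
        qed
      qed auto
      then show thesis using that by blast
    qed
    have pq: "p \<in> set cs" "q \<in> set cs" using s by auto
    obtain i where i: "i \<in> set cs" "col i \<noteq> col p" using less.prems(3-5) by metis
    define y where "y = x(p := x p * x q, q := 1)"
    have wcy: "coloured col y cs" unfolding y_def by (rule coloured_merge[OF wc pq s(2)])
    have cyc: "cyc cs (p # q # (\<gamma> @ \<beta>))" using cyc_append[of \<beta> "p # q # \<gamma>"] s by simp
    let ?t = "\<lambda>x V. kap \<psi> x (listing cs V) * (\<Prod>v\<in>V. moment \<psi> x (listing cs (set (arc cs V v))))"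
    \<comment> \<open>A block with two colours has vanishing cumulant before and after merging, by
      induction. A block of the colour of \<open>i\<close> contains neither \<open>p\<close> nor
      \<open>q\<close>.\<close>
    have "?t y V = ?t x V" if V: "i \<in> V" "V \<subset> set cs" for V
    proof (cases "\<exists>u\<in>V. col u \<noteq> col i")
      case True
      then obtain u where "u \<in> V" "col u \<noteq> col i" by blast
      then have "kap \<psi> y (listing cs V) = 0" "kap \<psi> x (listing cs V) = 0"
        using mixed0 V wc wcy by blast+
      then show ?thesis by simp
    next
      case False
      then have npq: "p \<notin> V" "q \<notin> V" using i s by metis+
      have "kap \<psi> y (listing cs V) = kap \<psi> x (listing cs V)"
        using npq by (intro kap_cong) (auto simp: y_def)
      moreover have "moment \<psi> y (listing cs (set (arc cs V v))) = moment \<psi> x (listing cs (set (arc cs V v)))"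
        if v: "v \<in> V" for v
      proof -
        let ?S = "set (arc cs V v)"
        from arc_adjacent_block[OF dist v _ cyc npq] V
        consider "p \<notin> ?S" "q \<notin> ?S" | "p \<in> ?S" "q \<in> ?S" by fastforce
        then show ?thesis
        proof cases
          case 1
          then show ?thesis by (intro moment_cong) (auto simp: y_def)
        next
          case 2
          then have "listing cs ?S = listing \<beta> ?S @ p # q # listing \<gamma> ?S" using s by simp
          then show ?thesis by (rule moment_merge) (use dist in \<open>auto simp: y_def\<close>)
        qed
      qed
      ultimately show ?thesis by simp
    qed
    moreover have "moment \<psi> y cs = moment \<psi> x cs"
      by (rule moment_merge[OF s(1) dist y_def])
    ultimately have "kap \<psi> x cs = kap \<psi> y cs"
      unfolding kap_anchored'[OF dist i(1)] by (intro arg_cong2[of _ _ _ _ minus] sum.cong) auto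
    also have "\<dots> = 0" by (rule kap_unit[OF dist len2 pq(2)]) (simp add: y_def)
    finally show ?thesis .
  next
    case True
    define y where "y = centred_on (set cs) x"
    have wcy: "coloured col y cs" unfolding y_def by (rule coloured_centred[OF wc])
    have c0: "\<psi> (y p) = 0" if "p \<in> set cs" for p unfolding y_def by (rule psi_centred[OF that])
    \<comment> \<open>The anchor is the head of the list, so that the arc behind it does not run
      over the end and is a contiguous part of the word.\<close>
    obtain h q r where cs: "cs = h # q # r"
      using len2 by (cases cs; cases "tl cs") auto
    have h: "h \<in> set cs" using cs by simp
    let ?t = "\<lambda>V. kap \<psi> y (listing cs V) * (\<Prod>v\<in>V. moment \<psi> y (listing cs (set (arc cs V v))))"
    have "?t V = 0" if V: "h \<in> V" "V \<subset> set cs" for V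
    proof (cases "\<exists>u\<in>V. col u \<noteq> col h")
      case True
      then have "kap \<psi> y (listing cs V) = 0" using mixed0 V wcy by blast
      then show ?thesis by simp
    next
      case mono: False
      \<comment> \<open>A monochrome \<open>V\<close> through \<open>h\<close> misses its neighbour
        \<open>q\<close>. The arc behind \<open>h\<close> is then a nonempty alternating word in
        centred elements, and freeness makes its moment zero.\<close>
      have "col q \<noteq> col h" using True cs by auto
      then have "q \<notin> V" using mono by blast
      have a: "arc cs V h = takeWhile (\<lambda>x. x \<notin> V) (q # r)"
        by (rule arc_cyc[OF dist]) (simp add: cs cyc_refl)
      define z where "z = dropWhile (\<lambda>x. x \<notin> V) (q # r)"
      have csz: "cs = h # arc cs V h @ z" unfolding a z_def takeWhile_dropWhile_id by (rule cs)
      have ane: "arc cs V h \<noteq> []" unfolding a using \<open>q \<notin> V\<close> by simp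
      have "successively (\<lambda>p q. col p \<noteq> col q) ([h] @ arc cs V h @ z)" using True csz by simp
      then have suc: "successively (\<lambda>p q. col p \<noteq> col q) (arc cs V h)"
        using successively_append_left successively_append_right by blast
      have d': "distinct (h # arc cs V h @ z)" using dist csz by simp
      have "listing cs (set (arc cs V h)) = listing (h # arc cs V h @ z) (set (arc cs V h))" using csz by simp
      also have "\<dots> = arc cs V h" using d' by (auto simp: filter_empty_conv filter_id_conv)
      finally have l: "listing cs (set (arc cs V h)) = arc cs V h" .
      have sub: "set (arc cs V h) \<subseteq> set cs" using arc_subset[OF dist V(1) h] by blast
      have "moment \<psi> y (arc cs V h) = 0"
        by (rule moment_alternating[OF coloured_subset[OF wcy sub] _ suc ane]) (use c0 sub in blast)
      then have "(\<Prod>v\<in>V. moment \<psi> y (listing cs (set (arc cs V v)))) = 0"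
        using V(1) l by (intro prod_zero bexI[of _ h] finite_subset[OF psubset_imp_subset[OF V(2)]]) auto
      then show ?thesis by simp
    qed
    then have "(\<Sum>V | h \<in> V \<and> V \<subset> set cs. ?t V) = 0" by (intro sum.neutral) auto
    moreover have "moment \<psi> y cs = 0"
      using moment_alternating[OF wcy c0 True] cs by simp
    ultimately have "kap \<psi> y cs = 0" unfolding kap_anchored'[OF dist h] by simp
    then show ?thesis using kap_centred_on[OF dist len2, of "set cs" x] by (simp add: y_def)
  qed
qed

text \<open>Neighbours are now taken on the circle. If two have the same colour, the word is rotated
  to begin with them and merged; two-coloured outer blocks vanish by induction or by
  \<open>kap_mixed\<close>. Otherwise the word alternates cyclically, and after centring freeness
  kills an arc of every monochrome proper block, while cyclic freeness kills the full
  moment.\<close>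

lemma dkap_mixed:
  assumes "distinct cs" "coloured col x cs" "a \<in> set cs" "b \<in> set cs" "col a \<noteq> col b"
  shows "dkap \<psi> D x cs = 0"
  using assms
proof (induction "length cs" arbitrary: cs x a b rule: less_induct)
  case less
  note dist = less.prems(1) and wc = less.prems(2)
  have len2: "length cs \<ge> 2"
  proof -
    have "card {a, b} \<le> card (set cs)" using less.prems by (intro card_mono) auto
    moreover have "a \<noteq> b" using less.prems(5) by auto
    ultimately show ?thesis using distinct_card[OF dist] by simp
  qed
  have mixed0: "dkap \<psi> D y (listing ds V) = 0"
    if "distinct ds" "length ds = length cs" "V \<subset> set ds" "coloured col y ds" "u \<in> V" "w \<in> V" "col u \<noteq> col w"
    for y ds V u w
    using that length_listing_less[OF that(1,3)]
    by (intro less.hyps[of "listing ds V" y u w]) (auto simp: coloured_def)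
  show ?case
  proof (cases "\<exists>p q r. cyc cs (p # q # r) \<and> col p = col q")
    case True
    then obtain p q r where s: "cyc cs (p # q # r)" "col p = col q" by blast
    define ds where "ds = p # q # r"
    have ds: "distinct ds" "set ds = set cs" "length ds = length cs" "cyc ds (p # q # r)"
      using s(1) dist cyc_distinct cyc_set cyc_length cyc_refl unfolding ds_def by blast+
    have pq: "p \<in> set ds" "q \<in> set ds" by (auto simp: ds_def)
    have wcd: "coloured col x ds" using wc ds by (simp add: coloured_def)
    obtain i where i: "i \<in> set ds" "col i \<noteq> col p" using less.prems(3-5) ds(2) by metis
    define y where "y = x(p := x p * x q, q := 1)"
    have wcy: "coloured col y ds" unfolding y_def by (rule coloured_merge[OF wcd pq s(2)])
    let ?t = "\<lambda>x V. dkap \<psi> D x (listing ds V) * (\<Prod>v\<in>V. moment \<psi> x (arc ds V v)) +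
       (\<Sum>v\<in>V. kap \<psi> x (listing_from ds V v) * (moment D x (arc ds V v) * (\<Prod>u\<in>V - {v}. moment \<psi> x (arc ds V u))))"
    have "?t y V = ?t x V" if V: "i \<in> V" "V \<subset> set ds" for V
    proof (cases "\<exists>u\<in>V. col u \<noteq> col i")
      case True
      then obtain u where u: "u \<in> V" "col u \<noteq> col i" by blast
      then have "dkap \<psi> D y (listing ds V) = 0" "dkap \<psi> D x (listing ds V) = 0"
        using mixed0[OF ds(1,3) V(2) _ u(1) V(1) u(2)] wcd wcy by blast+
      moreover have "kap \<psi> w (listing_from ds V v) = 0" if "v \<in> V" "coloured col w ds" for v w
        using listing_from_facts[OF ds(1) _ that(1)] V u that(2)
        by (intro kap_mixed[of _ col _ u i]) (auto simp: coloured_def)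
      ultimately show ?thesis using wcd wcy by simp
    next
      case False
      then have npq: "p \<notin> V" "q \<notin> V" using i s by metis+
      have "dkap \<psi> D y (listing ds V) = dkap \<psi> D x (listing ds V)"
        using npq by (intro dkap_cong) (auto simp: y_def)
      moreover have "kap \<psi> y (listing_from ds V v) = kap \<psi> x (listing_from ds V v)" if "v \<in> V" for v
        using npq V listing_from_facts[OF ds(1) _ that] by (intro kap_cong) (auto simp: y_def)
      moreover have "moment \<phi> y (arc ds V v) = moment \<phi> x (arc ds V v)" if v: "v \<in> V" for v \<phi>
      proof -
        have vd: "v \<in> set ds" using v V by blast
        from arc_adjacent_block[OF ds(1) v _ ds(4) npq] V
        consider "p \<notin> set (arc ds V v)" "q \<notin> set (arc ds V v)" | b c where "arc ds V v = b @ p # q # c" by blast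
        then show ?thesis
        proof cases
          case 1
          then show ?thesis by (intro moment_cong) (auto simp: y_def)
        next
          case 2
          then show ?thesis by (rule moment_merge) (use distinct_arc[OF ds(1) v vd] in \<open>auto simp: y_def\<close>)
        qed
      qed
      ultimately show ?thesis by (simp cong: sum.cong)
    qed
    moreover have "moment D y ds = moment D x ds"
      by (rule moment_merge[of _ "[]"]) (use ds in \<open>auto simp: y_def ds_def\<close>)
    ultimately have "dkap \<psi> D x ds = dkap \<psi> D y ds"
      unfolding dkap_anchored'[OF ds(1) i(1)] by (intro arg_cong2[of _ _ _ _ minus] sum.cong) auto
    also have "\<dots> = 0" by (rule dkap_unit[OF ds(1) _ pq(2)]) (use len2 ds in \<open>auto simp: y_def\<close>)
    finally show ?thesis using dkap_cyc[where \<psi> = \<psi> and D = D, OF dist psi_one D_tracial s(1)] by (simp add: ds_def)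
  next
    case alt: False
    define y where "y = centred_on (set cs) x"
    have wcy: "coloured col y cs" unfolding y_def by (rule coloured_centred[OF wc])
    have c0: "\<psi> (y p) = 0" if "p \<in> set cs" for p unfolding y_def by (rule psi_centred[OF that])
    have ne: "cs \<noteq> []" using len2 by auto
    \<comment> \<open>Every interval of every rotation alternates, including intervals across the
      end of the list.\<close>
    have suc: "successively (\<lambda>p q. col p \<noteq> col q) xs" if "cyc cs (ys @ xs @ zs)" for xs ys zs
      using that
    proof (induction xs arbitrary: ys rule: induct_list012)
      case (3 p q xs)
      have "cyc (ys @ (p # q # xs) @ zs) (p # q # (xs @ zs @ ys))"
        using cyc_append[of ys "(p # q # xs) @ zs"] by simp
      then have "col p \<noteq> col q" using 3(3) alt cyc_trans by blast
      moreover have "successively (\<lambda>p q. col p \<noteq> col q) (q # xs)" using 3(2)[of "ys @ [p]"] 3(3) by simp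
      ultimately show ?case by simp
    qed auto
    let ?t = "\<lambda>V. dkap \<psi> D y (listing cs V) * (\<Prod>v\<in>V. moment \<psi> y (arc cs V v))"
    have "?t V = 0" if V: "V \<noteq> {}" "V \<subset> set cs" for V
    proof -
      obtain v where v: "v \<in> V" using V by blast
      then have vc: "v \<in> set cs" using V by blast
      show ?thesis
      proof (cases "\<exists>u\<in>V. col u \<noteq> col v")
        case True
        then obtain u where u: "u \<in> V" "col u \<noteq> col v" by blast
        then have "dkap \<psi> D y (listing cs V) = 0"
          using mixed0[OF dist refl V(2) wcy u(1) v u(2)] by simp
        then show ?thesis by simp
      next
        case mono: False
        obtain z where z: "cyc cs (v # arc cs V v @ z)" "z = [] \<or> hd z \<in> V"
          by (rule arcE[OF dist v vc])
        \<comment> \<open>An empty arc would make \<open>v\<close> a neighbour of a point of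
          \<open>V\<close>, hence of its own colour.\<close>
        have ane: "arc cs V v \<noteq> []"
        proof
          assume e: "arc cs V v = []"
          have "length (v # z) = length cs" using cyc_length[OF z(1)] e by simp
          then obtain q r where qr: "z = q # r" using len2 by (cases z) auto
          then have "cyc cs (v # q # r)" "q \<in> V" using z e by auto
          then show False using alt mono by metis
        qed
        have sub: "set (arc cs V v) \<subseteq> set cs" using arc_subset[OF dist v vc] by blast
        have "moment \<psi> y (arc cs V v) = 0"
          by (rule moment_alternating[OF coloured_subset[OF wcy sub] _ suc[of "[v]" _ z] ane])
            (use c0 sub z in auto)
        then have "(\<Prod>v\<in>V. moment \<psi> y (arc cs V v)) = 0"
          using v by (intro prod_zero bexI[of _ v] finite_subset[OF psubset_imp_subset[OF V(2)]]) auto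
        then show ?thesis by simp
      qed
    qed
    then have "(\<Sum>V | V \<noteq> {} \<and> V \<subset> set cs. ?t V) = 0" by (intro sum.neutral) auto
    moreover have "moment D y cs = 0"
    proof (rule cyclic_moment_alternating[OF wcy c0 _ len2])
      show "successively (\<lambda>p q. col p \<noteq> col q) cs" using suc[of "[]" cs "[]"] cyc_refl[of cs] by simp
      obtain h t where ht: "cs = h # t" using ne by (cases cs) auto
      then have tne: "t \<noteq> []" using len2 by auto
      \<comment> \<open>The condition on the two ends, which distinguishes cyclic freeness from
        freeness, is adjacency across the end of the list.\<close>
      have "cyc cs (last t # h # butlast t)"
        using cyc_append[of "h # butlast t" "[last t]"] ht tne by simp
      then show "col (last cs) \<noteq> col (hd cs)" using alt ht tne by auto
    qed
    ultimately have "dkap \<psi> D y cs = 0" unfolding dkap_blocks'[OF dist ne] by simp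
    then show ?thesis using dkap_centred_on[OF dist len2, of "set cs" x] by (simp add: y_def)
  qed
qed

lemma moment_monochrome:
  assumes "distinct cs" "coloured col x cs" "i \<in> set cs"
  shows "moment \<psi> x cs = (\<Sum>V | i \<in> V \<and> V \<subseteq> set cs \<and> (\<forall>p\<in>V. col p = col i). kap \<psi> x (listing cs V) *
    (\<Prod>v\<in>V. moment \<psi> x (listing cs (set (arc cs V v)))))"
  unfolding moment_anchored'[OF assms(1,3)]
proof (rule sum.mono_neutral_right)
  show "finite {V. i \<in> V \<and> V \<subseteq> set cs}" by (rule finite_subset[of _ "Pow (set cs)"]) auto
  show "\<forall>V\<in>{V. i \<in> V \<and> V \<subseteq> set cs} - {V. i \<in> V \<and> V \<subseteq> set cs \<and> (\<forall>p\<in>V. col p = col i)}.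
      kap \<psi> x (listing cs V) * (\<Prod>v\<in>V. moment \<psi> x (listing cs (set (arc cs V v)))) = 0"
  proof
    fix V assume "V \<in> {V. i \<in> V \<and> V \<subseteq> set cs} - {V. i \<in> V \<and> V \<subseteq> set cs \<and> (\<forall>p\<in>V. col p = col i)}"
    then obtain p where V: "i \<in> V" "V \<subseteq> set cs" "p \<in> V" "col p \<noteq> col i" by blast
    have "kap \<psi> x (listing cs V) = 0"
      using V assms by (intro kap_mixed[of _ col _ p i] coloured_subset[OF assms(2)]) auto
    then show "kap \<psi> x (listing cs V) * (\<Prod>v\<in>V. moment \<psi> x (listing cs (set (arc cs V v)))) = 0" by simp
  qed
qed auto

lemma cyclic_moment_monochrome:
  assumes "distinct cs" "coloured col x cs" "cs \<noteq> []"
  shows "moment D x cs = (\<Sum>V | V \<noteq> {} \<and> V \<subseteq> set cs \<and> (\<forall>p\<in>V. \<forall>q\<in>V. col p = col q).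
    dkap \<psi> D x (listing cs V) * (\<Prod>v\<in>V. moment \<psi> x (arc cs V v)))"
  unfolding cyclic_moment_blocks'[OF assms(1,3)]
proof (rule sum.mono_neutral_right)
  show "finite {V. V \<noteq> {} \<and> V \<subseteq> set cs}" by (rule finite_subset[of _ "Pow (set cs)"]) auto
  show "\<forall>V\<in>{V. V \<noteq> {} \<and> V \<subseteq> set cs} - {V. V \<noteq> {} \<and> V \<subseteq> set cs \<and> (\<forall>p\<in>V. \<forall>q\<in>V. col p = col q)}.
      dkap \<psi> D x (listing cs V) * (\<Prod>v\<in>V. moment \<psi> x (arc cs V v)) = 0"
  proof
    fix V assume "V \<in> {V. V \<noteq> {} \<and> V \<subseteq> set cs} - {V. V \<noteq> {} \<and> V \<subseteq> set cs \<and> (\<forall>p\<in>V. \<forall>q\<in>V. col p = col q)}"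
    then obtain p q where V: "V \<subseteq> set cs" "p \<in> V" "q \<in> V" "col p \<noteq> col q" by blast
    have "dkap \<psi> D x (listing cs V) = 0"
      using V assms by (intro dkap_mixed[of _ col _ p q] coloured_subset[OF assms(2)]) auto
    then show "dkap \<psi> D x (listing cs V) * (\<Prod>v\<in>V. moment \<psi> x (arc cs V v)) = 0" by simp
  qed
qed auto

end

section \<open>Complete non-crossing partitions\<close>

text \<open>The empty arc counts as linked: if the two ends of a segment lie in one block, the arc
  of that block behind the last point is empty.\<close>

definition linked :: "'p set set \<Rightarrow> 'p list \<Rightarrow> bool" where
  "linked \<rho> a \<longleftrightarrow> a = [] \<or> (\<exists>W\<in>\<rho>. hd a \<in> W \<and> last a \<in> W)"

text \<open>On the barred circle, the monochrome complete partitions are the unions of a partition of the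
  plain points with its Kreweras complement.\<close>

definition complete :: "'p list \<Rightarrow> 'p set set \<Rightarrow> bool" where
  "complete cs \<rho> \<longleftrightarrow> (\<forall>V\<in>\<rho>. \<forall>v\<in>V. linked \<rho> (arc cs V v))"

lemma linked_sector:
  assumes "distinct cs" "\<pi> \<in> NC_on cs" "V \<in> \<pi>" "v \<in> V" "set a \<subseteq> set (arc cs V v)"
  shows "linked \<pi> a \<longleftrightarrow> linked (sector cs V \<pi> v) a"
proof (cases "a = []")
  case False
  have V: "V \<subseteq> set cs" using NC_onD[OF assms(2)] assms(3) by auto
  have v: "v \<in> set cs" using V assms(4) by blast
  have "W \<in> sector cs V \<pi> v" if W: "W \<in> \<pi>" "hd a \<in> W" for W
  proof -
    have h: "hd a \<in> set (arc cs V v)" using False assms(5) by auto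
    then have "W \<noteq> V" using W arc_subset[OF assms(1,4) v] by blast
    then obtain u where u: "u \<in> V" "W \<subseteq> set (arc cs V u)"
      using NC_on_arc[OF assms(1-3) W(1)] by metis
    then have "u = v" using arc_unique[OF assms(1) V u(1) assms(4)] h W by blast
    with u W show ?thesis by (simp add: sector_def)
  qed
  moreover have "sector cs V \<pi> v \<subseteq> \<pi>" by (auto simp: sector_def)
  ultimately show ?thesis using False unfolding linked_def by blast
qed (simp add: linked_def)

text \<open>The heredity for which completeness is made. Passing from the circle to the segment
  \<open>a\<close> behind \<open>v\<close> changes only the arc of a block \<open>W\<close> behind
  its last point in \<open>a\<close>, from \<open>c @ z @ v # b0\<close> to \<open>c @ b0\<close>.
  Because the ends of \<open>a\<close> are linked, either \<open>c\<close> and \<open>b0\<close> are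
  nonempty and the two lists have the same ends, or both are empty and the removed piece
  \<open>z @ [v]\<close> has its ends in \<open>V\<close>.\<close>

lemma complete_sectors:
  assumes "distinct cs" "\<pi> \<in> NC_on cs" "V \<in> \<pi>"
  shows "complete cs \<pi> \<longleftrightarrow> (\<forall>v\<in>V. linked (sector cs V \<pi> v) (arc cs V v) \<and>
    complete (arc cs V v) (sector cs V \<pi> v))"
proof -
  have V: "V \<subseteq> set cs" using NC_onD[OF assms(2)] assms(3) by auto
  have inner: "linked \<pi> (arc cs W w) \<longleftrightarrow> linked (sector cs V \<pi> v) (arc (arc cs V v) W w)"
    if v: "v \<in> V" and l: "linked (sector cs V \<pi> v) (arc cs V v)" and W: "W \<in> sector cs V \<pi> v" and w: "w \<in> W" for v W w
  proof -
    have vc: "v \<in> set cs" using v V by blast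
    note sec = sector_in_NC_on[OF assms(1-3) v]
    obtain z where z: "cyc cs (v # arc cs V v @ z)" "z = [] \<or> hd z \<in> V"
      "distinct (v # arc cs V v @ z)" "set (arc cs V v) \<inter> V = {}"
      "set cs = insert v (set (arc cs V v) \<union> set z)"
      by (rule arcE[OF assms(1) v vc])
    define a where "a = arc cs V v"
    have Wa: "W \<subseteq> set a" using W by (simp add: sector_def a_def)
    then obtain b c where bc: "a = b @ w # c" using w split_list by (metis subsetD)
    have da: "distinct a" using z(3) a_def by simp
    have "cyc (v # a @ z) (w # (c @ z @ v # b))"
      using cyc_append[of "v # b" "w # c @ z"] bc by simp
    then have "cyc cs (w # (c @ z @ v # b))" using z(1) a_def cyc_trans by blast
    then have A: "arc cs W w = takeWhile (\<lambda>x. x \<notin> W) (c @ z @ v # b)" using arc_cyc assms(1) by metis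
    have "cyc a (w # (c @ b))" using cyc_append[of b "w # c"] bc by simp
    then have B: "arc a W w = takeWhile (\<lambda>x. x \<notin> W) (c @ b)" using arc_cyc da by metis
    show ?thesis
    proof (cases "\<exists>x\<in>set c. x \<in> W")
      case True
      then obtain x where x: "x \<in> set c" "x \<in> W" by blast
      have e: "arc cs W w = takeWhile (\<lambda>x. x \<notin> W) c" "arc a W w = takeWhile (\<lambda>x. x \<notin> W) c"
        unfolding A B using x takeWhile_append1[of x c "\<lambda>x. x \<notin> W"] by auto
      have "set (takeWhile (\<lambda>x. x \<notin> W) c) \<subseteq> set a" using bc by (auto dest: set_takeWhileD)
      then show ?thesis using linked_sector[OF assms v] e a_def by metis
    next
      case False
      define b0 where "b0 = takeWhile (\<lambda>x. x \<notin> W) b"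
      have nW: "W \<inter> set z = {}" "v \<notin> W" using Wa z(3) a_def by auto
      have A': "arc cs W w = c @ z @ v # b0"
        unfolding A b0_def using False nW
        by (subst takeWhile_append2, blast, subst takeWhile_append2) auto
      have B': "arc a W w = c @ b0"
        unfolding B b0_def using False by (subst takeWhile_append2) auto
      have ane: "a \<noteq> []" using bc by simp
      obtain X where X: "X \<in> sector cs V \<pi> v" "hd a \<in> X" "last a \<in> X"
        using l ane unfolding linked_def a_def by blast
      show ?thesis
      proof (cases "c = []")
        case True
        \<comment> \<open>The point \<open>w\<close> is the end of the segment, so \<open>W\<close>
          is the block linking both ends: the inner arc is empty, and the outer one is bounded by
          points of \<open>V\<close>.\<close>
        then have "w \<in> X" using X bc by simp
        then have "X = W" using NC_onD(4)[OF sec X(1) W] w by blast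
        then have "b0 = []" using X bc unfolding b0_def by (cases b) auto
        then have "arc a W w = []" "arc cs W w = z @ [v]" using A' B' True by auto
        moreover have "hd (z @ [v]) \<in> V" using z(2) v by (cases z) auto
        ultimately show ?thesis using v assms(3) unfolding linked_def a_def[symmetric] by auto
      next
        case cne: False
        \<comment> \<open>Here \<open>W\<close> is not the linking block, and \<open>X\<close>
          supplies a point in front of \<open>W\<close>; hence \<open>b0\<close> is nonempty and the
          ends agree.\<close>
        then have "last a \<in> set c" using bc by simp
        then have XW: "X \<noteq> W" using False X by blast
        then have "w \<notin> X" using NC_onD(4)[OF sec X(1) W] w by blast
        then have bne: "b \<noteq> []" using X bc by (cases b) auto
        have hb: "hd b \<in> X" "hd b \<notin> W"
          using X bc bne NC_onD(4)[OF sec X(1) W XW] by auto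
        then have b0: "b0 \<noteq> []" using bne by (cases b) (auto simp: b0_def)
        have "linked \<pi> (arc cs W w) \<longleftrightarrow> linked \<pi> (arc a W w)"
          unfolding A' B' linked_def using cne b0 by simp
        also have "\<dots> \<longleftrightarrow> linked (sector cs V \<pi> v) (arc a W w)"
        proof (rule linked_sector[OF assms v])
          show "set (arc a W w) \<subseteq> set (arc cs V v)"
          proof -
            have "set (c @ b0) \<subseteq> set a" unfolding bc b0_def by (auto dest: set_takeWhileD)
            then show ?thesis using B' a_def by simp
          qed
        qed
        finally show ?thesis by (simp add: a_def)
      qed
    qed
  qed
  have self: "linked \<pi> (arc cs V v) \<longleftrightarrow> linked (sector cs V \<pi> v) (arc cs V v)" if "v \<in> V" for v
    by (rule linked_sector[OF assms that]) simp
  have pe: "\<pi> = insert V (\<Union>v\<in>V. sector cs V \<pi> v)"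
    using other_blocks_eq_sectors[OF assms] assms(3) by blast
  have "complete cs \<pi> \<longleftrightarrow> (\<forall>v\<in>V. linked \<pi> (arc cs V v)) \<and>
      (\<forall>v\<in>V. \<forall>W\<in>sector cs V \<pi> v. \<forall>w\<in>W. linked \<pi> (arc cs W w))"
  proof -
    have "(\<forall>W\<in>\<pi>. \<Phi> W) \<longleftrightarrow> \<Phi> V \<and> (\<forall>v\<in>V. \<forall>W\<in>sector cs V \<pi> v. \<Phi> W)" for \<Phi>
      using pe by (smt (verit) UN_iff insert_iff)
    then show ?thesis unfolding complete_def by simp
  qed
  also have "\<dots> \<longleftrightarrow> (\<forall>v\<in>V. linked (sector cs V \<pi> v) (arc cs V v) \<and>
    complete (arc cs V v) (sector cs V \<pi> v))"
    unfolding complete_def using self inner by meson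
  finally show ?thesis .
qed

definition monochrome :: "('p \<Rightarrow> nat) \<Rightarrow> 'p set \<Rightarrow> bool" where
  "monochrome col V \<longleftrightarrow> (\<forall>p\<in>V. \<forall>q\<in>V. col p = col q)"

text \<open>What a complete monochrome partition induces on an arc of one of its blocks. Linkedness
  of the whole segment records completeness at the outer block.\<close>

definition complete_segments :: "('p \<Rightarrow> nat) \<Rightarrow> 'p list \<Rightarrow> 'p set set set" where
  "complete_segments col a = {\<rho> \<in> NC_on a. linked \<rho> a \<and> complete a \<rho> \<and> (\<forall>V\<in>\<rho>. monochrome col V)}"

definition segment_sum :: "('a::ring_1 \<Rightarrow> complex) \<Rightarrow> ('p \<Rightarrow> nat) \<Rightarrow> ('p \<Rightarrow> 'a) \<Rightarrow> 'p list \<Rightarrow> complex" where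
  "segment_sum \<psi> col x a = (\<Sum>\<rho>\<in>complete_segments col a. \<Prod>W\<in>\<rho>. kap \<psi> x (listing a W))"

lemma complete_segments_sectors:
  assumes "distinct cs" "\<pi> \<in> NC_on cs" "V \<in> \<pi>"
  shows "complete cs \<pi> \<and> (\<forall>W\<in>\<pi>. monochrome col W) \<longleftrightarrow>
    monochrome col V \<and> (\<forall>v\<in>V. sector cs V \<pi> v \<in> complete_segments col (arc cs V v))"
proof -
  have pe: "\<pi> = insert V (\<Union>v\<in>V. sector cs V \<pi> v)"
    using other_blocks_eq_sectors[OF assms] assms(3) by blast
  have "(\<forall>W\<in>\<pi>. monochrome col W) \<longleftrightarrow> monochrome col V \<and> (\<forall>v\<in>V. \<forall>W\<in>sector cs V \<pi> v. monochrome col W)"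
    using pe by (smt (verit) UN_iff insert_iff)
  then show ?thesis
    unfolding complete_sectors[OF assms] complete_segments_def
    using sector_in_NC_on[OF assms] by blast
qed

text \<open>The weights are extended by zero to all non-crossing partitions of the arcs, so that the
  factorisation over sectors applies.\<close>

lemma sum_complete_block:
  fixes H :: "'p \<Rightarrow> 'p set set \<Rightarrow> complex"
  assumes "distinct cs" "V \<subseteq> set cs" "V \<noteq> {}" "monochrome col V"
  shows "(\<Sum>\<pi> | \<pi> \<in> NC_on cs \<and> V \<in> \<pi> \<and> complete cs \<pi> \<and> (\<forall>W\<in>\<pi>. monochrome col W).
      \<Prod>v\<in>V. H v (sector cs V \<pi> v)) =
    (\<Prod>v\<in>V. \<Sum>\<nu>\<in>complete_segments col (arc cs V v). H v \<nu>)"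
proof -
  have Vfin: "finite V" using assms finite_subset by blast
  define H' where "H' v \<nu> = (if \<nu> \<in> complete_segments col (arc cs V v) then H v \<nu> else 0)" for v \<nu>
  have cs_sub: "complete_segments col a \<subseteq> NC_on a" for a by (auto simp: complete_segments_def)
  have "(\<Prod>v\<in>V. \<Sum>\<nu>\<in>complete_segments col (arc cs V v). H v \<nu>) =
      (\<Prod>v\<in>V. \<Sum>\<nu>\<in>NC_on (arc cs V v). H' v \<nu>)"
    unfolding H'_def by (intro prod.cong refl sum.mono_neutral_cong_left finite_NC_on cs_sub) auto
  also have "\<dots> = (\<Sum>\<pi> | \<pi> \<in> NC_on cs \<and> V \<in> \<pi>. \<Prod>v\<in>V. H' v (sector cs V \<pi> v))"
    by (rule sum_NC_on_block[OF assms(1-3), symmetric])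
  also have "\<dots> = (\<Sum>\<pi> | \<pi> \<in> NC_on cs \<and> V \<in> \<pi> \<and> complete cs \<pi> \<and> (\<forall>W\<in>\<pi>. monochrome col W).
      \<Prod>v\<in>V. H v (sector cs V \<pi> v))"
  proof (rule sum.mono_neutral_cong_right)
    show "finite {\<pi>. \<pi> \<in> NC_on cs \<and> V \<in> \<pi>}" by (rule finite_subset[OF _ finite_NC_on]) auto
    show "\<forall>\<pi>\<in>{\<pi>. \<pi> \<in> NC_on cs \<and> V \<in> \<pi>} -
        {\<pi>. \<pi> \<in> NC_on cs \<and> V \<in> \<pi> \<and> complete cs \<pi> \<and> (\<forall>W\<in>\<pi>. monochrome col W)}.
        (\<Prod>v\<in>V. H' v (sector cs V \<pi> v)) = 0"
    proof
      fix \<pi> assume p: "\<pi> \<in> {\<pi>. \<pi> \<in> NC_on cs \<and> V \<in> \<pi>} -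
        {\<pi>. \<pi> \<in> NC_on cs \<and> V \<in> \<pi> \<and> complete cs \<pi> \<and> (\<forall>W\<in>\<pi>. monochrome col W)}"
      then obtain v where "v \<in> V" "sector cs V \<pi> v \<notin> complete_segments col (arc cs V v)"
        using complete_segments_sectors[OF assms(1), of \<pi> V col] assms(4) by blast
      then show "(\<Prod>v\<in>V. H' v (sector cs V \<pi> v)) = 0"
        using Vfin by (intro prod_zero) (auto simp: H'_def)
    qed
    show "(\<Prod>v\<in>V. H' v (sector cs V \<pi> v)) = (\<Prod>v\<in>V. H v (sector cs V \<pi> v))"
      if p: "\<pi> \<in> {\<pi>. \<pi> \<in> NC_on cs \<and> V \<in> \<pi> \<and> complete cs \<pi> \<and> (\<forall>W\<in>\<pi>. monochrome col W)}" for \<pi>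
      using complete_segments_sectors[OF assms(1), of \<pi> V col] p
      by (intro prod.cong refl) (auto simp: H'_def)
  qed auto
  finally show ?thesis ..
qed

text \<open>Only the arc behind the last point of \<open>V\<close> can run over the end of the list;
  as \<open>V\<close> contains an end, one of its two pieces is empty.\<close>

lemma listing_arc_linear:
  assumes "distinct cs" "hd cs \<in> V \<or> last cs \<in> V" "v \<in> V" "v \<in> set cs"
  shows "listing cs (set (arc cs V v)) = arc cs V v"
proof -
  obtain p s where ps: "cs = p @ v # s" using assms(4) split_list by metis
  have a: "arc cs V v = takeWhile (\<lambda>x. x \<notin> V) (s @ p)"
    using arc_cyc[OF assms(1)] cyc_append[of p "v # s"] ps by auto
  have "\<exists>y z. cs = y @ arc cs V v @ z"
  proof (cases "\<exists>x\<in>set s. x \<in> V")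
    case True
    then obtain x where x: "x \<in> set s" "x \<in> V" by blast
    have "arc cs V v = takeWhile (\<lambda>x. x \<notin> V) s"
      unfolding a using x takeWhile_append1[of x s "\<lambda>x. x \<notin> V" p] by simp
    then have "cs = (p @ [v]) @ arc cs V v @ dropWhile (\<lambda>x. x \<notin> V) s" using ps by simp
    then show ?thesis by blast
  next
    case False
    then have a2: "arc cs V v = s @ takeWhile (\<lambda>x. x \<notin> V) p"
      unfolding a by (subst takeWhile_append2) auto
    show ?thesis
    proof (cases "s = []")
      case True
      then have "cs = [] @ arc cs V v @ (dropWhile (\<lambda>x. x \<notin> V) p @ [v])" using ps a2 by simp
      then show ?thesis by blast
    next
      case sne: False
      then have "last cs \<in> set s" using ps by simp
      then have "hd cs \<in> V" using assms(2) False by blast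
      then have "takeWhile (\<lambda>x. x \<notin> V) p = []" using ps by (cases p) auto
      then have "cs = (p @ [v]) @ arc cs V v @ []" using ps a2 by simp
      then show ?thesis by blast
    qed
  qed
  then obtain y z where yz: "cs = y @ arc cs V v @ z" by blast
  define b where "b = arc cs V v"
  have e: "cs = y @ b @ z" using yz b_def by simp
  have "listing cs (set b) = b"
  proof -
    have "listing y (set b) = []" "listing z (set b) = []" "listing b (set b) = b"
      using assms(1) unfolding e by (auto simp: filter_empty_conv filter_id_conv)
    then show ?thesis unfolding e filter_append by simp
  qed
  then show ?thesis by (simp add: b_def)
qed

lemma segment_sum_Nil [simp]: "segment_sum \<psi> col x [] = 1"
proof -
  have "complete_segments col [] = {{}}"
    by (auto simp: complete_segments_def NC_on_Nil linked_def complete_def)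
  then show ?thesis by (simp add: segment_sum_def)
qed

text \<open>Linkedness forces the block through the first point to pass through the last one. All
  arcs of this block are intervals of \<open>a\<close>, so the linear and the arc order
  agree.\<close>

lemma segment_sum_rec:
  assumes "distinct a" "a \<noteq> []"
  shows "segment_sum \<psi> col x a = (\<Sum>V | V \<subseteq> set a \<and> monochrome col V \<and> hd a \<in> V \<and> last a \<in> V.
    kap \<psi> x (listing a V) * (\<Prod>v\<in>V. segment_sum \<psi> col x (arc a V v)))"
proof -
  let ?k = "\<lambda>W. kap \<psi> x (listing a W)"
  define F where "F \<pi> = (if \<pi> \<in> complete_segments col a then \<Prod>W\<in>\<pi>. ?k W else 0)" for \<pi>
  have "segment_sum \<psi> col x a = (\<Sum>\<pi>\<in>NC_on a. F \<pi>)"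
    unfolding segment_sum_def F_def
    by (intro sum.mono_neutral_cong_left finite_NC_on) (auto simp: complete_segments_def)
  also have "\<dots> = (\<Sum>V | hd a \<in> V \<and> V \<subseteq> set a. \<Sum>\<pi> | \<pi> \<in> NC_on a \<and> V \<in> \<pi>. F \<pi>)"
    using assms by (intro sum_NC_on_by_block) simp
  also have "\<dots> = (\<Sum>V | V \<subseteq> set a \<and> monochrome col V \<and> hd a \<in> V \<and> last a \<in> V. \<Sum>\<pi> | \<pi> \<in> NC_on a \<and> V \<in> \<pi>. F \<pi>)"
  proof (rule sum.mono_neutral_right)
    show "finite {V. hd a \<in> V \<and> V \<subseteq> set a}" by (rule finite_subset[of _ "Pow (set a)"]) auto
    show "\<forall>V\<in>{V. hd a \<in> V \<and> V \<subseteq> set a} - {V. V \<subseteq> set a \<and> monochrome col V \<and> hd a \<in> V \<and> last a \<in> V}.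
        (\<Sum>\<pi> | \<pi> \<in> NC_on a \<and> V \<in> \<pi>. F \<pi>) = 0"
    proof (intro ballI sum.neutral)
      fix V \<pi> assume V: "V \<in> {V. hd a \<in> V \<and> V \<subseteq> set a} -
          {V. V \<subseteq> set a \<and> monochrome col V \<and> hd a \<in> V \<and> last a \<in> V}"
        and p: "\<pi> \<in> {\<pi>. \<pi> \<in> NC_on a \<and> V \<in> \<pi>}"
      have "\<pi> \<notin> complete_segments col a"
      proof
        assume "\<pi> \<in> complete_segments col a"
        then obtain X where "X \<in> \<pi>" "hd a \<in> X" "last a \<in> X" "monochrome col V"
          using p assms(2) unfolding complete_segments_def linked_def by blast
        moreover from this have "X = V" using p V NC_onD(4)[of \<pi> a X V] by blast
        ultimately show False using V by blast
      qed
      then show "F \<pi> = 0" by (simp add: F_def)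
    qed
  qed auto
  also have "\<dots> = (\<Sum>V | V \<subseteq> set a \<and> monochrome col V \<and> hd a \<in> V \<and> last a \<in> V.
    ?k V * (\<Prod>v\<in>V. segment_sum \<psi> col x (arc a V v)))"
  proof (rule sum.cong[OF refl])
    fix V assume "V \<in> {V. V \<subseteq> set a \<and> monochrome col V \<and> hd a \<in> V \<and> last a \<in> V}"
    then have V: "V \<subseteq> set a" "monochrome col V" "hd a \<in> V" "last a \<in> V" "V \<noteq> {}" by auto
    have "(\<Sum>\<pi> | \<pi> \<in> NC_on a \<and> V \<in> \<pi>. F \<pi>) =
        (\<Sum>\<pi> | \<pi> \<in> NC_on a \<and> V \<in> \<pi> \<and> complete a \<pi> \<and> (\<forall>W\<in>\<pi>. monochrome col W).
          ?k V * (\<Prod>v\<in>V. \<Prod>W\<in>sector a V \<pi> v. kap \<psi> x (listing (arc a V v) W)))"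
    proof (rule sum.mono_neutral_cong_right)
      show "finite {\<pi>. \<pi> \<in> NC_on a \<and> V \<in> \<pi>}" by (rule finite_subset[OF _ finite_NC_on]) auto
      show "\<forall>\<pi>\<in>{\<pi>. \<pi> \<in> NC_on a \<and> V \<in> \<pi>} -
          {\<pi>. \<pi> \<in> NC_on a \<and> V \<in> \<pi> \<and> complete a \<pi> \<and> (\<forall>W\<in>\<pi>. monochrome col W)}. F \<pi> = 0"
        by (auto simp: F_def complete_segments_def)
      fix \<pi> assume p: "\<pi> \<in> {\<pi>. \<pi> \<in> NC_on a \<and> V \<in> \<pi> \<and> complete a \<pi> \<and> (\<forall>W\<in>\<pi>. monochrome col W)}"
      then have p': "\<pi> \<in> NC_on a" "V \<in> \<pi>" by auto
      have "\<pi> \<in> complete_segments col a" using p V by (auto simp: complete_segments_def linked_def)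
      then have "F \<pi> = (\<Prod>W\<in>\<pi>. ?k W)" by (simp add: F_def)
      also have "\<dots> = ?k V * (\<Prod>W\<in>\<pi> - {V}. ?k W)"
        by (rule prod.remove[OF NC_onD(5)[OF p'(1)] p'(2)])
      also have "(\<Prod>W\<in>\<pi> - {V}. ?k W) = (\<Prod>v\<in>V. \<Prod>W\<in>sector a V \<pi> v. ?k W)"
        by (rule prod_NC_on_block[OF assms(1) p'])
      also have "\<dots> = (\<Prod>v\<in>V. \<Prod>W\<in>sector a V \<pi> v. kap \<psi> x (listing (arc a V v) W))"
      proof (intro prod.cong refl arg_cong[of _ _ "kap \<psi> x"])
        fix v W assume v: "v \<in> V" and W: "W \<in> sector a V \<pi> v"
        have "listing a (set (arc a V v)) = arc a V v"
          using V v by (intro listing_arc_linear[OF assms(1)]) auto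
        then show "listing a W = listing (arc a V v) W"
          using W listing_listing[of W "set (arc a V v)" a] by (simp add: sector_def)
      qed
      finally show "F \<pi> = ?k V * (\<Prod>v\<in>V. \<Prod>W\<in>sector a V \<pi> v. kap \<psi> x (listing (arc a V v) W))" .
    qed auto
    also have "\<dots> = ?k V * (\<Prod>v\<in>V. segment_sum \<psi> col x (arc a V v))"
      unfolding sum_distrib_left[symmetric] segment_sum_def
      by (subst sum_complete_block[OF assms(1) V(1,5,2)]) simp
    finally show "(\<Sum>\<pi> | \<pi> \<in> NC_on a \<and> V \<in> \<pi>. F \<pi>) = ?k V * (\<Prod>v\<in>V. segment_sum \<psi> col x (arc a V v))" .
  qed
  finally show ?thesis .
qed

text \<open>Multiplying out: a choice of one subset in each arc is the same as one set
  \<open>X\<close> above \<open>V\<close>, recovered by intersecting with the arcs.\<close>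

lemma prod_sum_sectors:
  fixes h :: "'p \<Rightarrow> 'p set \<Rightarrow> complex"
  assumes "distinct cs" "V \<subseteq> set cs" "\<And>v. v \<in> V \<Longrightarrow> \<U> v \<subseteq> Pow (set (arc cs V v))" and Vne: "V \<noteq> {}"
  shows "(\<Prod>v\<in>V. \<Sum>U\<in>\<U> v. h v U) =
    (\<Sum>X | V \<subseteq> X \<and> X \<subseteq> set cs \<and> (\<forall>v\<in>V. X \<inter> set (arc cs V v) \<in> \<U> v). \<Prod>v\<in>V. h v (X \<inter> set (arc cs V v)))"
proof -
  have Vfin: "finite V" using assms finite_subset by blast
  have vc: "v \<in> set cs" if "v \<in> V" for v using that assms(2) by blast
  let ?S = "\<lambda>v. set (arc cs V v)"
  have "(\<Prod>v\<in>V. \<Sum>U\<in>\<U> v. h v U) = (\<Sum>f\<in>PiE V \<U>. \<Prod>v\<in>V. h v (f v))"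
    using Vfin assms(3) by (intro prod_sum_PiE) (auto intro: finite_subset)
  also have "\<dots> = (\<Sum>X | V \<subseteq> X \<and> X \<subseteq> set cs \<and> (\<forall>v\<in>V. X \<inter> ?S v \<in> \<U> v).
      \<Prod>v\<in>V. h v (restrict (\<lambda>v. X \<inter> ?S v) V v))"
  proof (rule sum.reindex_bij_betw[symmetric])
    have inter: "(V \<union> (\<Union>u\<in>V. f u)) \<inter> ?S v = f v" if f: "f \<in> PiE V \<U>" and v: "v \<in> V" for f v
    proof -
      have fs: "f u \<subseteq> ?S u" if "u \<in> V" for u using PiE_mem[OF f that] assms(3)[OF that] by blast
      have "f u \<inter> ?S v = {}" if "u \<in> V" "u \<noteq> v" for u
        using fs[OF that(1)] arc_disjoint[OF assms(1,2) that(1) v that(2)] by blast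
      moreover have "V \<inter> ?S v = {}" using arc_subset[OF assms(1) v vc[OF v]] by blast
      ultimately show ?thesis using fs[OF v] v by blast
    qed
    show "bij_betw (\<lambda>X. restrict (\<lambda>v. X \<inter> ?S v) V)
        {X. V \<subseteq> X \<and> X \<subseteq> set cs \<and> (\<forall>v\<in>V. X \<inter> ?S v \<in> \<U> v)} (PiE V \<U>)"
    proof (rule bij_betw_byWitness[where f' = "\<lambda>f. V \<union> (\<Union>u\<in>V. f u)"])
      show "\<forall>X\<in>{X. V \<subseteq> X \<and> X \<subseteq> set cs \<and> (\<forall>v\<in>V. X \<inter> ?S v \<in> \<U> v)}.
          V \<union> (\<Union>u\<in>V. restrict (\<lambda>v. X \<inter> ?S v) V u) = X"
      proof
        fix X assume "X \<in> {X. V \<subseteq> X \<and> X \<subseteq> set cs \<and> (\<forall>v\<in>V. X \<inter> ?S v \<in> \<U> v)}"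
        then have "X = (\<Union>v\<in>V. insert v (X \<inter> ?S v))" "V \<subseteq> X"
          using sectors_partition[OF assms(1) _ _ Vne, of X] by auto
        then show "V \<union> (\<Union>u\<in>V. restrict (\<lambda>v. X \<inter> ?S v) V u) = X" by auto
      qed
      show "\<forall>f\<in>PiE V \<U>. restrict (\<lambda>v. (V \<union> (\<Union>u\<in>V. f u)) \<inter> ?S v) V = f"
      proof
        fix f assume f: "f \<in> PiE V \<U>"
        show "restrict (\<lambda>v. (V \<union> (\<Union>u\<in>V. f u)) \<inter> ?S v) V = f"
        proof
          fix v show "restrict (\<lambda>v. (V \<union> (\<Union>u\<in>V. f u)) \<inter> ?S v) V v = f v"
            using inter[OF f, of v] PiE_arb[OF f, of v] by (cases "v \<in> V") simp_all
        qed
      qed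
      show "(\<lambda>X. restrict (\<lambda>v. X \<inter> ?S v) V) ` {X. V \<subseteq> X \<and> X \<subseteq> set cs \<and> (\<forall>v\<in>V. X \<inter> ?S v \<in> \<U> v)} \<subseteq> PiE V \<U>"
        by auto
      show "(\<lambda>f. V \<union> (\<Union>u\<in>V. f u)) ` PiE V \<U> \<subseteq> {X. V \<subseteq> X \<and> X \<subseteq> set cs \<and> (\<forall>v\<in>V. X \<inter> ?S v \<in> \<U> v)}"
      proof (rule image_subsetI)
        fix f assume f: "f \<in> PiE V \<U>"
        have "f u \<subseteq> set cs" if "u \<in> V" for u
          using PiE_mem[OF f that] assms(3)[OF that] arc_subset[OF assms(1) that vc[OF that]] by blast
        then show "V \<union> (\<Union>u\<in>V. f u) \<in> {X. V \<subseteq> X \<and> X \<subseteq> set cs \<and> (\<forall>v\<in>V. X \<inter> ?S v \<in> \<U> v)}"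
          using inter[OF f] PiE_mem[OF f] assms(2) by auto
      qed
    qed
  qed
  finally show ?thesis by simp
qed

section \<open>Alternating words\<close>

fun pcol :: "'i point \<Rightarrow> nat" where
  "pcol (Plain i) = 1"
| "pcol (Bar i) = 2"

fun partner :: "'i point \<Rightarrow> 'i point" where
  "partner (Plain i) = Bar i"
| "partner (Bar i) = Plain i"

text \<open>Admissible neighbours on a barred circle: a plain point is followed by its own bar, a
  bar by any plain point. The latter freedom lets the notion survive the removal of whole
  pairs.\<close>

fun step :: "'i point \<Rightarrow> 'i point \<Rightarrow> bool" where
  "step (Plain i) q \<longleftrightarrow> q = Bar i"
| "step (Bar i) q \<longleftrightarrow> pcol q = 1"

lemma partner_partner [simp]: "partner (partner p) = p"
  by (cases p) auto

lemma pcol_partner [simp]: "pcol (partner p) \<noteq> pcol p"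
  by (cases p) auto

lemma partner_neq [simp]: "partner p \<noteq> p"
  by (cases p) auto

lemma pcol_cases: "pcol p = 1 \<or> pcol p = 2"
  by (cases p) auto

lemma step_pcol: "step p q \<Longrightarrow> pcol p \<noteq> pcol q"
  by (cases p) auto

text \<open>The shape of an arc of a monochrome set: both ends have the colour opposite to that set,
  so the length is odd and exactly one point lacks its partner.\<close>

definition alternating :: "'i point list \<Rightarrow> bool" where
  "alternating a \<longleftrightarrow> distinct a \<and> a \<noteq> [] \<and> successively step a \<and> pcol (hd a) = pcol (last a)"

text \<open>Unions of pairs, together with every point whose partner is missing. The complement
  therefore consists of whole products.\<close>

definition paired_sets :: "'i point list \<Rightarrow> 'i point set set" where
  "paired_sets a = {X. X \<subseteq> set a \<and> (\<forall>p\<in>set a. p \<in> X \<longleftrightarrow> (partner p \<in> X \<or> partner p \<notin> set a))}"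

lemma successively_adjacent: "successively P (b @ p # q # c) \<Longrightarrow> P p q"
  by (simp add: successively_append_iff)

lemma distinct_split_unique:
  assumes "distinct (b @ x # c)" "b @ x # c = b' @ x # c'"
  shows "b = b' \<and> c = c'"
  using assms
proof (induction b arbitrary: b')
  case Nil
  then show ?case by (cases b') auto
next
  case step: (Cons y b)
  show ?case
  proof (cases b')
    case Nil
    then show ?thesis using step.prems by auto
  next
    case (Cons z zs)
    have "distinct (b @ x # c)" using step.prems(1) by simp
    moreover have "b @ x # c = zs @ x # c'" "y = z" using step.prems(2) Cons by simp_all
    ultimately show ?thesis using step.IH[of zs] Cons by simp
  qed
qed

text \<open>The unpaired point is the head if the word begins with a bar and the last point if it
  begins with a plain point; all other points form adjacent pairs in the order plain, bar.\<close>

lemma alternating_end: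
  assumes "alternating a"
  obtains e where "e \<in> set a" "pcol e = 2 \<and> e = hd a \<or> pcol e = 1 \<and> e = last a" "partner e \<notin> set a"
    "\<And>p. p \<in> set a \<Longrightarrow> p \<noteq> e \<Longrightarrow> \<exists>b c i. a = b @ Plain i # Bar i # c \<and> (p = Plain i \<or> p = Bar i)"
proof -
  have d: "distinct a" and ne: "a \<noteq> []" and s: "successively step a" and h: "pcol (hd a) = pcol (last a)"
    using assms by (auto simp: alternating_def)
  have nxt: "\<exists>b c. a = b @ Plain i # Bar i # c" if i: "Plain i \<in> set a" "Plain i \<noteq> last a" for i
  proof -
    obtain b r where br: "a = b @ Plain i # r" using i(1) split_list by metis
    then have "r \<noteq> []" using i(2) by auto
    then obtain q c where "r = q # c" by (cases r) auto
    then show ?thesis using successively_adjacent[of step b "Plain i" q c] s br by auto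
  qed
  have prv: "\<exists>b c. a = b @ Plain i # Bar i # c" if i: "Bar i \<in> set a" "Bar i \<noteq> hd a" for i
  proof -
    obtain b r where br: "a = b @ Bar i # r" using i(1) split_list by metis
    then have "b \<noteq> []" using i(2) by auto
    then obtain b' q where "b = b' @ [q]" by (cases b rule: rev_cases) auto
    then have "step q (Bar i)" "a = b' @ q # Bar i # r"
      using successively_adjacent[of step b' q "Bar i" r] s br by auto
    then show ?thesis by (cases q) auto
  qed
  show thesis
  proof (cases "hd a")
    case (Bar j)
    then obtain k where k: "last a = Bar k" using h by (cases "last a") auto
    have "Plain j \<notin> set a"
    proof
      assume "Plain j \<in> set a"
      then obtain b c where bc: "a = b @ Plain j # Bar j # c" using nxt[of j] k by auto
      moreover have "hd a = Bar j" by (rule Bar)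
      ultimately show False using d by (cases b) auto
    qed
    moreover have "\<exists>b c i. a = b @ Plain i # Bar i # c \<and> (p = Plain i \<or> p = Bar i)"
      if p: "p \<in> set a" "p \<noteq> Bar j" for p
    proof (cases p)
      case (Plain i)
      then show ?thesis using nxt[of i] p k by auto
    next
      case (Bar i)
      then show ?thesis using prv[of i] p \<open>hd a = Bar j\<close> by auto
    qed
    moreover have "Bar j \<in> set a" using Bar hd_in_set[OF ne] by simp
    ultimately show thesis using that[of "Bar j"] Bar by simp
  next
    case (Plain j')
    then obtain j where j: "last a = Plain j" using h by (cases "last a") auto
    have "Bar j \<notin> set a"
    proof
      assume "Bar j \<in> set a"
      then obtain b c where bc: "a = b @ Plain j # Bar j # c" using prv[of j] Plain by auto
      moreover have e: "butlast a @ [Plain j] = a" using j append_butlast_last_id[OF ne] by simp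
      ultimately have "b @ Plain j # (Bar j # c) = butlast a @ Plain j # []"
        using trans[OF bc[symmetric] e[symmetric]] by simp
      then have "Bar j # c = []" using distinct_split_unique[of b "Plain j" "Bar j # c"] d bc by metis
      then show False by simp
    qed
    moreover have "\<exists>b c i. a = b @ Plain i # Bar i # c \<and> (p = Plain i \<or> p = Bar i)"
      if p: "p \<in> set a" "p \<noteq> Plain j" for p
    proof (cases p)
      case (Plain i)
      then show ?thesis using nxt[of i] p j by auto
    next
      case (Bar i)
      then show ?thesis using prv[of i] p \<open>hd a = Plain j'\<close> by auto
    qed
    moreover have "Plain j \<in> set a" using j last_in_set[OF ne] by simp
    ultimately show thesis using that[of "Plain j"] j by simp
  qed
qed

lemma monochrome_partner:
  assumes "monochrome pcol V" "p \<in> V"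
  shows "partner p \<notin> V"
  using assms pcol_partner unfolding monochrome_def by blast

lemma alternating_between:
  assumes "monochrome pcol V" "v \<in> V" "w \<in> V" "distinct a" "successively step (v # a @ [w])"
  shows "alternating a"
proof -
  have vw: "pcol v = pcol w" using assms unfolding monochrome_def by blast
  have ne: "a \<noteq> []"
  proof
    assume "a = []"
    then show False using assms(5) vw step_pcol[of v w] by simp
  qed
  have "step v (hd a)" "step (last a) w" "successively step a"
    using assms(5) ne by (auto simp: successively_Cons successively_append_iff)
  then have "pcol (hd a) = pcol (last a)"
    using step_pcol[of v "hd a"] step_pcol[of "last a" w] vw pcol_cases[of v] pcol_cases[of "hd a"]
      pcol_cases[of "last a"] by auto
  then show ?thesis using ne assms(4) \<open>successively step a\<close> by (simp add: alternating_def)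
qed

text \<open>\<open>T\<close> collects the sectors that are to remain empty.\<close>

lemma paired_sets_sectors:
  assumes "distinct cs" "V \<subseteq> X" "X \<subseteq> set cs" "monochrome pcol V" "T \<subseteq> V"
    and pair: "\<And>p. p \<in> set cs \<Longrightarrow> partner p \<in> set cs \<Longrightarrow>
      (\<exists>r. cyc cs (p # partner p # r)) \<or> (\<exists>r. cyc cs (partner p # p # r))"
    and out: "\<And>p. p \<in> set cs \<Longrightarrow> partner p \<notin> set cs \<Longrightarrow> p \<in> V"
    and T: "\<And>v p. v \<in> T \<Longrightarrow> p \<in> set (arc cs V v) \<Longrightarrow> partner p \<notin> V"
    and Vne: "V \<noteq> {}"
  shows "X \<in> paired_sets cs \<and> (\<forall>v\<in>T. X \<inter> set (arc cs V v) = {}) \<longleftrightarrow>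
    (\<forall>v\<in>V. X \<inter> set (arc cs V v) \<in> (if v \<in> T then {{}} else paired_sets (arc cs V v)))"
proof -
  have VS: "V \<subseteq> set cs" using assms by blast
  have vc: "v \<in> set cs" if "v \<in> V" for v using that VS by blast
  have sub: "set (arc cs V v) \<subseteq> set cs - V" if "v \<in> V" for v by (rule arc_subset[OF assms(1) that vc[OF that]])
  \<comment> \<open>Partners are neighbours on the circle, and an arc can be left only through a
    point of \<open>V\<close>.\<close>
  have adj: "partner p \<in> set (arc cs V v) \<or> partner p \<in> V" if v: "v \<in> V" and p: "p \<in> set (arc cs V v)" for v p
  proof -
    have pc: "p \<in> set cs" "p \<notin> V" using sub[OF v] p by auto
    then have "partner p \<in> set cs" using out by blast
    then show ?thesis
      using pair[OF pc(1)] arc_adjacent_next[OF assms(1) v VS _ p] arc_adjacent_prev[OF assms(1) v VS _ p] by blast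
  qed
  show ?thesis
  proof
    assume L: "X \<in> paired_sets cs \<and> (\<forall>v\<in>T. X \<inter> set (arc cs V v) = {})"
    show "\<forall>v\<in>V. X \<inter> set (arc cs V v) \<in> (if v \<in> T then {{}} else paired_sets (arc cs V v))"
    proof
      fix v assume v: "v \<in> V"
      have "X \<inter> set (arc cs V v) \<in> paired_sets (arc cs V v)"
      proof -
        have "p \<in> X \<longleftrightarrow> partner p \<in> X \<inter> set (arc cs V v) \<or> partner p \<notin> set (arc cs V v)"
          if p: "p \<in> set (arc cs V v)" for p
        proof -
          have pc: "p \<in> set cs" "p \<notin> V" using sub[OF v] p by auto
          then have "partner p \<in> set cs" using out by blast
          moreover have "\<forall>p\<in>set cs. p \<in> X \<longleftrightarrow> (partner p \<in> X \<or> partner p \<notin> set cs)"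
            using L unfolding paired_sets_def by blast
          ultimately have "p \<in> X \<longleftrightarrow> partner p \<in> X" using pc by blast
          then show ?thesis using adj[OF v p] assms(2) by blast
        qed
        then show ?thesis by (auto simp: paired_sets_def)
      qed
      then show "X \<inter> set (arc cs V v) \<in> (if v \<in> T then {{}} else paired_sets (arc cs V v))" using L by simp
    qed
  next
    assume R: "\<forall>v\<in>V. X \<inter> set (arc cs V v) \<in> (if v \<in> T then {{}} else paired_sets (arc cs V v))"
    have T0: "\<forall>v\<in>T. X \<inter> set (arc cs V v) = {}"
    proof
      fix v assume "v \<in> T"
      then show "X \<inter> set (arc cs V v) = {}" using R assms(5) by (metis singletonD subsetD)
    qed
    have W: "p \<in> X \<longleftrightarrow> partner p \<in> X \<or> partner p \<notin> set (arc cs V v)"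
      if "v \<in> V" "v \<notin> T" "p \<in> set (arc cs V v)" for v p
    proof -
      have "X \<inter> set (arc cs V v) \<in> paired_sets (arc cs V v)" using R that by auto
      then show ?thesis using that(3) unfolding paired_sets_def by blast
    qed
    have "p \<in> X \<longleftrightarrow> partner p \<in> X" if p: "p \<in> set cs" "partner p \<in> set cs" for p
    proof -
      \<comment> \<open>The partner has the other colour, so it lies in some arc of
        \<open>V\<close>; there it is unpaired and hence belongs to the paired set of that
        arc.\<close>
      have one: "partner q \<in> X" if q: "q \<in> V" "partner q \<in> set cs" for q
      proof -
        have "partner q \<notin> V" by (rule monochrome_partner[OF assms(4) q(1)])
        then obtain u where u: "u \<in> V" "partner q \<in> set (arc cs V u)"
          using arc_cover[OF assms(1) VS Vne q(2)] by blast
        have "u \<notin> T" using T[of u "partner q"] u q by auto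
        moreover have "q \<notin> set (arc cs V u)" using sub[OF u(1)] q by blast
        ultimately show ?thesis using W[OF u(1) _ u(2)] by simp
      qed
      consider "p \<in> V" | "partner p \<in> V" | v where "v \<in> V" "p \<in> set (arc cs V v)" "partner p \<in> set (arc cs V v)"
        using arc_cover[OF assms(1) VS Vne p(1)] adj by metis
      then show ?thesis
      proof cases
        case 1
        then show ?thesis using one p assms(2) by blast
      next
        case 2
        then show ?thesis using one[of "partner p"] p assms(2) by auto
      next
        case 3
        then show ?thesis using W[of v p] T0 by (cases "v \<in> T") auto
      qed
    qed
    moreover have "partner p \<notin> X" "p \<in> X" if "p \<in> set cs" "partner p \<notin> set cs" for p
      using that out assms(2,3) by blast+
    ultimately have "X \<in> paired_sets cs" using assms(3) unfolding paired_sets_def by blast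
    then show "X \<in> paired_sets cs \<and> (\<forall>v\<in>T. X \<inter> set (arc cs V v) = {})" using T0 by blast
  qed
qed

lemma last_sector:
  assumes "distinct a" "V \<subseteq> set a" "V \<noteq> {}"
  obtains p s where "a = p @ last (listing a V) # s" "last (listing a V) \<in> V" "set s \<inter> V = {}"
    "arc a V (last (listing a V)) = s @ takeWhile (\<lambda>y. y \<notin> V) p"
proof -
  have "\<exists>v\<in>set a. v \<in> V" using assms by blast
  then obtain p v s where ps: "a = p @ v # s" "v \<in> V" "\<forall>y\<in>set s. y \<notin> V"
    using split_list_last_prop[of a "\<lambda>v. v \<in> V"] by metis
  have "listing s V = []" using ps by (simp add: filter_empty_conv)
  then have l: "last (listing a V) = v" using ps by simp
  have "arc a V v = takeWhile (\<lambda>y. y \<notin> V) (s @ p)"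
    using arc_cyc[OF assms(1)] cyc_append[of p "v # s"] ps(1) by auto
  also have "\<dots> = s @ takeWhile (\<lambda>y. y \<notin> V) p" using ps by (subst takeWhile_append2) auto
  finally show thesis using that[of p s] ps l by auto
qed

text \<open>The sector behind the last point of \<open>V\<close> consists of what lies beyond the
  two extreme points of \<open>V\<close>. It is free of \<open>X\<close> precisely when
  \<open>X\<close> extends no further than \<open>V\<close> on either side.\<close>

lemma last_sector_empty_iff:
  assumes "distinct a" "V \<subseteq> X" "X \<subseteq> set a" "V \<noteq> {}"
  shows "X \<inter> set (arc a V (last (listing a V))) = {} \<longleftrightarrow> hd (listing a X) \<in> V \<and> last (listing a X) \<in> V"
proof -
  obtain p s where ps: "a = p @ last (listing a V) # s" "last (listing a V) \<in> V" "set s \<inter> V = {}"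
    "arc a V (last (listing a V)) = s @ takeWhile (\<lambda>y. y \<notin> V) p"
    using last_sector[OF assms(1) order_trans[OF assms(2,3)] assms(4)] by blast
  define v where "v = last (listing a V)"
  define p0 where "p0 = takeWhile (\<lambda>y. y \<notin> V) p"
  define p1 where "p1 = dropWhile (\<lambda>y. y \<notin> V) p"
  have "p = p0 @ p1" by (simp add: p0_def p1_def)
  then have a: "a = p0 @ p1 @ v # s" using ps(1) unfolding v_def by (metis append.assoc)
  have vV: "v \<in> V" "v \<in> X" using ps(2) assms(2) v_def by auto
  have p0V: "set p0 \<inter> V = {}" by (auto simp: p0_def dest: set_takeWhileD)
  have l: "last (listing a X) \<in> V \<longleftrightarrow> X \<inter> set s = {}"
  proof (cases "listing s X = []")
    case True
    then have "last (listing a X) = v" using a vV by simp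
    then show ?thesis using True vV by (auto simp: filter_empty_conv)
  next
    case False
    then have "last (listing a X) = last (listing s X)" using a vV by simp
    moreover have "last (listing s X) \<in> set s" using False last_in_set[OF False] by auto
    moreover have "X \<inter> set s \<noteq> {}" using False by (auto simp: filter_empty_conv)
    ultimately show ?thesis using ps(3) by auto
  qed
  have h: "hd (listing a X) \<in> V \<longleftrightarrow> X \<inter> set p0 = {}"
  proof (cases "listing p0 X = []")
    case True
    have "hd (listing a X) \<in> V"
    proof (cases p1)
      case Nil
      then show ?thesis using a True vV by simp
    next
      case (Cons y ys)
      then have "y \<in> V" using hd_dropWhile[of "\<lambda>y. y \<notin> V" p] by (auto simp: p1_def)
      then show ?thesis using a True Cons assms(2) by auto
    qed
    then show ?thesis using True by (auto simp: filter_empty_conv)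
  next
    case False
    then have "hd (listing a X) = hd (listing p0 X)" using a by simp
    moreover have "hd (listing p0 X) \<in> set p0" using False hd_in_set[OF False] by auto
    moreover have "X \<inter> set p0 \<noteq> {}" using False by (auto simp: filter_empty_conv)
    ultimately show ?thesis using p0V by auto
  qed
  show ?thesis using l h ps(4) by (auto simp: v_def p0_def)
qed

text \<open>Inserting \<open>v\<close> before the segment cuts the arc that runs over its end into
  the pieces \<open>c\<close> and \<open>takeWhile (\<lambda>y. y \<notin> U) b\<close>. One of them
  is empty since \<open>U\<close> contains an end of the segment, and
  \<open>f [] = 1\<close>.\<close>

lemma prod_arcs_segment:
  fixes f :: "'p list \<Rightarrow> complex"
  assumes "distinct (v # a)" "U \<subseteq> set a" "hd a \<in> U \<or> last a \<in> U" "f [] = 1" "a \<noteq> []"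
  shows "(\<Prod>u\<in>insert v U. f (arc (v # a) (insert v U) u)) = (\<Prod>u\<in>U. f (arc a U u))"
proof -
  have fin: "finite U" using assms(2) finite_subset by blast
  have vU: "v \<notin> U" using assms by auto
  have da: "distinct a" using assms(1) by simp
  have "\<exists>w\<in>set a. w \<in> U" using assms(2,3,5) by auto
  then obtain b w c where bc: "a = b @ w # c" "w \<in> U" "\<forall>y\<in>set c. y \<notin> U"
    using split_list_last_prop[of a "\<lambda>v. v \<in> U"] by metis
  have nv: "v \<notin> set b" "v \<notin> set c" "v \<noteq> w" using assms(1) bc by auto
  have tw: "takeWhile (\<lambda>y. y \<notin> insert v U) l = takeWhile (\<lambda>y. y \<notin> U) l" if "v \<notin> set l" for l
    using that by (intro takeWhile_cong) auto
  have other: "arc (v # a) (insert v U) u = arc a U u" if u: "u \<in> U - {w}" for u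
  proof -
    have "u \<in> set b" using u assms(2) bc by auto
    then obtain b' s where bs: "b = b' @ u # s" using split_list by metis
    have "cyc (v # a) (u # (s @ w # c @ v # b'))" "cyc a (u # (s @ w # c @ b'))"
      using cyc_append[of "v # b'" "u # s @ w # c"] cyc_append[of b' "u # s @ w # c"] bs bc by auto
    then have "arc (v # a) (insert v U) u = takeWhile (\<lambda>y. y \<notin> insert v U) (s @ w # c @ v # b')"
      "arc a U u = takeWhile (\<lambda>y. y \<notin> U) (s @ w # c @ b')"
      using arc_cyc[OF assms(1)] arc_cyc[OF da] by blast+
    moreover have "takeWhile (\<lambda>y. y \<notin> insert v U) (s @ w # c @ v # b') = takeWhile (\<lambda>y. y \<notin> insert v U) s"
      using bc(2) by (induction s) auto
    moreover have "takeWhile (\<lambda>y. y \<notin> U) (s @ w # c @ b') = takeWhile (\<lambda>y. y \<notin> U) s"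
      using bc(2) by (induction s) auto
    ultimately show ?thesis using tw[of s] nv bs by simp
  qed
  have "cyc (v # a) (w # (c @ v # b))" "cyc a (w # (c @ b))"
    using cyc_append[of "v # b" "w # c"] cyc_append[of b "w # c"] bc by auto
  then have "arc (v # a) (insert v U) w = takeWhile (\<lambda>y. y \<notin> insert v U) (c @ v # b)"
    "arc a U w = takeWhile (\<lambda>y. y \<notin> U) (c @ b)"
    using arc_cyc[OF assms(1)] arc_cyc[OF da] by blast+
  moreover have "takeWhile (\<lambda>y. y \<notin> insert v U) (c @ v # b) = c"
    using bc nv by (subst takeWhile_append2) auto
  moreover have "takeWhile (\<lambda>y. y \<notin> U) (c @ b) = c @ takeWhile (\<lambda>y. y \<notin> U) b"
    using bc by (subst takeWhile_append2) auto
  ultimately have aw: "arc (v # a) (insert v U) w = c" "arc a U w = c @ takeWhile (\<lambda>y. y \<notin> U) b" by auto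
  have "arc (v # a) (insert v U) v = takeWhile (\<lambda>y. y \<notin> insert v U) a"
    by (rule arc_cyc[OF assms(1) cyc_refl])
  also have "\<dots> = takeWhile (\<lambda>y. y \<notin> U) a" using assms(1) by (intro tw) simp
  also have "\<dots> = takeWhile (\<lambda>y. y \<notin> U) b" unfolding bc(1) using bc(2) by (induction b) auto
  finally have av: "arc (v # a) (insert v U) v = takeWhile (\<lambda>y. y \<notin> U) b" .
  have ends: "c = [] \<or> takeWhile (\<lambda>y. y \<notin> U) b = []"
  proof (cases "c = []")
    case False
    then have "last a \<in> set c" using bc by simp
    then have "hd a \<in> U" using assms(3) bc by blast
    then show ?thesis using bc by (cases b) auto
  qed simp
  have "(\<Prod>u\<in>insert v U. f (arc (v # a) (insert v U) u)) =
      f (takeWhile (\<lambda>y. y \<notin> U) b) * (\<Prod>u\<in>U. f (arc (v # a) (insert v U) u))"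
    using fin vU av by simp
  also have "(\<Prod>u\<in>U. f (arc (v # a) (insert v U) u)) =
      f c * (\<Prod>u\<in>U - {w}. f (arc (v # a) (insert v U) u))"
    using fin bc(2) aw by (subst prod.remove[of U w]) auto
  also have "(\<Prod>u\<in>U - {w}. f (arc (v # a) (insert v U) u)) = (\<Prod>u\<in>U - {w}. f (arc a U u))"
    using other by (intro prod.cong) auto
  also have "f (takeWhile (\<lambda>y. y \<notin> U) b) * (f c * (\<Prod>u\<in>U - {w}. f (arc a U u))) =
      f (arc a U w) * (\<Prod>u\<in>U - {w}. f (arc a U u))"
    using ends aw(2) assms(4) by auto
  also have "\<dots> = (\<Prod>u\<in>U. f (arc a U u))" using prod.remove[OF fin bc(2), of "\<lambda>u. f (arc a U u)"] by simp
  finally show ?thesis .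
qed

text \<open>Double counting of a relation given by its sections \<open>B x\<close> and
  \<open>E y\<close>; it is applied to pairs of a block \<open>V\<close> and a paired set
  \<open>X\<close>.\<close>

lemma sum_pairs_swap:
  assumes "finite S" "\<And>x y. x \<in> A \<Longrightarrow> y \<in> B x \<Longrightarrow> y \<in> C \<and> x \<in> E y"
    "\<And>x y. y \<in> C \<Longrightarrow> x \<in> E y \<Longrightarrow> x \<in> A \<and> y \<in> B x"
    "A \<subseteq> S" "\<And>x. x \<in> A \<Longrightarrow> B x \<subseteq> S'" "finite S'" "C \<subseteq> S'" "\<And>y. y \<in> C \<Longrightarrow> E y \<subseteq> S"
  shows "(\<Sum>x\<in>A. \<Sum>y\<in>B x. f x y) = (\<Sum>y\<in>C. \<Sum>x\<in>E y. f x y :: complex)"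
proof -
  have fA: "finite A" "finite C" using finite_subset[OF assms(4,1)] finite_subset[OF assms(7,6)] by auto
  have fB: "\<forall>x\<in>A. finite (B x)" "\<forall>y\<in>C. finite (E y)"
    using finite_subset[OF assms(5,6)] finite_subset[OF assms(8,1)] by auto
  have "(\<Sum>x\<in>A. \<Sum>y\<in>B x. f x y) = (\<Sum>(x, y)\<in>Sigma A B. f x y)" by (rule sum.Sigma[OF fA(1) fB(1)])
  also have "\<dots> = (\<Sum>(y, x)\<in>Sigma C E. f x y)"
  proof (rule sum.reindex_bij_witness[of _ prod.swap prod.swap])
    fix z assume "z \<in> Sigma A B"
    then have "fst z \<in> A" "snd z \<in> B (fst z)" by auto
    then show "prod.swap z \<in> Sigma C E" using assms(2)[of "fst z" "snd z"] by (cases z) simp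
  next
    fix z assume "z \<in> Sigma C E"
    then have "fst z \<in> C" "snd z \<in> E (fst z)" by auto
    then show "prod.swap z \<in> Sigma A B" using assms(3)[of "fst z" "snd z"] by (cases z) simp
  qed auto
  also have "\<dots> = (\<Sum>y\<in>C. \<Sum>x\<in>E y. f x y)" by (rule sum.Sigma[OF fA(2) fB(2), symmetric])
  finally show ?thesis .
qed

section \<open>Moments of alternating words as sums over paired sets\<close>

context coloured_algebras
begin

lemma segment_sum_sector_listing:
  assumes "distinct a" "V \<subseteq> X" "X \<subseteq> set a" "v \<in> V"
  shows "arc (listing a X) V v = listing (arc a V v) (X \<inter> set (arc a V v))"
proof -
  have "arc (listing a X) V v = listing (arc a V v) X"
    using assms by (intro arc_filter) auto
  also have "\<dots> = listing (arc a V v) (X \<inter> set (arc a V v))" by (intro filter_cong) auto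
  finally show ?thesis .
qed

text \<open>Closes the segment with its outer point \<open>v\<close>, the form in which gap products
  of different arcs join by \<open>prod_arcs_nested\<close>. The unpaired end belongs to every
  paired set, as \<open>prod_arcs_segment\<close> demands.\<close>

lemma moment_sector:
  assumes IH: "moment \<psi> x a = (\<Sum>X\<in>paired_sets a. segment_sum \<psi> pcol x (listing a X) * (\<Prod>u\<in>X. moment \<psi> x (arc a X u)))"
    and "alternating a" "v \<notin> set a"
  shows "moment \<psi> x a = (\<Sum>X\<in>paired_sets a. segment_sum \<psi> pcol x (listing a X) *
    (\<Prod>u\<in>insert v X. moment \<psi> x (arc (v # a) (insert v X) u)))"
  unfolding IH
proof (intro sum.cong refl arg_cong2[of _ _ _ _ "(*)"])
  fix X assume X: "X \<in> paired_sets a"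
  have d: "distinct a" "a \<noteq> []" using assms(2) by (auto simp: alternating_def)
  obtain e where e: "e \<in> set a" "pcol e = 2 \<and> e = hd a \<or> pcol e = 1 \<and> e = last a" "partner e \<notin> set a"
    by (rule alternating_end[OF assms(2)])
  have "e \<in> X" "X \<subseteq> set a" using X e unfolding paired_sets_def by auto
  then show "(\<Prod>u\<in>X. moment \<psi> x (arc a X u)) = (\<Prod>u\<in>insert v X. moment \<psi> x (arc (v # a) (insert v X) u))"
    using d assms(3) e(2) by (intro prod_arcs_segment[symmetric]) (auto simp: moment_def psi_one)
qed

text \<open>Expanding the arcs outside \<open>T\<close> and keeping those in \<open>T\<close> whole
  turns the product of arc moments into a sum over sets \<open>X\<close> above \<open>V\<close>:
  segment sums inside the arcs of \<open>V\<close>, times moments of the gaps of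
  \<open>X\<close>.\<close>

lemma sectors_expansion:
  assumes "distinct cs" "V \<subseteq> set cs" "V \<noteq> {}" "T \<subseteq> V"
    and IH: "\<And>v. v \<in> V - T \<Longrightarrow> alternating (arc cs V v) \<and>
      moment \<psi> x (arc cs V v) = (\<Sum>X\<in>paired_sets (arc cs V v). segment_sum \<psi> pcol x (listing (arc cs V v) X) *
        (\<Prod>u\<in>X. moment \<psi> x (arc (arc cs V v) X u)))"
  shows "(\<Prod>v\<in>V. moment \<psi> x (arc cs V v)) =
    (\<Sum>X | V \<subseteq> X \<and> X \<subseteq> set cs \<and> (\<forall>v\<in>V. X \<inter> set (arc cs V v) \<in> (if v \<in> T then {{}} else paired_sets (arc cs V v))).
      (\<Prod>v\<in>V. segment_sum \<psi> pcol x (arc (listing cs X) V v)) * (\<Prod>u\<in>X. moment \<psi> x (arc cs X u)))"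
proof -
  let ?a = "arc cs V"
  have vc: "v \<in> set cs" if "v \<in> V" for v using that assms(2) by blast
  have va: "v \<notin> set (?a v)" if "v \<in> V" for v using arc_subset[OF assms(1) that vc[OF that]] that by blast
  define Q where "Q v U = (\<Prod>u\<in>insert v U. moment \<psi> x (arc (v # ?a v) (insert v U) u))" for v U
  define \<U> where "\<U> v = (if v \<in> T then {{}} else paired_sets (?a v))" for v
  have "moment \<psi> x (?a v) = (\<Sum>U\<in>\<U> v. segment_sum \<psi> pcol x (listing (?a v) U) * Q v U)" if v: "v \<in> V" for v
  proof (cases "v \<in> T")
    case True
    \<comment> \<open>The only choice is the empty set: its segment sum is \<open>1\<close>, and the
      single gap of \<open>{v}\<close> is the whole arc.\<close>
    have "distinct (v # ?a v)" using va[OF v] distinct_arc[OF assms(1) v vc[OF v]] by simp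
    then have "arc (v # ?a v) {v} v = takeWhile (\<lambda>y. y \<notin> {v}) (?a v)" by (rule arc_cyc[OF _ cyc_refl])
    also have "\<dots> = ?a v" using va[OF v] by (auto simp: takeWhile_eq_all_conv)
    finally show ?thesis using True by (simp add: \<U>_def Q_def)
  next
    case False
    then have v': "v \<in> V - T" using v by blast
    show ?thesis using moment_sector[OF conjunct2[OF IH[OF v']] conjunct1[OF IH[OF v']] va[OF v]] False
      by (simp add: \<U>_def Q_def)
  qed
  then have "(\<Prod>v\<in>V. moment \<psi> x (?a v)) = (\<Prod>v\<in>V. \<Sum>U\<in>\<U> v. segment_sum \<psi> pcol x (listing (?a v) U) * Q v U)"
    by (intro prod.cong) auto
  also have "\<dots> = (\<Sum>X | V \<subseteq> X \<and> X \<subseteq> set cs \<and> (\<forall>v\<in>V. X \<inter> set (?a v) \<in> \<U> v).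
      \<Prod>v\<in>V. segment_sum \<psi> pcol x (listing (?a v) (X \<inter> set (?a v))) * Q v (X \<inter> set (?a v)))"
    by (rule prod_sum_sectors[OF assms(1,2) _ assms(3)]) (auto simp: \<U>_def paired_sets_def)
  also have "\<dots> = (\<Sum>X | V \<subseteq> X \<and> X \<subseteq> set cs \<and> (\<forall>v\<in>V. X \<inter> set (?a v) \<in> \<U> v).
      (\<Prod>v\<in>V. segment_sum \<psi> pcol x (arc (listing cs X) V v)) * (\<Prod>u\<in>X. moment \<psi> x (arc cs X u)))"
  proof (rule sum.cong[OF refl])
    fix X assume "X \<in> {X. V \<subseteq> X \<and> X \<subseteq> set cs \<and> (\<forall>v\<in>V. X \<inter> set (?a v) \<in> \<U> v)}"
    then have X: "V \<subseteq> X" "X \<subseteq> set cs" by auto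
    have "(\<Prod>v\<in>V. Q v (X \<inter> set (?a v))) = (\<Prod>u\<in>X. moment \<psi> x (arc cs X u))"
      unfolding Q_def by (rule prod_arcs_nested[OF assms(1) X assms(3), symmetric])
    moreover have "(\<Prod>v\<in>V. segment_sum \<psi> pcol x (listing (?a v) (X \<inter> set (?a v)))) =
        (\<Prod>v\<in>V. segment_sum \<psi> pcol x (arc (listing cs X) V v))"
      using segment_sum_sector_listing[OF assms(1) X] by (intro prod.cong refl) simp
    ultimately show "(\<Prod>v\<in>V. segment_sum \<psi> pcol x (listing (?a v) (X \<inter> set (?a v))) * Q v (X \<inter> set (?a v))) =
      (\<Prod>v\<in>V. segment_sum \<psi> pcol x (arc (listing cs X) V v)) * (\<Prod>u\<in>X. moment \<psi> x (arc cs X u))"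
      by (simp add: prod.distrib)
  qed
  finally show ?thesis by (simp add: \<U>_def)
qed

text \<open>Anchor at the unpaired end \<open>e\<close>. The arcs of a monochrome block
  \<open>V\<close> through \<open>e\<close> are alternating, except the one over the end of the
  word, and are expanded by induction. For the resulting \<open>X\<close>, the possible
  \<open>V\<close> are the blocks through both ends of \<open>listing a X\<close>, so the sum over
  \<open>V\<close> is the recursion \<open>segment_sum_rec\<close>.\<close>

lemma moment_segment:
  assumes "alternating a" "coloured pcol x a"
  shows "moment \<psi> x a = (\<Sum>X\<in>paired_sets a. segment_sum \<psi> pcol x (listing a X) *
    (\<Prod>u\<in>X. moment \<psi> x (arc a X u)))"
  using assms
proof (induction "length a" arbitrary: a rule: less_induct)
  case less
  note g = less.prems(1)
  have d: "distinct a" and ne: "a \<noteq> []" and s: "successively step a"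
    using g by (auto simp: alternating_def)
  obtain e where e: "e \<in> set a" "pcol e = 2 \<and> e = hd a \<or> pcol e = 1 \<and> e = last a" "partner e \<notin> set a"
    and pairs: "\<And>p. p \<in> set a \<Longrightarrow> p \<noteq> e \<Longrightarrow> \<exists>b c i. a = b @ Plain i # Bar i # c \<and> (p = Plain i \<or> p = Bar i)"
    by (rule alternating_end[OF g]) blast
  define \<V> where "\<V> = {V. e \<in> V \<and> V \<subseteq> set a \<and> (\<forall>p\<in>V. pcol p = pcol e)}"
  \<comment> \<open>Behind the last point of \<open>V\<close> lies the arc over the end of the word.
    It is made of whole pairs, not alternating in the above sense, and stays unexpanded as a
    gap.\<close>
  define l where "l V = last (listing a V)" for V
  define \<X> where "\<X> V = {X. V \<subseteq> X \<and> X \<subseteq> set a \<and>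
    (\<forall>v\<in>V. X \<inter> set (arc a V v) \<in> (if v \<in> {l V} then {{}} else paired_sets (arc a V v)))}" for V
  define M where "M X = (\<Prod>u\<in>X. moment \<psi> x (arc a X u))" for X
  have V: "V \<subseteq> set a" "V \<noteq> {}" "monochrome pcol V" "e \<in> V" "hd a \<in> V \<or> last a \<in> V" if "V \<in> \<V>" for V
  proof -
    have a: "V \<subseteq> set a" "e \<in> V" "\<forall>p\<in>V. pcol p = pcol e" using that unfolding \<V>_def by blast+
    then show "V \<subseteq> set a" "V \<noteq> {}" "e \<in> V" by blast+
    show "monochrome pcol V" unfolding monochrome_def using a(3) by metis
    show "hd a \<in> V \<or> last a \<in> V" using e(2) a(2) by metis
  qed
  have pair: "(\<exists>r. cyc a (p # partner p # r)) \<or> (\<exists>r. cyc a (partner p # p # r))"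
    if p: "p \<in> set a" "partner p \<in> set a" for p
  proof -
    have "p \<noteq> e" using p e(3) by metis
    then obtain b c i where bc: "a = b @ Plain i # Bar i # c" "p = Plain i \<or> p = Bar i"
      using pairs p by metis
    then have "cyc a (Plain i # Bar i # (c @ b))" using cyc_append[of b "Plain i # Bar i # c"] by simp
    then show ?thesis using bc(2) by auto
  qed
  have out: "p = e" if "p \<in> set a" "partner p \<notin> set a" for p
  proof (rule ccontr)
    assume "p \<noteq> e"
    then obtain b c i where "a = b @ Plain i # Bar i # c" "p = Plain i \<or> p = Bar i"
      using pairs \<open>p \<in> set a\<close> by metis
    then show False using that by auto
  qed
  \<comment> \<open>No pair straddles this arc and \<open>V\<close>. If \<open>e\<close> is a bar at
    the head, the arc is a tail, and the bar following a plain point of it stays in the tail; if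
    \<open>e\<close> is a plain point at the end, the arc is an initial piece and also contains the
    plain point before each of its bars.\<close>
  have last_out: "partner p \<notin> V" if VV: "V \<in> \<V>" and p: "p \<in> set (arc a V (l V))" for V p
  proof
    assume pV: "partner p \<in> V"
    obtain b' s' where bs: "a = b' @ l V # s'" "l V \<in> V" "set s' \<inter> V = {}"
      "arc a V (l V) = s' @ takeWhile (\<lambda>y. y \<notin> V) b'"
      using last_sector[OF d V(1,2)[OF VV]] unfolding l_def by blast
    have pa: "p \<in> set a" "p \<notin> V" using arc_subset[OF d bs(2)] V(1)[OF VV] p bs(2) by blast+
    then have "p \<noteq> e" using V(4)[OF VV] by blast
    then obtain b c i where bc: "a = b @ Plain i # Bar i # c" "p = Plain i \<or> p = Bar i"
      using pairs pa by metis
    have pe: "pcol (partner p) = pcol e" using pV VV unfolding \<V>_def by blast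
    from e(2) show False
    proof
      assume e2: "pcol e = 2 \<and> e = hd a"
      have "takeWhile (\<lambda>y. y \<notin> V) b' = []"
      proof (cases b')
        case (Cons y ys)
        then have "y = e" using e2 bs(1) by simp
        then show ?thesis using Cons V(4)[OF VV] by simp
      qed simp
      then have "p \<in> set s'" using p bs(4) by simp
      moreover have "p = Plain i" using bc(2) pe e2 by auto
      ultimately obtain t u where tu: "s' = t @ Plain i # u" using split_list by metis
      have "b @ Plain i # (Bar i # c) = (b' @ l V # t) @ Plain i # u" using bc(1) bs(1) tu by simp
      then have "Bar i # c = u" using distinct_split_unique[of b "Plain i" "Bar i # c"] d bc(1) by metis
      then have "Bar i \<in> set s'" using tu by auto
      moreover have "Bar i \<in> V" using pV \<open>p = Plain i\<close> by simp
      ultimately show False using bs(3) by blast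
    next
      assume e1: "pcol e = 1 \<and> e = last a"
      have "s' = []"
      proof (rule ccontr)
        assume "s' \<noteq> []"
        then have "last a \<in> set s'" using bs(1) by simp
        then show False using e1 V(4)[OF VV] bs(3) by blast
      qed
      then have "p \<in> set (takeWhile (\<lambda>y. y \<notin> V) b')" using p bs(4) by simp
      moreover have pB: "p = Bar i" using bc(2) pe e1 by auto
      ultimately obtain t u where tu: "takeWhile (\<lambda>y. y \<notin> V) b' = t @ Bar i # u" using split_list by metis
      have "b' = takeWhile (\<lambda>y. y \<notin> V) b' @ dropWhile (\<lambda>y. y \<notin> V) b'" by simp
      then have "b' = t @ Bar i # (u @ dropWhile (\<lambda>y. y \<notin> V) b')" unfolding tu by simp
      then obtain u' where u': "b' = t @ Bar i # u'" by blast
      have "(b @ [Plain i]) @ Bar i # c = t @ Bar i # (u' @ l V # s')" using bc(1) bs(1) u' by simp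
      moreover have "distinct ((b @ [Plain i]) @ Bar i # c)" using d bc(1) by simp
      ultimately have "b @ [Plain i] = t" using distinct_split_unique by metis
      then have "Plain i \<in> set (takeWhile (\<lambda>y. y \<notin> V) b')" using tu by auto
      then have "Plain i \<notin> V" using set_takeWhileD by metis
      then show False using pV pB by simp
    qed
  qed
  have index: "X \<in> \<X> V \<longleftrightarrow> V \<subseteq> X \<and> X \<in> paired_sets a \<and> hd (listing a X) \<in> V \<and> last (listing a X) \<in> V"
    if VV: "V \<in> \<V>" for V X
  proof (cases "V \<subseteq> X \<and> X \<subseteq> set a")
    case True
    then have VX: "V \<subseteq> X" "X \<subseteq> set a" by auto
    have lV: "l V \<in> V" using last_sector[OF d V(1,2)[OF VV]] unfolding l_def by blast
    have "X \<in> \<X> V \<longleftrightarrow> X \<in> paired_sets a \<and> (\<forall>v\<in>{l V}. X \<inter> set (arc a V v) = {})"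
      unfolding \<X>_def mem_Collect_eq
      by (subst paired_sets_sectors[OF d VX V(3)[OF VV]])
        (use lV VX pair out V(2,4)[OF VV] last_out[OF VV] in auto)
    also have "\<dots> \<longleftrightarrow> X \<in> paired_sets a \<and> hd (listing a X) \<in> V \<and> last (listing a X) \<in> V"
      using last_sector_empty_iff[OF d VX V(2)[OF VV]] unfolding l_def by simp
    finally show ?thesis using VX by blast
  next
    case False
    then show ?thesis by (auto simp: \<X>_def paired_sets_def)
  qed
  have expand: "(\<Prod>v\<in>V. moment \<psi> x (listing a (set (arc a V v)))) =
      (\<Sum>X\<in>\<X> V. (\<Prod>v\<in>V. segment_sum \<psi> pcol x (arc (listing a X) V v)) * M X)" if VV: "V \<in> \<V>" for V
  proof -
    have lV: "l V \<in> V" using last_sector[OF d V(1,2)[OF VV]] unfolding l_def by blast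
    have "(\<Prod>v\<in>V. moment \<psi> x (listing a (set (arc a V v)))) = (\<Prod>v\<in>V. moment \<psi> x (arc a V v))"
    proof (rule prod.cong[OF refl])
      fix v assume v: "v \<in> V"
      then show "moment \<psi> x (listing a (set (arc a V v))) = moment \<psi> x (arc a V v)"
        using listing_arc_linear[OF d V(5)[OF VV] v] V(1)[OF VV] by auto
    qed
    also have "\<dots> = (\<Sum>X\<in>\<X> V. (\<Prod>v\<in>V. segment_sum \<psi> pcol x (arc (listing a X) V v)) * M X)"
      unfolding \<X>_def M_def
    proof (rule sectors_expansion[OF d V(1,2)[OF VV]])
      fix v assume v: "v \<in> V - {l V}"
      have vV: "v \<in> V" and va: "v \<in> set a" using v V(1)[OF VV] by auto
      obtain b' s' where bs: "a = b' @ l V # s'" "l V \<in> V" "set s' \<inter> V = {}"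
        "arc a V (l V) = s' @ takeWhile (\<lambda>y. y \<notin> V) b'"
        using last_sector[OF d V(1,2)[OF VV]] unfolding l_def by blast
      have "v \<in> set (b' @ l V # s')" using va unfolding bs(1)[symmetric] .
      then have "v \<in> set b'" using v bs(3) by auto
      then obtain t u where tu: "b' = t @ v # u" using split_list by metis
      define w where "w = u @ l V # s'"
      have av: "a = t @ v # w" using bs(1) unfolding tu w_def by simp
      have "cyc a (v # (w @ t))" using cyc_append[of t "v # w"] av by simp
      then have "arc a V v = takeWhile (\<lambda>y. y \<notin> V) (w @ t)" by (rule arc_cyc[OF d])
      also have "\<dots> = takeWhile (\<lambda>y. y \<notin> V) w"
        using takeWhile_append1[of "l V" w "\<lambda>y. y \<notin> V" t] lV by (simp add: w_def)
      finally have arcv: "arc a V v = takeWhile (\<lambda>y. y \<notin> V) w" .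
      have "l V \<in> set w" by (simp add: w_def)
      then have dne: "dropWhile (\<lambda>y. y \<notin> V) w \<noteq> []" using lV unfolding dropWhile_eq_Nil_conv by blast
      then obtain y ys where y: "dropWhile (\<lambda>y. y \<notin> V) w = y # ys" by (cases "dropWhile (\<lambda>y. y \<notin> V) w") auto
      have yV: "y \<in> V" using hd_dropWhile[OF dne] y by simp
      have "w = arc a V v @ y # ys" unfolding arcv y[symmetric] by simp
      then have "t @ (v # arc a V v @ [y]) @ ys = a" using av by simp
      then have "successively step (t @ (v # arc a V v @ [y]) @ ys)" using s by simp
      then have "successively step (v # arc a V v @ [y])"
        using successively_append_left successively_append_right by blast
      then have gd: "alternating (arc a V v)"
        by (rule alternating_between[OF V(3)[OF VV] vV yV distinct_arc[OF d vV va]])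
      moreover have "coloured pcol x (arc a V v)"
        using arc_subset[OF d vV va] by (intro coloured_subset[OF less.prems(2)]) auto
      ultimately show "alternating (arc a V v) \<and> moment \<psi> x (arc a V v) =
         (\<Sum>X\<in>paired_sets (arc a V v). segment_sum \<psi> pcol x (listing (arc a V v) X) *
            (\<Prod>u\<in>X. moment \<psi> x (arc (arc a V v) X u)))"
        using less.hyps[OF length_arc[OF d vV va]] by blast
    qed (use lV in auto)
    finally show ?thesis .
  qed
  define E where "E X = {V. V \<subseteq> set (listing a X) \<and> monochrome pcol V \<and>
    hd (listing a X) \<in> V \<and> last (listing a X) \<in> V}" for X
  have eX: "e \<in> X" "X \<subseteq> set a" "listing a X \<noteq> []" "set (listing a X) = X" if "X \<in> paired_sets a" for X
    using that e unfolding paired_sets_def by (auto simp: filter_empty_conv)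
  have EV: "V \<in> \<V> \<and> V \<subseteq> X" if X: "X \<in> paired_sets a" and VE: "V \<in> E X" for X V
  proof -
    have VX: "V \<subseteq> X" using VE eX(4)[OF X] by (auto simp: E_def)
    \<comment> \<open>As an end of \<open>a\<close> that belongs to every paired set,
      \<open>e\<close> is an end of \<open>listing a X\<close>.\<close>
    have "e \<in> V"
      using e(2)
    proof
      assume h: "pcol e = 2 \<and> e = hd a"
      then obtain t where "a = e # t" using ne by (cases a) auto
      then have "hd (listing a X) = e" using eX(1)[OF X] by simp
      then show ?thesis using VE by (auto simp: E_def)
    next
      assume h: "pcol e = 1 \<and> e = last a"
      then have "a = butlast a @ [e]" using ne by simp
      then have "listing a X = listing (butlast a) X @ [e]" using eX(1)[OF X] by (metis filter.simps filter_append)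
      then have "last (listing a X) = e" by simp
      then show ?thesis using VE by (auto simp: E_def)
    qed
    moreover have "\<forall>p\<in>V. pcol p = pcol e"
      using VE \<open>e \<in> V\<close> unfolding E_def monochrome_def by blast
    ultimately show ?thesis using VX eX(2)[OF X] unfolding \<V>_def by blast
  qed
  have "moment \<psi> x a = (\<Sum>V\<in>\<V>. kap \<psi> x (listing a V) * (\<Prod>v\<in>V. moment \<psi> x (listing a (set (arc a V v)))))"
    unfolding \<V>_def by (rule moment_monochrome[OF d less.prems(2) e(1)])
  also have "\<dots> = (\<Sum>V\<in>\<V>. \<Sum>X\<in>\<X> V. kap \<psi> x (listing a V) * ((\<Prod>v\<in>V. segment_sum \<psi> pcol x (arc (listing a X) V v)) * M X))"
    using expand by (simp add: sum_distrib_left)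
  \<comment> \<open>The gap moments depend on \<open>X\<close> alone, so the sum over
    \<open>V\<close> is carried out first.\<close>
  also have "\<dots> = (\<Sum>X\<in>paired_sets a. \<Sum>V\<in>E X. kap \<psi> x (listing a V) * ((\<Prod>v\<in>V. segment_sum \<psi> pcol x (arc (listing a X) V v)) * M X))"
  proof (rule sum_pairs_swap[where S = "Pow (set a)" and S' = "Pow (set a)"])
    show "X \<in> paired_sets a \<and> V \<in> E X" if "V \<in> \<V>" "X \<in> \<X> V" for V X
      using index[OF that(1), of X] that eX(4)[of X] V(3)[OF that(1)] by (auto simp: E_def)
    show "V \<in> \<V> \<and> X \<in> \<X> V" if "X \<in> paired_sets a" "V \<in> E X" for V X
    proof -
      have "V \<in> \<V>" "V \<subseteq> X" using EV[OF that] by auto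
      then show ?thesis using index[of V X] that by (auto simp: E_def)
    qed
    show "\<V> \<subseteq> Pow (set a)" "paired_sets a \<subseteq> Pow (set a)" by (auto simp: \<V>_def paired_sets_def)
    show "\<X> V \<subseteq> Pow (set a)" for V by (auto simp: \<X>_def)
    show "E X \<subseteq> Pow (set a)" if "X \<in> paired_sets a" for X by (auto simp: E_def)
  qed auto
  also have "\<dots> = (\<Sum>X\<in>paired_sets a. segment_sum \<psi> pcol x (listing a X) * M X)"
  proof (rule sum.cong[OF refl])
    fix X assume X: "X \<in> paired_sets a"
    have "segment_sum \<psi> pcol x (listing a X) = (\<Sum>V\<in>E X. kap \<psi> x (listing (listing a X) V) *
        (\<Prod>v\<in>V. segment_sum \<psi> pcol x (arc (listing a X) V v)))"
      unfolding E_def using d eX(3)[OF X] by (intro segment_sum_rec) auto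
    also have "\<dots> = (\<Sum>V\<in>E X. kap \<psi> x (listing a V) * (\<Prod>v\<in>V. segment_sum \<psi> pcol x (arc (listing a X) V v)))"
    proof (rule sum.cong[OF refl])
      fix V assume "V \<in> E X"
      then have "V \<subseteq> X" using EV[OF X] by blast
      then show "kap \<psi> x (listing (listing a X) V) * (\<Prod>v\<in>V. segment_sum \<psi> pcol x (arc (listing a X) V v)) =
          kap \<psi> x (listing a V) * (\<Prod>v\<in>V. segment_sum \<psi> pcol x (arc (listing a X) V v))"
        by (simp only: listing_listing)
    qed
    finally show "(\<Sum>V\<in>E X. kap \<psi> x (listing a V) * ((\<Prod>v\<in>V. segment_sum \<psi> pcol x (arc (listing a X) V v)) * M X)) =
        segment_sum \<psi> pcol x (listing a X) * M X"
      by (simp add: sum_distrib_right mult.assoc)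
  qed
  finally show ?case by (simp add: M_def)
qed

end

section \<open>Cyclic moments of closed alternating words\<close>

definition circular :: "'i point list \<Rightarrow> bool" where
  "circular cs \<longleftrightarrow> distinct cs \<and> cs \<noteq> [] \<and> (\<forall>p q r. cyc cs (p # q # r) \<longrightarrow> step p q) \<and>
    (\<forall>p\<in>set cs. partner p \<in> set cs)"

lemma circular_pair:
  assumes "circular cs" "p \<in> set cs"
  shows "(\<exists>r. cyc cs (p # partner p # r)) \<or> (\<exists>r. cyc cs (partner p # p # r))"
proof -
  have plain: "\<exists>r. cyc cs (Plain i # Bar i # r)" if i: "Plain i \<in> set cs" for i
  proof -
    obtain ys where ys: "cyc cs (Plain i # ys)" using cyc_to_head[OF i] .
    have "Bar i \<in> set cs" using assms(1) i unfolding circular_def by force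
    then have "ys \<noteq> []" using cyc_set[OF ys] by auto
    then obtain q r where qr: "ys = q # r" by (cases ys) auto
    then have "step (Plain i) q" using assms(1) ys unfolding circular_def by blast
    then show ?thesis using ys qr by auto
  qed
  show ?thesis
  proof (cases p)
    case (Plain i)
    then show ?thesis using plain[of i] assms(2) by auto
  next
    case (Bar i)
    then have "Plain i \<in> set cs" using assms unfolding circular_def by force
    then show ?thesis using plain[of i] Bar by auto
  qed
qed

lemma circular_successively:
  assumes "circular cs" "cyc cs (ys @ xs @ zs)"
  shows "successively step xs"
  using assms(2)
proof (induction xs arbitrary: ys rule: induct_list012)
  case (3 p q xs)
  have "cyc (ys @ (p # q # xs) @ zs) (p # q # (xs @ zs @ ys))"
    using cyc_append[of ys "(p # q # xs) @ zs"] by simp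
  then have "cyc cs (p # q # (xs @ zs @ ys))" using 3(3) cyc_trans by blast
  then have "step p q" using assms(1) unfolding circular_def by blast
  moreover have "successively step (q # xs)" using 3(2)[of "ys @ [p]"] 3(3) by simp
  ultimately show ?case by simp
qed auto

lemma circular_good_arc:
  assumes "circular cs" "monochrome pcol V" "V \<subseteq> set cs" "v \<in> V"
  shows "alternating (arc cs V v)"
proof -
  have d: "distinct cs" using assms(1) by (simp add: circular_def)
  have v: "v \<in> set cs" using assms by blast
  obtain z where z: "cyc cs (v # arc cs V v @ z)" "z = [] \<or> hd z \<in> V"
    by (rule arcE[OF d assms(4) v])
  define a where "a = arc cs V v"
  obtain w where w: "w \<in> V" "successively step (v # a @ [w])"
  proof (cases z)
    case (Cons y ys)
    have "cyc cs ([] @ (v # a @ [y]) @ ys)" using z(1) Cons a_def by simp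
    then have "successively step (v # a @ [y])" by (rule circular_successively[OF assms(1)])
    then show thesis using that[of y] z(2) Cons by auto
  next
    case Nil
    \<comment> \<open>With an empty rest the walk returns to \<open>v\<close> itself, so
      \<open>v\<close> bounds the arc on both sides; the step from the last point back to
      \<open>v\<close> is seen after a rotation.\<close>
    then have c: "cyc cs (v # a)" using z(1) a_def by simp
    have s: "successively step (v # a)" using circular_successively[OF assms(1), of "[]" "v # a" "[]"] c by simp
    have "a \<noteq> []"
    proof
      assume "a = []"
      then have "set cs = {v}" using cyc_set[OF c] by simp
      then have "partner v = v" using assms(1) unfolding circular_def by auto
      then show False by simp
    qed
    then have e: "v # a = (v # butlast a) @ [last a]" by simp
    then have "cyc cs (last a # v # butlast a)"
      using cyc_trans[OF c] cyc_append[of "v # butlast a" "[last a]"] by simp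
    then have "step (last a) v" using assms(1) unfolding circular_def by blast
    then have "successively step ((v # a) @ [v])" using s \<open>a \<noteq> []\<close> by (subst successively_append_iff) simp
    then show thesis using that[of v] assms(4) by simp
  qed
  show ?thesis using alternating_between[OF assms(2,4) w(1) distinct_arc[OF d assms(4) v]] w(2) a_def by simp
qed

text \<open>By \<open>complete_segments_sectors\<close>, a sum over complete monochrome partitions
  with one marked block \<open>V\<close>. It will be both the cyclic cumulant of the products and
  the sum over type B partitions.\<close>

definition circle_sum :: "('a::ring_1 \<Rightarrow> complex) \<Rightarrow> ('a \<Rightarrow> complex) \<Rightarrow> ('i point \<Rightarrow> 'a) \<Rightarrow> 'i point list \<Rightarrow> complex" where
  "circle_sum \<psi> D x cs = (\<Sum>V | V \<noteq> {} \<and> V \<subseteq> set cs \<and> monochrome pcol V.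
    dkap \<psi> D x (listing cs V) * (\<Prod>v\<in>V. segment_sum \<psi> pcol x (arc cs V v)))"

context coloured_algebras
begin

text \<open>The double counting of \<open>moment_segment\<close> on a closed word. There is no
  anchor and no exceptional arc: all arcs of a monochrome block are alternating, hence
  \<open>T\<close> is empty, and every nonempty paired set occurs.\<close>

lemma cyclic_moment_circular:
  assumes "circular cs" "coloured pcol x cs"
  shows "moment D x cs = (\<Sum>X | X \<in> paired_sets cs \<and> X \<noteq> {}. circle_sum \<psi> D x (listing cs X) *
    (\<Prod>u\<in>X. moment \<psi> x (arc cs X u)))"
proof -
  have d: "distinct cs" and ne: "cs \<noteq> []" using assms(1) by (auto simp: circular_def)
  define M where "M X = (\<Prod>u\<in>X. moment \<psi> x (arc cs X u))" for X
  define \<V> where "\<V> = {V. V \<noteq> {} \<and> V \<subseteq> set cs \<and> monochrome pcol V}"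
  define \<X> where "\<X> V = {X. V \<subseteq> X \<and> X \<subseteq> set cs \<and>
    (\<forall>v\<in>V. X \<inter> set (arc cs V v) \<in> (if v \<in> {} then {{}} else paired_sets (arc cs V v)))}" for V
  have index: "X \<in> \<X> V \<longleftrightarrow> V \<subseteq> X \<and> X \<in> paired_sets cs" if VV: "V \<in> \<V>" for V X
  proof (cases "V \<subseteq> X \<and> X \<subseteq> set cs")
    case True
    have V: "V \<noteq> {}" "monochrome pcol V" using VV by (auto simp: \<V>_def)
    have out: "p \<in> V" if "p \<in> set cs" "partner p \<notin> set cs" for p
      using that assms(1) by (auto simp: circular_def)
    have "X \<in> paired_sets cs \<and> (\<forall>v\<in>{}. X \<inter> set (arc cs V v) = {}) \<longleftrightarrow>
      (\<forall>v\<in>V. X \<inter> set (arc cs V v) \<in> (if v \<in> {} then {{}} else paired_sets (arc cs V v)))"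
      by (rule paired_sets_sectors[OF d _ _ V(2) _ _ _ _ V(1)])
        (use True circular_pair[OF assms(1)] out in auto)
    then show ?thesis using True unfolding \<X>_def by blast
  next
    case False
    then show ?thesis by (auto simp: \<X>_def paired_sets_def)
  qed
  have expand: "(\<Prod>v\<in>V. moment \<psi> x (arc cs V v)) =
      (\<Sum>X\<in>\<X> V. (\<Prod>v\<in>V. segment_sum \<psi> pcol x (arc (listing cs X) V v)) * M X)" if VV: "V \<in> \<V>" for V
    unfolding \<X>_def M_def
  proof (rule sectors_expansion[OF d])
    have V: "V \<noteq> {}" "V \<subseteq> set cs" "monochrome pcol V" using VV by (auto simp: \<V>_def)
    then show "V \<subseteq> set cs" "V \<noteq> {}" by auto
    fix v assume "v \<in> V - {}"
    then have v: "v \<in> V" "v \<in> set cs" using V by auto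
    have g: "alternating (arc cs V v)" by (rule circular_good_arc[OF assms(1) V(3,2) v(1)])
    have "coloured pcol x (arc cs V v)"
      using arc_subset[OF d v] by (intro coloured_subset[OF assms(2)]) auto
    then show "alternating (arc cs V v) \<and> moment \<psi> x (arc cs V v) =
         (\<Sum>X\<in>paired_sets (arc cs V v). segment_sum \<psi> pcol x (listing (arc cs V v) X) *
            (\<Prod>u\<in>X. moment \<psi> x (arc (arc cs V v) X u)))"
      using g moment_segment[OF g] by blast
  qed auto
  define E where "E X = {V. V \<noteq> {} \<and> V \<subseteq> set (listing cs X) \<and> monochrome pcol V}" for X
  have "moment D x cs = (\<Sum>V\<in>\<V>. dkap \<psi> D x (listing cs V) * (\<Prod>v\<in>V. moment \<psi> x (arc cs V v)))"
    unfolding \<V>_def monochrome_def by (rule cyclic_moment_monochrome[OF d assms(2) ne])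
  also have "\<dots> = (\<Sum>V\<in>\<V>. \<Sum>X\<in>\<X> V. dkap \<psi> D x (listing cs V) * ((\<Prod>v\<in>V. segment_sum \<psi> pcol x (arc (listing cs X) V v)) * M X))"
    using expand by (simp add: sum_distrib_left)
  also have "\<dots> = (\<Sum>X | X \<in> paired_sets cs \<and> X \<noteq> {}. \<Sum>V\<in>E X.
      dkap \<psi> D x (listing cs V) * ((\<Prod>v\<in>V. segment_sum \<psi> pcol x (arc (listing cs X) V v)) * M X))"
  proof (rule sum_pairs_swap[where S = "Pow (set cs)" and S' = "Pow (set cs)"])
    show "X \<in> {X. X \<in> paired_sets cs \<and> X \<noteq> {}} \<and> V \<in> E X" if "V \<in> \<V>" "X \<in> \<X> V" for V X
      using index[OF that(1), of X] that by (auto simp: E_def \<V>_def)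
    show "V \<in> \<V> \<and> X \<in> \<X> V" if "X \<in> {X. X \<in> paired_sets cs \<and> X \<noteq> {}}" "V \<in> E X" for V X
    proof -
      have "V \<in> \<V>" "V \<subseteq> X" using that by (auto simp: \<V>_def E_def)
      then show ?thesis using index[of V X] that by auto
    qed
    show "\<V> \<subseteq> Pow (set cs)" "{X. X \<in> paired_sets cs \<and> X \<noteq> {}} \<subseteq> Pow (set cs)"
      by (auto simp: \<V>_def paired_sets_def)
    show "\<X> V \<subseteq> Pow (set cs)" for V by (auto simp: \<X>_def)
    show "E X \<subseteq> Pow (set cs)" for X by (auto simp: E_def)
  qed auto
  also have "\<dots> = (\<Sum>X | X \<in> paired_sets cs \<and> X \<noteq> {}. circle_sum \<psi> D x (listing cs X) * M X)"
  proof (rule sum.cong[OF refl])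
    fix X
    have "circle_sum \<psi> D x (listing cs X) = (\<Sum>V\<in>E X. dkap \<psi> D x (listing cs V) *
        (\<Prod>v\<in>V. segment_sum \<psi> pcol x (arc (listing cs X) V v)))"
      unfolding circle_sum_def E_def[symmetric]
    proof (rule sum.cong[OF refl])
      fix V assume "V \<in> E X"
      then have "V \<subseteq> X" by (auto simp: E_def)
      then show "dkap \<psi> D x (listing (listing cs X) V) * (\<Prod>v\<in>V. segment_sum \<psi> pcol x (arc (listing cs X) V v)) =
          dkap \<psi> D x (listing cs V) * (\<Prod>v\<in>V. segment_sum \<psi> pcol x (arc (listing cs X) V v))"
        by (simp only: listing_listing)
    qed
    then show "(\<Sum>V\<in>E X. dkap \<psi> D x (listing cs V) * ((\<Prod>v\<in>V. segment_sum \<psi> pcol x (arc (listing cs X) V v)) * M X)) =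
        circle_sum \<psi> D x (listing cs X) * M X"
      by (simp add: sum_distrib_right mult.assoc)
  qed
  finally show ?thesis by (simp add: M_def)
qed

end

section \<open>The barred circle and the cyclic cumulants of products\<close>

lemma barred_circle_simps [simp]:
  "barred_circle [] = []" "barred_circle (i # js) = Plain i # Bar i # barred_circle js"
  "barred_circle (is @ js) = barred_circle is @ barred_circle js"
  by (auto simp: barred_circle_def)

lemma set_barred_circle: "set (barred_circle is) = Plain ` set is \<union> Bar ` set is"
  by (induction "is") auto

lemma distinct_barred_circle: "distinct is \<Longrightarrow> distinct (barred_circle is)"
  by (induction "is") (auto simp: set_barred_circle)

lemma cyc_barred_circle: "cyc is js \<Longrightarrow> cyc (barred_circle is) (barred_circle js)"
  unfolding cyc_def by (metis barred_circle_simps(3))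

lemma barred_circle_Nil_iff [simp]: "barred_circle is = [] \<longleftrightarrow> is = []"
  by (cases "is") auto

lemma cyc_barred_circle_Bar:
  assumes "cyc is (i # js)"
  shows "cyc (barred_circle is) (Bar i # (barred_circle js @ [Plain i]))"
  using cyc_trans[OF cyc_barred_circle[OF assms], of "Bar i # (barred_circle js @ [Plain i])"]
    cyc_append[of "[Plain i]" "Bar i # barred_circle js"] by simp

lemma circular_barred_circle:
  assumes "distinct is" "is \<noteq> []"
  shows "circular (barred_circle is)"
proof -
  have d: "distinct (barred_circle is)" by (rule distinct_barred_circle[OF assms(1)])
  have "step p q" if c: "cyc (barred_circle is) (p # q # r)" for p q r
  proof -
    have "p \<in> set (barred_circle is)" using cyc_set[OF c] by auto
    then obtain i where i: "i \<in> set is" "p = Plain i \<or> p = Bar i" by (auto simp: set_barred_circle)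
    obtain js where js: "cyc is (i # js)" using cyc_to_head[OF i(1)] .
    have "cyc (barred_circle is) (Plain i # Bar i # barred_circle js)"
      using cyc_barred_circle[OF js] by simp
    then have 1: "q # r = Bar i # barred_circle js" if "p = Plain i"
      using cyc_distinct_unique_head[OF d] c that by blast
    have 2: "q # r = barred_circle js @ [Plain i]" if "p = Bar i"
      using cyc_distinct_unique_head[OF d] cyc_barred_circle_Bar[OF js] c that by blast
    show ?thesis using i(2) 1 2 by (cases js) auto
  qed
  then show ?thesis using d assms(2) by (auto simp: circular_def set_barred_circle)
qed

lemma listing_barred_circle:
  "listing (barred_circle is) (Plain ` I \<union> Bar ` I) = barred_circle (listing is I)"
  by (induction "is") auto

lemma paired_sets_barred_circle:
  "paired_sets (barred_circle is) = (\<lambda>I. Plain ` I \<union> Bar ` I) ` Pow (set is)"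
proof (intro equalityI subsetI)
  fix X assume X: "X \<in> paired_sets (barred_circle is)"
  have Xs: "X \<subseteq> Plain ` set is \<union> Bar ` set is"
    and P: "\<And>p. p \<in> Plain ` set is \<union> Bar ` set is \<Longrightarrow> p \<in> X \<longleftrightarrow> partner p \<in> X \<or> partner p \<notin> Plain ` set is \<union> Bar ` set is"
    using X unfolding paired_sets_def set_barred_circle by blast+
  define I where "I = {i \<in> set is. Plain i \<in> X}"
  have B: "Bar i \<in> X \<longleftrightarrow> Plain i \<in> X" if "i \<in> set is" for i
    using P[of "Bar i"] that by auto
  have "X = Plain ` I \<union> Bar ` I"
  proof (rule set_eqI)
    fix p show "p \<in> X \<longleftrightarrow> p \<in> Plain ` I \<union> Bar ` I"
    proof (cases p)
      case (Plain i)
      then show ?thesis using Xs by (auto simp: I_def)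
    next
      case (Bar i)
      then show ?thesis using Xs B[of i] by (auto simp: I_def)
    qed
  qed
  moreover have "I \<in> Pow (set is)" by (auto simp: I_def)
  ultimately show "X \<in> (\<lambda>I. Plain ` I \<union> Bar ` I) ` Pow (set is)" by blast
next
  fix X assume "X \<in> (\<lambda>I. Plain ` I \<union> Bar ` I) ` Pow (set is)"
  then obtain I where "I \<subseteq> set is" "X = Plain ` I \<union> Bar ` I" by auto
  then show "X \<in> paired_sets (barred_circle is)"
    unfolding paired_sets_def set_barred_circle by auto
qed

lemma moment_barred_circle:
  "moment \<phi> x (barred_circle is) = moment \<phi> (\<lambda>i. x (Plain i) * x (Bar i)) is"
proof -
  have "prod_list (map x (barred_circle is)) = prod_list (map (\<lambda>i. x (Plain i) * x (Bar i)) is)"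
    by (induction "is") (auto simp: mult.assoc)
  then show ?thesis by (simp add: moment_def)
qed

text \<open>Gaps of a set of whole pairs: nothing lies between a plain point and its bar, and behind
  the bar comes the barred copy of an arc of \<open>I\<close>.\<close>

lemma arcs_barred_circle:
  assumes "distinct is" "I \<subseteq> set is" "i \<in> I"
  shows "arc (barred_circle is) (Plain ` I \<union> Bar ` I) (Plain i) = []"
    "arc (barred_circle is) (Plain ` I \<union> Bar ` I) (Bar i) = barred_circle (arc is I i)"
proof -
  have i: "i \<in> set is" using assms by blast
  have d: "distinct (barred_circle is)" by (rule distinct_barred_circle[OF assms(1)])
  obtain z where z: "cyc is (i # arc is I i @ z)" "z = [] \<or> hd z \<in> I" "set (arc is I i) \<inter> I = {}"
    by (rule arcE[OF assms(1,3) i])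
  have "cyc (barred_circle is) (Plain i # [] @ (Bar i # barred_circle (arc is I i @ z)))"
    using cyc_barred_circle[OF z(1)] by simp
  then show "arc (barred_circle is) (Plain ` I \<union> Bar ` I) (Plain i) = []"
    by (rule arc_eqI[OF d]) (use assms in auto)
  have "cyc (barred_circle is) (Bar i # barred_circle (arc is I i) @ (barred_circle z @ [Plain i]))"
    using cyc_barred_circle_Bar[OF z(1)] by simp
  then show "arc (barred_circle is) (Plain ` I \<union> Bar ` I) (Bar i) = barred_circle (arc is I i)"
  proof (rule arc_eqI[OF d])
    show "set (barred_circle (arc is I i)) \<inter> (Plain ` I \<union> Bar ` I) = {}"
      using z(3) by (auto simp: set_barred_circle)
    show "barred_circle z @ [Plain i] = [] \<or> hd (barred_circle z @ [Plain i]) \<in> Plain ` I \<union> Bar ` I"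
      using z(2) assms(3) by (cases z) auto
  qed
qed

context coloured_algebras
begin

text \<open>Paired sets of the barred circle are sets \<open>I\<close> of indices, and the gaps are
  words in the products. So \<open>cyclic_moment_circular\<close> is the recursion
  \<open>dkap_blocks\<close> for the products, with \<open>circle_sum\<close> in place of the cyclic
  cumulants; induction identifies all terms but the full one.\<close>

lemma dkap_products:
  assumes "distinct is" "is \<noteq> []" "coloured pcol x (barred_circle is)"
  shows "dkap \<psi> D (\<lambda>i. x (Plain i) * x (Bar i)) is = circle_sum \<psi> D x (barred_circle is)"
  using assms
proof (induction "length is" arbitrary: "is" rule: less_induct)
  case less
  let ?y = "\<lambda>i. x (Plain i) * x (Bar i)"
  let ?X = "\<lambda>I. Plain ` I \<union> Bar ` I"
  note d = less.prems(1) and ne = less.prems(2)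
  define P where "P I = (\<Prod>i\<in>I. moment \<psi> ?y (arc is I i))" for I
  have inj: "inj_on ?X (Pow (set is))" by (rule inj_onI) blast
  have prods: "(\<Prod>u\<in>?X I. moment \<psi> x (arc (barred_circle is) (?X I) u)) = P I" if I: "I \<subseteq> set is" for I
  proof -
    have fin: "finite I" using I finite_subset by blast
    have "(\<Prod>u\<in>?X I. moment \<psi> x (arc (barred_circle is) (?X I) u)) =
        (\<Prod>u\<in>Plain ` I. moment \<psi> x (arc (barred_circle is) (?X I) u)) *
        (\<Prod>u\<in>Bar ` I. moment \<psi> x (arc (barred_circle is) (?X I) u))"
      using fin by (intro prod.union_disjoint) auto
    also have "(\<Prod>u\<in>Plain ` I. moment \<psi> x (arc (barred_circle is) (?X I) u)) = 1"
      using arcs_barred_circle(1)[OF d I] by (intro prod.neutral) (auto simp: moment_def psi_one)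
    also have "(\<Prod>u\<in>Bar ` I. moment \<psi> x (arc (barred_circle is) (?X I) u)) = P I"
      using arcs_barred_circle(2)[OF d I] by (simp add: prod.reindex inj_on_def P_def moment_barred_circle)
    finally show ?thesis by simp
  qed
  have "moment D x (barred_circle is) = (\<Sum>X | X \<in> ?X ` Pow (set is) \<and> X \<noteq> {}.
      circle_sum \<psi> D x (listing (barred_circle is) X) * (\<Prod>u\<in>X. moment \<psi> x (arc (barred_circle is) X u)))"
    using cyclic_moment_circular[OF circular_barred_circle[OF d ne] less.prems(3)]
    unfolding paired_sets_barred_circle .
  also have "{X. X \<in> ?X ` Pow (set is) \<and> X \<noteq> {}} = ?X ` {I. I \<noteq> {} \<and> I \<subseteq> set is}" by auto
  also have "(\<Sum>X\<in>?X ` {I. I \<noteq> {} \<and> I \<subseteq> set is}.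
      circle_sum \<psi> D x (listing (barred_circle is) X) * (\<Prod>u\<in>X. moment \<psi> x (arc (barred_circle is) X u))) =
      (\<Sum>I | I \<noteq> {} \<and> I \<subseteq> set is. circle_sum \<psi> D x (barred_circle (listing is I)) * P I)"
  proof (subst sum.reindex)
    show "inj_on ?X {I. I \<noteq> {} \<and> I \<subseteq> set is}" by (rule inj_on_subset[OF inj]) auto
    show "sum ((\<lambda>X. circle_sum \<psi> D x (listing (barred_circle is) X) * (\<Prod>u\<in>X. moment \<psi> x (arc (barred_circle is) X u))) \<circ> ?X)
        {I. I \<noteq> {} \<and> I \<subseteq> set is} = (\<Sum>I | I \<noteq> {} \<and> I \<subseteq> set is. circle_sum \<psi> D x (barred_circle (listing is I)) * P I)"
    proof (rule sum.cong[OF refl])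
      fix I assume "I \<in> {I. I \<noteq> {} \<and> I \<subseteq> set is}"
      then have "I \<subseteq> set is" by blast
      then show "((\<lambda>X. circle_sum \<psi> D x (listing (barred_circle is) X) *
          (\<Prod>u\<in>X. moment \<psi> x (arc (barred_circle is) X u))) \<circ> ?X) I =
          circle_sum \<psi> D x (barred_circle (listing is I)) * P I"
        unfolding comp_def by (simp only: prods listing_barred_circle)
    qed
  qed
  also have "\<dots> = circle_sum \<psi> D x (barred_circle is) + (\<Sum>I | I \<noteq> {} \<and> I \<subset> set is. circle_sum \<psi> D x (barred_circle (listing is I)) * P I)"
  proof -
    have "{I. I \<noteq> {} \<and> I \<subseteq> set is} = insert (set is) {I. I \<noteq> {} \<and> I \<subset> set is}" using ne by auto
    moreover have "finite {I. I \<noteq> {} \<and> I \<subset> set is}" by (rule finite_subset[of _ "Pow (set is)"]) auto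
    moreover have "P (set is) = 1" unfolding P_def using arc_full[OF d] by (simp add: moment_def psi_one)
    ultimately show ?thesis by (simp add: listing_full)
  qed
  also have "(\<Sum>I | I \<noteq> {} \<and> I \<subset> set is. circle_sum \<psi> D x (barred_circle (listing is I)) * P I) =
      (\<Sum>I | I \<noteq> {} \<and> I \<subset> set is. dkap \<psi> D ?y (listing is I) * P I)"
  proof (rule sum.cong[OF refl])
    fix I assume "I \<in> {I. I \<noteq> {} \<and> I \<subset> set is}"
    then have I: "I \<noteq> {}" "I \<subset> set is" by auto
    have "listing is I \<noteq> []" using I by (auto simp: filter_empty_conv)
    moreover have "coloured pcol x (barred_circle (listing is I))"
      by (rule coloured_subset[OF less.prems(3)]) (auto simp: set_barred_circle)
    ultimately have "dkap \<psi> D ?y (listing is I) = circle_sum \<psi> D x (barred_circle (listing is I))"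
      using less.hyps[OF length_listing_less[OF d I(2)]] d by simp
    then show "circle_sum \<psi> D x (barred_circle (listing is I)) * P I = dkap \<psi> D ?y (listing is I) * P I" by simp
  qed
  finally have "moment D ?y is = circle_sum \<psi> D x (barred_circle is) +
      (\<Sum>I | I \<noteq> {} \<and> I \<subset> set is. dkap \<psi> D ?y (listing is I) * P I)"
    by (simp add: moment_barred_circle)
  then show ?case unfolding dkap_blocks'[OF d ne] P_def by simp
qed

end

section \<open>The Kreweras complement\<close>

text \<open>Two points of one colour that no block of the other colour separates lie in the same block.
  The first block met after \<open>p\<close> ends before \<open>q\<close>; completeness links \<open>p\<close> to the point behind it.\<close>

lemma complete_linked:
  assumes circ: "circular cs" and nc: "\<rho> \<in> NC_on cs" and comp: "complete cs \<rho>"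
    and mono: "\<And>W. W \<in> \<rho> \<Longrightarrow> monochrome pcol W"
    and "cyc cs (p # g @ q # z)" "pcol p = pcol q"
    and "\<And>W. W \<in> \<rho> \<Longrightarrow> W \<inter> set g \<noteq> {} \<Longrightarrow> W \<inter> set z \<noteq> {} \<Longrightarrow> \<forall>w\<in>W. pcol w = pcol p"
  shows "\<exists>U\<in>\<rho>. p \<in> U \<and> q \<in> U"
  using assms(5-7)
proof (induction "length g" arbitrary: p g z rule: less_induct)
  case less
  have d: "distinct cs" using circ by (simp add: circular_def)
  have cy: "cyc cs (p # g @ q # z)" and col: "pcol p = pcol q" by fact+
  have dl: "distinct (p # g @ q # z)" using cyc_distinct[OF cy] d by simp
  have scs: "set cs = set (p # g @ q # z)" using cyc_set[OF cy] by simp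
  have suc: "successively step (p # g @ [q])"
    using circular_successively[OF circ, of "[]" "p # g @ [q]" z] cy by simp
  have gne: "g \<noteq> []" using suc step_pcol[of p q] col by auto
  have "step p (hd g)" using suc gne by (auto simp: successively_Cons)
  then have ch: "pcol (hd g) \<noteq> pcol p" using step_pcol by metis
  \<comment> \<open>\<open>V\<close> has the other colour; if it also met \<open>z\<close> it would
    separate \<open>p\<close> from \<open>q\<close>. So it stays within \<open>g\<close>.\<close>
  obtain V where V: "V \<in> \<rho>" "hd g \<in> V" using NC_onD(7)[OF nc, of "hd g"] scs gne by auto
  have VS: "V \<subseteq> set cs" using NC_onD(2)[OF nc V(1)] .
  have colV: "pcol w \<noteq> pcol p" if "w \<in> V" for w
    using mono[OF V(1)] V(2) that ch unfolding monochrome_def by metis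
  have Vz: "V \<inter> set z = {}"
  proof (rule ccontr)
    assume "V \<inter> set z \<noteq> {}"
    moreover have "V \<inter> set g \<noteq> {}" using V(2) gne by auto
    ultimately show False using less.prems(3)[OF V(1)] V(2) ch by blast
  qed
  have "p \<notin> V" "q \<notin> V" using colV col by metis+
  then have Vg: "V \<subseteq> set g" using VS scs Vz by auto
  obtain g1 v g2 where g: "g = g1 @ v # g2" "v \<in> V" "\<forall>y\<in>set g2. y \<notin> V"
  proof -
    have "\<exists>v\<in>set g. v \<in> V" using V(2) gne by auto
    then show thesis using split_list_last_prop[of g "\<lambda>v. v \<in> V"] that by metis
  qed
  have "cyc cs (v # (g2 @ q # z @ [p]) @ g1)"
    using cyc_trans[OF cy] cyc_append[of "p # g1" "v # g2 @ q # z"] g(1) by simp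
  then have arcv: "arc cs V v = g2 @ q # z @ [p]"
  proof (rule arc_eqI[OF d])
    show "set (g2 @ q # z @ [p]) \<inter> V = {}" using g(3) Vz \<open>p \<notin> V\<close> \<open>q \<notin> V\<close> by auto
    show "g1 = [] \<or> hd g1 \<in> V" using V(2) g(1) by (cases g1) auto
  qed
  have "linked \<rho> (arc cs V v)" using comp V(1) g(2) unfolding complete_def by blast
  then obtain U where U: "U \<in> \<rho>" "hd (g2 @ [q]) \<in> U" "p \<in> U"
    unfolding linked_def arcv by (cases g2) auto
  show ?case
  proof (cases g2)
    case Nil
    then show ?thesis using U by auto
  next
    case (Cons k g3)
    have kU: "k \<in> U" using U Cons by simp
    have ck: "pcol k = pcol p" using mono[OF U(1)] kU U(3) unfolding monochrome_def by blast
    have "cyc cs (k # g3 @ q # (z @ p # g1 @ [v]))"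
      using cyc_trans[OF cy] cyc_append[of "p # g1 @ [v]" "k # g3 @ q # z"] g(1) Cons by simp
    moreover have "length g3 < length g" using g(1) Cons by simp
    moreover have "pcol k = pcol q" using ck col by simp
    \<comment> \<open>A block of the other colour separating \<open>k\<close> from \<open>q\<close>
      meets \<open>g\<close>, so it avoids \<open>z\<close> by hypothesis. It would have to reach
      back to \<open>g1\<close>, across \<open>V\<close>.\<close>
    moreover have "\<forall>w\<in>W. pcol w = pcol k"
      if W: "W \<in> \<rho>" "W \<inter> set g3 \<noteq> {}" "W \<inter> set (z @ p # g1 @ [v]) \<noteq> {}" for W
    proof (rule ccontr)
      assume n: "\<not> ?thesis"
      then obtain w0 where w0: "w0 \<in> W" "pcol w0 \<noteq> pcol p" using ck by auto
      have Wg: "W \<inter> set g \<noteq> {}" using W(2) g(1) Cons by auto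
      have pW: "p \<notin> W" using mono[OF W(1)] w0 unfolding monochrome_def by metis
      have WV: "W \<noteq> V" using W(2) g(3) Cons by auto
      have dj: "W \<inter> V = {}" by (rule NC_onD(4)[OF nc W(1) V(1) WV])
      have "W \<inter> set z = {}"
      proof (rule ccontr)
        assume "W \<inter> set z \<noteq> {}"
        then have "\<forall>w\<in>W. pcol w = pcol p" by (rule less.prems(3)[OF W(1) Wg])
        then show False using w0 by blast
      qed
      then obtain y' where y': "y' \<in> W" "y' \<in> set g1" using W(3) pW dj g(2) by auto
      obtain y where y: "y \<in> W" "y \<in> set g3" using W(2) by blast
      obtain u where u: "u \<in> V" "W \<subseteq> set (arc cs V u)"
        by (rule NC_on_arc[OF d nc V(1) W(1) WV[symmetric]])
      have "y \<in> set (arc cs V v)" using y Cons arcv by auto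
      then have "u = v" using arc_unique[OF d VS u(1) g(2)] u(2) y by blast
      then have "y' \<in> set (g2 @ q # z @ [p])" using u(2) y' arcv by auto
      then show False using y' dl g(1) by auto
    qed
    ultimately obtain U' where U': "U' \<in> \<rho>" "k \<in> U'" "q \<in> U'" using less.hyps[of g3 k] by blast
    then have "U' = U" using NC_onD(4)[OF nc U'(1) U(1)] kU by blast
    then show ?thesis using U U' by auto
  qed
qed

text \<open>An explicit model of the Kreweras complement: two bars are related if no block of
  \<open>\<pi>\<close> separates them.\<close>

definition kr_rel :: "'i list \<Rightarrow> 'i set set \<Rightarrow> ('i \<times> 'i) set" where
  "kr_rel is \<pi> = {(i, j). i \<in> set is \<and> j \<in> set is \<and> (\<forall>V\<in>\<pi>. \<forall>v\<in>V.
     Bar i \<in> set (arc (barred_circle is) (Plain ` V) (Plain v)) \<longleftrightarrow>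
     Bar j \<in> set (arc (barred_circle is) (Plain ` V) (Plain v)))}"

definition with_bars :: "'i set set \<Rightarrow> 'i set set \<Rightarrow> 'i point set set" where
  "with_bars \<pi> \<sigma> = (`) Plain ` \<pi> \<union> (`) Bar ` \<sigma>"

lemma equiv_kr_rel: "equiv (set is) (kr_rel is \<pi>)"
  by (rule equivI) (auto simp: kr_rel_def refl_on_def sym_def trans_def)

lemma filter_Plain_barred_circle: "filter (\<lambda>p. pcol p = 1) (barred_circle is) = map Plain is"
  by (induction "is") auto

lemma filter_Bar_barred_circle: "filter (\<lambda>p. pcol p = 2) (barred_circle is) = map Bar is"
  by (induction "is") auto

lemma filter_arc_barred_circle:
  assumes "distinct is" "V \<subseteq> set is" "v \<in> V" "C = Plain \<and> c = 1 \<or> C = Bar \<and> c = 2"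
  shows "filter (\<lambda>p. pcol p = c) (arc (barred_circle is) (C ` V) (C v)) = map C (arc is V v)"
proof -
  have d: "distinct (barred_circle is)" by (rule distinct_barred_circle[OF assms(1)])
  have "filter (\<lambda>p. pcol p = c) (barred_circle is) = map C is"
    using assms(4) filter_Plain_barred_circle filter_Bar_barred_circle by auto
  moreover have "arc (filter (\<lambda>p. pcol p = c) (barred_circle is)) (C ` V) (C v) =
      filter (\<lambda>p. pcol p = c) (arc (barred_circle is) (C ` V) (C v))"
    using assms by (intro arc_filter[OF d]) (auto simp: set_barred_circle)
  moreover have "arc (map C is) (C ` V) (C v) = map C (arc is V v)"
    using assms by (intro arc_map) (auto simp: inj_on_def)
  ultimately show ?thesis by simp
qed

lemma same_colour_arc_iff:
  assumes "distinct is" "V \<subseteq> set is" "v \<in> V" "C = Plain \<or> C = Bar"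
  shows "C j \<in> set (arc (barred_circle is) (C ` V) (C v)) \<longleftrightarrow> j \<in> set (arc is V v)"
proof -
  define c where "c = (if C = Plain then 1 else 2 :: nat)"
  have C: "C = Plain \<and> c = 1 \<or> C = Bar \<and> c = 2" "pcol (C j) = c" "inj C"
    using assms(4) by (auto simp: c_def inj_on_def fun_eq_iff)
  have "C j \<in> set (arc (barred_circle is) (C ` V) (C v)) \<longleftrightarrow>
      C j \<in> set (filter (\<lambda>p. pcol p = c) (arc (barred_circle is) (C ` V) (C v)))"
    using C(2) by simp
  also have "\<dots> \<longleftrightarrow> j \<in> set (arc is V v)"
    unfolding filter_arc_barred_circle[OF assms(1-3) C(1)] using C(3) by (auto simp: inj_def)
  finally show ?thesis .
qed

text \<open>Provides a complete partition with prescribed plain part. Non-crossing: a class lies in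
  one arc of each plain block, and two classes are separated by some plain block. Completeness: the
  ends of an arc are shown not to be separated, or to lie in one plain block.\<close>

lemma kr_partition:
  assumes dist: "distinct is" and ne: "is \<noteq> []" and nc: "\<pi> \<in> NC_on is"
  defines "\<rho> \<equiv> with_bars \<pi> (set is // kr_rel is \<pi>)"
  shows "\<rho> \<in> NC_on (barred_circle is)" "complete (barred_circle is) \<rho>"
    "\<And>W. W \<in> \<rho> \<Longrightarrow> monochrome pcol W"
proof -
  define cs where "cs = barred_circle is"
  have circ: "circular cs" unfolding cs_def by (rule circular_barred_circle[OF dist ne])
  have d: "distinct cs" using circ by (simp add: circular_def)
  have scs: "set cs = Plain ` set is \<union> Bar ` set is" by (simp add: cs_def set_barred_circle)
  have part: "partition_on (set is) (set is // kr_rel is \<pi>)"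
    by (rule partition_on_quotient[OF equiv_kr_rel])
  have same: "Bar i \<in> set (arc cs (Plain ` V) (Plain v)) \<longleftrightarrow> Bar j \<in> set (arc cs (Plain ` V) (Plain v))"
    if "U \<in> set is // kr_rel is \<pi>" "i \<in> U" "j \<in> U" "V \<in> \<pi>" "v \<in> V" for U i j V v
  proof -
    have "(i, j) \<in> kr_rel is \<pi>"
      using that(1-3) equiv_kr_rel by (meson in_quotient_imp_in_rel empty_subsetI insert_subset)
    then show ?thesis using that(4,5) unfolding kr_rel_def cs_def by blast
  qed
  have rel: "\<exists>U\<in>set is // kr_rel is \<pi>. i \<in> U \<and> j \<in> U"
    if "i \<in> set is" "j \<in> set is"
      "\<And>V v. V \<in> \<pi> \<Longrightarrow> v \<in> V \<Longrightarrow> Bar i \<in> set (arc cs (Plain ` V) (Plain v)) \<longleftrightarrow> Bar j \<in> set (arc cs (Plain ` V) (Plain v))"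
    for i j
  proof -
    have "(i, j) \<in> kr_rel is \<pi>" using that unfolding kr_rel_def cs_def by blast
    moreover have "i \<in> kr_rel is \<pi> `` {i}" using equiv_class_self[OF equiv_kr_rel that(1)] .
    ultimately show ?thesis using quotientI[OF that(1)] by blast
  qed
  have Vs: "V \<subseteq> set is" "V \<noteq> {}" "Plain ` V \<subseteq> set cs" "Plain ` V \<noteq> {}" if "V \<in> \<pi>" for V
    using NC_onD(2,3)[OF nc that] scs by auto
  have Us: "U \<subseteq> set is" "U \<noteq> {}" "Bar ` U \<subseteq> set cs" "Bar ` U \<noteq> {}" if "U \<in> set is // kr_rel is \<pi>" for U
    using part that scs unfolding partition_on_def by auto
  have class_unique: "X = Y" if "X \<in> set is // kr_rel is \<pi>" "Y \<in> set is // kr_rel is \<pi>" "k \<in> X" "k \<in> Y" for X Y k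
    using quotient_disj[OF equiv_kr_rel that(1,2)] that(3,4) by blast
  have UinV: "\<exists>v\<in>V. Bar ` U \<subseteq> set (arc cs (Plain ` V) (Plain v))"
    if U: "U \<in> set is // kr_rel is \<pi>" and V: "V \<in> \<pi>" for U V
  proof -
    obtain i where i: "i \<in> U" using Us(2)[OF U] by blast
    have "Bar i \<in> set cs" "Bar i \<notin> Plain ` V" using i Us(1)[OF U] scs by auto
    then obtain v where v: "v \<in> V" "Bar i \<in> set (arc cs (Plain ` V) (Plain v))"
      using arc_cover[OF d Vs(3)[OF V] Vs(4)[OF V]] by auto
    then have "Bar ` U \<subseteq> set (arc cs (Plain ` V) (Plain v))" using same[OF U _ i V] by blast
    with v show ?thesis by blast
  qed
  have VinV: "\<exists>v\<in>V. Plain ` V' \<subseteq> set (arc cs (Plain ` V) (Plain v))"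
    if V: "V \<in> \<pi>" "V' \<in> \<pi>" "V \<noteq> V'" for V V'
  proof -
    obtain v where v: "v \<in> V" "V' \<subseteq> set (arc is V v)" by (rule NC_on_arc[OF dist nc V])
    then have "Plain ` V' \<subseteq> set (arc cs (Plain ` V) (Plain v))"
      unfolding cs_def using same_colour_arc_iff[OF dist Vs(1)[OF V(1)] v(1), of Plain] by blast
    with v show ?thesis by blast
  qed
  have arcs: "\<exists>x\<in>A. B \<subseteq> set (arc cs A x)" if AB: "A \<in> \<rho>" "B \<in> \<rho>" "A \<noteq> B" for A B
  proof -
    consider V where "V \<in> \<pi>" "A = Plain ` V" | U where "U \<in> set is // kr_rel is \<pi>" "A = Bar ` U"
      using AB(1) unfolding \<rho>_def with_bars_def by blast
    then show ?thesis
    proof cases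
      case A: 1
      consider V' where "V' \<in> \<pi>" "B = Plain ` V'" | U where "U \<in> set is // kr_rel is \<pi>" "B = Bar ` U"
        using AB(2) unfolding \<rho>_def with_bars_def by blast
      then show ?thesis
      proof cases
        case B: 1
        then have "V \<noteq> V'" using A AB(3) by blast
        then obtain v where "v \<in> V" "Plain ` V' \<subseteq> set (arc cs (Plain ` V) (Plain v))"
          using VinV[OF A(1) B(1)] by blast
        then show ?thesis unfolding A(2) B(2) by blast
      next
        case B: 2
        then obtain v where "v \<in> V" "Bar ` U \<subseteq> set (arc cs (Plain ` V) (Plain v))"
          using UinV[OF B(1) A(1)] by blast
        then show ?thesis unfolding A(2) B(2) by blast
      qed
    next
      case A: 2
      \<comment> \<open>A plain block with the class in one of its arcs and \<open>B\<close> outside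
        that arc puts \<open>B\<close> behind a single point of the class.\<close>
      have sep: "\<exists>x\<in>A. B \<subseteq> set (arc cs A x)"
        if V: "V \<in> \<pi>" "v \<in> V" "Bar ` U \<subseteq> set (arc cs (Plain ` V) (Plain v))"
          "B \<subseteq> set cs - set (arc cs (Plain ` V) (Plain v))" for V v
      proof -
        have "Plain v \<in> Plain ` V" using V by blast
        then obtain w where "w \<in> Bar ` U" "set cs - set (arc cs (Plain ` V) (Plain v)) \<subseteq> set (arc cs (Bar ` U) w)"
          using arc_within[OF d Vs(3)[OF V(1)] _ V(3) Us(4)[OF A(1)]] by blast
        then show ?thesis unfolding A(2) using V(4) by blast
      qed
      consider V' where "V' \<in> \<pi>" "B = Plain ` V'" | U' where "U' \<in> set is // kr_rel is \<pi>" "B = Bar ` U'"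
        using AB(2) unfolding \<rho>_def with_bars_def by blast
      then show ?thesis
      proof cases
        case B: 1
        obtain v where v: "v \<in> V'" "Bar ` U \<subseteq> set (arc cs (Plain ` V') (Plain v))"
          using UinV[OF A(1) B(1)] by blast
        have "B \<subseteq> set cs - set (arc cs (Plain ` V') (Plain v))"
          using arc_subset[OF d, of "Plain v" "Plain ` V'"] v Vs(3)[OF B(1)] B by blast
        then show ?thesis using sep[OF B(1) v] by blast
      next
        case B: 2
        obtain i j where ij: "i \<in> U" "j \<in> U'" using Us(2) A B by blast
        \<comment> \<open>Points of different classes are unrelated, which yields the separating
          plain block.\<close>
        have "\<not> (\<exists>X\<in>set is // kr_rel is \<pi>. i \<in> X \<and> j \<in> X)"
        proof
          assume "\<exists>X\<in>set is // kr_rel is \<pi>. i \<in> X \<and> j \<in> X"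
          then obtain X where "X \<in> set is // kr_rel is \<pi>" "i \<in> X" "j \<in> X" by blast
          then have "X = U" "X = U'" using class_unique A(1) B(1) ij by metis+
          then show False using A(2) B(2) AB(3) by simp
        qed
        moreover have "i \<in> set is" "j \<in> set is" using ij Us(1)[OF A(1)] Us(1)[OF B(1)] by auto
        ultimately obtain V v where V: "V \<in> \<pi>" "v \<in> V"
          "(Bar i \<in> set (arc cs (Plain ` V) (Plain v))) \<noteq> (Bar j \<in> set (arc cs (Plain ` V) (Plain v)))"
          using rel[of i j] by metis
        obtain w w' where w: "w \<in> V" "Bar ` U \<subseteq> set (arc cs (Plain ` V) (Plain w))"
          "w' \<in> V" "Bar ` U' \<subseteq> set (arc cs (Plain ` V) (Plain w'))"
          using UinV[OF A(1) V(1)] UinV[OF B(1) V(1)] by blast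
        have "w \<noteq> w'"
        proof
          assume e: "w = w'"
          have "Bar i \<in> set (arc cs (Plain ` V) (Plain w))" "Bar j \<in> set (arc cs (Plain ` V) (Plain w))"
            using w ij e by auto
          then have "Bar k \<in> set (arc cs (Plain ` V) (Plain v)) \<longleftrightarrow> v = w" if "k = i \<or> k = j" for k
            using that arc_unique[OF d Vs(3)[OF V(1)], of "Plain v" "Plain w" "Bar k"] V(2) w(1) by auto
          then show False using V(3) by blast
        qed
        then have "set (arc cs (Plain ` V) (Plain w)) \<inter> set (arc cs (Plain ` V) (Plain w')) = {}"
          using w by (intro arc_disjoint[OF d Vs(3)[OF V(1)]]) auto
        then have "B \<subseteq> set cs - set (arc cs (Plain ` V) (Plain w))"
          using w(4) B Us(3)[OF B(1)] by blast
        then show ?thesis using sep[OF V(1) w(1,2)] by blast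
      qed
    qed
  qed
  have "\<Union> \<rho> = set cs"
  proof -
    have "\<Union> \<pi> = set is" "\<Union> (set is // kr_rel is \<pi>) = set is"
      using NC_onD(1)[OF nc] part by (auto simp: partition_on_def)
    moreover have "\<Union> \<rho> = Plain ` \<Union> \<pi> \<union> Bar ` \<Union> (set is // kr_rel is \<pi>)"
      unfolding \<rho>_def with_bars_def by blast
    ultimately show ?thesis unfolding scs by simp
  qed
  moreover have "{} \<notin> \<rho>" 
  proof
    assume "{} \<in> \<rho>"
    then have "(\<exists>V\<in>\<pi>. Plain ` V = {}) \<or> (\<exists>U\<in>set is // kr_rel is \<pi>. Bar ` U = {})"
      unfolding \<rho>_def with_bars_def by auto
    then show False using Vs(4) Us(4) by metis
  qed
  moreover have "disjoint \<rho>"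
  proof -
    have "A \<inter> B = {}" if AB: "A \<in> \<rho>" "B \<in> \<rho>" "A \<noteq> B" for A B
    proof -
      obtain x where x: "x \<in> A" "B \<subseteq> set (arc cs A x)" using arcs[OF AB] by blast
      have "x \<in> set cs" using x AB(1) \<open>\<Union> \<rho> = set cs\<close> by blast
      then show ?thesis using arc_subset[OF d x(1)] x by blast
    qed
    then show ?thesis by (auto simp: disjoint_def)
  qed
  ultimately have nc\<rho>: "\<rho> \<in> NC_on cs" using arcs NC_on_iff[OF d] by (auto simp: partition_on_def)
  then show "\<rho> \<in> NC_on (barred_circle is)" by (simp add: cs_def)
  show mono: "monochrome pcol W" if "W \<in> \<rho>" for W
    using that unfolding \<rho>_def with_bars_def monochrome_def by auto
  \<comment> \<open>One implication suffices: \<open>Bar i\<close> lies in exactly one arc of each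
    plain block, and this arc then also contains \<open>Bar j\<close>.\<close>
  have linkB: "\<exists>U\<in>\<rho>. Bar i \<in> U \<and> Bar j \<in> U"
    if ij: "i \<in> set is" "j \<in> set is"
      "\<And>V v. V \<in> \<pi> \<Longrightarrow> v \<in> V \<Longrightarrow> Bar i \<in> set (arc cs (Plain ` V) (Plain v)) \<Longrightarrow> Bar j \<in> set (arc cs (Plain ` V) (Plain v))"
    for i j
  proof -
    have "Bar i \<in> set (arc cs (Plain ` V) (Plain v)) \<longleftrightarrow> Bar j \<in> set (arc cs (Plain ` V) (Plain v))"
      if V: "V \<in> \<pi>" "v \<in> V" for V v
    proof -
      have "Bar i \<in> set cs" "Bar i \<notin> Plain ` V" using \<open>i \<in> set is\<close> scs by auto
      then obtain w where w: "w \<in> V" "Bar i \<in> set (arc cs (Plain ` V) (Plain w))"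
        using arc_cover[OF d Vs(3)[OF V(1)] Vs(4)[OF V(1)]] by auto
      then have "Bar j \<in> set (arc cs (Plain ` V) (Plain w))" using ij(3)[OF V(1)] by blast
      then have "Bar k \<in> set (arc cs (Plain ` V) (Plain v)) \<longleftrightarrow> v = w" if "k = i \<or> k = j" for k
        using that w arc_unique[OF d Vs(3)[OF V(1)], of "Plain v" "Plain w" "Bar k"] V(2) by auto
      then show ?thesis by blast
    qed
    then obtain U where "U \<in> set is // kr_rel is \<pi>" "i \<in> U" "j \<in> U" using rel[OF ij(1,2)] by blast
    then show ?thesis unfolding \<rho>_def with_bars_def by blast
  qed
  \<comment> \<open>An arc of a plain block can be left only through a plain point, so bars next to
    a plain point of the arc belong to it too.\<close>
  have spread: "Bar m \<in> set (arc cs (Plain ` W) (Plain w))"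
    if W: "W \<in> \<pi>" "w \<in> W" and u: "Plain u \<in> set (arc cs (Plain ` W) (Plain w))"
      and adj: "(\<exists>r. cyc cs (Plain u # Bar m # r)) \<or> (\<exists>r. cyc cs (Bar m # Plain u # r))" for W w u m
    using adj arc_adjacent_next[OF d _ Vs(3)[OF W(1)] _ u] arc_adjacent_prev[OF d _ Vs(3)[OF W(1)] _ u] W(2)
    by blast
  show "complete (barred_circle is) \<rho>"
    unfolding complete_def cs_def[symmetric]
  proof (intro ballI)
    fix A x assume A: "A \<in> \<rho>" and x: "x \<in> A"
    have AS: "A \<subseteq> set cs" using NC_onD(2)[OF nc\<rho> A] .
    have xc: "x \<in> set cs" using AS x by blast
    obtain z where z: "cyc cs (x # arc cs A x @ z)" "z = [] \<or> hd z \<in> A"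
      "distinct (x # arc cs A x @ z)" "set (arc cs A x) \<inter> A = {}"
      "set cs = insert x (set (arc cs A x) \<union> set z)"
      by (rule arcE[OF d x xc])
    define a where "a = arc cs A x"
    have alternating: "alternating a" unfolding a_def by (rule circular_good_arc[OF circ mono[OF A] AS x])
    then have ane: "a \<noteq> []" by (simp add: alternating_def)
    have za: "cyc cs (x # a @ z)" using z(1) by (simp add: a_def)
    have hda: "hd a # (tl a @ w) = a @ w" and lasta: "butlast a @ last a # w = a @ w" for w
      using ane by (cases a; simp) (metis append_butlast_last_id[OF ane] append.assoc append_Cons append_Nil)
    have first: "cyc cs (x # hd a # (tl a @ z))" unfolding hda by (rule za)
    have stx: "step x (hd a)" using circ first unfolding circular_def by blast
    obtain y r where y: "y \<in> A" "cyc cs (last a # y # r)"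
    proof (cases z)
      case Nil
      then have "cyc cs ((x # butlast a) @ [last a])" using za ane by simp
      then have "cyc cs ([last a] @ x # butlast a)" by (rule cyc_trans[OF _ cyc_append])
      then have "cyc cs (last a # x # butlast a)" by simp
      then show thesis using that x by blast
    next
      case (Cons y ys)
      have "cyc cs ((x # butlast a) @ (last a # y # ys))" using za unfolding Cons by (simp only: append_Cons lasta)
      then have "cyc cs ((last a # y # ys) @ x # butlast a)" by (rule cyc_trans[OF _ cyc_append])
      then have "cyc cs (last a # y # (ys @ x # butlast a))" by simp
      then show thesis using that Cons z(2) by auto
    qed
    have sty: "step (last a) y" using circ y(2) unfolding circular_def by blast
    have ac: "set a \<subseteq> set cs" using z(5) a_def by auto
    consider V where "V \<in> \<pi>" "A = Plain ` V" | U where "U \<in> set is // kr_rel is \<pi>" "A = Bar ` U"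
      using A unfolding \<rho>_def with_bars_def by blast
    then show "linked \<rho> (arc cs A x)"
    proof cases
      case 1
      obtain v where v: "v \<in> V" "x = Plain v" using x 1 by blast
      obtain v' where v': "v' \<in> V" "y = Plain v'" using y 1 by blast
      have h: "hd a = Bar v" using stx v by simp
      obtain l where l: "last a = Bar l" using sty v' by (cases "last a") auto
      \<comment> \<open>The arc behind \<open>Plain v\<close> begins with \<open>Bar v\<close> and
        ends with the bar before the next point \<open>v'\<close> of \<open>V\<close>. The block
        \<open>V\<close> has both in one arc, and any other plain block has all of \<open>V\<close>,
        with its neighbouring bars, in one arc.\<close>
      have "\<exists>U\<in>\<rho>. Bar v \<in> U \<and> Bar l \<in> U"
      proof (rule linkB)
        show "v \<in> set is" "l \<in> set is" using v Vs(1)[OF 1(1)] ac last_in_set[OF ane] l scs by auto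
        fix W w assume W: "W \<in> \<pi>" "w \<in> W" and i: "Bar v \<in> set (arc cs (Plain ` W) (Plain w))"
        have pw: "Plain w \<in> Plain ` W" using W by blast
        show "Bar l \<in> set (arc cs (Plain ` W) (Plain w))"
        proof (cases "W = V")
          case True
          have "Bar v \<in> set (arc cs A x)" using h ane a_def hd_in_set[OF ane] by simp
          then have "Plain w = x"
            using arc_unique[OF d AS pw[unfolded True, folded 1(2)] x] i True 1(2) by blast
          then show ?thesis using True 1(2) l last_in_set[OF ane] a_def by simp
        next
          case False
          then obtain w0 where w0: "w0 \<in> W" "Plain ` V \<subseteq> set (arc cs (Plain ` W) (Plain w0))"
            using VinV[OF W(1) 1(1)] by blast
          have "Plain v \<in> set (arc cs (Plain ` W) (Plain w0))" "Plain v' \<in> set (arc cs (Plain ` W) (Plain w0))"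
            using w0 v v' by auto
          then have b: "Bar v \<in> set (arc cs (Plain ` W) (Plain w0))" "Bar l \<in> set (arc cs (Plain ` W) (Plain w0))"
            using spread[OF W(1) w0(1), of v v] spread[OF W(1) w0(1), of v' l] first y h v l v' by auto
          have "Plain w0 \<in> Plain ` W" using w0 by blast
          then have "Plain w0 = Plain w" using arc_unique[OF d Vs(3)[OF W(1)] _ pw b(1) i] by blast
          then show ?thesis using b by simp
        qed
      qed
      then show ?thesis using h l ane unfolding linked_def a_def by auto
    next
      case 2
      \<comment> \<open>The arc begins with a plain point whose block \<open>V\<close> lies entirely
        in the arc. If \<open>V\<close> did not reach the end of the arc, the bar behind the last
        point of \<open>V\<close> would not be separated from \<open>Bar u\<close>, so it would be a
        point of \<open>A\<close> inside an arc of \<open>A\<close>.\<close>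
      obtain u where u: "u \<in> U" "x = Bar u" using x 2 by blast
      have "pcol (hd a) = 1" using stx u by simp
      then obtain k where k: "hd a = Plain k" by (cases "hd a") auto
      have kc: "k \<in> set is" using k hd_in_set[OF ane] ac scs by auto
      obtain V where V: "V \<in> \<pi>" "k \<in> V" using NC_onD(7)[OF nc kc] by blast
      have V\<rho>: "Plain ` V \<in> \<rho>" using V unfolding \<rho>_def with_bars_def by blast
      have VA: "A \<noteq> Plain ` V" using u x by auto
      obtain x1 where x1: "x1 \<in> A" "Plain ` V \<subseteq> set (arc cs A x1)" by (rule NC_on_arc[OF d nc\<rho> A V\<rho> VA])
      have "hd a \<in> set (arc cs A x1)" using x1 k V by auto
      moreover have "hd a \<in> set (arc cs A x)" using hd_in_set[OF ane] a_def by simp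
      ultimately have "x1 = x" using arc_unique[OF d AS x1(1) x] by blast
      then have Va: "Plain ` V \<subseteq> set a" using x1 a_def by simp
      have "\<exists>p\<in>set a. p \<in> Plain ` V" using k V ane hd_in_set[OF ane] by force
      then obtain b p c where bc: "a = b @ p # c" "p \<in> Plain ` V" "\<forall>y\<in>set c. y \<notin> Plain ` V"
        using split_list_last_prop[of a "\<lambda>p. p \<in> Plain ` V"] by metis
      then obtain v where v: "v \<in> V" "p = Plain v" by blast
      show ?thesis
      proof (cases c)
        case Nil
        then have "last a \<in> Plain ` V" using bc by simp
        moreover have "hd a \<in> Plain ` V" using k V by simp
        ultimately show ?thesis using V\<rho> unfolding linked_def a_def by blast
      next
        case (Cons m c')
        have "cyc cs ((x # b) @ (Plain v # m # c' @ z))" using za bc(1) v Cons by simp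
        then have "cyc cs ((Plain v # m # c' @ z) @ x # b)" by (rule cyc_trans[OF _ cyc_append])
        then have nxt: "cyc cs (Plain v # m # (c' @ z @ x # b))" by simp
        then have m: "m = Bar v" using circ unfolding circular_def by fastforce
        have "cyc cs (Plain v # (c @ z @ [x]) @ b)" using nxt Cons by simp
        then have arcV: "arc cs (Plain ` V) (Plain v) = c @ z @ [x]"
        proof (rule arc_eqI[OF d])
          have "Plain ` V \<inter> set z = {}" "x \<notin> Plain ` V" using Va z(3) a_def u by auto
          then show "set (c @ z @ [x]) \<inter> Plain ` V = {}" using bc(3) by auto
          show "b = [] \<or> hd b \<in> Plain ` V" using k V bc(1) by (cases b) auto
        qed
        have "\<exists>U\<in>\<rho>. Bar u \<in> U \<and> Bar v \<in> U"
        proof (rule linkB)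
          show "u \<in> set is" "v \<in> set is" using u Us(1)[OF 2(1)] v Vs(1)[OF V(1)] by auto
          fix W w assume W: "W \<in> \<pi>" "w \<in> W" and i: "Bar u \<in> set (arc cs (Plain ` W) (Plain w))"
          have pw: "Plain w \<in> Plain ` W" using W by blast
          show "Bar v \<in> set (arc cs (Plain ` W) (Plain w))"
          proof (cases "W = V")
            case True
            have "Bar u \<in> set (arc cs (Plain ` V) (Plain v))" using arcV u by simp
            then have "Plain w = Plain v"
              using arc_unique[OF d Vs(3)[OF V(1)], of "Plain w" "Plain v" "Bar u"] i True pw v by blast
            then show ?thesis using True arcV Cons m by simp
          next
            case False
            then obtain w0 where w0: "w0 \<in> W" "Plain ` V \<subseteq> set (arc cs (Plain ` W) (Plain w0))"
              using VinV[OF W(1) V(1)] by blast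
            have "Plain v \<in> set (arc cs (Plain ` W) (Plain w0))" "Plain k \<in> set (arc cs (Plain ` W) (Plain w0))"
              using w0 v V by auto
            then have b: "Bar v \<in> set (arc cs (Plain ` W) (Plain w0))" "Bar u \<in> set (arc cs (Plain ` W) (Plain w0))"
              using spread[OF W(1) w0(1), of v v] spread[OF W(1) w0(1), of k u] first nxt m k u by auto
            have "Plain w0 \<in> Plain ` W" using w0 by blast
            then have "Plain w0 = Plain w" using arc_unique[OF d Vs(3)[OF W(1)] _ pw b(2) i] by blast
            then show ?thesis using b by simp
          qed
        qed
        then obtain B where B: "B \<in> \<rho>" "x \<in> B" "Bar v \<in> B" using u by blast
        then have "B = A" using NC_onD(4)[OF nc\<rho> B(1) A] x by blast
        then have "m \<in> A" using B m by simp
        then show ?thesis using z(4) bc(1) Cons a_def by auto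
      qed
    qed
  qed
qed

lemma with_bars_parts:
  assumes "distinct is" "with_bars \<pi> \<sigma> \<in> NC_on (barred_circle is)"
  shows "\<pi> \<in> NC_on is" "\<sigma> \<in> NC_on is"
proof -
  let ?cs = "barred_circle is"
  have d: "distinct ?cs" by (rule distinct_barred_circle[OF assms(1)])
  have part: "\<tau> \<in> NC_on is"
    if C: "C = Plain \<or> C = Bar" and sub: "(`) C ` \<tau> \<subseteq> with_bars \<pi> \<sigma>"
      and all: "\<And>W i. W \<in> with_bars \<pi> \<sigma> \<Longrightarrow> C i \<in> W \<Longrightarrow> \<exists>V\<in>\<tau>. W = C ` V" for C \<tau>
  proof -
    have injC: "inj C" using C by (auto simp: inj_def)
    have mem: "C i \<in> set ?cs \<longleftrightarrow> i \<in> set is" for i using C by (auto simp: set_barred_circle)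
    have V: "V \<subseteq> set is" "V \<noteq> {}" "C ` V \<in> with_bars \<pi> \<sigma>" if "V \<in> \<tau>" for V
    proof -
      show 1: "C ` V \<in> with_bars \<pi> \<sigma>" using sub that by blast
      show "V \<subseteq> set is" using NC_onD(2)[OF assms(2) 1] mem by blast
      show "V \<noteq> {}" using NC_onD(3)[OF assms(2) 1] by blast
    qed
    have cover: "\<exists>V\<in>\<tau>. i \<in> V" if i: "i \<in> set is" for i
    proof -
      obtain W where W: "W \<in> with_bars \<pi> \<sigma>" "C i \<in> W" using NC_onD(7)[OF assms(2)] mem i by blast
      then obtain V where "V \<in> \<tau>" "W = C ` V" using all by blast
      then show ?thesis using W(2) injC by (auto simp: inj_def)
    qed
    have arcs: "\<exists>v\<in>V. V' \<subseteq> set (arc is V v)" if VV: "V \<in> \<tau>" "V' \<in> \<tau>" "V \<noteq> V'" for V V'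
    proof -
      have "C ` V \<noteq> C ` V'" using VV(3) injC by (simp add: inj_image_eq_iff)
      then obtain p where p: "p \<in> C ` V" "C ` V' \<subseteq> set (arc ?cs (C ` V) p)"
        by (rule NC_on_arc[OF d assms(2) V(3)[OF VV(1)] V(3)[OF VV(2)]])
      then obtain v where v: "v \<in> V" "p = C v" by blast
      then have "V' \<subseteq> set (arc is V v)"
        using p(2) same_colour_arc_iff[OF assms(1) V(1)[OF VV(1)] v(1) C] by blast
      with v show ?thesis by blast
    qed
    have "disjoint \<tau>"
    proof -
      have "V \<inter> V' = {}" if VV: "V \<in> \<tau>" "V' \<in> \<tau>" "V \<noteq> V'" for V V'
      proof -
        obtain v where "v \<in> V" "V' \<subseteq> set (arc is V v)" using arcs[OF VV] by blast
        then show ?thesis using arc_subset[OF assms(1)] V(1)[OF VV(1)] by blast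
      qed
      then show ?thesis by (auto simp: disjoint_def)
    qed
    moreover have "\<Union> \<tau> = set is" "{} \<notin> \<tau>" using V cover by blast+
    ultimately show ?thesis using arcs NC_on_iff[OF assms(1)] by (auto simp: partition_on_def)
  qed
  show "\<pi> \<in> NC_on is" by (rule part[of Plain]) (auto simp: with_bars_def)
  show "\<sigma> \<in> NC_on is" by (rule part[of Bar]) (auto simp: with_bars_def)
qed

lemma crossing_gaps:
  assumes "x \<in> A" "y \<in> A" "B \<inter> set g \<noteq> {}" "B \<inter> set z \<noteq> {}"
  shows "crosses (x # g @ y # z) A B"
proof -
  obtain i where i: "i < length g" "g ! i \<in> B" using assms(3) by (auto simp: in_set_conv_nth)
  obtain k where k: "k < length z" "z ! k \<in> B" using assms(4) by (auto simp: in_set_conv_nth)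
  let ?l = "x # g @ y # z"
  have "?l ! 0 = x" "?l ! Suc i = g ! i" "?l ! Suc (length g) = y" "?l ! Suc (Suc (length g + k)) = z ! k"
    using i k by (auto simp: nth_append)
  moreover have "0 < Suc i" "Suc i < Suc (length g)" "Suc (length g) < Suc (Suc (length g + k))"
    "Suc (Suc (length g + k)) < length ?l" using i k by auto
  ultimately show ?thesis using assms(1,2) i(2) k(2) unfolding crosses_def by metis
qed

text \<open>Completeness implies maximality. A plain block separating two bars of one block of
  \<open>\<tau>\<close> would cross that block, so \<open>complete_linked\<close> puts these bars
  into one block of \<open>\<sigma>\<close>.\<close>

lemma admissible_refines:
  assumes dist: "distinct is" and ne: "is \<noteq> []" and nc: "with_bars \<pi> \<sigma> \<in> NC_on (barred_circle is)"
    and comp: "complete (barred_circle is) (with_bars \<pi> \<sigma>)"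
    and part: "partition_on (set is) \<tau>" and adm: "noncrossing (barred_circle is) (with_bars \<pi> \<tau>)"
  shows "refines (set is) \<tau> \<sigma>"
proof -
  let ?cs = "barred_circle is"
  have circ: "circular ?cs" by (rule circular_barred_circle[OF dist ne])
  have \<sigma>: "\<sigma> \<in> NC_on is" by (rule with_bars_parts[OF dist nc])
  have "\<exists>U\<in>\<sigma>. T \<subseteq> U" if T: "T \<in> \<tau>" for T
  proof -
    have TS: "T \<subseteq> set is" "T \<noteq> {}" using part T by (auto simp: partition_on_def)
    then obtain i where i: "i \<in> T" "i \<in> set is" by blast
    obtain U where U: "U \<in> \<sigma>" "i \<in> U" using NC_onD(7)[OF \<sigma> i(2)] by blast
    have "j \<in> U" if j: "j \<in> T" for j
    proof (cases "j = i")
      case False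
      have "Bar i \<in> set ?cs" using i by (auto simp: set_barred_circle)
      then obtain ys where ys: "cyc ?cs (Bar i # ys)" using cyc_to_head by metis
      have "Bar j \<in> set ?cs" using j TS by (auto simp: set_barred_circle)
      then have "Bar j \<in> set ys" using cyc_set[OF ys] False by auto
      then obtain g z where gz: "ys = g @ Bar j # z" using split_list by metis
      have cy: "cyc ?cs (Bar i # g @ Bar j # z)" using ys gz by simp
      have "\<exists>X\<in>with_bars \<pi> \<sigma>. Bar i \<in> X \<and> Bar j \<in> X"
      proof (rule complete_linked[OF circ nc comp _ cy])
        show "monochrome pcol W" if "W \<in> with_bars \<pi> \<sigma>" for W
          using that by (auto simp: with_bars_def monochrome_def)
        fix W assume W: "W \<in> with_bars \<pi> \<sigma>" "W \<inter> set g \<noteq> {}" "W \<inter> set z \<noteq> {}"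
        show "\<forall>w\<in>W. pcol w = pcol (Bar i)"
        proof (cases "\<exists>V\<in>\<pi>. W = Plain ` V")
          case True
          then have W\<tau>: "W \<in> with_bars \<pi> \<tau>" "Bar ` T \<in> with_bars \<pi> \<tau>" "Bar ` T \<noteq> W"
            using T i by (auto simp: with_bars_def)
          have "crosses (Bar i # g @ Bar j # z) (Bar ` T) W"
            by (rule crossing_gaps) (use i j W in auto)
          then have "crosses ?cs (Bar ` T) W" using crosses_cyc cyc_sym[OF cy] by metis
          then show ?thesis using adm W\<tau> unfolding noncrossing_iff_crosses by blast
        next
          case False
          then show ?thesis using W(1) by (auto simp: with_bars_def)
        qed
      qed simp
      then obtain U' where U': "U' \<in> \<sigma>" "i \<in> U'" "j \<in> U'" by (auto simp: with_bars_def)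
      then have "U' = U" using NC_onD(4)[OF \<sigma> U'(1) U(1)] U(2) by blast
      then show ?thesis using U' by simp
    qed (simp add: U)
    then show ?thesis using U(1) by blast
  qed
  then show ?thesis using part NC_onD(1)[OF \<sigma>] unfolding refines_def by blast
qed

lemma distinct_circleB: "distinct (circleB n)"
  by (auto simp: circleB_def distinct_map inj_on_def)

lemma circleB_Nil_iff: "circleB n = [] \<longleftrightarrow> n = 0"
  by (simp add: circleB_def circle_def)

lemma set_circleB: "set (circleB n) = {z. z \<noteq> 0 \<and> nat \<bar>z\<bar> \<le> n}"
proof -
  have "z \<in> int ` {1..n} \<union> (\<lambda>i. - int i) ` {1..n}" if "z \<noteq> 0" "nat \<bar>z\<bar> \<le> n" for z
  proof (cases "z > 0")
    case True
    then have "z = int (nat \<bar>z\<bar>)" "nat \<bar>z\<bar> \<in> {1..n}" using that by auto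
    then show ?thesis by blast
  next
    case False
    then have "z = - int (nat \<bar>z\<bar>)" "nat \<bar>z\<bar> \<in> {1..n}" using that by auto
    then show ?thesis by blast
  qed
  then show ?thesis by (auto simp: circleB_def)
qed

lemma Kreweras_admissible_iff:
  "Kreweras_admissible n \<pi> \<sigma> \<longleftrightarrow> partition_on (set (circleB n)) \<sigma> \<and>
    noncrossing (barred_circle (circleB n)) (with_bars \<pi> \<sigma>)"
  by (simp add: Kreweras_admissible_def with_bars_def)

text \<open>Completeness replaces the maximality in the definition; \<open>Kr\<close> is identified
  through this criterion from here on.\<close>

lemma Kr_eqI:
  assumes "n \<ge> 1" "with_bars \<pi> \<sigma> \<in> NC_on (barred_circle (circleB n))"
    "complete (barred_circle (circleB n)) (with_bars \<pi> \<sigma>)"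
  shows "Kr n \<pi> = \<sigma>"
proof -
  have ne: "circleB n \<noteq> []" using assms(1) by (simp add: circleB_Nil_iff)
  have \<sigma>: "\<sigma> \<in> NC_on (circleB n)" by (rule with_bars_parts[OF distinct_circleB assms(2)])
  have adm: "Kreweras_admissible n \<pi> \<sigma>"
    using assms(2) NC_onD(1)[OF \<sigma>] by (simp add: Kreweras_admissible_iff NC_on_def)
  have ref: "refines (set (circleB n)) \<tau> \<sigma>" if "Kreweras_admissible n \<pi> \<tau>" for \<tau>
    using admissible_refines[OF distinct_circleB ne assms(2,3)] that by (simp add: Kreweras_admissible_iff)
  show ?thesis
    unfolding Kr_def
  proof (rule the_equality)
    show "Kreweras_admissible n \<pi> \<sigma> \<and> (\<forall>\<tau>. Kreweras_admissible n \<pi> \<tau> \<longrightarrow> refines (set (circleB n)) \<tau> \<sigma>)"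
      using adm ref by blast
    fix \<sigma>' assume "Kreweras_admissible n \<pi> \<sigma>' \<and> (\<forall>\<tau>. Kreweras_admissible n \<pi> \<tau> \<longrightarrow> refines (set (circleB n)) \<tau> \<sigma>')"
    then have "refines (set (circleB n)) \<sigma>' \<sigma>" "refines (set (circleB n)) \<sigma> \<sigma>'" using adm ref by blast+
    then show "\<sigma>' = \<sigma>" by (rule refines_asym)
  qed
qed

lemma Kr_complete:
  assumes "n \<ge> 1" "\<pi> \<in> NC_on (circleB n)"
  shows "with_bars \<pi> (Kr n \<pi>) \<in> NC_on (barred_circle (circleB n))"
    "complete (barred_circle (circleB n)) (with_bars \<pi> (Kr n \<pi>))"
proof -
  have ne: "circleB n \<noteq> []" using assms(1) by (simp add: circleB_Nil_iff)
  note k = kr_partition[OF distinct_circleB ne assms(2)]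
  have "Kr n \<pi> = set (circleB n) // kr_rel (circleB n) \<pi>" by (rule Kr_eqI[OF assms(1) k(1,2)])
  then show "with_bars \<pi> (Kr n \<pi>) \<in> NC_on (barred_circle (circleB n))"
    "complete (barred_circle (circleB n)) (with_bars \<pi> (Kr n \<pi>))" using k by simp_all
qed

section \<open>Symmetries of complete partitions\<close>

lemma monochrome_with_bars: "W \<in> with_bars \<pi> \<sigma> \<Longrightarrow> monochrome pcol W"
  by (auto simp: with_bars_def monochrome_def)

lemma complete_cyc:
  assumes "distinct cs" "cyc cs ds" "\<rho> \<in> NC_on cs"
  shows "complete ds \<rho> \<longleftrightarrow> complete cs \<rho>"
proof -
  have "arc ds V v = arc cs V v" if "V \<in> \<rho>" "v \<in> V" for V v
    using arc_cyc_eq[OF assms(1,2)] NC_onD(2)[OF assms(3) that(1)] that(2) by blast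
  then show ?thesis unfolding complete_def by simp
qed

lemma linked_map: "linked \<rho> a \<Longrightarrow> linked ((`) f ` \<rho>) (map f a)"
  by (cases "a = []") (auto simp: linked_def hd_map last_map)

lemma complete_map:
  assumes "distinct cs" "inj_on f (set cs)" "\<rho> \<in> NC_on cs" "complete cs \<rho>"
  shows "complete (map f cs) ((`) f ` \<rho>)"
  unfolding complete_def
proof (intro ballI)
  fix A x assume "A \<in> (`) f ` \<rho>" "x \<in> A"
  then obtain V v where V: "V \<in> \<rho>" "v \<in> V" "A = f ` V" "x = f v" by blast
  have "arc (map f cs) A x = map f (arc cs V v)"
    unfolding V(3,4) using NC_onD(2)[OF assms(3) V(1)] V(2) by (intro arc_map[OF assms(1,2)]) auto
  then show "linked ((`) f ` \<rho>) (arc (map f cs) A x)"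
    using assms(4) V(1,2) linked_map unfolding complete_def by metis
qed

lemma barred_circle_map: "barred_circle (map f is) = map (map_point f) (barred_circle is)"
  by (induction "is") auto

lemma pcol_map_point [simp]: "pcol (map_point f p) = pcol p"
  by (cases p) auto

lemma map_point_comp: "map_point f (map_point g p) = map_point (\<lambda>i. f (g i)) p"
  by (cases p) auto

abbreviation neg :: "int point \<Rightarrow> int point" where
  "neg \<equiv> map_point uminus"

abbreviation pabs :: "int point \<Rightarrow> nat point" where
  "pabs \<equiv> map_point (\<lambda>z. nat \<bar>z\<bar>)"

lemma neg_neg [simp]: "neg (neg p) = p"
  by (cases p) auto

lemma neg_image_image [simp]: "neg ` neg ` W = W"
  by (force simp: image_image)

lemma uminus_image_image [simp]: "uminus ` uminus ` (W :: int set) = W"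
  by (force simp: image_image)

lemma pabs_neg [simp]: "pabs (neg p) = pabs p"
  by (cases p) auto

text \<open>Half of the barred type B circle, a fundamental domain for \<open>neg\<close>;
  \<open>neg\<close> turns the circle by half.\<close>

definition upper :: "nat \<Rightarrow> int point list" where
  "upper n = map (map_point int) (barred_circle (circle n))"

lemma barred_circleB: "barred_circle (circleB n) = upper n @ map neg (upper n)"
  by (simp add: circleB_def upper_def barred_circle_map map_point_comp comp_def)

lemma map_pabs_upper: "map pabs (upper n) = barred_circle (circle n)"
proof -
  have "map_point (\<lambda>i. i) p = p" for p :: "nat point" by (cases p) auto
  then show ?thesis by (simp add: upper_def map_point_comp comp_def)
qed

lemma inj_neg: "inj neg"
  by (rule injI) (metis neg_neg)

lemma cyc_neg_barred_circleB: "cyc (barred_circle (circleB n)) (map neg (barred_circle (circleB n)))"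
  using cyc_append[of "upper n" "map neg (upper n)"] by (simp add: barred_circleB comp_def)

lemma neg_with_bars: "(`) neg ` with_bars \<pi> \<sigma> = with_bars ((`) uminus ` \<pi>) ((`) uminus ` \<sigma>)"
proof -
  have "neg ` Plain ` V = Plain ` uminus ` V" "neg ` Bar ` V = Bar ` uminus ` V" for V
    by (simp_all add: image_image)
  then show ?thesis by (simp add: with_bars_def image_Un image_image)
qed

lemma symmetric_image:
  assumes "\<forall>V\<in>\<pi>. uminus ` V \<in> \<pi>"
  shows "(`) uminus ` \<pi> = (\<pi> :: int set set)"
  using assms by (metis (no_types, lifting) image_eqI subsetI subset_antisym image_subset_iff uminus_image_image)

lemma transfer_complete:
  assumes "distinct cs" "\<rho> \<in> NC_on cs" "complete cs \<rho>" "inj_on f (set cs)" "cyc cs (map f cs)"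
  shows "(`) f ` \<rho> \<in> NC_on cs" "complete cs ((`) f ` \<rho>)"
proof -
  have m: "(`) f ` \<rho> \<in> NC_on (map f cs)" by (rule NC_on_map_mem[OF assms(1,4,2)])
  then show 1: "(`) f ` \<rho> \<in> NC_on cs" using NC_on_cyc[OF assms(1,5)] by simp
  show "complete cs ((`) f ` \<rho>)"
    using complete_map[OF assms(1,4,2,3)] complete_cyc[OF assms(1,5) 1] by simp
qed

text \<open>Negation is a rotation of the barred circle and thus preserves complete partitions. It
  fixes the plain part, hence also the barred part, which that part determines.\<close>

lemma Kr_NCB:
  assumes "n \<ge> 1" "\<pi> \<in> NCB n"
  shows "Kr n \<pi> \<in> NCB n"
proof -
  let ?cs = "barred_circle (circleB n)"
  have nc: "\<pi> \<in> NC_on (circleB n)" and sym: "(`) uminus ` \<pi> = \<pi>"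
    using assms(2) symmetric_image by (auto simp: NCB_def)
  note k = Kr_complete[OF assms(1) nc]
  have d: "distinct ?cs" by (rule distinct_barred_circle[OF distinct_circleB])
  have "with_bars \<pi> ((`) uminus ` Kr n \<pi>) \<in> NC_on ?cs" "complete ?cs (with_bars \<pi> ((`) uminus ` Kr n \<pi>))"
    using transfer_complete[OF d k inj_on_subset[OF inj_neg] cyc_neg_barred_circleB] sym
    by (simp_all add: neg_with_bars)
  then have "Kr n \<pi> = (`) uminus ` Kr n \<pi>" by (rule Kr_eqI[OF assms(1)])
  then have "\<forall>V\<in>Kr n \<pi>. uminus ` V \<in> Kr n \<pi>" by blast
  then show ?thesis using with_bars_parts(2)[OF distinct_circleB k(1)] by (simp add: NCB_def)
qed

text \<open>Rotating by half a step exchanges the colours, so it maps \<open>\<pi> \<union> Kr \<pi>\<close> to a complete partition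
  whose plain part is \<open>Kr \<pi>\<close>; its barred part, a shift of \<open>\<pi>\<close>, is therefore \<open>Kr (Kr \<pi>)\<close>.\<close>

fun rot :: "('i \<Rightarrow> 'i) \<Rightarrow> 'i point \<Rightarrow> 'i point" where
  "rot f (Plain i) = Bar (f i)"
| "rot f (Bar i) = Plain i"

text \<open>The rotation is expressed by one bar appended on one side and one prepended on the
  other, so that a plain list induction works. \<open>f\<close> is the predecessor map and
  \<open>w\<close> the point before the list.\<close>

lemma map_rot_barred_circle:
  assumes "is \<noteq> []" "f (hd is) = w" "successively (\<lambda>u v. f v = u) is"
  shows "map (rot f) (barred_circle is) @ [Bar (last is)] = Bar w # barred_circle is"
  using assms
proof (induction "is" arbitrary: w rule: induct_list012)
  case (3 x y zs)
  have "map (rot f) (barred_circle (y # zs)) @ [Bar (last (y # zs))] = Bar x # barred_circle (y # zs)"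
    by (rule "3.IH"(2)) (use "3.prems" in auto)
  then show ?case using "3.prems" by simp
qed auto

lemma cyc_rot_barred_circle:
  assumes "is \<noteq> []" "f (hd is) = last is" "successively (\<lambda>u v. f v = u) is"
  shows "cyc (barred_circle is) (map (rot f) (barred_circle is))"
proof -
  have e: "map (rot f) (barred_circle is) @ [Bar (last is)] = Bar (last is) # barred_circle is"
    by (rule map_rot_barred_circle[OF assms])
  define q where "q = butlast (barred_circle is)"
  have l: "barred_circle is = q @ [Bar (last is)]"
  proof -
    have "last (barred_circle is) = Bar (last is)" using assms(1)
      by (induction "is" rule: rev_induct) auto
    then show ?thesis using assms(1) by (metis append_butlast_last_id barred_circle_Nil_iff q_def)
  qed
  have "map (rot f) (barred_circle is) @ [Bar (last is)] = (Bar (last is) # q) @ [Bar (last is)]"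
    using e l by simp
  then have "map (rot f) (barred_circle is) = Bar (last is) # q" by simp
  then show ?thesis using cyc_append[of q "[Bar (last is)]"] l by simp
qed

lemma inj_on_rot:
  assumes "is \<noteq> []" "distinct is" "f (hd is) = last is" "successively (\<lambda>u v. f v = u) is"
  shows "inj_on (rot f) (set (barred_circle is))"
  using cyc_distinct[OF cyc_rot_barred_circle[OF assms(1,3,4)]] distinct_barred_circle[OF assms(2)]
  by (simp add: distinct_map)

text \<open>The predecessor on the circle \<open>1, ..., n, -1, ..., -n\<close>, with seams at
  \<open>1\<close> and \<open>-1\<close>. On absolute values it becomes
  \<open>predN\<close>.\<close>

definition predB :: "nat \<Rightarrow> int \<Rightarrow> int" where
  "predB n z = (if z = 1 then - int n else if z = -1 then int n else if z > 0 then z - 1 else z + 1)"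

definition predN :: "nat \<Rightarrow> nat \<Rightarrow> nat" where
  "predN n i = (if i = 1 then n else i - 1)"

lemma circle_nth: "i < n \<Longrightarrow> circle n ! i = Suc i"
  by (simp add: circle_def del: upt_Suc)

lemma length_circle [simp]: "length (circle n) = n"
  by (simp add: circle_def del: upt_Suc)

lemma circleB_nth: "i < 2 * n \<Longrightarrow> circleB n ! i = (if i < n then int (Suc i) else - int (Suc (i - n)))"
  by (auto simp: circleB_def nth_append circle_nth)

lemma length_circleB [simp]: "length (circleB n) = 2 * n"
  by (simp add: circleB_def)

lemma predB_circleB:
  assumes "n \<ge> 1"
  shows "predB n (hd (circleB n)) = last (circleB n)" "successively (\<lambda>u v. predB n v = u) (circleB n)"
proof -
  have ne: "circleB n \<noteq> []" using assms by (simp add: circleB_Nil_iff)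
  have "hd (circleB n) = 1" using assms circleB_nth[of 0 n] by (simp add: hd_conv_nth[OF ne])
  moreover have "last (circleB n) = - int n"
    using assms circleB_nth[of "2 * n - 1" n] by (simp add: last_conv_nth[OF ne])
  ultimately show "predB n (hd (circleB n)) = last (circleB n)" by (simp add: predB_def)
  show "successively (\<lambda>u v. predB n v = u) (circleB n)"
    unfolding successively_conv_nth using assms by (auto simp: circleB_nth predB_def)
qed

lemma predN_circle:
  assumes "n \<ge> 1"
  shows "predN n (hd (circle n)) = last (circle n)" "successively (\<lambda>u v. predN n v = u) (circle n)"
proof -
  have ne: "circle n \<noteq> []" using assms by (simp add: circle_def)
  have "hd (circle n) = 1" using assms circle_nth[of 0 n] by (simp add: hd_conv_nth[OF ne])
  moreover have "last (circle n) = n"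
    using assms circle_nth[of "n - 1" n] by (simp add: last_conv_nth[OF ne])
  ultimately show "predN n (hd (circle n)) = last (circle n)" by (simp add: predN_def)
  show "successively (\<lambda>u v. predN n v = u) (circle n)"
    unfolding successively_conv_nth by (auto simp: circle_nth predN_def)
qed

lemma abs_predB: "z \<noteq> 0 \<Longrightarrow> nat \<bar>predB n z\<bar> = predN n (nat \<bar>z\<bar>)"
  by (auto simp: predB_def predN_def)

lemma Kr_Kr:
  assumes "n \<ge> 1" "\<pi> \<in> NC_on (circleB n)"
  shows "Kr n (Kr n \<pi>) = (`) (predB n) ` \<pi>"
proof -
  let ?cs = "barred_circle (circleB n)"
  have ne: "circleB n \<noteq> []" using assms by (simp add: circleB_Nil_iff)
  note k = Kr_complete[OF assms]
  have d: "distinct ?cs" by (rule distinct_barred_circle[OF distinct_circleB])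
  note t = transfer_complete[OF d k inj_on_rot[OF ne distinct_circleB predB_circleB[OF assms(1)]]
      cyc_rot_barred_circle[OF ne predB_circleB[OF assms(1)]]]
  have "(`) (rot (predB n)) ` with_bars \<pi> (Kr n \<pi>) = with_bars (Kr n \<pi>) ((`) (predB n) ` \<pi>)"
  proof -
    have "rot (predB n) ` Plain ` V = Bar ` predB n ` V" "rot (predB n) ` Bar ` V = Plain ` V" for V
      by (simp_all add: image_image)
    then show ?thesis by (simp add: with_bars_def image_Un image_image Un_commute)
  qed
  with t show ?thesis by (intro Kr_eqI[OF assms(1)]) simp_all
qed

text \<open>A block distinct from its negative has its negative in one of its arcs; by completeness the
  ends of the shortest such arc lie in a block with an even shorter one.\<close>

lemma zero_block_exists:
  assumes circ: "circular cs" and nc: "\<rho> \<in> NC_on cs" and comp: "complete cs \<rho>"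
    and mono: "\<And>W. W \<in> \<rho> \<Longrightarrow> monochrome pcol W"
    and neg: "cyc cs (map neg cs)" and sym: "\<And>W. W \<in> \<rho> \<Longrightarrow> neg ` W \<in> \<rho>"
  shows "\<exists>Z\<in>\<rho>. neg ` Z = Z"
proof (rule ccontr)
  assume no: "\<not> (\<exists>Z\<in>\<rho>. neg ` Z = Z)"
  have d: "distinct cs" "cs \<noteq> []" using circ by (auto simp: circular_def)
  have ex: "\<exists>v\<in>V. neg ` V \<subseteq> set (arc cs V v)" if V: "V \<in> \<rho>" for V
    using NC_on_arc[OF d(1) nc V sym[OF V]] no V by metis
  define P where "P k \<longleftrightarrow> (\<exists>V v. V \<in> \<rho> \<and> v \<in> V \<and> neg ` V \<subseteq> set (arc cs V v) \<and> length (arc cs V v) = k)" for k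
  have "\<exists>k. P k"
  proof -
    obtain V where "V \<in> \<rho>" using NC_onD(7)[OF nc hd_in_set[OF d(2)]] by blast
    then show ?thesis using ex unfolding P_def by blast
  qed
  then have "P (LEAST k. P k)" by (rule LeastI_ex)
  then obtain V v where V: "V \<in> \<rho>" "v \<in> V" "neg ` V \<subseteq> set (arc cs V v)"
    and min: "length (arc cs V v) = (LEAST k. P k)" unfolding P_def by blast
  have VS: "V \<subseteq> set cs" using NC_onD(2)[OF nc V(1)] .
  have vc: "v \<in> set cs" using VS V by blast
  obtain z where z: "cyc cs (v # arc cs V v @ z)" "z = [] \<or> hd z \<in> V"
    "distinct (v # arc cs V v @ z)" "set (arc cs V v) \<inter> V = {}"
    "set cs = insert v (set (arc cs V v) \<union> set z)"
    by (rule arcE[OF d(1) V(2) vc])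
  define a where "a = arc cs V v"
  have ane: "a \<noteq> []" using V a_def by auto
  obtain U where U: "U \<in> \<rho>" "hd a \<in> U" "last a \<in> U"
    using comp V ane unfolding complete_def linked_def a_def by blast
  have US: "U \<subseteq> set cs" using NC_onD(2)[OF nc U(1)] .
  have ha: "hd a \<in> set a" "last a \<in> set a" using ane by auto
  have UV: "V \<noteq> U" using U(2) ha z(4) a_def by blast
  have Ua: "U \<subseteq> set a"
  proof -
    obtain w where w: "w \<in> V" "U \<subseteq> set (arc cs V w)" by (rule NC_on_arc[OF d(1) nc V(1) U(1) UV])
    then have "w = v" using arc_unique[OF d(1) VS w(1) V(2)] ha U a_def by blast
    then show ?thesis using w a_def by simp
  qed
  obtain u where u: "u \<in> U" "neg ` U \<subseteq> set (arc cs U u)" using ex[OF U(1)] by blast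
  obtain t where t: "a = hd a # t" using ane by (cases a) auto
  have za: "cyc cs (v # a @ z)" using z(1) by (simp add: a_def)
  \<comment> \<open>The arc contains \<open>neg v\<close>, so the successor
    \<open>neg (hd a)\<close> of that point lies in the arc or in \<open>V\<close>; the latter is
    excluded by its colour.\<close>
  have nh: "neg (hd a) \<in> set a"
  proof -
    have c: "cyc cs (v # hd a # (t @ z))" using za t by (metis append_Cons)
    then have "step v (hd a)" using circ unfolding circular_def by blast
    then have col: "pcol (neg (hd a)) \<noteq> pcol v" using step_pcol[of v "hd a"] by simp
    have "cyc (map neg cs) (neg v # neg (hd a) # map neg (t @ z))" using cyc_map[OF c, of neg] by simp
    then have "cyc cs (neg v # neg (hd a) # map neg (t @ z))" using cyc_trans[OF neg] by blast
    moreover have "neg v \<in> set (arc cs V v)" using V by blast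
    ultimately have "neg (hd a) \<in> V \<or> neg (hd a) \<in> set (arc cs V v)"
      using arc_adjacent_next[OF d(1) V(2) VS] by blast
    moreover have "neg (hd a) \<notin> V" using mono[OF V(1)] V(2) col unfolding monochrome_def by blast
    ultimately show ?thesis by (simp add: a_def)
  qed
  obtain b c where bc: "a = b @ u # c" using u(1) Ua split_list by (metis subsetD)
  have "cyc cs (u # (c @ z @ v # b))"
    using cyc_trans[OF za] cyc_append[of "v # b" "u # c @ z"] bc by simp
  then have arcU: "arc cs U u = takeWhile (\<lambda>y. y \<notin> U) (c @ z @ v # b)" by (rule arc_cyc[OF d(1)])
  show False
  proof (cases "\<exists>y\<in>set c. y \<in> U")
    case True
    then obtain y where "y \<in> set c" "y \<in> U" by blast
    then have "arc cs U u = takeWhile (\<lambda>y. y \<notin> U) c"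
      unfolding arcU using takeWhile_append1[of y c "\<lambda>y. y \<notin> U" "z @ v # b"] by simp
    then have "length (arc cs U u) < length a" using bc length_takeWhile_le[of "\<lambda>y. y \<notin> U" c] by simp
    moreover have "P (length (arc cs U u))" unfolding P_def using U(1) u by blast
    ultimately show False using min not_less_Least a_def by metis
  next
    case False
    \<comment> \<open>Now \<open>u\<close> is the last point of \<open>a\<close>, and the arc of
      \<open>U\<close> behind it is the complement of \<open>a\<close>. It contains
      \<open>neg (hd a)\<close>, which was shown to lie in \<open>a\<close>.\<close>
    have "c = []" using False U(3) bc last_in_set[of c] by (cases "c = []") auto
    moreover have "U \<inter> set z = {}" "v \<notin> U" using Ua z(3) a_def by auto
    moreover have "takeWhile (\<lambda>y. y \<notin> U) b = []" using U(2) bc by (cases b) auto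
    ultimately have "arc cs U u = z @ [v]"
      unfolding arcU by (simp, subst takeWhile_append2) auto
    moreover have "neg (hd a) \<in> neg ` U" using U(2) by blast
    ultimately have "neg (hd a) \<in> set z \<or> neg (hd a) = v" using u(2) by auto
    then show False using nh z(3) a_def by auto
  qed
qed

lemma arc_neg:
  assumes "distinct cs" "cyc cs (map neg cs)" "Z \<subseteq> set cs" "neg ` Z = Z" "z \<in> Z"
  shows "arc cs Z (neg z) = map neg (arc cs Z z)"
proof -
  have "neg z \<in> set cs" "z \<in> set cs" using assms(3-5) by blast+
  then have "arc cs Z (neg z) = arc (map neg cs) Z (neg z)"
    using arc_cyc_eq[OF assms(1,2)] by metis
  also have "\<dots> = arc (map neg cs) (neg ` Z) (neg z)" using assms(4) by simp
  also have "\<dots> = map neg (arc cs Z z)"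
    by (rule arc_map[OF assms(1) inj_on_subset[OF inj_neg] assms(3) \<open>z \<in> set cs\<close>]) simp
  finally show ?thesis .
qed

text \<open>If \<open>Y\<close> lay in the arc of \<open>Z\<close> behind \<open>z\<close>, then by
  symmetry it would also lie in the arc behind \<open>neg z\<close>, which is a different
  one.\<close>

lemma zero_block_unique:
  assumes "distinct cs" "\<rho> \<in> NC_on cs" "cyc cs (map neg cs)" "\<And>p. p \<in> set cs \<Longrightarrow> neg p \<noteq> p"
    "Z \<in> \<rho>" "neg ` Z = Z" "Y \<in> \<rho>" "neg ` Y = Y"
  shows "Y = Z"
proof (rule ccontr)
  assume "Y \<noteq> Z"
  then obtain z where z: "z \<in> Z" "Y \<subseteq> set (arc cs Z z)" using NC_on_arc[OF assms(1,2,5,7)] by metis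
  have ZS: "Z \<subseteq> set cs" using NC_onD(2)[OF assms(2,5)] .
  have zc: "z \<in> set cs" using z ZS by blast
  have nz: "neg z \<in> Z" using z assms(6) by blast
  have "set (arc cs Z (neg z)) = neg ` set (arc cs Z z)"
    using arc_neg[OF assms(1,3) ZS assms(6) z(1)] by simp
  moreover have "neg ` Y \<subseteq> neg ` set (arc cs Z z)" using z(2) by (rule image_mono)
  ultimately have "Y \<subseteq> set (arc cs Z (neg z))" using assms(8) by simp
  moreover obtain y where "y \<in> Y" using NC_onD(3)[OF assms(2,7)] by blast
  ultimately have "neg z = z" using arc_unique[OF assms(1) ZS nz z(1)] z(2) by blast
  then show False using assms(4)[OF zc] by blast
qed

section \<open>Summation over the partitions of type B\<close>

definition completeB :: "nat \<Rightarrow> int point set set set" where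
  "completeB n = {\<rho> \<in> NC_on (barred_circle (circleB n)). complete (barred_circle (circleB n)) \<rho> \<and>
    (\<forall>W\<in>\<rho>. monochrome pcol W) \<and> (\<forall>W\<in>\<rho>. neg ` W \<in> \<rho>)}"

lemma with_bars_inject:
  assumes "with_bars \<pi> \<sigma> = with_bars \<pi>' \<sigma>'" "{} \<notin> \<pi>" "{} \<notin> \<pi>'"
  shows "\<pi> = \<pi>'"
proof -
  have part: "V \<in> \<pi> \<longleftrightarrow> Plain ` V \<in> with_bars \<pi> \<sigma>" if ne: "V \<noteq> {}" for V and \<pi> \<sigma> :: "'a set set"
  proof -
    obtain v where v: "v \<in> V" using ne by blast
    have "Plain v \<notin> Bar ` W" for W :: "'a set" by blast
    then have "Plain ` V \<noteq> Bar ` W" for W :: "'a set" using v by blast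
    then have "Plain ` V \<notin> (`) Bar ` \<sigma>" by blast
    moreover have "Plain ` V \<in> (`) Plain ` \<pi> \<longleftrightarrow> V \<in> \<pi>"
    proof
      assume "Plain ` V \<in> (`) Plain ` \<pi>"
      then obtain W where W: "W \<in> \<pi>" "Plain ` V = Plain ` W" by blast
      have "inj (Plain :: 'a \<Rightarrow> 'a point)" by (simp add: inj_def)
      then have "V = W" using W(2) by (simp add: inj_image_eq_iff)
      then show "V \<in> \<pi>" using W(1) by simp
    qed (rule imageI)
    ultimately show ?thesis by (simp add: with_bars_def)
  qed
  have "V \<in> \<pi> \<longleftrightarrow> V \<in> \<pi>'" for V
  proof (cases "V = {}")
    case True
    then show ?thesis using assms(2,3) by blast
  next
    case False
    show ?thesis using part[OF False, of \<pi> \<sigma>] part[OF False, of \<pi>' \<sigma>'] assms(1) by simp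
  qed
  then show ?thesis by blast
qed

lemma with_bars_uminus:
  assumes "\<forall>V\<in>\<pi>. uminus ` V \<in> \<pi>" "\<forall>V\<in>\<sigma>. uminus ` V \<in> \<sigma>" "W \<in> with_bars \<pi> \<sigma>"
  shows "neg ` W \<in> with_bars \<pi> \<sigma>"
proof -
  have "neg ` Plain ` V = Plain ` uminus ` V" "neg ` Bar ` V = Bar ` uminus ` V" for V
    by (simp_all add: image_image)
  then show ?thesis using assms by (auto simp: with_bars_def)
qed

text \<open>The plain part of a complete partition determines its barred part by
  \<open>Kr_eqI\<close>, so type B partitions and symmetric complete partitions are the same
  data.\<close>

lemma bij_betw_completeB:
  assumes n: "n \<ge> 1"
  shows "bij_betw (\<lambda>\<pi>. with_bars \<pi> (Kr n \<pi>)) (NCB n) (completeB n)"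
proof (rule bij_betw_imageI)
  show "inj_on (\<lambda>\<pi>. with_bars \<pi> (Kr n \<pi>)) (NCB n)"
  proof (rule inj_onI)
    fix \<pi> \<pi>' assume p: "\<pi> \<in> NCB n" "\<pi>' \<in> NCB n" "with_bars \<pi> (Kr n \<pi>) = with_bars \<pi>' (Kr n \<pi>')"
    have "{} \<notin> \<pi>" "{} \<notin> \<pi>'" using p(1,2) NC_onD(3) unfolding NCB_def by blast+
    then show "\<pi> = \<pi>'" by (rule with_bars_inject[OF p(3)])
  qed
  show "(\<lambda>\<pi>. with_bars \<pi> (Kr n \<pi>)) ` NCB n = completeB n"
  proof (intro equalityI subsetI)
    fix \<rho> assume "\<rho> \<in> (\<lambda>\<pi>. with_bars \<pi> (Kr n \<pi>)) ` NCB n"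
    then obtain \<pi> where p: "\<pi> \<in> NCB n" "\<rho> = with_bars \<pi> (Kr n \<pi>)" by blast
    have nc: "\<pi> \<in> NC_on (circleB n)" "\<forall>V\<in>\<pi>. uminus ` V \<in> \<pi>" using p(1) by (auto simp: NCB_def)
    have "\<forall>V\<in>Kr n \<pi>. uminus ` V \<in> Kr n \<pi>" using Kr_NCB[OF n p(1)] by (auto simp: NCB_def)
    then show "\<rho> \<in> completeB n"
      using Kr_complete[OF n nc(1)] nc(2) p(2) monochrome_with_bars with_bars_uminus
      unfolding completeB_def by blast
  next
    fix \<rho> assume r: "\<rho> \<in> completeB n"
    define \<pi> where "\<pi> = {V. Plain ` V \<in> \<rho>}"
    define \<sigma> where "\<sigma> = {V. Bar ` V \<in> \<rho>}"
    have nc: "\<rho> \<in> NC_on (barred_circle (circleB n))" and comp: "complete (barred_circle (circleB n)) \<rho>"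
      and mono: "\<And>W. W \<in> \<rho> \<Longrightarrow> monochrome pcol W" and sym: "\<And>W. W \<in> \<rho> \<Longrightarrow> neg ` W \<in> \<rho>"
      using r by (auto simp: completeB_def)
    have "W \<in> with_bars \<pi> \<sigma>" if W: "W \<in> \<rho>" for W
    proof -
      obtain p where p: "p \<in> W" using NC_onD(3)[OF nc W] by blast
      have m: "pcol q = pcol p" if "q \<in> W" for q using mono[OF W] that p unfolding monochrome_def by blast
      show ?thesis
      proof (cases p)
        case (Plain i)
        have "W = Plain ` {i. Plain i \<in> W}"
        proof (intro equalityI subsetI)
          fix q assume q: "q \<in> W"
          then show "q \<in> Plain ` {i. Plain i \<in> W}" using m[OF q] Plain by (cases q) auto
        qed auto
        then have "W = Plain ` {i. Plain i \<in> W} \<and> {i. Plain i \<in> W} \<in> \<pi>" using W \<pi>_def by simp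
        then show ?thesis unfolding with_bars_def by blast
      next
        case (Bar i)
        have "W = Bar ` {i. Bar i \<in> W}"
        proof (intro equalityI subsetI)
          fix q assume q: "q \<in> W"
          then show "q \<in> Bar ` {i. Bar i \<in> W}" using m[OF q] Bar by (cases q) auto
        qed auto
        then have "W = Bar ` {i. Bar i \<in> W} \<and> {i. Bar i \<in> W} \<in> \<sigma>" using W \<sigma>_def by simp
        then show ?thesis unfolding with_bars_def by blast
      qed
    qed
    then have e: "\<rho> = with_bars \<pi> \<sigma>" by (auto simp: with_bars_def \<pi>_def \<sigma>_def)
    have "\<pi> \<in> NC_on (circleB n)" using with_bars_parts(1)[OF distinct_circleB] nc e by metis
    moreover have "\<forall>V\<in>\<pi>. uminus ` V \<in> \<pi>"
    proof
      fix V assume "V \<in> \<pi>"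
      then have "neg ` Plain ` V \<in> \<rho>" using sym \<pi>_def by blast
      moreover have "neg ` Plain ` V = Plain ` uminus ` V" by (simp add: image_image)
      ultimately show "uminus ` V \<in> \<pi>" by (simp add: \<pi>_def)
    qed
    moreover have "Kr n \<pi> = \<sigma>" using Kr_eqI[OF n] nc comp e by metis
    ultimately show "\<rho> \<in> (\<lambda>\<pi>. with_bars \<pi> (Kr n \<pi>)) ` NCB n" using e by (auto simp: NCB_def)
  qed
qed

lemma circular_barred_circleB: "n \<ge> 1 \<Longrightarrow> circular (barred_circle (circleB n))"
  by (rule circular_barred_circle[OF distinct_circleB]) (simp add: circleB_Nil_iff)

lemma distinct_barred_circleB: "distinct (barred_circle (circleB n))"
  by (rule distinct_barred_circle[OF distinct_circleB])

lemma distinct_barred_circleN: "distinct (barred_circle (circle n))"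
  by (rule distinct_barred_circle) simp

section \<open>Folding the type B circle by the absolute value\<close>

lemma neg_neq: "p \<in> set (barred_circle (circleB n)) \<Longrightarrow> neg p \<noteq> p"
  by (cases p) (auto simp: set_barred_circle set_circleB)

text \<open>A walk from \<open>z\<close> meets \<open>neg z\<close> after half a turn, and the
  points passed in between are one representative of every other point of the folded circle, in the
  same order.\<close>

lemma double_cover:
  assumes "z \<in> set (barred_circle (circleB n))"
  shows "\<exists>r1 r2. cyc (barred_circle (circleB n)) (z # r1 @ neg z # r2) \<and>
    cyc (barred_circle (circle n)) (pabs z # map pabs r1)"
proof -
  have comp: "map pabs (map neg l) = map pabs l" for l by simp
  have base: "\<exists>b c. upper n = b @ y # c \<and>
      cyc (barred_circle (circle n)) (pabs y # map pabs (c @ b))" if y: "y \<in> set (upper n)" for y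
  proof -
    obtain b c where bc: "upper n = b @ y # c" using y split_list by metis
    have "barred_circle (circle n) = map pabs b @ pabs y # map pabs c"
      unfolding map_pabs_upper[symmetric] bc by simp
    then have "cyc (barred_circle (circle n)) ((pabs y # map pabs c) @ map pabs b)"
      by (simp only: cyc_append)
    with bc show ?thesis by auto
  qed
  consider "z \<in> set (upper n)" | y where "y \<in> set (upper n)" "z = neg y"
    using assms unfolding barred_circleB by auto
  then show ?thesis
  proof cases
    case 1
    then obtain b c where bc: "upper n = b @ z # c"
      "cyc (barred_circle (circle n)) (pabs z # map pabs (c @ b))" using base by blast
    have "barred_circle (circleB n) = b @ (z # c @ map neg b @ neg z # map neg c)"
      unfolding barred_circleB bc(1) by simp
    then have "cyc (barred_circle (circleB n)) ((z # c @ map neg b @ neg z # map neg c) @ b)"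
      by (simp only: cyc_append)
    then have "cyc (barred_circle (circleB n)) (z # (c @ map neg b) @ neg z # (map neg c @ b))" by simp
    moreover have "map pabs (c @ map neg b) = map pabs (c @ b)" by simp
    ultimately show ?thesis using bc(2) by metis
  next
    case 2
    then obtain b c where bc: "upper n = b @ y # c"
      "cyc (barred_circle (circle n)) (pabs y # map pabs (c @ b))" using base by blast
    have "barred_circle (circleB n) = (b @ y # c @ map neg b) @ (z # map neg c)"
      unfolding barred_circleB bc(1) 2(2) by simp
    then have "cyc (barred_circle (circleB n)) ((z # map neg c) @ b @ y # c @ map neg b)"
      by (simp only: cyc_append)
    then have "cyc (barred_circle (circleB n)) (z # (map neg c @ b) @ neg z # (c @ map neg b))"
      using 2(2) by simp
    moreover have "map pabs (map neg c @ b) = map pabs (c @ b)" "pabs y = pabs z" using 2(2) by simp_all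
    ultimately show ?thesis using bc(2) by metis
  qed
qed

lemma pabs_eq_iff: "pabs p = pabs q \<longleftrightarrow> p = q \<or> p = neg q"
  by (cases p; cases q) auto

lemma pabs_mem_iff: "neg ` Z = Z \<Longrightarrow> pabs q \<in> pabs ` Z \<longleftrightarrow> q \<in> Z"
proof -
  assume Z: "neg ` Z = Z"
  have "q \<in> Z" if "pabs q = pabs p" "p \<in> Z" for p
    using that Z unfolding pabs_eq_iff by auto
  then show ?thesis by auto
qed

text \<open>Since \<open>Z\<close> contains \<open>neg z\<close>, the arc ends within half a turn.
  There folding is injective and preserves the order.\<close>

lemma arc_double_cover:
  assumes "Z \<subseteq> set (barred_circle (circleB n))" "neg ` Z = Z" "z \<in> Z"
  shows "map pabs (arc (barred_circle (circleB n)) Z z) = arc (barred_circle (circle n)) (pabs ` Z) (pabs z)"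
    "inj_on pabs (set (arc (barred_circle (circleB n)) Z z))"
proof -
  obtain r1 r2 where r: "cyc (barred_circle (circleB n)) (z # r1 @ neg z # r2)"
    "cyc (barred_circle (circle n)) (pabs z # map pabs r1)"
    using double_cover assms(1,3) by blast
  have "neg z \<in> Z" using assms(2,3) by blast
  then have "takeWhile (\<lambda>y. y \<notin> Z) (r1 @ neg z # r2) = takeWhile (\<lambda>y. y \<notin> Z) r1"
    by (induction r1) auto
  then have a: "arc (barred_circle (circleB n)) Z z = takeWhile (\<lambda>y. y \<notin> Z) r1"
    using arc_cyc[OF distinct_barred_circleB r(1)] by simp
  have "arc (barred_circle (circle n)) (pabs ` Z) (pabs z) = takeWhile (\<lambda>y. y \<notin> pabs ` Z) (map pabs r1)"
    by (rule arc_cyc[OF distinct_barred_circleN r(2)])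
  also have "\<dots> = map pabs (takeWhile (\<lambda>y. y \<notin> Z) r1)"
    using pabs_mem_iff[OF assms(2)] by (simp add: takeWhile_map comp_def)
  finally show "map pabs (arc (barred_circle (circleB n)) Z z) = arc (barred_circle (circle n)) (pabs ` Z) (pabs z)"
    using a by simp
  have "distinct (map pabs r1)" using cyc_distinct[OF r(2)] distinct_barred_circleN by simp
  then have "inj_on pabs (set r1)" by (simp add: distinct_map)
  then show "inj_on pabs (set (arc (barred_circle (circleB n)) Z z))"
    unfolding a by (rule inj_on_subset) (auto dest: set_takeWhileD)
qed

lemma complete_segments_map:
  assumes "distinct a" "inj_on f (set a)" "\<And>p. p \<in> set a \<Longrightarrow> pcol (f p) = pcol p" "\<nu> \<in> complete_segments pcol a"
  shows "(`) f ` \<nu> \<in> complete_segments pcol (map f a)"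
proof -
  have nc: "\<nu> \<in> NC_on a" and c: "linked \<nu> a" "complete a \<nu>" "\<And>V. V \<in> \<nu> \<Longrightarrow> monochrome pcol V"
    using assms(4) by (auto simp: complete_segments_def)
  have "monochrome pcol (f ` V)" if V: "V \<in> \<nu>" for V
  proof -
    have "pcol (f p) = pcol p" if "p \<in> V" for p using NC_onD(2)[OF nc V] assms(3) that by blast
    moreover have "pcol p = pcol q" if "p \<in> V" "q \<in> V" for p q
      using c(3)[OF V] that unfolding monochrome_def by blast
    ultimately show ?thesis unfolding monochrome_def by (metis imageE)
  qed
  then show ?thesis
    using NC_on_map_mem[OF assms(1,2) nc] linked_map[OF c(1)] complete_map[OF assms(1,2) nc c(2)]
    unfolding complete_segments_def by blast
qed

definition pos :: "nat point \<Rightarrow> int point" where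
  "pos = map_point int"

lemma pabs_pos [simp]: "pabs (pos p) = p"
  by (cases p) (auto simp: pos_def)

lemma pos_mem: "p \<in> set (barred_circle (circle n)) \<Longrightarrow> pos p \<in> set (barred_circle (circleB n))"
  by (auto simp: barred_circleB upper_def pos_def)

lemma pabs_mem: "p \<in> set (barred_circle (circleB n)) \<Longrightarrow> pabs p \<in> set (barred_circle (circle n))"
  unfolding map_pabs_upper[symmetric] barred_circleB by auto

lemma neg_mem: "p \<in> set (barred_circle (circleB n)) \<Longrightarrow> neg p \<in> set (barred_circle (circleB n))"
  unfolding barred_circleB by auto

text \<open>The full preimage under folding; the only symmetric set of points of the circle with
  image \<open>V\<close>.\<close>

definition lift :: "nat \<Rightarrow> nat point set \<Rightarrow> int point set" where
  "lift n V = {p \<in> set (barred_circle (circleB n)). pabs p \<in> V}"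

lemma neg_lift: "neg ` lift n V = lift n V"
proof -
  have "neg ` lift n V \<subseteq> lift n V" by (auto simp: lift_def neg_mem)
  moreover from image_mono[OF this, of neg] have "lift n V \<subseteq> neg ` lift n V" by simp
  ultimately show ?thesis by blast
qed

lemma pabs_lift:
  assumes "V \<subseteq> set (barred_circle (circle n))"
  shows "pabs ` lift n V = V"
proof
  show "V \<subseteq> pabs ` lift n V"
  proof
    fix v assume v: "v \<in> V"
    then have "pos v \<in> lift n V" using assms pos_mem by (auto simp: lift_def)
    then show "v \<in> pabs ` lift n V" by (metis image_eqI pabs_pos)
  qed
qed (auto simp: lift_def)

lemma lift_pabs:
  assumes "Z \<subseteq> set (barred_circle (circleB n))" "neg ` Z = Z"
  shows "lift n (pabs ` Z) = Z"
  unfolding lift_def pabs_mem_iff[OF assms(2)] using assms(1) by blast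

definition folded_sector :: "nat \<Rightarrow> int point set \<Rightarrow> int point set set \<Rightarrow> nat point \<Rightarrow> nat point set set" where
  "folded_sector n Z \<rho> v = (`) pabs ` sector (barred_circle (circleB n)) Z \<rho> (pos v)"

lemma pos_cases: "z = pos (pabs z) \<or> z = neg (pos (pabs z))"
  by (cases z) (auto simp: pos_def)

text \<open>Negation exchanges the sectors behind \<open>z\<close> and \<open>neg z\<close>, a
  difference that folding forgets. So the choice of \<open>pos v\<close> in
  \<open>folded_sector\<close> is immaterial.\<close>

lemma folded_sector_pabs:
  assumes "\<rho> \<in> completeB n" "Z \<in> \<rho>" "neg ` Z = Z" "z \<in> Z"
  shows "(`) pabs ` sector (barred_circle (circleB n)) Z \<rho> z = folded_sector n Z \<rho> (pabs z)"
proof -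
  let ?cs = "barred_circle (circleB n)"
  have nc: "\<rho> \<in> NC_on ?cs" and sym: "\<And>W. W \<in> \<rho> \<Longrightarrow> neg ` W \<in> \<rho>"
    using assms(1) by (auto simp: completeB_def)
  have ZS: "Z \<subseteq> set ?cs" by (rule NC_onD(2)[OF nc assms(2)])
  have sub: "(`) pabs ` sector ?cs Z \<rho> y \<subseteq> (`) pabs ` sector ?cs Z \<rho> (neg y)" if y: "y \<in> Z" for y
  proof
    fix X assume "X \<in> (`) pabs ` sector ?cs Z \<rho> y"
    then obtain W where W: "W \<in> \<rho>" "W \<subseteq> set (arc ?cs Z y)" "X = pabs ` W" by (auto simp: sector_def)
    have "arc ?cs Z (neg y) = map neg (arc ?cs Z y)"
      by (rule arc_neg[OF distinct_barred_circleB cyc_neg_barred_circleB ZS assms(3) y])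
    then have "neg ` W \<subseteq> set (arc ?cs Z (neg y))" using W(2) by auto
    then have "neg ` W \<in> sector ?cs Z \<rho> (neg y)" using sym[OF W(1)] by (simp add: sector_def)
    moreover have "X = pabs ` neg ` W" using W(3) by (simp add: image_image)
    ultimately show "X \<in> (`) pabs ` sector ?cs Z \<rho> (neg y)" by blast
  qed
  have nz: "neg z \<in> Z" using assms(3,4) by blast
  have "(`) pabs ` sector ?cs Z \<rho> (neg z) = (`) pabs ` sector ?cs Z \<rho> z"
    using sub[OF assms(4)] sub[OF nz] by simp
  moreover have "pos (pabs z) = z \<or> pos (pabs z) = neg z" using pos_cases[of z] by (metis neg_neg)
  ultimately show ?thesis unfolding folded_sector_def by metis
qed

lemma folded_sector_complete:
  assumes "\<rho> \<in> completeB n" "Z \<in> \<rho>" "neg ` Z = Z" "v \<in> pabs ` Z"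
  shows "folded_sector n Z \<rho> v \<in> complete_segments pcol (arc (barred_circle (circle n)) (pabs ` Z) v)"
proof -
  let ?cs = "barred_circle (circleB n)"
  have nc: "\<rho> \<in> NC_on ?cs" using assms(1) by (simp add: completeB_def)
  have ZS: "Z \<subseteq> set ?cs" by (rule NC_onD(2)[OF nc assms(2)])
  obtain z where z: "z \<in> Z" "v = pabs z" using assms(4) by blast
  have zc: "z \<in> set ?cs" using z ZS by blast
  have "sector ?cs Z \<rho> z \<in> complete_segments pcol (arc ?cs Z z)"
    using complete_segments_sectors[OF distinct_barred_circleB nc assms(2), of pcol] assms(1) z(1)
    by (auto simp: completeB_def)
  then have "(`) pabs ` sector ?cs Z \<rho> z \<in> complete_segments pcol (map pabs (arc ?cs Z z))"
    by (intro complete_segments_map distinct_arc[OF distinct_barred_circleB z(1) zc]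
        arc_double_cover(2)[OF ZS assms(3) z(1)]) auto
  then show ?thesis
    unfolding arc_double_cover(1)[OF ZS assms(3) z(1)] folded_sector_pabs[OF assms(1-3) z(1)] z(2) .
qed

lemma pabs_image_eq_glue:
  assumes "\<rho> \<in> completeB n" "Z \<in> \<rho>" "neg ` Z = Z"
  shows "(`) pabs ` \<rho> = glue (pabs ` Z) (folded_sector n Z \<rho>)"
proof -
  have nc: "\<rho> \<in> NC_on (barred_circle (circleB n))" using assms(1) by (simp add: completeB_def)
  have "(`) pabs ` \<rho> = (`) pabs ` glue Z (sector (barred_circle (circleB n)) Z \<rho>)"
    using glue_sector[OF distinct_barred_circleB nc assms(2)] by simp
  also have "\<dots> = insert (pabs ` Z) (\<Union>z\<in>Z. (`) pabs ` sector (barred_circle (circleB n)) Z \<rho> z)"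
    unfolding glue_def by blast
  also have "\<dots> = glue (pabs ` Z) (folded_sector n Z \<rho>)"
    unfolding glue_def using folded_sector_pabs[OF assms] by simp
  finally show ?thesis .
qed

lemma pabs_image_NC:
  assumes "\<rho> \<in> completeB n" "Z \<in> \<rho>" "neg ` Z = Z"
  shows "(`) pabs ` \<rho> \<in> NC_on (barred_circle (circle n))"
    "v \<in> pabs ` Z \<Longrightarrow> sector (barred_circle (circle n)) (pabs ` Z) ((`) pabs ` \<rho>) v = folded_sector n Z \<rho> v"
proof -
  have nc: "\<rho> \<in> NC_on (barred_circle (circleB n))" using assms(1) by (simp add: completeB_def)
  have V: "pabs ` Z \<subseteq> set (barred_circle (circle n))" "pabs ` Z \<noteq> {}"
    using NC_onD(2,3)[OF nc assms(2)] pabs_mem by auto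
  have f: "folded_sector n Z \<rho> u \<in> NC_on (arc (barred_circle (circle n)) (pabs ` Z) u)" if "u \<in> pabs ` Z" for u
    using folded_sector_complete[OF assms that] by (simp add: complete_segments_def)
  show "(`) pabs ` \<rho> \<in> NC_on (barred_circle (circle n))"
    unfolding pabs_image_eq_glue[OF assms] by (rule glue_in_NC_on[OF distinct_barred_circleN V f])
  show "v \<in> pabs ` Z \<Longrightarrow> sector (barred_circle (circle n)) (pabs ` Z) ((`) pabs ` \<rho>) v = folded_sector n Z \<rho> v"
    unfolding pabs_image_eq_glue[OF assms] by (rule sector_glue[OF distinct_barred_circleN V f])
qed

text \<open>Two opposite sectors are negatives of each other, so one segment partition for each arc
  of the folded circle determines the symmetric partition. Conversely, any family of complete
  segments lifts to both arcs above each point and glues together with the zero block.\<close>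

lemma bij_betw_folded_sectors:
  assumes "V \<subseteq> set (barred_circle (circle n))" "V \<noteq> {}" "monochrome pcol V"
  shows "bij_betw (\<lambda>\<rho>. restrict (folded_sector n (lift n V) \<rho>) V) {\<rho> \<in> completeB n. lift n V \<in> \<rho>}
    (PiE V (\<lambda>v. complete_segments pcol (arc (barred_circle (circle n)) V v)))"
proof -
  let ?cs = "barred_circle (circleB n)" and ?bc = "barred_circle (circle n)"
  define Z where "Z = lift n V"
  have ZV: "pabs ` Z = V" unfolding Z_def by (rule pabs_lift[OF assms(1)])
  have nZ: "neg ` Z = Z" unfolding Z_def by (rule neg_lift)
  have ZS: "Z \<subseteq> set ?cs" by (auto simp: Z_def lift_def)
  have Zne: "Z \<noteq> {}" using ZV assms(2) by auto
  have zc: "z \<in> set ?cs" if "z \<in> Z" for z using that ZS by blast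
  have Zmono: "monochrome pcol Z" using assms(3) ZV unfolding monochrome_def by (metis imageI pcol_map_point)
  have posZ: "pos v \<in> Z" if "v \<in> V" for v using that assms(1) pos_mem by (auto simp: Z_def lift_def)
  \<comment> \<open>The inverse of folding on the arc behind \<open>z\<close>; \<open>N\<close> uses
    it to lift a segment partition to that arc.\<close>
  define g where "g z = inv_into (set (arc ?cs Z z)) pabs" for z
  define N where "N \<mu> z = (`) (g z) ` \<mu> (pabs z)" for \<mu> z
  note ad = arc_double_cover[OF ZS nZ]
  have setarc: "set (arc ?bc V (pabs z)) = pabs ` set (arc ?cs Z z)" if "z \<in> Z" for z
    using ad(1)[OF that] ZV by (metis set_map)
  have g1: "g z y \<in> set (arc ?cs Z z)" "pabs (g z y) = y" if "z \<in> Z" "y \<in> set (arc ?bc V (pabs z))" for z y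
    using that setarc[OF that(1)] inv_into_into[of y pabs] f_inv_into_f[of y pabs] by (auto simp: g_def)
  have g2: "g z (pabs p) = p" if "z \<in> Z" "p \<in> set (arc ?cs Z z)" for z p
    using ad(2)[OF that(1)] that(2) by (simp add: g_def)
  have NC: "N \<mu> z \<in> complete_segments pcol (arc ?cs Z z)"
    if m: "\<mu> \<in> PiE V (\<lambda>v. complete_segments pcol (arc ?bc V v))" and z: "z \<in> Z" for \<mu> z
  proof -
    have pz: "pabs z \<in> V" using ZV z by blast
    have "N \<mu> z \<in> complete_segments pcol (map (g z) (arc ?bc V (pabs z)))"
      unfolding N_def
    proof (rule complete_segments_map)
      show "distinct (arc ?bc V (pabs z))"
        using assms(1) pz by (intro distinct_arc[OF distinct_barred_circleN]) auto
      show "inj_on (g z) (set (arc ?bc V (pabs z)))" 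
        by (rule inj_on_inverseI[where g = pabs]) (rule g1(2)[OF z])
      show "pcol (g z p) = pcol p" if "p \<in> set (arc ?bc V (pabs z))" for p
        using arg_cong[OF g1(2)[OF z that], of pcol] by simp
      show "\<mu> (pabs z) \<in> complete_segments pcol (arc ?bc V (pabs z))" using PiE_mem[OF m pz] .
    qed
    moreover have "map (g z) (arc ?bc V (pabs z)) = arc ?cs Z z"
      unfolding ZV[symmetric] ad(1)[OF z, symmetric] map_map using g2[OF z] by (simp add: map_idI)
    ultimately show ?thesis by simp
  qed
  have sec: "sector ?cs Z (glue Z (N \<mu>)) z = N \<mu> z"
    if m: "\<mu> \<in> PiE V (\<lambda>v. complete_segments pcol (arc ?bc V v))" and z: "z \<in> Z" for \<mu> z
    by (rule sector_glue[OF distinct_barred_circleB ZS Zne _ z])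
      (use NC[OF m] in \<open>auto simp: complete_segments_def\<close>)
  have fs: "(`) pabs ` N \<mu> z = \<mu> (pabs z)"
    if m: "\<mu> \<in> PiE V (\<lambda>v. complete_segments pcol (arc ?bc V v))" and z: "z \<in> Z" for \<mu> z
  proof -
    have pz: "pabs z \<in> V" using ZV z by blast
    have "pabs ` g z ` X = X" if "X \<in> \<mu> (pabs z)" for X
    proof -
      have "X \<subseteq> set (arc ?bc V (pabs z))"
        using PiE_mem[OF m pz] that NC_onD(2) unfolding complete_segments_def by blast
      then have "pabs (g z y) = y" if "y \<in> X" for y using g1(2)[OF z] that by blast
      then have "(\<lambda>y. pabs (g z y)) ` X = (\<lambda>y. y) ` X" by (rule image_cong[OF refl])
      then show ?thesis by (simp add: image_image)
    qed
    then have "(\<lambda>X. pabs ` g z ` X) ` \<mu> (pabs z) = (\<lambda>X. X) ` \<mu> (pabs z)" by (rule image_cong[OF refl])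
    then show ?thesis unfolding N_def image_image[of "(`) pabs"] by simp
  qed
  have mem: "glue Z (N \<mu>) \<in> completeB n" "Z \<in> glue Z (N \<mu>)"
    if m: "\<mu> \<in> PiE V (\<lambda>v. complete_segments pcol (arc ?bc V v))" for \<mu>
  proof -
    show Zin: "Z \<in> glue Z (N \<mu>)" by (simp add: glue_def)
    have nc: "glue Z (N \<mu>) \<in> NC_on ?cs"
      by (rule glue_in_NC_on[OF distinct_barred_circleB ZS Zne])
        (use NC[OF m] in \<open>auto simp: complete_segments_def\<close>)
    have c: "complete ?cs (glue Z (N \<mu>)) \<and> (\<forall>W\<in>glue Z (N \<mu>). monochrome pcol W)"
      using complete_segments_sectors[OF distinct_barred_circleB nc Zin, of pcol] sec[OF m] NC[OF m] Zmono by simp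
    have "neg ` W \<in> glue Z (N \<mu>)" if W: "W \<in> glue Z (N \<mu>)" for W
    proof (cases "W = Z")
      case True
      then show ?thesis using nZ Zin by simp
    next
      case False
      then obtain z where z: "z \<in> Z" "W \<in> N \<mu> z" using W unfolding glue_def by blast
      then obtain X where X: "X \<in> \<mu> (pabs z)" "W = g z ` X" unfolding N_def by blast
      have pz: "pabs z \<in> V" using ZV z by blast
      have Xs: "X \<subseteq> set (arc ?bc V (pabs z))"
        using PiE_mem[OF m pz] X(1) NC_onD(2) unfolding complete_segments_def by blast
      have nz: "neg z \<in> Z" using nZ z by blast
      \<comment> \<open>The lifts to opposite arcs are exchanged by \<open>neg\<close>, which makes
        the glued partition symmetric.\<close>
      have "neg (g z y) = g (neg z) y" if y: "y \<in> X" for y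
      proof -
        have "g z y \<in> set (arc ?cs Z z)" "pabs (g z y) = y" using g1[OF z(1)] Xs y by blast+
        then have "neg (g z y) \<in> set (arc ?cs Z (neg z))" "pabs (neg (g z y)) = y"
          using arc_neg[OF distinct_barred_circleB cyc_neg_barred_circleB ZS nZ z(1)] by auto
        then show ?thesis using g2[OF nz] by metis
      qed
      then have "neg ` W = g (neg z) ` X" unfolding X(2) image_image by (rule image_cong[OF refl])
      then have "neg ` W \<in> N \<mu> (neg z)" using X(1) by (simp add: N_def)
      then show ?thesis using nz unfolding glue_def by blast
    qed
    then show "glue Z (N \<mu>) \<in> completeB n" using nc c by (simp add: completeB_def)
  qed
  show ?thesis
    unfolding Z_def[symmetric]
  proof (rule bij_betw_byWitness[where f' = "\<lambda>\<mu>. glue Z (N \<mu>)"])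
    show "\<forall>\<rho>\<in>{\<rho> \<in> completeB n. Z \<in> \<rho>}. glue Z (N (restrict (folded_sector n Z \<rho>) V)) = \<rho>"
    proof
      fix \<rho> assume "\<rho> \<in> {\<rho> \<in> completeB n. Z \<in> \<rho>}"
      then have r: "\<rho> \<in> completeB n" "Z \<in> \<rho>" by auto
      have nc: "\<rho> \<in> NC_on ?cs" using r(1) by (simp add: completeB_def)
      have "N (restrict (folded_sector n Z \<rho>) V) z = sector ?cs Z \<rho> z" if z: "z \<in> Z" for z
      proof -
        have pz: "pabs z \<in> V" using ZV z by blast
        have "N (restrict (folded_sector n Z \<rho>) V) z = (`) (g z) ` (`) pabs ` sector ?cs Z \<rho> z"
          unfolding N_def folded_sector_pabs[OF r nZ z] using pz by simp
        also have "\<dots> = sector ?cs Z \<rho> z"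
        proof -
          have "g z ` pabs ` W = W" if "W \<in> sector ?cs Z \<rho> z" for W
          proof -
            have "g z (pabs p) = p" if "p \<in> W" for p
              using g2[OF z] that \<open>W \<in> sector ?cs Z \<rho> z\<close> unfolding sector_def by blast
            then have "(\<lambda>p. g z (pabs p)) ` W = (\<lambda>p. p) ` W" by (rule image_cong[OF refl])
            then show ?thesis by (simp add: image_image)
          qed
          then have "(\<lambda>W. g z ` pabs ` W) ` sector ?cs Z \<rho> z = (\<lambda>W. W) ` sector ?cs Z \<rho> z"
            by (rule image_cong[OF refl])
          then show ?thesis unfolding image_image[of "(`) (g z)"] by simp
        qed
        finally show ?thesis .
      qed
      then have "glue Z (N (restrict (folded_sector n Z \<rho>) V)) = glue Z (sector ?cs Z \<rho>)"
        by (simp add: glue_def)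
      then show "glue Z (N (restrict (folded_sector n Z \<rho>) V)) = \<rho>"
        using glue_sector[OF distinct_barred_circleB nc r(2)] by simp
    qed
    show "\<forall>\<mu>\<in>PiE V (\<lambda>v. complete_segments pcol (arc ?bc V v)). restrict (folded_sector n Z (glue Z (N \<mu>))) V = \<mu>"
    proof
      fix \<mu> assume m: "\<mu> \<in> PiE V (\<lambda>v. complete_segments pcol (arc ?bc V v))"
      show "restrict (folded_sector n Z (glue Z (N \<mu>))) V = \<mu>"
      proof
        fix v show "restrict (folded_sector n Z (glue Z (N \<mu>))) V v = \<mu> v"
        proof (cases "v \<in> V")
          case True
          then show ?thesis using sec[OF m posZ[OF True]] fs[OF m posZ[OF True]] by (simp add: folded_sector_def)
        next
          case False
          then show ?thesis using PiE_arb[OF m False] by simp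
        qed
      qed
    qed
    show "(\<lambda>\<rho>. restrict (folded_sector n Z \<rho>) V) ` {\<rho> \<in> completeB n. Z \<in> \<rho>} \<subseteq>
        PiE V (\<lambda>v. complete_segments pcol (arc ?bc V v))"
      using folded_sector_complete[OF _ _ nZ] ZV by auto
    show "(\<lambda>\<mu>. glue Z (N \<mu>)) ` PiE V (\<lambda>v. complete_segments pcol (arc ?bc V v)) \<subseteq> {\<rho> \<in> completeB n. Z \<in> \<rho>}"
      using mem by auto
  qed
qed

definition folded_zero :: "int point set set \<Rightarrow> nat point set" where
  "folded_zero \<rho> = pabs ` (THE Z. Z \<in> \<rho> \<and> neg ` Z = Z)"

lemma folded_zero_eq:
  assumes "n \<ge> 1" "\<rho> \<in> completeB n" "Z \<in> \<rho>" "neg ` Z = Z"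
  shows "folded_zero \<rho> = pabs ` Z"
proof -
  have nc: "\<rho> \<in> NC_on (barred_circle (circleB n))" using assms(2) by (simp add: completeB_def)
  have "(THE Z. Z \<in> \<rho> \<and> neg ` Z = Z) = Z"
  proof (rule the_equality)
    show "Z \<in> \<rho> \<and> neg ` Z = Z" using assms by blast
    show "Y = Z" if "Y \<in> \<rho> \<and> neg ` Y = Y" for Y
      using zero_block_unique[OF distinct_barred_circleB nc cyc_neg_barred_circleB neg_neq[of _ n] assms(3,4)] that by blast
  qed
  then show ?thesis by (simp add: folded_zero_def)
qed

lemma completeB_zero:
  assumes "n \<ge> 1" "\<rho> \<in> completeB n"
  obtains Z where "Z \<in> \<rho>" "neg ` Z = Z"
  using zero_block_exists[OF circular_barred_circleB[OF assms(1)], of \<rho>] cyc_neg_barred_circleB assms(2)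
  unfolding completeB_def by blast

text \<open>Both brackets multiplied together and read on one barred circle, with \<open>V\<close>
  as the image of the unique zero block. This form treats the two colours alike.\<close>

definition bracket_term :: "('a::ring_1 \<Rightarrow> complex) \<Rightarrow> ('a \<Rightarrow> complex) \<Rightarrow> (nat point \<Rightarrow> 'a) \<Rightarrow> nat \<Rightarrow>
    nat point set set \<Rightarrow> nat point set \<Rightarrow> complex" where
  "bracket_term \<psi> D x n \<tau> V = dkap \<psi> D x (listing (barred_circle (circle n)) V) *
    (\<Prod>W\<in>\<tau> - {V}. kap \<psi> x (arc_listing (barred_circle (circle n)) V W))"

lemma sum_completeB:
  assumes n: "n \<ge> 1"
  shows "(\<Sum>\<rho>\<in>completeB n. bracket_term \<psi> D x n ((`) pabs ` \<rho>) (folded_zero \<rho>)) =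
    circle_sum \<psi> D x (barred_circle (circle n))"
proof -
  let ?cs = "barred_circle (circleB n)" and ?bc = "barred_circle (circle n)"
  define \<V> where "\<V> = {V. V \<noteq> {} \<and> V \<subseteq> set ?bc \<and> monochrome pcol V}"
  have "(\<Sum>\<rho>\<in>completeB n. bracket_term \<psi> D x n ((`) pabs ` \<rho>) (folded_zero \<rho>)) =
      (\<Sum>\<rho>\<in>completeB n. \<Sum>V\<in>{folded_zero \<rho>}. bracket_term \<psi> D x n ((`) pabs ` \<rho>) V)" by simp
  \<comment> \<open>Sorting by the folded zero block: \<open>lift n V\<close> is symmetric, so it is
    the zero block of every complete partition that contains it, and the zero block is recovered
    from its image.\<close>
  also have "\<dots> = (\<Sum>V\<in>\<V>. \<Sum>\<rho>\<in>{\<rho> \<in> completeB n. lift n V \<in> \<rho>}. bracket_term \<psi> D x n ((`) pabs ` \<rho>) V)"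
  proof (rule sum_pairs_swap[where S = "NC_on ?cs" and S' = "Pow (set ?bc)"])
    fix \<rho> V assume r: "\<rho> \<in> completeB n" and "V \<in> {folded_zero \<rho>}"
    then have V: "V = folded_zero \<rho>" by simp
    obtain Z where Z: "Z \<in> \<rho>" "neg ` Z = Z" by (rule completeB_zero[OF n r])
    have nc: "\<rho> \<in> NC_on ?cs" and mono: "monochrome pcol Z" using r Z by (auto simp: completeB_def)
    have VZ: "V = pabs ` Z" using V folded_zero_eq[OF n r Z] by simp
    have ZS: "Z \<subseteq> set ?cs" "Z \<noteq> {}" using NC_onD(2,3)[OF nc Z(1)] by auto
    have "monochrome pcol V" using mono unfolding VZ monochrome_def by (metis imageE pcol_map_point)
    then have "V \<in> \<V>" using VZ ZS pabs_mem by (auto simp: \<V>_def)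
    moreover have "lift n V = Z" unfolding VZ by (rule lift_pabs[OF ZS(1) Z(2)])
    ultimately show "V \<in> \<V> \<and> \<rho> \<in> {\<rho> \<in> completeB n. lift n V \<in> \<rho>}" using r Z by simp
  next
    fix \<rho> V assume "V \<in> \<V>" "\<rho> \<in> {\<rho> \<in> completeB n. lift n V \<in> \<rho>}"
    then have V: "V \<subseteq> set ?bc" and r: "\<rho> \<in> completeB n" "lift n V \<in> \<rho>" by (auto simp: \<V>_def)
    have "folded_zero \<rho> = V" using folded_zero_eq[OF n r neg_lift] pabs_lift[OF V] by simp
    then show "\<rho> \<in> completeB n \<and> V \<in> {folded_zero \<rho>}" using r by simp
  next
    show "completeB n \<subseteq> NC_on ?cs" by (auto simp: completeB_def)
    show "\<V> \<subseteq> Pow (set ?bc)" by (auto simp: \<V>_def)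
    show "{folded_zero \<rho>} \<subseteq> Pow (set ?bc)" if r: "\<rho> \<in> completeB n" for \<rho>
    proof -
      obtain Z where Z: "Z \<in> \<rho>" "neg ` Z = Z" by (rule completeB_zero[OF n r])
      then have "Z \<subseteq> set ?cs" using r NC_onD(2) unfolding completeB_def by blast
      then show ?thesis using folded_zero_eq[OF n r Z] pabs_mem by auto
    qed
    show "{\<rho> \<in> completeB n. lift n V \<in> \<rho>} \<subseteq> NC_on ?cs" for V by (auto simp: completeB_def)
  qed (auto simp: finite_NC_on)
  also have "\<dots> = circle_sum \<psi> D x ?bc"
    unfolding circle_sum_def \<V>_def[symmetric]
  proof (rule sum.cong[OF refl])
    fix V assume "V \<in> \<V>"
    then have V: "V \<noteq> {}" "V \<subseteq> set ?bc" "monochrome pcol V" by (auto simp: \<V>_def)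
    have Vfin: "finite V" using V(2) finite_subset by blast
    define Z where "Z = lift n V"
    have ZV: "pabs ` Z = V" unfolding Z_def by (rule pabs_lift[OF V(2)])
    define h where "h v \<nu> = (\<Prod>W\<in>\<nu>. kap \<psi> x (listing (arc ?bc V v) W))" for v \<nu>
    have "bracket_term \<psi> D x n ((`) pabs ` \<rho>) V = dkap \<psi> D x (listing ?bc V) *
        (\<Prod>v\<in>V. h v (restrict (folded_sector n Z \<rho>) V v))"
      if "\<rho> \<in> {\<rho> \<in> completeB n. Z \<in> \<rho>}" for \<rho>
    proof -
      have r: "\<rho> \<in> completeB n" "Z \<in> \<rho>" "neg ` Z = Z" using that neg_lift by (auto simp: Z_def)
      note nc = pabs_image_NC[OF r, unfolded ZV]
      have Vin: "V \<in> (`) pabs ` \<rho>" using r(2) ZV by blast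
      have "(\<Prod>W\<in>(`) pabs ` \<rho> - {V}. kap \<psi> x (arc_listing ?bc V W)) =
          (\<Prod>v\<in>V. \<Prod>W\<in>sector ?bc V ((`) pabs ` \<rho>) v. kap \<psi> x (arc_listing ?bc V W))"
        by (rule prod_NC_on_block[OF distinct_barred_circleN nc(1) Vin])
      also have "\<dots> = (\<Prod>v\<in>V. h v (restrict (folded_sector n Z \<rho>) V v))"
      proof (rule prod.cong[OF refl])
        fix v assume v: "v \<in> V"
        have "kap \<psi> x (arc_listing ?bc V W) = kap \<psi> x (listing (arc ?bc V v) W)"
          if "W \<in> sector ?bc V ((`) pabs ` \<rho>) v" for W
        proof -
          have "W \<subseteq> set (arc ?bc V v)" "W \<noteq> {}" using that NC_onD(3)[OF nc(1)] unfolding sector_def by blast+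
          then show ?thesis using arc_listing_eq[OF distinct_barred_circleN V(2) v] by simp
        qed
        then show "(\<Prod>W\<in>sector ?bc V ((`) pabs ` \<rho>) v. kap \<psi> x (arc_listing ?bc V W)) =
            h v (restrict (folded_sector n Z \<rho>) V v)"
          using v nc(2)[OF v] by (simp add: h_def)
      qed
      finally show ?thesis by (simp add: bracket_term_def)
    qed
    then have "(\<Sum>\<rho>\<in>{\<rho> \<in> completeB n. lift n V \<in> \<rho>}. bracket_term \<psi> D x n ((`) pabs ` \<rho>) V) =
        dkap \<psi> D x (listing ?bc V) *
        (\<Sum>\<rho>\<in>{\<rho> \<in> completeB n. Z \<in> \<rho>}. \<Prod>v\<in>V. h v (restrict (folded_sector n Z \<rho>) V v))"
      unfolding Z_def[symmetric] sum_distrib_left by (intro sum.cong) auto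
    also have "(\<Sum>\<rho>\<in>{\<rho> \<in> completeB n. Z \<in> \<rho>}. \<Prod>v\<in>V. h v (restrict (folded_sector n Z \<rho>) V v)) =
        (\<Sum>\<mu>\<in>PiE V (\<lambda>v. complete_segments pcol (arc ?bc V v)). \<Prod>v\<in>V. h v (\<mu> v))"
      unfolding Z_def
      by (rule sum.reindex_bij_betw[OF bij_betw_folded_sectors[OF V(2,1,3)], of "\<lambda>\<mu>. \<Prod>v\<in>V. h v (\<mu> v)"])
    also have "\<dots> = (\<Prod>v\<in>V. \<Sum>\<nu>\<in>complete_segments pcol (arc ?bc V v). h v \<nu>)"
    proof (rule prod_sum_PiE[symmetric, OF Vfin])
      show "finite (complete_segments pcol (arc ?bc V v))" for v
        by (rule finite_subset[OF _ finite_NC_on]) (auto simp: complete_segments_def)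
    qed
    also have "\<dots> = (\<Prod>v\<in>V. segment_sum \<psi> pcol x (arc ?bc V v))" by (simp add: h_def segment_sum_def)
    finally show "(\<Sum>\<rho>\<in>{\<rho> \<in> completeB n. lift n V \<in> \<rho>}. bracket_term \<psi> D x n ((`) pabs ` \<rho>) V) =
        dkap \<psi> D x (listing ?bc V) * (\<Prod>v\<in>V. segment_sum \<psi> pcol x (arc ?bc V v))" .
  qed
  finally show ?thesis .
qed

section \<open>Evaluation of the brackets\<close>

lemma pabs_with_bars: "(`) pabs ` with_bars \<pi> \<sigma> = with_bars (Abs_part \<pi>) (Abs_part \<sigma>)"
  by (simp add: with_bars_def Abs_part_def image_Un image_image abs_block_def)

lemma completeB_zero_unique:
  assumes "\<rho> \<in> completeB n" "Z \<in> \<rho>" "neg ` Z = Z" "Y \<in> \<rho>" "neg ` Y = Y"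
  shows "Y = Z"
proof -
  have nc: "\<rho> \<in> NC_on (barred_circle (circleB n))" using assms(1) by (simp add: completeB_def)
  show ?thesis
    by (rule zero_block_unique[OF distinct_barred_circleB nc cyc_neg_barred_circleB neg_neq[of _ n] assms(2-5)])
qed

lemma with_bars_completeB: "n \<ge> 1 \<Longrightarrow> \<pi> \<in> NCB n \<Longrightarrow> with_bars \<pi> (Kr n \<pi>) \<in> completeB n"
  by (rule bij_betw_apply[OF bij_betw_completeB])

lemma is_zero_block_Plain: "is_zero_block \<pi> Z \<Longrightarrow> Plain ` Z \<in> with_bars \<pi> \<sigma> \<and> neg ` Plain ` Z = Plain ` Z"
proof -
  assume Z: "is_zero_block \<pi> Z"
  have "neg ` Plain ` Z = Plain ` uminus ` Z" by (simp add: image_image)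
  then show ?thesis using Z by (simp add: is_zero_block_def with_bars_def)
qed

lemma is_zero_block_Bar: "is_zero_block \<sigma> Z \<Longrightarrow> Bar ` Z \<in> with_bars \<pi> \<sigma> \<and> neg ` Bar ` Z = Bar ` Z"
proof -
  assume Z: "is_zero_block \<sigma> Z"
  have "neg ` Bar ` Z = Bar ` uminus ` Z" by (simp add: image_image)
  then show ?thesis using Z by (simp add: is_zero_block_def with_bars_def)
qed

text \<open>A zero block of \<open>\<pi>\<close> becomes one of the complete partition
  \<open>with_bars \<pi> (Kr n \<pi>)\<close>, where uniqueness is known.\<close>

lemma zero_block_eq:
  assumes "n \<ge> 1" "\<pi> \<in> NCB n" "is_zero_block \<pi> Z"
  shows "zero_block \<pi> = Z"
  unfolding zero_block_def
proof (rule the_equality)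
  show "is_zero_block \<pi> Z" by (rule assms(3))
  fix Y assume Y: "is_zero_block \<pi> Y"
  have "Plain ` Y = Plain ` Z"
    by (rule completeB_zero_unique[OF with_bars_completeB[OF assms(1,2)]
          conjunct1[OF is_zero_block_Plain[OF assms(3)]] conjunct2[OF is_zero_block_Plain[OF assms(3)]]
          conjunct1[OF is_zero_block_Plain[OF Y]] conjunct2[OF is_zero_block_Plain[OF Y]]])
  moreover have "inj (Plain :: int \<Rightarrow> int point)" by (simp add: inj_def)
  ultimately show "Y = Z" by (simp add: inj_image_eq_iff)
qed

text \<open>The unique zero block of the complete partition cannot be plain and barred at
  once.\<close>

lemma zero_blocks_exclusive:
  assumes "n \<ge> 1" "\<pi> \<in> NCB n" "is_zero_block \<pi> Z" "is_zero_block (Kr n \<pi>) Y"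
  shows False
proof -
  have e: "Plain ` Z = Bar ` Y"
    by (rule completeB_zero_unique[OF with_bars_completeB[OF assms(1,2)]
          conjunct1[OF is_zero_block_Bar[OF assms(4)]] conjunct2[OF is_zero_block_Bar[OF assms(4)]]
          conjunct1[OF is_zero_block_Plain[OF assms(3)]] conjunct2[OF is_zero_block_Plain[OF assms(3)]]])
  have "Z \<noteq> {}" using assms(2,3) NC_onD(3) unfolding NCB_def is_zero_block_def by blast
  then obtain z where "z \<in> Z" by blast
  then have "Plain z \<in> Bar ` Y" using e by blast
  then show False by blast
qed

lemma arc_listing_cyc:
  assumes "distinct cs" "cyc cs zs" "V \<subseteq> set cs" "v \<in> V" "W \<subseteq> set (arc cs V v)" "W \<noteq> {}"
  shows "arc_listing zs V W = arc_listing cs V W"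
proof -
  have a: "arc zs V v = arc cs V v" using arc_cyc_eq[OF assms(1,2)] assms(3,4) by blast
  have "distinct zs" using cyc_distinct[OF assms(2)] assms(1) by blast
  moreover have "V \<subseteq> set zs" using cyc_set[OF assms(2)] assms(3) by blast
  ultimately have "arc_listing zs V W = filter (\<lambda>x. x \<in> W) (arc zs V v)"
    by (rule arc_listing_eq) (use assms a in simp_all)
  then show ?thesis using arc_listing_eq[OF assms(1,3,4,5,6)] a by simp
qed

lemma listing_same_colour:
  "listing (barred_circle is) (Plain ` V) = map Plain (listing is V)"
  "listing (barred_circle is) (Bar ` V) = map Bar (listing is V)"
  by (induction "is") auto

lemma arc_listing_same_colour:
  assumes "distinct is" "V \<subseteq> set is" "v \<in> V" "W \<subseteq> set (arc is V v)" "W \<noteq> {}" "C = Plain \<or> C = Bar"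
  shows "arc_listing (barred_circle is) (C ` V) (C ` W) = map C (arc_listing is V W)"
proof -
  let ?bc = "barred_circle is"
  define c where "c = (if C = Plain then 1 else 2 :: nat)"
  have C: "C = Plain \<and> c = 1 \<or> C = Bar \<and> c = 2" and pc: "pcol (C j) = c" and inj: "inj C" for j
    using assms(6) by (auto simp: c_def inj_on_def fun_eq_iff)
  have sub: "C ` W \<subseteq> set (arc ?bc (C ` V) (C v))"
    using same_colour_arc_iff[OF assms(1-3,6)] assms(4) by blast
  have CV: "C ` V \<subseteq> set ?bc" using assms(2,6) by (auto simp: set_barred_circle)
  have "arc_listing ?bc (C ` V) (C ` W) = filter (\<lambda>p. p \<in> C ` W) (arc ?bc (C ` V) (C v))"
    by (rule arc_listing_eq[OF distinct_barred_circle[OF assms(1)] CV _ sub]) (use assms in auto)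
  also have "\<dots> = filter (\<lambda>p. p \<in> C ` W) (filter (\<lambda>p. pcol p = c) (arc ?bc (C ` V) (C v)))"
    unfolding filter_filter by (rule filter_cong) (auto simp: pc)
  also have "\<dots> = listing (map C (arc is V v)) (C ` W)"
    unfolding filter_arc_barred_circle[OF assms(1-3) C] ..
  also have "\<dots> = map C (listing (arc is V v) W)"
    by (rule listing_map[OF inj_on_subset[OF inj] assms(4)]) simp
  finally show ?thesis using arc_listing_eq[OF assms(1-5)] by simp
qed

text \<open>When \<open>\<pi>\<close> has the zero block, the bracket of \<open>Kr n \<pi>\<close>
  draws its bars from \<open>Kr n (Kr n \<pi>)\<close>, where that block reappears shifted by
  \<open>predN\<close>. A rotation by half a step turns this listing into that of the bars
  \<open>W\<close> around the plain block itself.\<close>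

lemma arc_listing_shift:
  assumes "n \<ge> 1" "V \<subseteq> {1..n}" "v \<in> V" "Bar ` W \<subseteq> set (arc (barred_circle (circle n)) (Plain ` V) (Plain v))"
    "W \<noteq> {}"
  shows "arc_listing (barred_circle (circle n)) (Bar ` predN n ` V) (Plain ` W) =
    map (rot (predN n)) (arc_listing (barred_circle (circle n)) (Plain ` V) (Bar ` W))"
proof -
  let ?bc = "barred_circle (circle n)" and ?f = "rot (predN n)"
  have ne: "circle n \<noteq> []" and d: "distinct (circle n)" using assms(1) by (auto simp: circle_def)
  have inj: "inj_on ?f (set ?bc)" by (rule inj_on_rot[OF ne d predN_circle[OF assms(1)]])
  have c: "cyc ?bc (map ?f ?bc)" by (rule cyc_rot_barred_circle[OF ne predN_circle[OF assms(1)]])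
  have V: "Plain ` V \<subseteq> set ?bc" using assms(2) by (auto simp: set_barred_circle)
  have vV: "Plain v \<in> Plain ` V" and v: "Plain v \<in> set ?bc" using assms(3) V by auto
  have W: "Bar ` W \<noteq> {}" using assms(5) by simp
  have fV: "?f ` Plain ` V = Bar ` predN n ` V" and fW: "?f ` Bar ` W = Plain ` W" by (simp_all add: image_image)
  have dm: "distinct (map ?f ?bc)" and sm: "set (map ?f ?bc) = set ?bc"
    using cyc_distinct[OF c] cyc_set[OF c] distinct_barred_circleN by auto
  have fs: "?f ` Plain ` V \<subseteq> set (map ?f ?bc)" using V by auto
  have am: "arc (map ?f ?bc) (?f ` Plain ` V) (?f (Plain v)) = map ?f (arc ?bc (Plain ` V) (Plain v))"
    by (rule arc_map[OF distinct_barred_circleN inj V v])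
  have "arc_listing ?bc (?f ` Plain ` V) (?f ` Bar ` W) = arc_listing (map ?f ?bc) (?f ` Plain ` V) (?f ` Bar ` W)"
  proof (rule arc_listing_cyc[OF dm cyc_sym[OF c] fs])
    show "?f (Plain v) \<in> ?f ` Plain ` V" by (rule imageI[OF vV])
    show "?f ` Bar ` W \<subseteq> set (arc (map ?f ?bc) (?f ` Plain ` V) (?f (Plain v)))"
      unfolding am set_map using assms(4) by (rule image_mono)
  qed (use W in simp)
  also have "\<dots> = map ?f (arc_listing ?bc (Plain ` V) (Bar ` W))"
    by (rule arc_listing_map[OF distinct_barred_circleN inj V vV assms(4) W])
  finally show ?thesis unfolding fV fW .
qed

abbreviation sides :: "('i \<Rightarrow> 'a) \<Rightarrow> ('i \<Rightarrow> 'a) \<Rightarrow> 'i point \<Rightarrow> 'a" where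
  "sides a b \<equiv> case_point a b"

lemma map_sides_map [simp]:
  "map (sides a b) (map Plain l) = map a l" "map (sides a b) (map Bar l) = map b l"
  by simp_all

lemma map_sides:
  "set l \<subseteq> Plain ` W \<Longrightarrow> map (sides a b) l = map a (map idx l)"
  "set l \<subseteq> Bar ` W \<Longrightarrow> map (sides a b) l = map b (map idx l)"
  "set l \<subseteq> Bar ` W \<Longrightarrow> map idx (map (rot f) l) = map idx l"
  by (induction l) auto

lemma set_arc_listing: "set (arc_listing cs V W) \<subseteq> W"
  by (auto simp: arc_listing_def)

lemma prod_with_bars:
  assumes "finite \<pi>" "finite \<sigma>" "{} \<notin> \<pi>"
  shows "(\<Prod>W\<in>with_bars \<pi> \<sigma>. h W) = (\<Prod>V\<in>\<pi>. h (Plain ` V)) * (\<Prod>V\<in>\<sigma>. h (Bar ` V))"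
proof -
  have "inj_on ((`) Plain) \<pi>" "inj_on ((`) Bar) \<sigma>"
    by (auto intro!: inj_onI simp: inj_image_eq_iff inj_def)
  moreover have "(`) Plain ` \<pi> \<inter> (`) Bar ` \<sigma> = {}"
  proof -
    have "Plain ` V \<noteq> Bar ` W" if V: "V \<in> \<pi>" for V W
    proof -
      obtain v where v: "v \<in> V" using V assms(3) by (metis equals0I)
      have "Plain v \<notin> Bar ` W" by blast
      then show ?thesis using v by blast
    qed
    then show ?thesis by blast
  qed
  ultimately show ?thesis
    unfolding with_bars_def using assms(1,2) by (simp add: prod.union_disjoint prod.reindex)
qed

lemma with_bars_remove:
  assumes "V \<noteq> {}"
  shows "with_bars \<pi> \<sigma> - {Plain ` V} = with_bars (\<pi> - {V}) \<sigma>"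
    "with_bars \<pi> \<sigma> - {Bar ` V} = with_bars \<pi> (\<sigma> - {V})"
proof -
  obtain v where v: "v \<in> V" using assms by blast
  have "Plain v \<notin> Bar ` W" "Bar v \<notin> Plain ` W" for W by blast+
  then have "Plain ` V \<noteq> Bar ` W" "Bar ` V \<noteq> Plain ` W" for W using v by blast+
  moreover have "Plain ` U = Plain ` W \<longleftrightarrow> U = W" "Bar ` U = Bar ` W \<longleftrightarrow> U = W" for U W
    by (rule inj_image_eq_iff; simp add: inj_def)+
  ultimately show "with_bars \<pi> \<sigma> - {Plain ` V} = with_bars (\<pi> - {V}) \<sigma>"
    "with_bars \<pi> \<sigma> - {Bar ` V} = with_bars \<pi> (\<sigma> - {V})"
    unfolding with_bars_def by (blast, blast)
qed

context
  fixes n :: nat and A B :: "nat set set" and \<psi> D :: "'a::ring_1 \<Rightarrow> complex" and a b :: "nat \<Rightarrow> 'a"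
  assumes n: "n \<ge> 1" and nc: "with_bars A B \<in> NC_on (barred_circle (circle n))"
begin

lemma parts_NC: "A \<in> NC n" "B \<in> NC n"
  using with_bars_parts[OF _ nc] by (auto simp: circle_def simp del: upt_Suc)

lemma parts_finite: "finite A" "finite B"
proof -
  have "A \<subseteq> Pow {1..n}" "B \<subseteq> Pow {1..n}" using parts_NC NC_block_subset by blast+
  then show "finite A" "finite B" by (auto intro: finite_subset)
qed

lemma parts_nonempty: "{} \<notin> A" "{} \<notin> B"
  using parts_NC NC_onD(3) by blast+

text \<open>The marked block is plain: the \<open>a\<close>-part is a bracket with zero block, and
  the \<open>b\<close>-part, moved by half a step, a bracket without one.\<close>

lemma bracket_term_Plain:
  assumes Q: "Q \<in> A"
  shows "bracket_term \<psi> D (sides a b) n (with_bars A B) (Plain ` Q) =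
    (cyclic_free_cumulant \<psi> D (map a (sorted_list_of_set Q)) *
      (\<Prod>V\<in>A - {Q}. free_cumulant \<psi> (map a (arc_listing (circle n) Q V)))) *
    (\<Prod>V\<in>B. free_cumulant \<psi> (map b (map idx
      (arc_listing (barred_circle (circle n)) (Bar ` predN n ` Q) (Plain ` V)))))"
proof -
  let ?bc = "barred_circle (circle n)"
  have Qn: "Q \<subseteq> {1..n}" "Q \<noteq> {}" using NC_block_subset[OF parts_NC(1) Q] parts_nonempty Q by auto
  have d: "distinct (circle n)" by simp
  have Qb: "Plain ` Q \<in> with_bars A B" using Q by (simp add: with_bars_def)
  have l: "dkap \<psi> D (sides a b) (listing ?bc (Plain ` Q)) = cyclic_free_cumulant \<psi> D (map a (sorted_list_of_set Q))"
    unfolding dkap_def listing_same_colour listing_circle[OF Qn(1)] map_sides_map ..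
  have p: "kap \<psi> (sides a b) (arc_listing ?bc (Plain ` Q) (Plain ` V)) =
      free_cumulant \<psi> (map a (arc_listing (circle n) Q V))" if V: "V \<in> A - {Q}" for V
  proof -
    have "Plain ` V \<in> with_bars A B - {Plain ` Q}" using V with_bars_remove(1)[OF Qn(2)] by (auto simp: with_bars_def)
    then obtain q where "q \<in> Plain ` Q" "Plain ` V \<subseteq> set (arc ?bc (Plain ` Q) q)"
      using NC_on_arc[OF distinct_barred_circleN nc Qb, of "Plain ` V"] by blast
    then obtain v where v: "v \<in> Q" "Plain ` V \<subseteq> set (arc ?bc (Plain ` Q) (Plain v))" by blast
    have "V \<subseteq> set (arc (circle n) Q v)"
      using v(2) same_colour_arc_iff[OF d _ v(1), of Plain] Qn(1) by auto
    moreover have "V \<noteq> {}" using V parts_nonempty by blast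
    ultimately have "arc_listing ?bc (Plain ` Q) (Plain ` V) = map Plain (arc_listing (circle n) Q V)"
      using arc_listing_same_colour[OF d _ v(1), of V Plain] Qn(1) by simp
    then show ?thesis unfolding kap_def by (simp del: map_map)
  qed
  have q: "kap \<psi> (sides a b) (arc_listing ?bc (Plain ` Q) (Bar ` V)) =
      free_cumulant \<psi> (map b (map idx (arc_listing ?bc (Bar ` predN n ` Q) (Plain ` V))))" if V: "V \<in> B" for V
  proof -
    have "Bar ` V \<in> with_bars A B - {Plain ` Q}" using V with_bars_remove(1)[OF Qn(2)] by (auto simp: with_bars_def)
    then obtain q where "q \<in> Plain ` Q" "Bar ` V \<subseteq> set (arc ?bc (Plain ` Q) q)"
      using NC_on_arc[OF distinct_barred_circleN nc Qb, of "Bar ` V"] by blast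
    then obtain v where v: "v \<in> Q" "Bar ` V \<subseteq> set (arc ?bc (Plain ` Q) (Plain v))" by blast
    have "V \<noteq> {}" using V parts_nonempty by blast
    note s = arc_listing_shift[OF n Qn(1) v this]
    show ?thesis unfolding kap_def s map_sides(3)[OF set_arc_listing] map_sides(2)[OF set_arc_listing] ..
  qed
  have "(\<Prod>W\<in>with_bars A B - {Plain ` Q}. kap \<psi> (sides a b) (arc_listing ?bc (Plain ` Q) W)) =
      (\<Prod>V\<in>A - {Q}. kap \<psi> (sides a b) (arc_listing ?bc (Plain ` Q) (Plain ` V))) *
      (\<Prod>V\<in>B. kap \<psi> (sides a b) (arc_listing ?bc (Plain ` Q) (Bar ` V)))"
    unfolding with_bars_remove(1)[OF Qn(2)] using parts_finite parts_nonempty by (intro prod_with_bars) auto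
  then show ?thesis unfolding bracket_term_def l using p q by (simp add: mult.assoc)
qed

text \<open>With a barred marked block, the bracket of the \<open>a\<close>-part is already defined
  by listings around bars, so both parts match without a shift.\<close>

lemma bracket_term_Bar:
  assumes Q: "Q \<in> B"
  shows "bracket_term \<psi> D (sides a b) n (with_bars A B) (Bar ` Q) =
    (\<Prod>V\<in>A. free_cumulant \<psi> (map a (map idx (arc_listing (barred_circle (circle n)) (Bar ` Q) (Plain ` V))))) *
    (cyclic_free_cumulant \<psi> D (map b (sorted_list_of_set Q)) *
      (\<Prod>V\<in>B - {Q}. free_cumulant \<psi> (map b (arc_listing (circle n) Q V))))"
proof -
  let ?bc = "barred_circle (circle n)"
  have Qn: "Q \<subseteq> {1..n}" "Q \<noteq> {}" using NC_block_subset[OF parts_NC(2) Q] parts_nonempty Q by auto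
  have d: "distinct (circle n)" by simp
  have Qb: "Bar ` Q \<in> with_bars A B" using Q by (simp add: with_bars_def)
  have l: "dkap \<psi> D (sides a b) (listing ?bc (Bar ` Q)) = cyclic_free_cumulant \<psi> D (map b (sorted_list_of_set Q))"
    unfolding dkap_def listing_same_colour listing_circle[OF Qn(1)] map_sides_map ..
  have p: "kap \<psi> (sides a b) (arc_listing ?bc (Bar ` Q) (Bar ` V)) =
      free_cumulant \<psi> (map b (arc_listing (circle n) Q V))" if V: "V \<in> B - {Q}" for V
  proof -
    have "Bar ` V \<in> with_bars A B - {Bar ` Q}" using V with_bars_remove(2)[OF Qn(2)] by (auto simp: with_bars_def)
    then obtain q where "q \<in> Bar ` Q" "Bar ` V \<subseteq> set (arc ?bc (Bar ` Q) q)"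
      using NC_on_arc[OF distinct_barred_circleN nc Qb, of "Bar ` V"] by blast
    then obtain v where v: "v \<in> Q" "Bar ` V \<subseteq> set (arc ?bc (Bar ` Q) (Bar v))" by blast
    have "V \<subseteq> set (arc (circle n) Q v)"
      using v(2) same_colour_arc_iff[OF d _ v(1), of Bar] Qn(1) by auto
    moreover have "V \<noteq> {}" using V parts_nonempty by blast
    ultimately have "arc_listing ?bc (Bar ` Q) (Bar ` V) = map Bar (arc_listing (circle n) Q V)"
      using arc_listing_same_colour[OF d _ v(1), of V Bar] Qn(1) by simp
    then show ?thesis unfolding kap_def by (simp del: map_map)
  qed
  have q: "kap \<psi> (sides a b) (arc_listing ?bc (Bar ` Q) (Plain ` V)) =
      free_cumulant \<psi> (map a (map idx (arc_listing ?bc (Bar ` Q) (Plain ` V))))" for V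
    unfolding kap_def map_sides(1)[OF set_arc_listing] ..
  have "(\<Prod>W\<in>with_bars A B - {Bar ` Q}. kap \<psi> (sides a b) (arc_listing ?bc (Bar ` Q) W)) =
      (\<Prod>V\<in>A. kap \<psi> (sides a b) (arc_listing ?bc (Bar ` Q) (Plain ` V))) *
      (\<Prod>V\<in>B - {Q}. kap \<psi> (sides a b) (arc_listing ?bc (Bar ` Q) (Bar ` V)))"
    unfolding with_bars_remove(2)[OF Qn(2)] using parts_finite parts_nonempty by (intro prod_with_bars) auto
  then show ?thesis unfolding bracket_term_def l q using p by (simp add: mult_ac)
qed

end

lemma predB_uminus: "z \<noteq> 0 \<Longrightarrow> predB n (- z) = - predB n z"
  by (auto simp: predB_def)

text \<open>Exactly one of \<open>\<pi>\<close> and \<open>Kr n \<pi>\<close> has a zero block, so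
  exactly one bracket contributes a cyclic cumulant. The zero block of the complete partition tells
  which of the two it is.\<close>

lemma bracketB_mult:
  assumes n: "n \<ge> 1" and p: "\<pi> \<in> NCB n"
  shows "bracketB n (free_cumulant \<psi>) (cyclic_free_cumulant \<psi> D) \<pi> a *
      bracketB n (free_cumulant \<psi>) (cyclic_free_cumulant \<psi> D) (Kr n \<pi>) b =
    bracket_term \<psi> D (sides a b) n ((`) pabs ` with_bars \<pi> (Kr n \<pi>)) (folded_zero (with_bars \<pi> (Kr n \<pi>)))"
proof -
  define \<rho> where "\<rho> = with_bars \<pi> (Kr n \<pi>)"
  have r: "\<rho> \<in> completeB n" unfolding \<rho>_def by (rule with_bars_completeB[OF n p])
  have k: "Kr n \<pi> \<in> NCB n" by (rule Kr_NCB[OF n p])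
  obtain Z where Z: "Z \<in> \<rho>" "neg ` Z = Z" by (rule completeB_zero[OF n r])
  have nc: "with_bars (Abs_part \<pi>) (Abs_part (Kr n \<pi>)) \<in> NC_on (barred_circle (circle n))"
    using pabs_image_NC(1)[OF r Z] unfolding \<rho>_def pabs_with_bars .
  have fz: "folded_zero \<rho> = pabs ` Z" by (rule folded_zero_eq[OF n r Z])
  have inj: "inj (Plain :: int \<Rightarrow> int point)" "inj (Bar :: int \<Rightarrow> int point)" by (simp_all add: inj_def)
  consider (plain) Y where "Y \<in> \<pi>" "Z = Plain ` Y" | (bar) Y where "Y \<in> Kr n \<pi>" "Z = Bar ` Y"
    using Z(1) unfolding \<rho>_def with_bars_def by blast
  then show ?thesis
  proof cases
    case plain
    have "Plain ` uminus ` Y = Plain ` Y" using Z(2) plain(2) by (simp add: image_image)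
    then have "uminus ` Y = Y" using inj(1) by (simp add: inj_image_eq_iff)
    then have Y: "is_zero_block \<pi> Y" using plain(1) by (simp add: is_zero_block_def)
    have Yn: "Y \<subseteq> set (circleB n)" using p plain(1) NC_onD(2) unfolding NCB_def by blast
    have Y0: "z \<noteq> 0" if "z \<in> Y" for z using Yn that by (auto simp: set_circleB)
    \<comment> \<open>The second bracket refers to the zero block of
      \<open>Kr n (Kr n \<pi>)\<close>; by \<open>Kr_Kr\<close> it is \<open>Y\<close> moved one
      step back.\<close>
    have kk: "Kr n (Kr n \<pi>) \<in> NCB n" by (rule Kr_NCB[OF n k])
    have "uminus ` predB n ` Y = predB n ` uminus ` Y"
      unfolding image_image by (rule image_cong[OF refl]) (simp add: predB_uminus Y0)
    then have "uminus ` predB n ` Y = predB n ` Y" using \<open>uminus ` Y = Y\<close> by simp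
    moreover have "predB n ` Y \<in> Kr n (Kr n \<pi>)" using Kr_Kr[OF n] p plain(1) by (auto simp: NCB_def)
    ultimately have "is_zero_block (Kr n (Kr n \<pi>)) (predB n ` Y)" by (simp add: is_zero_block_def)
    then have "zero_block (Kr n (Kr n \<pi>)) = predB n ` Y" by (rule zero_block_eq[OF n kk])
    moreover have "abs_block (predB n ` Y) = predN n ` abs_block Y"
      unfolding abs_block_def image_image by (rule image_cong[OF refl]) (simp add: abs_predB Y0)
    ultimately have R: "abs_block (zero_block (Kr n (Kr n \<pi>))) = predN n ` abs_block Y" by simp
    have m: "\<pi> \<in> NCZ n" "Kr n \<pi> \<notin> NCZ n"
      using Y p zero_blocks_exclusive[OF n p Y] unfolding NCZ_def by blast+
    have e: "bracketB n (free_cumulant \<psi>) (cyclic_free_cumulant \<psi> D) \<pi> a =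
        cyclic_free_cumulant \<psi> D (map a (sorted_list_of_set (abs_block Y))) *
        (\<Prod>V\<in>Abs_part \<pi> - {abs_block Y}. free_cumulant \<psi> (map a (arc_listing (circle n) (abs_block Y) V)))"
      unfolding bracketB_def Let_def zero_block_eq[OF n p Y] by (simp only: m if_True)
    have f: "bracketB n (free_cumulant \<psi>) (cyclic_free_cumulant \<psi> D) (Kr n \<pi>) b =
        (\<Prod>V\<in>Abs_part (Kr n \<pi>). free_cumulant \<psi> (map b (map idx
          (arc_listing (barred_circle (circle n)) (Bar ` predN n ` abs_block Y) (Plain ` V)))))"
      unfolding bracketB_def Let_def R by (simp only: m if_False)
    have z: "pabs ` Z = Plain ` abs_block Y" unfolding plain(2) by (simp add: abs_block_def image_image)
    have "abs_block Y \<in> Abs_part \<pi>" using plain(1) by (simp add: Abs_part_def)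
    then show ?thesis
      unfolding e f \<rho>_def[symmetric] fz z unfolding \<rho>_def pabs_with_bars
      by (rule bracket_term_Plain[OF n nc, symmetric])
  next
    case bar
    have "Bar ` uminus ` Y = Bar ` Y" using Z(2) bar(2) by (simp add: image_image)
    then have "uminus ` Y = Y" using inj(2) by (simp add: inj_image_eq_iff)
    then have Y: "is_zero_block (Kr n \<pi>) Y" using bar(1) by (simp add: is_zero_block_def)
    have m: "\<pi> \<notin> NCZ n" "Kr n \<pi> \<in> NCZ n"
      using Y k zero_blocks_exclusive[OF n p _ Y] unfolding NCZ_def by blast+
    have e: "bracketB n (free_cumulant \<psi>) (cyclic_free_cumulant \<psi> D) (Kr n \<pi>) b =
        cyclic_free_cumulant \<psi> D (map b (sorted_list_of_set (abs_block Y))) *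
        (\<Prod>V\<in>Abs_part (Kr n \<pi>) - {abs_block Y}.
          free_cumulant \<psi> (map b (arc_listing (circle n) (abs_block Y) V)))"
      unfolding bracketB_def Let_def zero_block_eq[OF n k Y] by (simp only: m if_True)
    have f: "bracketB n (free_cumulant \<psi>) (cyclic_free_cumulant \<psi> D) \<pi> a =
        (\<Prod>V\<in>Abs_part \<pi>. free_cumulant \<psi> (map a (map idx
          (arc_listing (barred_circle (circle n)) (Bar ` abs_block Y) (Plain ` V)))))"
      unfolding bracketB_def Let_def zero_block_eq[OF n k Y] by (simp only: m if_False)
    have z: "pabs ` Z = Bar ` abs_block Y" unfolding bar(2) by (simp add: abs_block_def image_image)
    have "abs_block Y \<in> Abs_part (Kr n \<pi>)" using bar(1) by (simp add: Abs_part_def)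
    then show ?thesis
      unfolding e f \<rho>_def[symmetric] fz z unfolding \<rho>_def pabs_with_bars
      by (rule bracket_term_Bar[OF n nc, symmetric])
  qed
qed

theorem corollary2p19:
  fixes scale :: "complex \<Rightarrow> 'a::ring_1 \<Rightarrow> 'a"
    and \<psi> D\<psi> :: "'a \<Rightarrow> complex"
    and n :: nat
    and a b :: "nat \<Rightarrow> 'a"
  assumes "unital_complex_algebra scale"
    and "Vector_Spaces.linear scale (*) \<psi>"
    and "\<psi> 1 = 1"
    and "Vector_Spaces.linear scale (*) D\<psi>"
    and "tracial D\<psi>"
    and "D\<psi> 1 = 0"
    and "n \<ge> 1"
    and "cyclically_free scale \<psi> D\<psi> (a ` {1..n}) (b ` {1..n})"
  shows "cyclic_free_cumulant \<psi> D\<psi> (map (\<lambda>i. a i * b i) [1..<Suc n]) =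
    (\<Sum>\<pi>\<in>NCB n.
       bracketB n (free_cumulant \<psi>) (cyclic_free_cumulant \<psi> D\<psi>) \<pi> a *
       bracketB n (free_cumulant \<psi>) (cyclic_free_cumulant \<psi> D\<psi>) (Kr n \<pi>) b)"
proof -
  note n = assms(7)
  interpret unital_complex_algebra scale by (rule assms(1))
  \<comment> \<open>The indices \<open>1\<close> and \<open>2\<close> are the values of
    \<open>pcol\<close> on plain and barred points.\<close>
  define A where "A = (\<lambda>i::nat. if i = 1 then generated_algebra scale (a ` {1..n})
    else generated_algebra scale (b ` {1..n}))"
  have diff: "x - scale c 1 \<in> generated_algebra scale S" if "x \<in> generated_algebra scale S" for x c S
  proof -
    have "x + scale (- c) 1 \<in> generated_algebra scale S"
      by (intro generated_algebra.add that generated_algebra.scale generated_algebra.one)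
    then show ?thesis by (simp add: scale_minus_left)
  qed
  interpret cyclic_probability_space scale \<psi> D\<psi>
    by (intro cyclic_probability_space.intro cyclic_probability_space_axioms.intro assms(1-6))
  interpret coloured_algebras scale \<psi> D\<psi> A
  proof unfold_locales
    show "cyclically_free_algebras \<psi> D\<psi> A" using assms(8) unfolding cyclically_free_def A_def .
  qed (simp_all add: A_def diff generated_algebra.one generated_algebra.mult split: if_splits)
  have col: "coloured pcol (sides a b) (barred_circle (circle n))"
    unfolding coloured_def
  proof
    fix p assume p: "p \<in> set (barred_circle (circle n))"
    show "pcol p \<in> {1, 2} \<and> sides a b p \<in> A (pcol p)"
      by (cases p) (use p in \<open>auto simp: set_barred_circle A_def intro: generated_algebra.generator\<close>)
  qed
  have "cyclic_free_cumulant \<psi> D\<psi> (map (\<lambda>i. a i * b i) [1..<Suc n]) =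
      dkap \<psi> D\<psi> (\<lambda>i. sides a b (Plain i) * sides a b (Bar i)) (circle n)"
    by (simp add: dkap_def circle_def del: upt_Suc)
  also have "\<dots> = circle_sum \<psi> D\<psi> (sides a b) (barred_circle (circle n))"
    using n by (intro dkap_products col) (auto simp: circle_def)
  also have "\<dots> = (\<Sum>\<rho>\<in>completeB n. bracket_term \<psi> D\<psi> (sides a b) n ((`) pabs ` \<rho>) (folded_zero \<rho>))"
    by (rule sum_completeB[OF n, symmetric])
  also have "\<dots> = (\<Sum>\<pi>\<in>NCB n. bracket_term \<psi> D\<psi> (sides a b) n ((`) pabs ` with_bars \<pi> (Kr n \<pi>))
      (folded_zero (with_bars \<pi> (Kr n \<pi>))))"
    by (rule sum.reindex_bij_betw[OF bij_betw_completeB[OF n], symmetric])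
  also have "\<dots> = (\<Sum>\<pi>\<in>NCB n.
       bracketB n (free_cumulant \<psi>) (cyclic_free_cumulant \<psi> D\<psi>) \<pi> a *
       bracketB n (free_cumulant \<psi>) (cyclic_free_cumulant \<psi> D\<psi>) (Kr n \<pi>) b)"
    by (rule sum.cong[OF refl]) (rule bracketB_mult[OF n, symmetric])
  finally show ?thesis .
qed

end
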